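(* Let $X,U,Y$ be Hilbert spaces over $\mathbb K\in\{\mathbb R,\mathbb C\}$, let $\Sigma_N(\mathfrak A,\mathfrak B,\mathfrak C)$ be an NBCO-system on $(X,U,Y)$ whose boundary operators $\mathfrak B(t)=\mathfrak B$, $\mathfrak C(t)=\mathfrak C$ and whose domain $D(\mathfrak A(t))=\mathfrak D$ do not depend on $t$, and let $A(t)=\mathfrak A(t)|_{\mathfrak D\cap\ker\mathfrak B}$ and $\tilde B(t)$ be the associated main operators and lifting operators. Let $M:[0,\infty)\to\mathcal L(X)$ be self-adjoint valued and uniformly coercive, with $M(\cdot)x\in C^2([0,\infty);X)$ and $M^{-1}(\cdot)x\in C([0,\infty);X)$ for each $x\in X$. Assume that (a) $\mathfrak A:[0,\infty)\to\mathcal L(\mathfrak D,X)$ is strongly $C^1$-continuous, i.e. $\mathfrak A(\cdot)x\in C^1([0,\infty);X)$ for each $x\in\mathfrak D$; (b) for every $t\ge0$ the main operator $A(t):\mathfrak D\cap\ker\mathfrak B\to X$ generates a contraction $C_0$-semigroup on $X$; (c) $\tilde B(\cdot)u_0\in C^2([0,\infty);X)$ for each $u_0\in U$. Then the perturbed system $\Sigma_{N,M}(\mathfrak A,\mathfrak B,\mathfrak C):=\Sigma_N(\mathfrak A M,\mathfrak B M,\mathfrak C M)$, that is $$\dot x(t)=\mathfrak A(t)M(t)x(t),\ x(s)=x_s,\qquad \mathfrak B M(t)x(t)=u(t),\qquad \mathfrak C M(t)x(t)=y(t),\qquad t\ge s,$$ is an NBCO-system on $(X,U,Y)$. Furthermore,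 let $\mathcal W=\{W(t,s)\}$ be the associated evolution family (generated by the main operators $\{A(t)M(t)\mid t\ge0\}$) and put $\tilde B_M(t):=M^{-1}(t)\tilde B(t)$, $\mathfrak C_M(t):=\mathfrak C M(t)$. Then for each $s\ge0$ and each $(x_s,u)\in X\times C^2([0,\infty);U)$ with $M(s)x_s\in\mathfrak D$ and $\mathfrak B M(s)x_s=u(s)$, the perturbed system has a unique classical solution $(x,y)$, given for $t\ge s$ by $$x(t)=W(t,s)x_s+\int_s^tW(t,r)\mathfrak A(r)\tilde B(r)u(r)\,dr-\int_s^tW(t,r)\frac{d}{dr}\big[\tilde B_M(r)u(r)\big]dr,$$ $$y(t)=\mathfrak C_M(t)W(t,s)x_s+\mathfrak C_M(t)\int_s^tW(t,r)\mathfrak A(r)\tilde B(r)u(r)\,dr-\mathfrak C_M(t)\int_s^tW(t,r)\frac{d}{dr}\big[\tilde B_M(r)u(r)\big]dr.$$ Finally, $\Sigma_{N,M}(\mathfrak A,\mathfrak B,\mathfrak C)$ is well-posed if in addition $$2\operatorname{Re}(\mathfrak A(t)x_0\mid x_0)_X\le (R(t)u_0\mid\mathfrak B x_0)_U-(\mathfrak C x_0\mid J(t)\mathfrak C x_0)_Y$$ for all $t\ge0$ and all $(x_0,u_0)\in\mathcal V:=\{(x,u)\in X\times U\mid x\in\mathfrak D,\ \mathfrak B x=u\}$, where $R=R^*\in L^\infty_{loc}([0,\infty);\mathcal L(U))$ and $J=J^*:[0,\infty)\to\mathcal L(Y)$ is uniformly coercive.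
   Context: Uniformly coercive: $M:[0,\infty)\to\mathcal L(H)$, $H$ a Hilbert space, is uniformly coercive if $(M(t)x\mid x)\ge\beta\|x\|^2$ for some $\beta>0$ and all $t\ge0$, $x\in H$. $\mathfrak D$ carries the graph norm. Evolution family on $X$: a family $\{U(t,s)\mid t\ge s\ge0\}\subset\mathcal L(X)$, strongly continuous in $(t,s)$, with $U(t,t)=I$ and $U(t,s)=U(t,r)U(r,s)$ for $0\le s\le r\le t$. It is generated by a family $\{A(t)\}$ of closed operators if there are dense subspaces $Y_t\subset D(A(t))$ (regularity spaces) such that for all $s\ge 0$, $x_s\in Y_s$, the function $t\mapsto U(t,s)x_s$ is the unique classical solution of $\dot u=A(t)u$ on $[s,\infty)$, $u(s)=x_s$ (i.e. continuous on $[s,\infty)$, $C^1$ on $(s,\infty)$, $u(t)\in D(A(t))$ for $t\ge s$). BCO-system: a triple of linear operators $\mathfrak A:D(\mathfrak A)\subset X\to X$, $\mathfrak B:D(\mathfrak B)\subset X\to U$, $\mathfrak C:D(\mathfrak A)\to Y$ with $D(\mathfrak A)\subset D(\mathfrak B)$ such that (i) the main operator $A:=\mathfrak A|_{D(A)}$, $D(A)=D(\mathfrak A)\cap\ker\mathfrak B$, generates a $C_0$-semigroup on $X$; (ii) there is $\tilde B\in\mathcal L(U,X)$ (lifting operator) with $\tilde Bu\in D(\mathfrak A)$, $\mathfrak B\tilde Bu=u$ for all $u\in U$ and $\mathfrak A\tilde B\in\mathcal L(U,X)$; (iii) $\mathfrak C$ is bounded from $D(\mathfrak A)$ with the graph norm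 to $Y$. NBCO-system: a family $\Sigma_N(\mathfrak A,\mathfrak B,\mathfrak C)$ of operators $\mathfrak A(t),\mathfrak B(t),\mathfrak C(t)$, $t\ge0$, such that each $(\mathfrak A(t),\mathfrak B(t),\mathfrak C(t))$ is a BCO-system and the family $\{A(t)\}$ of main operators generates an evolution family; $\tilde B(t)$ denotes operators as in (ii) for each $t$. Classical solution of $\dot x=\mathfrak A(t)x$, $x(s)=x_s$, $\mathfrak B(t)x=u$, $\mathfrak C(t)x=y$ on $[s,\infty)$: a pair $(x,y)$ with $x\in C^1([s,\infty);X)$, $x(t)\in D(\mathfrak A(t))$ for $t\ge s$, $y\in C([s,\infty);Y)$, satisfying these equations. Well-posed: for any $\tau>0$ there is $m_\tau>0$ such that all classical solutions (with initial time $s\in[0,\tau]$) satisfy $\|x(\tau)\|^2+\int_s^\tau\|y(r)\|^2dr\le m_\tau\big(\|x(s)\|^2+\int_s^\tau\|u(r)\|^2dr\big)$.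
   Formalization: The printed formulas for x and y are false (transport on (0,1), u=1, x_s=1); W(t,s)x_s is replaced by W(t,s)(x_s − B̃_M(s)u(s)) + B̃_M(t)u(t), with ℭ_M(t) applied termwise for y; integrals are Henstock–Kurzweil, since 𝔄(r)B̃(r)u(r) need not be Bochner integrable. *)

theory Defs
  imports "HOL-Analysis.Analysis"
begin

section \<open>Hilbert spaces over the real or complex numbers\<close>

text \<open>
  The library provides real inner product spaces only. A Hilbert space over a scalar field \<open>K\<close>,
  where \<open>K\<close> is \<open>\<real>\<close> or the whole of \<^typ>\<open>complex\<close>, is presented as a complete
  real inner product space (a type) together with a scalar multiplication by the elements of \<open>K\<close> and a
  \<open>K\<close>-valued inner product, linear in the first argument, whose real part is the
  inner product of the type. Hence the norm of the type is the Hilbert space norm.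
  For \<open>K = \<real>\<close> the additional data carry no information; values of the scalar
  multiplication outside \<open>K\<close> are irrelevant.
\<close>

record 'x hilbert_structure =
  smul :: "complex \<Rightarrow> 'x \<Rightarrow> 'x"
  ip :: "'x \<Rightarrow> 'x \<Rightarrow> complex"

definition hilbert_over :: "complex set \<Rightarrow> 'x::{real_inner,banach} hilbert_structure \<Rightarrow> bool" where
  "hilbert_over K X \<longleftrightarrow>
     (K = \<real> \<or> K = UNIV) \<and>
     (\<forall>a\<in>K. \<forall>b\<in>K. \<forall>x. smul X (a * b) x = smul X a (smul X b x)) \<and>
     (\<forall>a\<in>K. \<forall>b\<in>K. \<forall>x. smul X (a + b) x = smul X a x + smul X b x) \<and>
     (\<forall>a\<in>K. \<forall>x y. smul X a (x + y) = smul X a x + smul X a y) \<and>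
     (\<forall>r x. smul X (of_real r) x = r *\<^sub>R x) \<and>
     (\<forall>x y. ip X x y \<in> K) \<and>
     (\<forall>x y z. ip X (x + y) z = ip X x z + ip X y z) \<and>
     (\<forall>a\<in>K. \<forall>x y. ip X (smul X a x) y = a * ip X x y) \<and>
     (\<forall>x y. ip X y x = cnj (ip X x y)) \<and>
     (\<forall>x y. Re (ip X x y) = x \<bullet> y)"


section \<open>Linear operators\<close>

text \<open>
  An operator \<open>T : D(T) \<rightarrow> Y\<close>, \<open>D(T) \<subseteq> X\<close>, is
  a set together with a total function; the values of the function outside the set are irrelevant.
\<close>

definition K_subspace :: "complex set \<Rightarrow> 'x::real_vector hilbert_structure \<Rightarrow> 'x set \<Rightarrow> bool" where
  "K_subspace K X D \<longleftrightarrow>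
     0 \<in> D \<and> (\<forall>x\<in>D. \<forall>y\<in>D. x + y \<in> D) \<and> (\<forall>c\<in>K. \<forall>x\<in>D. smul X c x \<in> D)"

definition K_linear_on :: "complex set \<Rightarrow> 'x::real_vector hilbert_structure \<Rightarrow> 'y::real_vector hilbert_structure
    \<Rightarrow> 'x set \<Rightarrow> ('x \<Rightarrow> 'y) \<Rightarrow> bool" where
  "K_linear_on K X Y D T \<longleftrightarrow>
     K_subspace K X D \<and>
     (\<forall>x\<in>D. \<forall>y\<in>D. T (x + y) = T x + T y) \<and>
     (\<forall>c\<in>K. \<forall>x\<in>D. T (smul X c x) = smul Y c (T x))"

definition bdd_op :: "complex set \<Rightarrow> 'x::real_normed_vector hilbert_structure
    \<Rightarrow> 'y::real_normed_vector hilbert_structure \<Rightarrow> ('x \<Rightarrow> 'y) \<Rightarrow> bool" where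
  "bdd_op K X Y T \<longleftrightarrow> bounded_linear T \<and> (\<forall>c\<in>K. \<forall>x. T (smul X c x) = smul Y c (T x))"

definition closed_operator :: "complex set \<Rightarrow> 'x::real_normed_vector hilbert_structure
    \<Rightarrow> 'x set \<Rightarrow> ('x \<Rightarrow> 'x) \<Rightarrow> bool" where
  "closed_operator K X D T \<longleftrightarrow> K_linear_on K X X D T \<and> closed {(x, T x) |x. x \<in> D}"

definition graph_bounded :: "'x::real_normed_vector set \<Rightarrow> ('x \<Rightarrow> 'x) \<Rightarrow> ('x \<Rightarrow> 'y::real_normed_vector) \<Rightarrow> bool" where
  "graph_bounded D A T \<longleftrightarrow> (\<exists>c. \<forall>x\<in>D. norm (T x) \<le> c * (norm x + norm (A x)))"

definition selfadjoint_valued :: "'x hilbert_structure \<Rightarrow> (real \<Rightarrow> 'x \<Rightarrow> 'x) \<Rightarrow> bool" where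
  "selfadjoint_valued X M \<longleftrightarrow> (\<forall>t\<ge>0. \<forall>x y. ip X (M t x) y = ip X x (M t y))"

text \<open>The inequality between scalars includes the claim that the left-hand side is real.\<close>

definition uniformly_coercive :: "'x::real_normed_vector hilbert_structure \<Rightarrow> (real \<Rightarrow> 'x \<Rightarrow> 'x) \<Rightarrow> bool" where
  "uniformly_coercive X M \<longleftrightarrow>
     (\<exists>\<beta>>0. \<forall>t\<ge>0. \<forall>x. Im (ip X (M t x) x) = 0 \<and> Re (ip X (M t x) x) \<ge> \<beta> * (norm x)\<^sup>2)"


section \<open>Regularity of functions of time\<close>

text \<open>Derivatives are taken within the set, hence are one-sided at the end point of \<open>[s, \<infinity>)\<close>.\<close>

primrec Ck_on :: "nat \<Rightarrow> real set \<Rightarrow> (real \<Rightarrow> 'x::real_normed_vector) \<Rightarrow> bool" where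
  "Ck_on 0 S f \<longleftrightarrow> continuous_on S f"
| "Ck_on (Suc k) S f \<longleftrightarrow>
     (\<exists>f'. (\<forall>t\<in>S. (f has_vector_derivative f' t) (at t within S)) \<and> Ck_on k S f')"

text \<open>
  Strong \<open>C\<^sup>1\<close>-continuity of \<open>A : [0, \<infinity>) \<rightarrow> L(D, X)\<close>. Here \<open>D\<close> is a
  single normed space: it carries the graph norm of one of the operators \<open>A r\<close>, with respect to
  which all \<open>A t\<close> have to be bounded.
\<close>

definition strongly_C1 :: "'x::real_normed_vector set \<Rightarrow> (real \<Rightarrow> 'x \<Rightarrow> 'x) \<Rightarrow> bool" where
  "strongly_C1 D A \<longleftrightarrow>
     (\<exists>r\<ge>0. \<forall>t\<ge>0. graph_bounded D (A r) (A t)) \<and>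
     (\<forall>x\<in>D. Ck_on 1 {0..} (\<lambda>t. A t x))"

definition strongly_measurable :: "'a measure \<Rightarrow> ('a \<Rightarrow> 'x::topological_space) \<Rightarrow> bool" where
  "strongly_measurable N f \<longleftrightarrow>
     (\<exists>S. (\<forall>n. simple_function N (S n)) \<and> (AE t in N. (\<lambda>n. S n t) \<longlonglongrightarrow> f t))"

text \<open>
  Membership in \<open>L\<^sup>\<infinity>\<^sub>l\<^sub>o\<^sub>c([0, \<infinity>); L(U))\<close>. Measurability is
  required of the orbits \<open>R(\<cdot>)v\<close> only, which is implied by measurability in operator norm.
\<close>

definition Linfty_loc :: "complex set \<Rightarrow> 'u::real_normed_vector hilbert_structure \<Rightarrow> (real \<Rightarrow> 'u \<Rightarrow> 'u) \<Rightarrow> bool" where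
  "Linfty_loc K U R \<longleftrightarrow>
     (\<forall>t\<ge>0. bdd_op K U U (R t)) \<and>
     (\<forall>v. strongly_measurable (lebesgue_on {0..}) (\<lambda>t. R t v)) \<and>
     (\<forall>\<tau>>0. \<exists>c. AE t in lebesgue_on {0..\<tau>}. onorm (R t) \<le> c)"


section \<open>Semigroups and evolution families\<close>

definition C0_semigroup :: "complex set \<Rightarrow> 'x::real_normed_vector hilbert_structure \<Rightarrow> (real \<Rightarrow> 'x \<Rightarrow> 'x) \<Rightarrow> bool" where
  "C0_semigroup K X T \<longleftrightarrow>
     (\<forall>t\<ge>0. bdd_op K X X (T t)) \<and> T 0 = id \<and>
     (\<forall>t\<ge>0. \<forall>s\<ge>0. T (t + s) = T t \<circ> T s) \<and>
     (\<forall>x. continuous_on {0..} (\<lambda>t. T t x))"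

definition is_generator :: "'x::real_normed_vector set \<Rightarrow> ('x \<Rightarrow> 'x) \<Rightarrow> (real \<Rightarrow> 'x \<Rightarrow> 'x) \<Rightarrow> bool" where
  "is_generator D A T \<longleftrightarrow>
     D = {x. \<exists>y. ((\<lambda>h. (1 / h) *\<^sub>R (T h x - x)) \<longlongrightarrow> y) (at_right 0)} \<and>
     (\<forall>x\<in>D. ((\<lambda>h. (1 / h) *\<^sub>R (T h x - x)) \<longlongrightarrow> A x) (at_right 0))"

definition generates_C0_semigroup :: "complex set \<Rightarrow> 'x::real_normed_vector hilbert_structure
    \<Rightarrow> 'x set \<Rightarrow> ('x \<Rightarrow> 'x) \<Rightarrow> bool" where
  "generates_C0_semigroup K X D A \<longleftrightarrow> (\<exists>T. C0_semigroup K X T \<and> is_generator D A T)"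

definition generates_contraction_C0_semigroup :: "complex set \<Rightarrow> 'x::real_normed_vector hilbert_structure
    \<Rightarrow> 'x set \<Rightarrow> ('x \<Rightarrow> 'x) \<Rightarrow> bool" where
  "generates_contraction_C0_semigroup K X D A \<longleftrightarrow>
     (\<exists>T. C0_semigroup K X T \<and> (\<forall>t\<ge>0. \<forall>x. norm (T t x) \<le> norm x) \<and> is_generator D A T)"

definition evolution_family :: "complex set \<Rightarrow> 'x::real_normed_vector hilbert_structure
    \<Rightarrow> (real \<Rightarrow> real \<Rightarrow> 'x \<Rightarrow> 'x) \<Rightarrow> bool" where
  "evolution_family K X W \<longleftrightarrow>
     (\<forall>t s. 0 \<le> s \<and> s \<le> t \<longrightarrow> bdd_op K X X (W t s)) \<and>
     (\<forall>x. continuous_on {(t, s). 0 \<le> s \<and> s \<le> t} (\<lambda>(t, s). W t s x)) \<and>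
     (\<forall>t\<ge>0. W t t = id) \<and>
     (\<forall>t r s. 0 \<le> s \<and> s \<le> r \<and> r \<le> t \<longrightarrow> W t s = W t r \<circ> W r s)"

definition cauchy_classical_solution :: "(real \<Rightarrow> 'x::real_normed_vector set) \<Rightarrow> (real \<Rightarrow> 'x \<Rightarrow> 'x)
    \<Rightarrow> real \<Rightarrow> 'x \<Rightarrow> (real \<Rightarrow> 'x) \<Rightarrow> bool" where
  "cauchy_classical_solution D A s xs v \<longleftrightarrow>
     continuous_on {s..} v \<and> Ck_on 1 {s<..} v \<and> (\<forall>t\<ge>s. v t \<in> D t) \<and>
     (\<forall>t>s. (v has_vector_derivative A t (v t)) (at t)) \<and> v s = xs"

definition generated_by :: "complex set \<Rightarrow> 'x::real_normed_vector hilbert_structure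
    \<Rightarrow> (real \<Rightarrow> real \<Rightarrow> 'x \<Rightarrow> 'x) \<Rightarrow> (real \<Rightarrow> 'x set) \<Rightarrow> (real \<Rightarrow> 'x \<Rightarrow> 'x) \<Rightarrow> bool" where
  "generated_by K X W D A \<longleftrightarrow>
     evolution_family K X W \<and>
     (\<forall>t\<ge>0. closed_operator K X (D t) (A t)) \<and>
     (\<exists>Z. (\<forall>t\<ge>0. K_subspace K X (Z t) \<and> closure (Z t) = UNIV \<and> Z t \<subseteq> D t) \<and>
          (\<forall>s\<ge>0. \<forall>xs\<in>Z s.
             cauchy_classical_solution D A s xs (\<lambda>t. W t s xs) \<and>
             (\<forall>v. cauchy_classical_solution D A s xs v \<longrightarrow> (\<forall>t\<ge>s. v t = W t s xs))))"


section \<open>Boundary control and observation systems\<close>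

definition main_domain :: "'x set \<Rightarrow> ('x \<Rightarrow> 'u::zero) \<Rightarrow> 'x set" where
  "main_domain D B = D \<inter> {x. B x = 0}"

definition is_lifting :: "complex set \<Rightarrow> 'x::real_normed_vector hilbert_structure
    \<Rightarrow> 'u::real_normed_vector hilbert_structure
    \<Rightarrow> 'x set \<Rightarrow> ('x \<Rightarrow> 'x) \<Rightarrow> ('x \<Rightarrow> 'u) \<Rightarrow> ('u \<Rightarrow> 'x) \<Rightarrow> bool" where
  "is_lifting K X U D A B L \<longleftrightarrow>
     bdd_op K U X L \<and> (\<forall>u. L u \<in> D \<and> B (L u) = u) \<and> bdd_op K U X (\<lambda>u. A (L u))"

definition bco_system :: "complex set \<Rightarrow> 'x::real_normed_vector hilbert_structure
    \<Rightarrow> 'u::real_normed_vector hilbert_structure \<Rightarrow> 'y::real_normed_vector hilbert_structure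
    \<Rightarrow> 'x set \<Rightarrow> ('x \<Rightarrow> 'x) \<Rightarrow> 'x set \<Rightarrow> ('x \<Rightarrow> 'u) \<Rightarrow> ('x \<Rightarrow> 'y) \<Rightarrow> bool" where
  "bco_system K X U Y D A DB B C \<longleftrightarrow>
     K_linear_on K X X D A \<and> K_linear_on K X U DB B \<and> K_linear_on K X Y D C \<and> D \<subseteq> DB \<and>
     generates_C0_semigroup K X (main_domain D B) A \<and>
     (\<exists>L. is_lifting K X U D A B L) \<and>
     graph_bounded D A C"

definition nbco_system :: "complex set \<Rightarrow> 'x::real_normed_vector hilbert_structure
    \<Rightarrow> 'u::real_normed_vector hilbert_structure \<Rightarrow> 'y::real_normed_vector hilbert_structure
    \<Rightarrow> (real \<Rightarrow> 'x set) \<Rightarrow> (real \<Rightarrow> 'x \<Rightarrow> 'x) \<Rightarrow> (real \<Rightarrow> 'x set) \<Rightarrow> (real \<Rightarrow> 'x \<Rightarrow> 'u)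
    \<Rightarrow> (real \<Rightarrow> 'x \<Rightarrow> 'y) \<Rightarrow> bool" where
  "nbco_system K X U Y D A DB B C \<longleftrightarrow>
     (\<forall>t\<ge>0. bco_system K X U Y (D t) (A t) (DB t) (B t) (C t)) \<and>
     (\<exists>W. generated_by K X W (\<lambda>t. main_domain (D t) (B t)) A)"

definition classical_solution :: "(real \<Rightarrow> 'x::real_normed_vector set) \<Rightarrow> (real \<Rightarrow> 'x \<Rightarrow> 'x)
    \<Rightarrow> (real \<Rightarrow> 'x \<Rightarrow> 'u) \<Rightarrow> (real \<Rightarrow> 'x \<Rightarrow> 'y::real_normed_vector)
    \<Rightarrow> real \<Rightarrow> 'x \<Rightarrow> (real \<Rightarrow> 'u) \<Rightarrow> (real \<Rightarrow> 'x) \<Rightarrow> (real \<Rightarrow> 'y) \<Rightarrow> bool" where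
  "classical_solution D A B C s xs u x y \<longleftrightarrow>
     Ck_on 1 {s..} x \<and> (\<forall>t\<ge>s. x t \<in> D t) \<and> continuous_on {s..} y \<and> x s = xs \<and>
     (\<forall>t\<ge>s. (x has_vector_derivative A t (x t)) (at t within {s..}) \<and>
             B t (x t) = u t \<and> C t (x t) = y t)"

text \<open>
  The input \<open>u\<close> of a classical solution is determined by \<open>x\<close>, but need not be square
  integrable, since the boundary operators are not assumed to be bounded in the graph norm. The
  integrals are therefore taken in \<open>[0, \<infinity>]\<close>.
\<close>

definition well_posed :: "(real \<Rightarrow> 'x::real_normed_vector set) \<Rightarrow> (real \<Rightarrow> 'x \<Rightarrow> 'x)
    \<Rightarrow> (real \<Rightarrow> 'x \<Rightarrow> 'u::real_normed_vector) \<Rightarrow> (real \<Rightarrow> 'x \<Rightarrow> 'y::real_normed_vector) \<Rightarrow> bool" where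
  "well_posed D A B C \<longleftrightarrow>
     (\<forall>\<tau>>0. \<exists>m>0. \<forall>s\<in>{0..\<tau>}. \<forall>xs u x y. classical_solution D A B C s xs u x y \<longrightarrow>
        ennreal ((norm (x \<tau>))\<^sup>2) + (\<integral>\<^sup>+r\<in>{s..\<tau>}. ennreal ((norm (y r))\<^sup>2) \<partial>lborel)
        \<le> ennreal m * (ennreal ((norm (x s))\<^sup>2) + (\<integral>\<^sup>+r\<in>{s..\<tau>}. ennreal ((norm (u r))\<^sup>2) \<partial>lborel)))"

text \<open>
  Solution formula. With a lifting \<open>L(t)\<close> of the perturbed system and a classical solution
  \<open>x\<close> with input \<open>u\<close>, the function \<open>z = x - L u\<close> solves
  \<open>z' = A M z + (\<AA> M L) u - (L u)'\<close>, so that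
  \<open>x(t) = L(t)u(t) + W(t,s)(x(s) - L(s)u(s)) + \<integral> W(t,r)(\<AA> M L u)(r) dr - \<integral> W(t,r)(L u)'(r) dr\<close>.
  The terms \<open>L(t)u(t)\<close> and \<open>W(t,s)L(s)u(s)\<close> cannot be omitted: for
  \<open>\<AA>f = -f'\<close> on the Sobolev space \<open>H\<^sup>1(0,1)\<close>, \<open>\<BB>f = f(0)\<close>, \<open>M = I\<close>,
  \<open>L(t)u = u 1\<close>, the input \<open>u = 1\<close> and initial state \<open>1\<close> give
  \<open>x = 1\<close>, both integrals vanish, and \<open>W\<close> is the nilpotent shift. The output
  operator can be applied to each of the summands, but not to \<open>W(t,s)x(s)\<close>, which need not
  belong to its domain. Integrals are Henstock-Kurzweil integrals, as \<open>\<AA>(r)L(r)u(r)\<close> is not assumed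
  to be continuous in \<open>r\<close>.
\<close>

end

theory Submission
  imports Defs
begin

text \<open>In the variable \<open>z = M x\<close> the perturbed equation becomes \<open>z' = M A z + P z\<close> with \<open>P = M' M\<^sup>-\<^sup>1\<close>,
  whose domain \<open>D \<inter> ker B\<close> does not depend on time and whose principal part is dissipative for the
  inner product \<open>(M\<^sup>-\<^sup>1 z | z)\<close>: this is the situation of Kato's theorem on hyperbolic
  equations. Solutions are limits of those of the equations with \<open>A\<close> replaced by its Yosida
  approximations; the energy inequality makes these a Cauchy sequence, and the derivative \<open>w = z'\<close> is
  obtained from a Volterra equation, because \<open>A' z\<close> can be expressed through \<open>w\<close>. The boundary
  input is removed by a lifting, and the solution formula is the fundamental theorem of calculus for
  \<open>r \<mapsto> W(t,r)(x(r) - M\<^sup>-\<^sup>1(r) Bt(r) u(r))\<close>. Well-posedness is Gronwall's inequality for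
  \<open>(M x | x)\<close>.\<close>


section \<open>Families of bounded operators\<close>

text \<open>The change of variable is forced by the domain \<open>{x. M t x \<in> D}\<close> of
  A(t)M(t), which moves with t. Its price is that dissipativity holds only in an inner product that
  depends on t itself; the variation of that inner product costs an exponential factor in every
  estimate. The obstacle is regularity. Differentiating the equation in time produces A' z, which is
  not bounded in terms of z. Since the A(t) are all bounded in one graph norm, A'(I - A)^-1 is a
  bounded operator, so A' z is a bounded function of z - A z. The derivative of P z also appears,
  and this is where the second derivative of M enters. All operator families are differentiable only
  in the strong sense, so products and inverses rest on uniform boundedness instead of limits in
  operator norm. The analysis is carried out over the reals; linearity over \<open>K\<close> is
  recovered afterwards, because by uniqueness the evolution family commutes with scalar
  multiplication. With coefficients frozen at one time, the same construction yields the semigroup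
  generated by A(t)M(t).\<close>

lemma closed_countable_cover_ball:
  fixes S :: "nat \<Rightarrow> 'a::complete_space set"
  assumes "\<And>n. closed (S n)" and "(\<Union>n. S n) = UNIV"
  obtains n x e where "e > 0" "cball x e \<subseteq> S n"
proof -
  have "\<exists>n. interior (S n) \<noteq> {}"
  proof (rule ccontr)
    assume "\<not> (\<exists>n. interior (S n) \<noteq> {})"
    then have "euclidean interior_of (\<Union>(range S)) = {}"
      using assms(1) by (intro Baire_category_alt) (auto simp: completely_metrizable_space_euclidean)
    then show False using assms(2) by simp
  qed
  then obtain n x where "x \<in> interior (S n)" by blast
  then obtain e where "e > 0" "cball x e \<subseteq> S n"
    using mem_interior_cball by blast
  then show ?thesis using that by blast
qed

text \<open>Banach-Steinhaus for an arbitrary index set. By Baire some sublevel set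
  \<open>S n\<close> of the pointwise supremum contains a ball, and every vector as long as its
  radius is a difference of two points of the ball. The constant is made positive because later
  estimates divide by it.\<close>

lemma uniform_boundedness:
  fixes T :: "'i \<Rightarrow> 'a::banach \<Rightarrow> 'b::real_normed_vector"
  assumes lin: "\<And>i. i \<in> I \<Longrightarrow> bounded_linear (T i)"
    and bdd: "\<And>x. \<exists>c. \<forall>i\<in>I. norm (T i x) \<le> c"
  obtains c where "c > 0" "\<And>i x. i \<in> I \<Longrightarrow> norm (T i x) \<le> c * norm x"
proof -
  define S where "S n = {x. \<forall>i\<in>I. norm (T i x) \<le> real n}" for n
  have "closed (S n)" for n
  proof -
    have "S n = (\<Inter>i\<in>I. {x. norm (T i x) \<le> real n})" unfolding S_def by auto
    moreover have "closed {x. norm (T i x) \<le> real n}" if "i \<in> I" for i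
      using lin[OF that]
      by (intro closed_Collect_le continuous_intros linear_continuous_on)
    ultimately show ?thesis by auto
  qed
  moreover have "(\<Union>n. S n) = UNIV"
  proof -
    have "\<exists>n. x \<in> S n" for x
    proof -
      obtain c where c: "\<forall>i\<in>I. norm (T i x) \<le> c" using bdd by blast
      obtain n where "c \<le> real n" using real_arch_simple by blast
      with c show ?thesis unfolding S_def by (auto intro: order_trans)
    qed
    then show ?thesis by auto
  qed
  ultimately obtain n x0 e where e: "e > 0" "cball x0 e \<subseteq> S n"
    using closed_countable_cover_ball by metis
  have key: "norm (T i x) \<le> (2 * real n / e) * norm x" if i: "i \<in> I" for i x
  proof (cases "x = 0")
    case True
    interpret bounded_linear "T i" by (rule lin[OF i])
    show ?thesis using True zero by simp
  next
    case False
    interpret bounded_linear "T i" by (rule lin[OF i])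
    define v where "v = (e / norm x) *\<^sub>R x"
    have nv: "norm v = e" using False e by (simp add: v_def)
    have "x0 + v \<in> S n" "x0 \<in> S n" using e nv by (auto simp: dist_norm subset_iff)
    then have "norm (T i (x0 + v)) \<le> n" "norm (T i x0) \<le> n" using i unfolding S_def by auto
    moreover have "T i v = T i (x0 + v) - T i x0" by (simp add: add)
    ultimately have "norm (T i v) \<le> 2 * real n"
      using norm_triangle_ineq4[of "T i (x0 + v)" "T i x0"] by auto
    moreover have "norm (T i v) = (e / norm x) * norm (T i x)"
      using e by (simp add: v_def scaleR)
    ultimately show ?thesis using e False by (simp add: field_simps)
  qed
  show ?thesis
  proof (rule that[of "2 * real n / e + 1"])
    show "2 * real n / e + 1 > 0" using e by (simp add: add_nonneg_pos)
    fix i x assume "i \<in> I"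
    from key[OF this, of x] show "norm (T i x) \<le> (2 * real n / e + 1) * norm x"
      by (smt (verit, best) mult_right_mono norm_ge_zero)
  qed
qed

text \<open>The bounded inverse theorem. A ball in the closure of a sublevel set of \<open>F\<close>
  yields only approximate preimages; as the error is at most half the norm, the corrections form a
  geometric series, and continuity of \<open>E\<close> identifies its sum as
  \<open>F y\<close>.\<close>

lemma bounded_linear_inverse:
  fixes E :: "'a::banach \<Rightarrow> 'b::banach"
  assumes E: "bounded_linear E" and EF: "\<And>y. E (F y) = y" and FE: "\<And>x. F (E x) = x"
  shows "bounded_linear F"
proof -
  interpret E: bounded_linear E by (rule E)
  have F_add: "F (x + y) = F x + F y" for x y by (metis E.add EF FE)
  have F_scale: "F (c *\<^sub>R x) = c *\<^sub>R F x" for c x by (metis E.scaleR EF FE)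
  have F_diff: "F (x - y) = F x - F y" for x y by (metis E.diff EF FE)
  define S where "S n = closure {y. norm (F y) \<le> real n}" for n
  have "(\<Union>n. S n) = UNIV"
    unfolding S_def by (metis (mono_tags, lifting) UNIV_eq_I UN_I closure_subset iso_tuple_UNIV_I mem_Collect_eq real_arch_simple subsetD)
  moreover have "closed (S n)" for n by (simp add: S_def)
  ultimately obtain n y0 e where e: "e > 0" "cball y0 e \<subseteq> S n"
    using closed_countable_cover_ball[of S] by metis
  define k where "k = 2 * real n / e"
  have "k \<ge> 0" using e by (simp add: k_def)
  have appr: "\<exists>y'. norm (y - y') \<le> norm y / 2 \<and> norm (F y') \<le> k * norm y" for y
  proof (cases "y = 0")
    case True
    then show ?thesis using F_scale[of 0 0] by (intro exI[of _ 0]) simp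
  next
    case False
    define a where "a = e / norm y"
    have a: "a > 0" using e False by (simp add: a_def)
    have "norm (a *\<^sub>R y) = e" using e False by (simp add: a_def)
    then have 1: "y0 + a *\<^sub>R y \<in> S n" "y0 \<in> S n" using e by (auto simp: dist_norm subset_iff)
    have d: "e / 4 > 0" using e by simp
    obtain p where p: "norm (F p) \<le> n" "dist p (y0 + a *\<^sub>R y) < e / 4"
      using 1(1) d unfolding S_def closure_approachable by blast
    obtain q where q: "norm (F q) \<le> n" "dist q y0 < e / 4"
      using 1(2) d unfolding S_def closure_approachable by blast
    \<comment> \<open>Scaled difference of two points of the sublevel set, one near
      \<open>y0 + a *\<^sub>R y\<close> and one near \<open>y0\<close>. Each is within e/4 of its
      target, and e is the norm of \<open>a *\<^sub>R y\<close>, which gives the factor 1/2.\<close>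
    define y' where "y' = (1/a) *\<^sub>R (p - q)"
    have "y - y' = (1/a) *\<^sub>R ((q - y0) - (p - (y0 + a *\<^sub>R y)))"
      using a by (simp add: y'_def algebra_simps)
    then have "norm (y - y') = (1/a) * norm ((q - y0) - (p - (y0 + a *\<^sub>R y)))" using a by simp
    also have "\<dots> \<le> (1/a) * (e/4 + e/4)"
      using p q a unfolding dist_norm
      by (intro mult_left_mono order_trans[OF norm_triangle_ineq4]) auto
    also have "\<dots> = norm y / 2" using e False by (simp add: a_def field_simps)
    finally have A: "norm (y - y') \<le> norm y / 2" .
    have "norm (F y') = (1/a) * norm (F p - F q)" using a by (simp add: y'_def F_scale F_diff)
    also have "\<dots> \<le> (1/a) * (n + n)"
      using p q a by (intro mult_left_mono order_trans[OF norm_triangle_ineq4]) auto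
    also have "\<dots> = k * norm y" using e False by (simp add: a_def k_def field_simps)
    finally show ?thesis using A by blast
  qed
  then obtain h where h: "\<And>y. norm (y - h y) \<le> norm y / 2" "\<And>y. norm (F (h y)) \<le> k * norm y"
    by metis
  have "norm (F y) \<le> norm y * (2 * k)" for y
  proof -
    \<comment> \<open>\<open>r j\<close> is the residual left after j corrections; it halves at each
      stage.\<close>
    define r where "r j = ((\<lambda>z. z - h z) ^^ j) y" for j
    have r0: "r 0 = y" and rS: "r (Suc j) = r j - h (r j)" for j by (simp_all add: r_def)
    have nr: "norm (r j) \<le> norm y * (1/2)^j" for j
    proof (induction j)
      case (Suc j)
      have "norm (r (Suc j)) \<le> norm (r j) / 2" using h(1)[of "r j"] rS by simp
      with Suc show ?case by simp
    qed (simp add: r0)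
    define x where "x j = F (h (r j))" for j
    have nx: "norm (x j) \<le> (k * norm y) * (1/2)^j" for j
      using order_trans[OF h(2)[of "r j"] mult_left_mono[OF nr \<open>k \<ge> 0\<close>]] by (simp add: x_def mult.assoc)
    have sg: "(\<lambda>j. (k * norm y) * (1/2)^j) sums ((k * norm y) * 2)"
      using sums_mult[OF geometric_sums[of "1/2::real"], of "k * norm y"] by simp
    have sx: "summable (\<lambda>j. norm (x j))"
      by (rule summable_comparison_test[OF _ sums_summable[OF sg]]) (use nx in auto)
    have "norm (suminf x) \<le> (\<Sum>j. norm (x j))" by (rule summable_norm[OF sx])
    also have "\<dots> \<le> (\<Sum>j. (k * norm y) * (1/2)^j)"
      by (rule suminf_le[OF nx sx sums_summable[OF sg]])
    also have "\<dots> = (k * norm y) * 2" using sg by (rule sums_unique[symmetric])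
    finally have nsx: "norm (suminf x) \<le> norm y * (2 * k)" by (simp add: algebra_simps)
    have part: "E (\<Sum>j<m. x j) = y - r m" for m
      by (induction m) (simp_all add: E.zero r0 rS E.add x_def EF)
    have "(\<lambda>m. E (\<Sum>j<m. x j)) \<longlonglongrightarrow> E (suminf x)"
      using summable_LIMSEQ[OF summable_norm_cancel[OF sx]] by (rule E.tendsto)
    moreover have "r \<longlonglongrightarrow> 0"
    proof (rule Lim_null_comparison)
      show "\<forall>\<^sub>F j in sequentially. norm (r j) \<le> norm y * (1/2)^j" using nr by simp
      show "(\<lambda>j. norm y * (1/2)^j) \<longlonglongrightarrow> 0"
        by (intro tendsto_mult_right_zero LIMSEQ_power_zero) simp
    qed
    then have "(\<lambda>m. y - r m) \<longlonglongrightarrow> y - 0" by (intro tendsto_intros)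
    ultimately have "E (suminf x) = y" unfolding part using LIMSEQ_unique by fastforce
    then have "F y = suminf x" using FE by metis
    then show ?thesis using nsx by simp
  qed
  then show ?thesis using F_add F_scale by (intro bounded_linear_intro)
qed

section \<open>Strong continuity and strong differentiability of operator families\<close>

definition strongly_cont :: "'t::topological_space set \<Rightarrow> ('t \<Rightarrow> 'a::real_normed_vector \<Rightarrow> 'b::real_normed_vector) \<Rightarrow> bool" where
  "strongly_cont S T \<longleftrightarrow> (\<forall>t\<in>S. bounded_linear (T t)) \<and> (\<forall>x. continuous_on S (\<lambda>t. T t x))"

lemma strongly_contD:
  assumes "strongly_cont S T"
  shows "t \<in> S \<Longrightarrow> bounded_linear (T t)" "continuous_on S (\<lambda>t. T t x)"
  using assms by (auto simp: strongly_cont_def)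

lemma strongly_cont_subset: "strongly_cont S T \<Longrightarrow> S' \<subseteq> S \<Longrightarrow> strongly_cont S' T"
  unfolding strongly_cont_def by (meson continuous_on_subset subsetD)

text \<open>Strong continuity contains no uniform bound; on compact parameter sets uniform
  boundedness supplies one.\<close>

lemma strongly_cont_bound:
  fixes T :: "'t::topological_space \<Rightarrow> 'a::banach \<Rightarrow> 'b::real_normed_vector"
  assumes "strongly_cont S T" "compact S"
  obtains c where "c > 0" "\<And>t x. t \<in> S \<Longrightarrow> norm (T t x) \<le> c * norm x"
proof (rule uniform_boundedness[of S T])
  show "\<exists>c. \<forall>t\<in>S. norm (T t x) \<le> c" for x
  proof -
    have "bounded ((\<lambda>t. T t x) ` S)"
      using compact_imp_bounded[OF compact_continuous_image] assms by (metis strongly_contD(2))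
    then show ?thesis unfolding bounded_iff by auto
  qed
qed (use assms strongly_contD in auto)

text \<open>Strong convergence does not by itself pass through a moving argument; an eventual common
  bound \<open>c\<close> on the operators makes it do so. Nearly every limit of an operator applied
  to a moving vector is taken this way.\<close>

lemma tendsto_apply_bounded:
  fixes T :: "'t \<Rightarrow> 'a::real_normed_vector \<Rightarrow> 'b::real_normed_vector"
  assumes ev: "\<forall>\<^sub>F t in F. bounded_linear (T t) \<and> (\<forall>x. norm (T t x) \<le> c * norm x)"
    and v: "(v \<longlongrightarrow> v0) F" and T: "((\<lambda>t. T t v0) \<longlongrightarrow> l) F"
  shows "((\<lambda>t. T t (v t)) \<longlongrightarrow> l) F"
proof -
  have "((\<lambda>t. T t (v t) - T t v0) \<longlongrightarrow> 0) F"
  proof (rule Lim_null_comparison)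
    show "\<forall>\<^sub>F t in F. norm (T t (v t) - T t v0) \<le> c * norm (v t - v0)"
      using ev by eventually_elim (metis bounded_linear.axioms(1) linear_diff)
    have "((\<lambda>t. norm (v t - v0)) \<longlongrightarrow> 0) F"
      using v Lim_null tendsto_norm_zero by blast
    then show "((\<lambda>t. c * norm (v t - v0)) \<longlongrightarrow> 0) F" by (rule tendsto_mult_right_zero)
  qed
  from tendsto_add[OF this T] show ?thesis by simp
qed

text \<open>A closed set in a Heine-Borel space meets a ball in a compact set, so the bound on
  compact sets becomes a local one.\<close>

lemma strongly_cont_local_bound:
  fixes T :: "'t::heine_borel \<Rightarrow> 'a::banach \<Rightarrow> 'b::real_normed_vector"
  assumes "strongly_cont S T" "closed S"
  obtains c where "c > 0" "\<forall>\<^sub>F s in at t within S. bounded_linear (T s) \<and> (\<forall>x. norm (T s x) \<le> c * norm x)"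
proof -
  have "strongly_cont (S \<inter> cball t 1) T" using assms strongly_cont_subset by blast
  moreover have "compact (S \<inter> cball t 1)" using assms by (simp add: closed_Int_compact)
  ultimately obtain c where c: "c > 0" "\<And>s x. s \<in> S \<inter> cball t 1 \<Longrightarrow> norm (T s x) \<le> c * norm x"
    using strongly_cont_bound by metis
  have "\<forall>\<^sub>F s in at t within S. s \<in> S \<inter> cball t 1"
    unfolding eventually_at by (rule exI[of _ 1]) (auto simp: dist_commute)
  then have "\<forall>\<^sub>F s in at t within S. bounded_linear (T s) \<and> (\<forall>x. norm (T s x) \<le> c * norm x)"
    by eventually_elim (use c assms strongly_contD in auto)
  then show ?thesis using that c by blast
qed

lemma strongly_cont_apply:
  fixes T :: "'t::heine_borel \<Rightarrow> 'a::banach \<Rightarrow> 'b::real_normed_vector"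
  assumes T: "strongly_cont S T" and S: "closed S" and u: "continuous_on S u"
  shows "continuous_on S (\<lambda>t. T t (u t))"
  unfolding continuous_on_def
proof
  fix t assume t: "t \<in> S"
  obtain c where "c > 0"
    and c: "\<forall>\<^sub>F s in at t within S. bounded_linear (T s) \<and> (\<forall>x. norm (T s x) \<le> c * norm x)"
    by (rule strongly_cont_local_bound[OF T S])
  from c show "((\<lambda>t. T t (u t)) \<longlongrightarrow> T t (u t)) (at t within S)"
  proof (rule tendsto_apply_bounded)
    show "(u \<longlongrightarrow> u t) (at t within S)" using u t by (simp add: continuous_on_def)
    show "((\<lambda>s. T s (u t)) \<longlongrightarrow> T t (u t)) (at t within S)"
      using strongly_contD(2)[OF T, of "u t"] t by (simp add: continuous_on_def)
  qed
qed

text \<open>Difference quotients converge on each vector, not in operator norm. The derivative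
  family is carried explicitly, so that it can be composed and differentiated again.\<close>

definition strong_C1 :: "real set \<Rightarrow> (real \<Rightarrow> 'a::real_normed_vector \<Rightarrow> 'b::real_normed_vector)
    \<Rightarrow> (real \<Rightarrow> 'a \<Rightarrow> 'b) \<Rightarrow> bool" where
  "strong_C1 S T T' \<longleftrightarrow> (\<forall>t\<in>S. bounded_linear (T t)) \<and> strongly_cont S T' \<and>
     (\<forall>x. \<forall>t\<in>S. ((\<lambda>t. T t x) has_vector_derivative T' t x) (at t within S))"

lemma strong_C1D:
  assumes "strong_C1 S T T'"
  shows "t \<in> S \<Longrightarrow> bounded_linear (T t)" "strongly_cont S T'" "strongly_cont S T"
    "t \<in> S \<Longrightarrow> ((\<lambda>t. T t x) has_vector_derivative T' t x) (at t within S)"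
    "t \<in> S \<Longrightarrow> bounded_linear (T' t)"
  using assms unfolding strong_C1_def strongly_cont_def
  by (auto intro!: continuous_on_vector_derivative)

lemma strong_C1_subset: "strong_C1 S T T' \<Longrightarrow> S' \<subseteq> S \<Longrightarrow> strong_C1 S' T T'"
  unfolding strong_C1_def
  by (meson has_vector_derivative_within_subset strongly_cont_subset subsetD)

text \<open>The form in which strong derivatives are computed: a quotient splits into terms to which
  operators with a common bound can be applied.\<close>

lemma has_vector_derivative_iff_quotient:
  "(f has_vector_derivative D) (at t within S) \<longleftrightarrow>
     ((\<lambda>s. (1 / (s - t)) *\<^sub>R (f s - f t)) \<longlongrightarrow> D) (at t within S)"
proof -
  have "(f has_vector_derivative D) (at t within S) \<longleftrightarrow>
     ((\<lambda>s. (1 / norm (s - t)) *\<^sub>R (f s - (f t + (s - t) *\<^sub>R D))) \<longlongrightarrow> 0) (at t within S)"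
    unfolding has_vector_derivative_def has_derivative_within
    by (simp add: bounded_linear_scaleR_left)
  also have "\<dots> \<longleftrightarrow> ((\<lambda>s. norm ((1 / norm (s - t)) *\<^sub>R (f s - (f t + (s - t) *\<^sub>R D)))) \<longlongrightarrow> 0) (at t within S)"
    by (rule tendsto_norm_zero_iff[symmetric])
  also have "\<dots> \<longleftrightarrow> ((\<lambda>s. norm ((1 / (s - t)) *\<^sub>R (f s - f t) - D)) \<longlongrightarrow> 0) (at t within S)"
  proof (rule filterlim_cong[OF refl refl])
    have "norm ((1 / norm (s - t)) *\<^sub>R (f s - (f t + (s - t) *\<^sub>R D))) =
        norm ((1 / (s - t)) *\<^sub>R (f s - f t) - D)" if "s \<noteq> t" for s
    proof -
      have "(1 / (s - t)) *\<^sub>R (f s - (f t + (s - t) *\<^sub>R D))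
          = (1 / (s - t)) *\<^sub>R (f s - f t) - (1 / (s - t)) *\<^sub>R ((s - t) *\<^sub>R D)"
        by (simp only: scaleR_diff_right[symmetric] diff_diff_eq)
      also have "(1 / (s - t)) *\<^sub>R ((s - t) *\<^sub>R D) = D" using that by simp
      finally have "(1 / (s - t)) *\<^sub>R (f s - f t) - D = (1 / (s - t)) *\<^sub>R (f s - (f t + (s - t) *\<^sub>R D))"
        by simp
      then show ?thesis by simp
    qed
    then show "\<forall>\<^sub>F s in at t within S. norm ((1 / norm (s - t)) *\<^sub>R (f s - (f t + (s - t) *\<^sub>R D))) =
        norm ((1 / (s - t)) *\<^sub>R (f s - f t) - D)"
      unfolding eventually_at_filter by simp
  qed
  also have "\<dots> \<longleftrightarrow> ((\<lambda>s. (1 / (s - t)) *\<^sub>R (f s - f t)) \<longlongrightarrow> D) (at t within S)"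
    unfolding tendsto_norm_zero_iff by (rule Lim_null[symmetric])
  finally show ?thesis .
qed

text \<open>Product rule. The increment is (T s - T t) (u t) + T s (u s - u t); the first term is
  strong differentiability, the second needs the local bound on \<open>T s\<close>.\<close>

lemma strong_C1_apply:
  fixes T :: "real \<Rightarrow> 'a::banach \<Rightarrow> 'b::real_normed_vector"
  assumes T: "strong_C1 S T T'" and S: "closed S" and t: "t \<in> S"
    and u: "(u has_vector_derivative u') (at t within S)"
  shows "((\<lambda>t. T t (u t)) has_vector_derivative T' t (u t) + T t u') (at t within S)"
proof -
  obtain c where "c > 0"
    and c: "\<forall>\<^sub>F s in at t within S. bounded_linear (T s) \<and> (\<forall>x. norm (T s x) \<le> c * norm x)"
    by (rule strongly_cont_local_bound[OF strong_C1D(3)[OF T] S])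
  have "((\<lambda>s. T s ((1 / (s - t)) *\<^sub>R (u s - u t))) \<longlongrightarrow> T t u') (at t within S)"
  proof (rule tendsto_apply_bounded[OF c])
    show "((\<lambda>s. (1 / (s - t)) *\<^sub>R (u s - u t)) \<longlongrightarrow> u') (at t within S)"
      using u by (simp add: has_vector_derivative_iff_quotient)
    show "((\<lambda>s. T s u') \<longlongrightarrow> T t u') (at t within S)"
      using strongly_contD(2)[OF strong_C1D(3)[OF T], of u'] t by (simp add: continuous_on_def)
  qed
  moreover have "((\<lambda>s. (1 / (s - t)) *\<^sub>R (T s (u t) - T t (u t))) \<longlongrightarrow> T' t (u t)) (at t within S)"
    using strong_C1D(4)[OF T t] by (simp add: has_vector_derivative_iff_quotient)
  ultimately have "((\<lambda>s. (1 / (s - t)) *\<^sub>R (T s (u t) - T t (u t)) + T s ((1 / (s - t)) *\<^sub>R (u s - u t)))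
      \<longlongrightarrow> T' t (u t) + T t u') (at t within S)" by (intro tendsto_add)
  moreover have "\<forall>\<^sub>F s in at t within S.
      (1 / (s - t)) *\<^sub>R (T s (u t) - T t (u t)) + T s ((1 / (s - t)) *\<^sub>R (u s - u t))
      = (1 / (s - t)) *\<^sub>R (T s (u s) - T t (u t))"
    using c
  proof eventually_elim
    case (elim s)
    then interpret bounded_linear "T s" by blast
    show ?case by (simp add: scaleR diff algebra_simps)
  qed
  ultimately show ?thesis
    unfolding has_vector_derivative_iff_quotient by (rule Lim_transform_eventually)
qed

lemma strong_C1_apply_subset:
  fixes T :: "real \<Rightarrow> 'a::banach \<Rightarrow> 'b::real_normed_vector"
  assumes "strong_C1 S T T'" "S' \<subseteq> S" "closed S'" "t \<in> S'"
    and "(u has_vector_derivative u') (at t within S')"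
  shows "((\<lambda>t. T t (u t)) has_vector_derivative T' t (u t) + T t u') (at t within S')"
  using assms strong_C1_apply strong_C1_subset by blast

lemma strongly_cont_compose:
  fixes T :: "'t::heine_borel \<Rightarrow> 'b::banach \<Rightarrow> 'c::real_normed_vector"
  assumes "strongly_cont S T" "strongly_cont S R" "closed S"
  shows "strongly_cont S (\<lambda>t x. T t (R t x))"
  using assms strongly_cont_apply[OF assms(1,3)] unfolding strongly_cont_def
  by (auto intro: bounded_linear_compose)

lemma strongly_cont_add:
  assumes "strongly_cont S T" "strongly_cont S R"
  shows "strongly_cont S (\<lambda>t x. T t x + R t x)"
  using assms unfolding strongly_cont_def by (auto intro!: bounded_linear_add continuous_intros)

lemma strongly_cont_minus:
  assumes "strongly_cont S T"
  shows "strongly_cont S (\<lambda>t x. - T t x)"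
  using assms unfolding strongly_cont_def by (auto intro!: bounded_linear_minus continuous_intros)

lemma strong_C1_compose:
  fixes T :: "real \<Rightarrow> 'b::banach \<Rightarrow> 'c::real_normed_vector" and R :: "real \<Rightarrow> 'a::real_normed_vector \<Rightarrow> 'b"
  assumes T: "strong_C1 S T T'" and R: "strong_C1 S R R'" and S: "closed S"
  shows "strong_C1 S (\<lambda>t x. T t (R t x)) (\<lambda>t x. T' t (R t x) + T t (R' t x))"
  unfolding strong_C1_def
proof (intro conjI ballI allI)
  show "strongly_cont S (\<lambda>t x. T' t (R t x) + T t (R' t x))"
    by (rule strongly_cont_add[OF
          strongly_cont_compose[OF strong_C1D(2)[OF T] strong_C1D(3)[OF R] S]
          strongly_cont_compose[OF strong_C1D(3)[OF T] strong_C1D(2)[OF R] S]])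
  fix t assume t: "t \<in> S"
  show "bounded_linear (\<lambda>x. T t (R t x))"
    by (rule bounded_linear_compose[OF strong_C1D(1)[OF T t] strong_C1D(1)[OF R t]])
  show "((\<lambda>t. T t (R t x)) has_vector_derivative T' t (R t x) + T t (R' t x)) (at t within S)" for x
    by (rule strong_C1_apply[OF T S t strong_C1D(4)[OF R t]])
qed

text \<open>The difficulty is a bound on \<open>F s\<close> for s near t. It is obtained from E s -
  E t = (s - t) Q s, where the quotients \<open>Q s\<close> are uniformly bounded, by absorbing this
  small perturbation. The formula for the derivative then follows from F s - F t = - F s (E s - E t)
  F t.\<close>

lemma strong_C1_inverse:
  fixes E :: "real \<Rightarrow> 'a::banach \<Rightarrow> 'b::banach"
  assumes E: "strong_C1 S E E'" and S: "closed S"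
    and EF: "\<And>t y. t \<in> S \<Longrightarrow> E t (F t y) = y" and FE: "\<And>t x. t \<in> S \<Longrightarrow> F t (E t x) = x"
  shows "strong_C1 S F (\<lambda>t y. - F t (E' t (F t y)))"
proof -
  have bF: "bounded_linear (F t)" if "t \<in> S" for t
    using bounded_linear_inverse strong_C1D(1)[OF E] EF FE that by metis
  have bE: "bounded_linear (E t)" if "t \<in> S" for t using strong_C1D(1)[OF E that] .
  have bd: "\<exists>c>0. \<forall>\<^sub>F s in at t within S. bounded_linear (F s) \<and> (\<forall>x. norm (F s x) \<le> c * norm x)"
    if t: "t \<in> S" for t
  proof -
    obtain c where "c > 0" "\<forall>y. norm (F t y) \<le> norm y * c"
      using bounded_linear.pos_bounded[OF bF[OF t]] by blast
    then have c: "c > 0" "\<And>y. norm (F t y) \<le> c * norm y" by (simp_all add: mult.commute)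
    define Q where "Q s x = (if s = t then 0 else (1 / (s - t)) *\<^sub>R (E s x - E t x))" for s x
    define SS where "SS = S \<inter> cball t 1"
    have "\<exists>k>0. \<forall>s\<in>SS. \<forall>x. norm (Q s x) \<le> k * norm x"
    proof -
      have *: "\<exists>k. \<forall>s\<in>SS. norm (Q s x) \<le> k" for x
      proof -
        \<comment> \<open>At t the quotient is completed by the derivative. It becomes continuous on
          the compact set \<open>SS\<close>, hence bounded there.\<close>
        let ?q = "\<lambda>s. if s = t then E' t x else (1 / (s - t)) *\<^sub>R (E s x - E t x)"
        have "continuous_on SS ?q"
          unfolding continuous_on_def
        proof
          fix s0 assume s0: "s0 \<in> SS"
          show "(?q \<longlongrightarrow> ?q s0) (at s0 within SS)"
          proof (cases "s0 = t")
            case True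
            have "((\<lambda>s. (1 / (s - t)) *\<^sub>R (E s x - E t x)) \<longlongrightarrow> E' t x) (at t within SS)"
              using strong_C1D(4)[OF E t, of x] unfolding has_vector_derivative_iff_quotient
              by (rule tendsto_within_subset) (auto simp: SS_def)
            then have "(?q \<longlongrightarrow> E' t x) (at t within SS)"
              by (rule Lim_transform_eventually) (auto simp: eventually_at_filter)
            then show ?thesis using True by simp
          next
            case False
            have "((\<lambda>s. E s x) \<longlongrightarrow> E s0 x) (at s0 within SS)"
              using strong_C1D(3)[OF E] s0 unfolding strongly_cont_def continuous_on_def SS_def
              by (meson Int_iff Int_lower1 tendsto_within_subset)
            then have "((\<lambda>s. (1 / (s - t)) *\<^sub>R (E s x - E t x)) \<longlongrightarrow> (1 / (s0 - t)) *\<^sub>R (E s0 x - E t x)) (at s0 within SS)"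
              using False by (intro tendsto_intros) auto
            moreover have "\<forall>\<^sub>F s in at s0 within SS. s \<noteq> t"
              using False by (metis eventually_neq_at_within)
            then have "\<forall>\<^sub>F s in at s0 within SS. (1 / (s - t)) *\<^sub>R (E s x - E t x) = ?q s"
              by eventually_elim simp
            ultimately have "(?q \<longlongrightarrow> (1 / (s0 - t)) *\<^sub>R (E s0 x - E t x)) (at s0 within SS)"
              by (rule Lim_transform_eventually)
            then show ?thesis using False by simp
          qed
        qed
        moreover have "compact SS" using S by (simp add: SS_def closed_Int_compact)
        ultimately have "bounded (?q ` SS)" using compact_continuous_image compact_imp_bounded by blast
        then obtain k where k: "\<forall>s\<in>SS. norm (?q s) \<le> k"
          unfolding bounded_iff by blast
        show ?thesis
        proof (intro exI[of _ "max k 0"] ballI)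
          fix s assume "s \<in> SS"
          with k show "norm (Q s x) \<le> max k 0"
            unfolding Q_def by (cases "s = t") (auto intro: order_trans[OF _ max.cobounded1])
        qed
      qed
      have "bounded_linear (Q s)" if "s \<in> SS" for s
      proof (cases "s = t")
        case False
        then show ?thesis using that bE t unfolding Q_def SS_def
          by (simp add: bounded_linear_scaleR_right bounded_linear_sub bounded_linear_compose[OF bounded_linear_scaleR_right])
      next
        case True
        then have "Q s = (\<lambda>x. 0)" by (simp add: Q_def fun_eq_iff)
        then show ?thesis by simp
      qed
      then show ?thesis using uniform_boundedness[of SS Q] * by metis
    qed
    then obtain k where k: "k > 0" "\<And>s x. s \<in> SS \<Longrightarrow> norm (Q s x) \<le> k * norm x" by blast
    \<comment> \<open>The radius makes \<open>c * k * \<bar>s - t\<bar> \<le> 1/2\<close>, so that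
      half of the norm of \<open>F s y\<close> is absorbed and \<open>2 * c\<close> bounds
      \<open>F s\<close>.\<close>
    have "\<forall>\<^sub>F s in at t within S. s \<in> SS \<and> s \<noteq> t \<and> \<bar>s - t\<bar> < 1 / (2 * c * k)"
      unfolding eventually_at SS_def
      by (rule exI[of _ "min 1 (1 / (2 * c * k))"]) (use c k in \<open>auto simp: dist_real_def\<close>)
    then have "\<forall>\<^sub>F s in at t within S. bounded_linear (F s) \<and> (\<forall>x. norm (F s x) \<le> (2 * c) * norm x)"
    proof eventually_elim
      case (elim s)
      then have s: "s \<in> S" unfolding SS_def by simp
      have "norm (F s y) \<le> 2 * c * norm y" for y
      proof -
        let ?x = "F s y"
        interpret Ft: bounded_linear "F t" by (rule bF[OF t])
        have "E s ?x - E t ?x = (s - t) *\<^sub>R Q s ?x" using elim by (simp add: Q_def)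
        then have "?x = F t y - F t ((s - t) *\<^sub>R Q s ?x)"
          using FE[OF t, of ?x] EF[OF s, of y] by (metis Ft.diff diff_diff_eq2 add_diff_cancel_left')
        then have "norm ?x \<le> norm (F t y) + norm (F t ((s - t) *\<^sub>R Q s ?x))"
          by (metis norm_triangle_ineq4)
        also have "\<dots> \<le> c * norm y + c * (\<bar>s - t\<bar> * (k * norm ?x))"
          using c k(2)[of s ?x] elim by (intro add_mono order_trans[OF c(2)] mult_left_mono) (auto intro: mult_left_mono)
        also have "c * (\<bar>s - t\<bar> * (k * norm ?x)) \<le> (1/2) * norm ?x"
        proof -
          have "c * k * \<bar>s - t\<bar> \<le> 1/2" using elim c k by (simp add: field_simps)
          from mult_right_mono[OF this, of "norm ?x"] show ?thesis by (simp add: algebra_simps)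
        qed
        finally show ?thesis by simp
      qed
      then show ?case using bF[OF s] by blast
    qed
    then show ?thesis using c by (intro exI[of _ "2 * c"]) auto
  qed
  have scF: "strongly_cont S F"
    unfolding strongly_cont_def continuous_on_def
  proof (intro conjI ballI allI)
    fix y t assume t: "t \<in> S"
    obtain c where c: "\<forall>\<^sub>F s in at t within S. bounded_linear (F s) \<and> (\<forall>x. norm (F s x) \<le> c * norm x)"
      using bd[OF t] by blast
    have "((\<lambda>s. F s y - F t y) \<longlongrightarrow> 0) (at t within S)"
    proof (rule Lim_null_comparison)
      show "\<forall>\<^sub>F s in at t within S. norm (F s y - F t y) \<le> c * norm (E t (F t y) - E s (F t y))"
        using c unfolding eventually_at_filter
      proof eventually_elim
        case (elim s)
        show ?case
        proof (intro impI)
          assume s: "s \<noteq> t" "s \<in> S"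
          with elim interpret Fs: bounded_linear "F s" by blast
          have "F s y - F t y = F s (E t (F t y) - E s (F t y))"
            using FE EF t s by (simp add: Fs.diff)
          then show "norm (F s y - F t y) \<le> c * norm (E t (F t y) - E s (F t y))"
            using elim s by metis
        qed
      qed
      have "((\<lambda>s. E s (F t y)) \<longlongrightarrow> E t (F t y)) (at t within S)"
        using strong_C1D(3)[OF E] t unfolding strongly_cont_def continuous_on_def by blast
      then have "((\<lambda>s. E t (F t y) - E s (F t y)) \<longlongrightarrow> E t (F t y) - E t (F t y)) (at t within S)"
        by (intro tendsto_intros)
      then show "((\<lambda>s. c * norm (E t (F t y) - E s (F t y))) \<longlongrightarrow> 0) (at t within S)"
        by (intro tendsto_mult_right_zero tendsto_norm_zero) simp
    qed
    then show "((\<lambda>s. F s y) \<longlongrightarrow> F t y) (at t within S)" by (simp add: LIM_zero_cancel)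
  qed (rule bF)
  show ?thesis
    unfolding strong_C1_def
  proof (intro conjI ballI allI)
    show "strongly_cont S (\<lambda>t y. - F t (E' t (F t y)))"
      by (rule strongly_cont_minus[OF strongly_cont_compose[OF scF
            strongly_cont_compose[OF strong_C1D(2)[OF E] scF S] S]])
    fix y t assume t: "t \<in> S"
    obtain c where c: "\<forall>\<^sub>F s in at t within S. bounded_linear (F s) \<and> (\<forall>x. norm (F s x) \<le> c * norm x)"
      using bd[OF t] by blast
    have "((\<lambda>s. F s ((1 / (s - t)) *\<^sub>R (E s (F t y) - E t (F t y)))) \<longlongrightarrow> F t (E' t (F t y))) (at t within S)"
    proof (rule tendsto_apply_bounded[OF c])
      show "((\<lambda>s. (1 / (s - t)) *\<^sub>R (E s (F t y) - E t (F t y))) \<longlongrightarrow> E' t (F t y)) (at t within S)"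
        using strong_C1D(4)[OF E t, of "F t y"] by (simp add: has_vector_derivative_iff_quotient)
      show "((\<lambda>s. F s (E' t (F t y))) \<longlongrightarrow> F t (E' t (F t y))) (at t within S)"
        using strongly_contD(2)[OF scF, of "E' t (F t y)"] t by (simp add: continuous_on_def)
    qed
    then have "((\<lambda>s. - F s ((1 / (s - t)) *\<^sub>R (E s (F t y) - E t (F t y)))) \<longlongrightarrow> - F t (E' t (F t y))) (at t within S)"
      by (rule tendsto_minus)
    moreover have "\<forall>\<^sub>F s in at t within S. - F s ((1 / (s - t)) *\<^sub>R (E s (F t y) - E t (F t y)))
        = (1 / (s - t)) *\<^sub>R (F s y - F t y)"
      using c unfolding eventually_at_filter
    proof eventually_elim
      case (elim s)
      show ?case
      proof (intro impI)
        assume s: "s \<noteq> t" "s \<in> S"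
        with elim interpret Fs: bounded_linear "F s" by blast
        show "- F s ((1 / (s - t)) *\<^sub>R (E s (F t y) - E t (F t y))) = (1 / (s - t)) *\<^sub>R (F s y - F t y)"
          using FE EF t s by (simp add: Fs.diff Fs.scaleR algebra_simps)
      qed
    qed
    ultimately show "((\<lambda>t. F t y) has_vector_derivative - F t (E' t (F t y))) (at t within S)"
      unfolding has_vector_derivative_iff_quotient by (rule Lim_transform_eventually)
  qed (rule bF)
qed

lemma bounded_linear_limit:
  fixes T :: "nat \<Rightarrow> 'a::banach \<Rightarrow> 'b::real_normed_vector"
  assumes lin: "\<And>n. bounded_linear (T n)" and lim: "\<And>x. (\<lambda>n. T n x) \<longlonglongrightarrow> L x"
  shows "bounded_linear L"
proof -
  have "\<exists>c. \<forall>n\<in>UNIV. norm (T n x) \<le> c" for x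
    using Bseq_def convergentI[OF lim] convergent_imp_Bseq by (metis UNIV_I)
  then obtain c where c: "\<And>n x. norm (T n x) \<le> c * norm x"
    using uniform_boundedness[of UNIV T] lin by (metis UNIV_I)
  show ?thesis
  proof (rule bounded_linear_intro)
    fix x y :: 'a and r :: real
    have "(\<lambda>n. T n (x + y)) \<longlonglongrightarrow> L x + L y"
      using tendsto_add[OF lim lim] bounded_linear.axioms(1)[OF lin] by (simp add: linear_add)
    then show "L (x + y) = L x + L y" using LIMSEQ_unique lim by blast
    have "(\<lambda>n. T n (r *\<^sub>R x)) \<longlonglongrightarrow> r *\<^sub>R L x"
      using tendsto_scaleR[OF tendsto_const lim] bounded_linear.axioms(1)[OF lin] by (simp add: linear_scale)
    then show "L (r *\<^sub>R x) = r *\<^sub>R L x" using LIMSEQ_unique lim by blast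
    show "norm (L x) \<le> norm x * c"
      by (rule LIMSEQ_le_const2[OF tendsto_norm[OF lim]]) (use c in \<open>auto simp: mult.commute\<close>)
  qed
qed

text \<open>Linearity and boundedness of \<open>T' t\<close> come for free: it is the pointwise
  limit of difference quotients along a sequence, which \<open>acc\<close> provides.\<close>

lemma strong_C1_I:
  fixes T :: "real \<Rightarrow> 'a::banach \<Rightarrow> 'b::real_normed_vector"
  assumes lin: "\<And>t. t \<in> S \<Longrightarrow> bounded_linear (T t)"
    and der: "\<And>x t. t \<in> S \<Longrightarrow> ((\<lambda>t. T t x) has_vector_derivative T' t x) (at t within S)"
    and cont: "\<And>x. continuous_on S (\<lambda>t. T' t x)"
    and acc: "\<And>t. t \<in> S \<Longrightarrow> at t within S \<noteq> bot"
  shows "strong_C1 S T T'"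
  unfolding strong_C1_def strongly_cont_def
proof (intro conjI ballI allI)
  fix t assume t: "t \<in> S"
  from acc[OF t] obtain f where f: "\<And>n. f n \<in> S - {t}" "f \<longlonglongrightarrow> t"
    by (metis islimpt_sequential trivial_limit_within)
  have "(\<lambda>n. (1 / (f n - t)) *\<^sub>R (T (f n) x - T t x)) \<longlonglongrightarrow> T' t x" for x
    using der[OF t, of x] f unfolding has_vector_derivative_iff_quotient tendsto_at_iff_sequentially o_def
    by blast
  then show "bounded_linear (T' t)"
  proof (rule bounded_linear_limit[rotated])
    fix n
    have "f n \<in> S" using f(1) by blast
    then show "bounded_linear (\<lambda>x. (1 / (f n - t)) *\<^sub>R (T (f n) x - T t x))"
      by (intro bounded_linear_compose[OF bounded_linear_scaleR_right] bounded_linear_sub lin t)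
  qed
qed (use lin der cont in auto)


section \<open>Maximal dissipative operators\<close>

text \<open>The Lumer-Phillips conditions for generating a contraction semigroup, over the reals and
  with the range condition for every \<open>l\<close> at once.\<close>

definition maximal_dissipative :: "'a::real_inner set \<Rightarrow> ('a \<Rightarrow> 'a) \<Rightarrow> bool" where
  "maximal_dissipative D A \<longleftrightarrow> subspace D \<and> closure D = UNIV \<and>
     (\<forall>x\<in>D. \<forall>y\<in>D. A (x + y) = A x + A y) \<and> (\<forall>c. \<forall>x\<in>D. A (c *\<^sub>R x) = c *\<^sub>R A x) \<and>
     (\<forall>x\<in>D. A x \<bullet> x \<le> 0) \<and> (\<forall>l>0. \<forall>y. \<exists>x\<in>D. x - l *\<^sub>R A x = y)"

text \<open>This is (I - l A)^-1, so \<open>l\<close> is the reciprocal of the usual spectral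
  parameter: for maximal dissipative A it is a contraction and tends strongly to the identity as l
  tends to 0.\<close>

definition resolvent :: "'a::real_vector set \<Rightarrow> ('a \<Rightarrow> 'a) \<Rightarrow> real \<Rightarrow> 'a \<Rightarrow> 'a" where
  "resolvent D A l y = (THE x. x \<in> D \<and> x - l *\<^sub>R A x = y)"

locale max_dissipative =
  fixes D :: "'a::real_inner set" and A
  assumes md: "maximal_dissipative D A"
begin

lemma subspace_D: "subspace D" using md by (simp add: maximal_dissipative_def)
lemma dense_D: "closure D = UNIV" using md by (simp add: maximal_dissipative_def)
lemma A_add: "x \<in> D \<Longrightarrow> y \<in> D \<Longrightarrow> A (x + y) = A x + A y"
  using md by (simp add: maximal_dissipative_def)
lemma A_scale: "x \<in> D \<Longrightarrow> A (c *\<^sub>R x) = c *\<^sub>R A x" using md by (simp add: maximal_dissipative_def)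
lemma A_dissip: "x \<in> D \<Longrightarrow> A x \<bullet> x \<le> 0" using md by (simp add: maximal_dissipative_def)
lemma A_diff: "x \<in> D \<Longrightarrow> y \<in> D \<Longrightarrow> A (x - y) = A x - A y"
  using A_add[of x "(-1) *\<^sub>R y"] A_scale[of y "-1"] subspace_scale[OF subspace_D, of y "-1"] by simp

lemma norm_le_range:
  assumes "x \<in> D" "l > 0" shows "norm x \<le> norm (x - l *\<^sub>R A x)"
proof -
  have "(norm x)\<^sup>2 \<le> (x - l *\<^sub>R A x) \<bullet> x"
    using mult_left_mono[OF A_dissip[OF assms(1)], of l] assms(2)
    by (simp add: inner_diff_left power2_norm_eq_inner)
  also have "\<dots> \<le> norm (x - l *\<^sub>R A x) * norm x" by (rule norm_cauchy_schwarz)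
  finally have "norm x * norm x \<le> norm (x - l *\<^sub>R A x) * norm x" by (simp add: power2_eq_square)
  then show ?thesis by (cases "x = 0") auto
qed

abbreviation R :: "real \<Rightarrow> 'a \<Rightarrow> 'a" where "R \<equiv> resolvent D A"

lemma R_ex1:
  assumes "l > 0" shows "\<exists>!x. x \<in> D \<and> x - l *\<^sub>R A x = y"
proof (rule ex_ex1I)
  show "\<exists>x. x \<in> D \<and> x - l *\<^sub>R A x = y" using md assms unfolding maximal_dissipative_def by blast
  fix x1 x2 assume x: "x1 \<in> D \<and> x1 - l *\<^sub>R A x1 = y" "x2 \<in> D \<and> x2 - l *\<^sub>R A x2 = y"
  then have d: "x1 - x2 \<in> D" using subspace_diff[OF subspace_D] by blast
  have "(x1 - x2) - l *\<^sub>R A (x1 - x2) = (x1 - l *\<^sub>R A x1) - (x2 - l *\<^sub>R A x2)"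
    using x by (simp add: A_diff algebra_simps)
  then have "(x1 - x2) - l *\<^sub>R A (x1 - x2) = 0" using x by simp
  then show "x1 = x2" using norm_le_range[OF d assms] by simp
qed

lemma R_in: "l > 0 \<Longrightarrow> R l y \<in> D" and R_eq: "l > 0 \<Longrightarrow> R l y - l *\<^sub>R A (R l y) = y"
  using theI'[OF R_ex1, of l y] unfolding resolvent_def by blast+

lemma R_unique: "l > 0 \<Longrightarrow> x \<in> D \<Longrightarrow> x - l *\<^sub>R A x = y \<Longrightarrow> R l y = x"
  using R_ex1[of l y] R_in R_eq by blast

lemma norm_R_le: "l > 0 \<Longrightarrow> norm (R l y) \<le> norm y"
  using norm_le_range[OF R_in R_eq[THEN subst]] R_in R_eq norm_le_range by metis

lemma R_add: "l > 0 \<Longrightarrow> R l (x + y) = R l x + R l y"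
proof (rule R_unique)
  assume l: "l > 0"
  show "R l x + R l y \<in> D" using R_in[OF l] subspace_D subspace_add by blast
  have "R l x + R l y - l *\<^sub>R A (R l x + R l y) = (R l x - l *\<^sub>R A (R l x)) + (R l y - l *\<^sub>R A (R l y))"
    using A_add[OF R_in[OF l] R_in[OF l], of x y] by (simp add: algebra_simps)
  then show "R l x + R l y - l *\<^sub>R A (R l x + R l y) = x + y" by (simp only: R_eq[OF l])
qed

lemma R_scale: "l > 0 \<Longrightarrow> R l (c *\<^sub>R x) = c *\<^sub>R R l x"
proof (rule R_unique)
  assume l: "l > 0"
  show "c *\<^sub>R R l x \<in> D" using R_in[OF l] subspace_D subspace_scale by blast
  have "c *\<^sub>R R l x - l *\<^sub>R A (c *\<^sub>R R l x) = c *\<^sub>R (R l x - l *\<^sub>R A (R l x))"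
    using A_scale[OF R_in[OF l]] by (simp add: algebra_simps)
  then show "c *\<^sub>R R l x - l *\<^sub>R A (c *\<^sub>R R l x) = c *\<^sub>R x" using R_eq[OF l] by simp
qed

lemma bounded_linear_R: "l > 0 \<Longrightarrow> bounded_linear (R l)"
  by (rule bounded_linear_intro[of _ 1]) (auto simp: R_add R_scale norm_R_le)

lemma R_A: "l > 0 \<Longrightarrow> x \<in> D \<Longrightarrow> R l (A x) = A (R l x)"
proof -
  assume l: "l > 0" and x: "x \<in> D"
  interpret bounded_linear "R l" by (rule bounded_linear_R[OF l])
  have "R l (x - l *\<^sub>R A x) = x" using R_unique[OF l x refl] .
  then have "l *\<^sub>R R l (A x) = R l x - x" by (simp add: diff scaleR algebra_simps)
  also have "\<dots> = l *\<^sub>R A (R l x)" using R_eq[OF l, of x] by (simp add: algebra_simps)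
  finally show ?thesis using l by simp
qed

lemma A_R: "l > 0 \<Longrightarrow> A (R l y) = (1 / l) *\<^sub>R (R l y - y)"
proof -
  assume l: "l > 0"
  have "l *\<^sub>R A (R l y) = R l y - y" using R_eq[OF l, of y] by (simp add: algebra_simps)
  then have "(1 / l) *\<^sub>R l *\<^sub>R A (R l y) = (1 / l) *\<^sub>R (R l y - y)" by simp
  then show ?thesis using l by simp
qed

text \<open>Writes a vector of the range of \<open>R l\<close> as \<open>R 1\<close> of an explicit
  argument. This later lets A' act on it through the single bounded operator A'(I - A)^-1.\<close>

lemma R_via_one: "l > 0 \<Longrightarrow> R l y = R 1 (R l y - A (R l y))"
  using R_unique[of 1 "R l y"] R_in by simp

lemma bounded_linear_AR: "l > 0 \<Longrightarrow> bounded_linear (\<lambda>y. A (R l y))"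
  unfolding A_R
  by (intro bounded_linear_compose[OF bounded_linear_scaleR_right] bounded_linear_sub
      bounded_linear_R bounded_linear_ident)

text \<open>Dissipativity of the Yosida approximation: since y = R l y - l A (R l y), the inner
  product is that of A at \<open>R l y\<close>, minus l times a square.\<close>

lemma AR_dissip: "l > 0 \<Longrightarrow> A (R l y) \<bullet> y \<le> 0"
proof -
  assume l: "l > 0"
  have "A (R l y) \<bullet> y = A (R l y) \<bullet> R l y - l * (A (R l y) \<bullet> A (R l y))"
    using R_eq[OF l, of y] by (metis inner_diff_right inner_scaleR_right)
  also have "\<dots> \<le> 0" using A_dissip[OF R_in[OF l]] l by (smt (verit) inner_ge_zero mult_nonneg_nonneg)
  finally show ?thesis .
qed

lemma norm_R_diff_le: "l > 0 \<Longrightarrow> x \<in> D \<Longrightarrow> norm (R l x - x) \<le> l * norm (A x)"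
proof -
  assume l: "l > 0" and x: "x \<in> D"
  have "R l x - x = l *\<^sub>R R l (A x)" using R_eq[OF l, of x] R_A[OF l x] by (simp add: algebra_simps)
  then show ?thesis using l norm_R_le[OF l, of "A x"] by simp
qed

text \<open>Closedness comes from continuity of \<open>R 1\<close>, because x n = R 1 (x n - A (x
  n)) passes to the limit.\<close>

lemma A_closed:
  assumes "\<And>n. x n \<in> D" "x \<longlonglongrightarrow> a" "(\<lambda>n. A (x n)) \<longlonglongrightarrow> b"
  shows "a \<in> D" "A a = b"
proof -
  interpret bounded_linear "R 1" by (rule bounded_linear_R) simp
  have "(\<lambda>n. R 1 (x n - A (x n))) \<longlonglongrightarrow> R 1 (a - b)"
    by (intro tendsto tendsto_intros assms)
  moreover have "R 1 (x n - A (x n)) = x n" for n using R_unique[of 1 "x n"] assms(1) by simp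
  ultimately have *: "R 1 (a - b) = a" using assms(2) LIMSEQ_unique by fastforce
  then show "a \<in> D" using R_in[of 1 "a - b"] by simp
  show "A a = b" using R_eq[of 1 "a - b"] * by (simp add: algebra_simps)
qed

text \<open>
  With \<open>\<mu>\<close> large, \<open>N - \<mu>\<close> has norm less than \<open>\<mu>\<close>, while \<open>(\<mu> - A)\<^sup>-\<^sup>1\<close> has norm at
  most \<open>1/\<mu>\<close>; so \<open>N - A = (\<mu> - A) + (N - \<mu>)\<close> is onto by the contraction principle.
\<close>

lemma coercive_minus_onto:
  fixes N :: "'a \<Rightarrow> 'a"
  assumes N: "bounded_linear N" and nu: "\<nu> > 0" "\<And>x. N x \<bullet> x \<ge> \<nu> * (norm x)\<^sup>2"
    and complete: "complete (UNIV :: 'a set)"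
  shows "\<exists>x\<in>D. N x - A x = y"
proof -
  interpret N: bounded_linear N by (rule N)
  obtain c where "c > 0" "\<forall>x. norm (N x) \<le> norm x * c" using N.pos_bounded by blast
  then have c: "c > 0" "\<And>x. norm (N x) \<le> c * norm x" by (simp_all add: mult.commute)
  \<comment> \<open>This m minimizes 1 - 2 \<nu> / m + c^2 / m^2, the square of the contraction
    factor, and the minimum is 1 - \<nu> / m. It is nonnegative unless the space is zero, whence the
    \<open>max 0\<close> below.\<close>
  define m where "m = c\<^sup>2 / \<nu>"
  have m: "m > 0" using c nu by (simp add: m_def)
  define k where "k = sqrt (max 0 (1 - \<nu> / m))"
  have k: "0 \<le> k" "k < 1" using nu m by (auto simp: k_def)
  have est: "norm (x - (1/m) *\<^sub>R N x) \<le> k * norm x" for x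
  proof -
    have "(norm (x - (1/m) *\<^sub>R N x))\<^sup>2 = (norm x)\<^sup>2 - (2/m) * (N x \<bullet> x) + (1/m)\<^sup>2 * (norm (N x))\<^sup>2"
      unfolding power2_norm_eq_inner inner_diff_left inner_diff_right inner_scaleR_left inner_scaleR_right
        inner_commute[of x "N x"] by (simp add: power2_eq_square diff_divide_distrib)
    also have "\<dots> \<le> (norm x)\<^sup>2 - (2/m) * (\<nu> * (norm x)\<^sup>2) + (1/m)\<^sup>2 * (c * norm x)\<^sup>2"
      using m nu(2) c(2) by (intro add_mono diff_mono mult_left_mono power_mono) auto
    also have "\<dots> = (1 - \<nu> / m) * (norm x)\<^sup>2"
      using m nu by (simp add: m_def field_simps power2_eq_square)
    also have "\<dots> \<le> (max 0 (1 - \<nu> / m)) * (norm x)\<^sup>2" by (intro mult_right_mono) auto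
    also have "\<dots> = (k * norm x)\<^sup>2" by (simp add: k_def power_mult_distrib)
    finally show ?thesis by (rule power2_le_imp_le) (use k in simp)
  qed
  define l where "l = 1 / m"
  have l: "l > 0" using m by (simp add: l_def)
  define f where "f x = R l (l *\<^sub>R y + (x - l *\<^sub>R N x))" for x
  interpret Rl: bounded_linear "R l" by (rule bounded_linear_R[OF l])
  have "dist (f x) (f z) \<le> k * dist x z" for x z
  proof -
    have "f x - f z = R l ((x - z) - l *\<^sub>R N (x - z))"
      unfolding f_def Rl.diff[symmetric] by (simp add: N.diff algebra_simps)
    then show ?thesis unfolding dist_norm
      using norm_R_le[OF l] est[of "x - z"] l_def by (metis order_trans)
  qed
  then have "\<exists>!x. x \<in> UNIV \<and> f x = x"
    by (intro Banach_fix[OF complete _ k]) auto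
  then obtain x where x: "f x = x" by blast
  have xD: "x \<in> D" using R_in[OF l] x unfolding f_def by metis
  have "x - l *\<^sub>R A x = l *\<^sub>R y + (x - l *\<^sub>R N x)" using R_eq[OF l] x unfolding f_def by metis
  then have "l *\<^sub>R (N x - A x) = l *\<^sub>R y" by (simp add: algebra_simps)
  then have "N x - A x = y" using l by simp
  then show ?thesis using xD by blast
qed

end

lemma maximal_dissipative_zero: "maximal_dissipative UNIV (\<lambda>_. 0)"
  unfolding maximal_dissipative_def by auto

text \<open>Lax-Milgram, as the case A = 0 of \<open>coercive_minus_onto\<close>.\<close>

lemma coercive_bij:
  fixes N :: "'a::{real_inner,banach} \<Rightarrow> 'a"
  assumes N: "bounded_linear N" and nu: "\<nu> > 0" "\<And>x. N x \<bullet> x \<ge> \<nu> * (norm x)\<^sup>2"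
  shows "bij N"
proof -
  interpret max_dissipative UNIV "\<lambda>_::'a. 0" by unfold_locales (rule maximal_dissipative_zero)
  have "surj N" using coercive_minus_onto[OF N nu complete_UNIV] by (metis diff_zero surjI)
  moreover have "inj N"
  proof (rule injI)
    fix x y assume "N x = N y"
    then have "N (x - y) = 0" by (simp add: linear_diff[OF bounded_linear.axioms(1)[OF N]])
    then have "\<nu> * (norm (x - y))\<^sup>2 \<le> 0" using nu(2)[of "x - y"] by simp
    then show "x = y" using nu(1) by (simp add: mult_le_0_iff)
  qed
  ultimately show ?thesis by (simp add: bij_def)
qed


section \<open>Gronwall's inequality and Volterra equations\<close>

text \<open>The source grows at a rate \<open>k\<close> above the rate \<open>c\<close> of the
  homogeneous inequality and therefore enters only with the factor \<open>1 / (k - c)\<close>. For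
  large \<open>k\<close> this is small, which is what produces contractions in exponentially
  weighted norms.\<close>

lemma gronwall:
  fixes e e' :: "real \<Rightarrow> real"
  assumes st: "s \<le> b" and cont: "continuous_on {s..b} e"
    and der: "\<And>t. s < t \<Longrightarrow> t < b \<Longrightarrow> (e has_real_derivative e' t) (at t)"
    and le: "\<And>t. s < t \<Longrightarrow> t < b \<Longrightarrow> e' t \<le> c * e t + h * exp (k * (t - s))"
    and ck: "c < k" and h: "h \<ge> 0" and e0: "e s \<ge> 0"
  shows "e b \<le> exp (k * (b - s)) * (e s + h / (k - c))"
proof -
  \<comment> \<open>Integrating factor minus the antiderivative of the transformed source; the
    inequality says that \<open>q\<close> does not increase.\<close>
  define q where "q t = e t * exp (- c * (t - s)) - h / (k - c) * exp ((k - c) * (t - s))" for t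
  have "q b \<le> q s"
  proof (cases "s = b")
    case False
    then have sb: "s < b" using st by simp
    have "continuous_on {s..b} q" unfolding q_def by (intro continuous_intros cont)
    moreover have dq: "(q has_real_derivative (e' t - c * e t) * exp (- c * (t - s)) - h * exp ((k - c) * (t - s))) (at t)"
      if "s < t" "t < b" for t
    proof -
      let ?E = "exp (- c * (t - s))" and ?X = "exp ((k - c) * (t - s))"
      have "(q has_real_derivative (e' t * ?E + e t * (?E * (- c)) - h / (k - c) * (?X * (k - c)))) (at t)"
        unfolding q_def by (auto intro!: derivative_eq_intros der[OF that])
      moreover have "h / (k - c) * (?X * (k - c)) = h * ?X" using ck by simp
      ultimately show ?thesis by (simp add: algebra_simps)
    qed
    ultimately obtain l z where z: "s < z" "z < b" "(q has_real_derivative l) (at z)" "q b - q s = (b - s) * l"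
      using MVT[OF sb, of q] real_differentiable_def by blast
    have l: "l = (e' z - c * e z) * exp (- c * (z - s)) - h * exp ((k - c) * (z - s))"
      using DERIV_unique[OF z(3) dq[OF z(1,2)]] .
    have "(e' z - c * e z) * exp (- c * (z - s)) \<le> h * exp (k * (z - s)) * exp (- c * (z - s))"
      using le[OF z(1,2)] by (intro mult_right_mono) auto
    also have "\<dots> = h * exp ((k - c) * (z - s))" by (simp add: mult.assoc mult_exp_exp) (simp add: algebra_simps)
    finally have "l \<le> 0" using l by simp
    then show ?thesis using z(4) sb by (smt (verit) mult_nonneg_nonpos)
  qed simp
  moreover have "q s = e s - h / (k - c)" by (simp add: q_def)
  moreover have "h / (k - c) \<ge> 0" using h ck by simp
  ultimately have "e b * exp (- c * (b - s)) \<le> e s + h / (k - c) * exp ((k - c) * (b - s))"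
    unfolding q_def by linarith
  then have "e b * exp (- c * (b - s)) * exp (c * (b - s))
      \<le> (e s + h / (k - c) * exp ((k - c) * (b - s))) * exp (c * (b - s))"
    by (intro mult_right_mono) auto
  moreover have "exp ((k - c) * (b - s)) * exp (c * (b - s)) = exp (k * (b - s))"
    by (simp add: mult_exp_exp algebra_simps)
  ultimately have "e b \<le> e s * exp (c * (b - s)) + h / (k - c) * exp (k * (b - s))"
    by (simp add: mult.assoc mult_exp_exp distrib_right)
  also have "\<dots> \<le> e s * exp (k * (b - s)) + h / (k - c) * exp (k * (b - s))"
    using e0 ck st by (intro add_right_mono mult_left_mono) (auto intro: mult_right_mono)
  finally show ?thesis by (simp add: algebra_simps)
qed

text \<open>Picard iteration converges because the map is a contraction in the norm weighted by \<open>e\<^sup>-\<^sup>k\<^sup>t\<close>.\<close>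

lemma weighted_fixed_point:
  fixes \<Phi> :: "(real \<Rightarrow> 'a::banach) \<Rightarrow> real \<Rightarrow> 'a"
  assumes k: "k \<ge> 0"
    and cont: "\<And>u. continuous_on {s..b} u \<Longrightarrow> continuous_on {s..b} (\<Phi> u)"
    and contr: "\<And>u v c t. continuous_on {s..b} u \<Longrightarrow> continuous_on {s..b} v \<Longrightarrow> c \<ge> 0 \<Longrightarrow>
       (\<And>r. r \<in> {s..b} \<Longrightarrow> norm (u r - v r) \<le> c * exp (k * (r - s))) \<Longrightarrow> t \<in> {s..b} \<Longrightarrow>
       norm (\<Phi> u t - \<Phi> v t) \<le> c / 2 * exp (k * (t - s))"
  obtains u where "continuous_on {s..b} u" "\<And>t. t \<in> {s..b} \<Longrightarrow> \<Phi> u t = u t"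
proof -
  define U where "U n = (\<Phi> ^^ n) (\<lambda>_. 0)" for n
  have U: "U 0 = (\<lambda>_. 0)" "U (Suc n) = \<Phi> (U n)" for n by (simp_all add: U_def)
  have cU: "continuous_on {s..b} (U n)" for n by (induction n) (simp_all add: U cont)
  have "bounded (U 1 ` {s..b})" using cU compact_continuous_image compact_imp_bounded by blast
  then obtain c0 where c0: "\<And>t. t \<in> {s..b} \<Longrightarrow> norm (U 1 t) \<le> c0" unfolding bounded_iff by blast
  define c where "c = max c0 0"
  have c: "c \<ge> 0" "\<And>t. t \<in> {s..b} \<Longrightarrow> norm (U 1 t) \<le> c" using c0 by (force simp: c_def)+
  have d: "norm (U (Suc n) t - U n t) \<le> c * (1/2)^n * exp (k * (t - s))" if "t \<in> {s..b}" for n t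
    using that
  proof (induction n arbitrary: t)
    case 0
    have "c * 1 \<le> c * exp (k * (t - s))" using c k 0 by (intro mult_left_mono) auto
    then show ?case using c(2)[OF 0] by (simp add: U(1))
  next
    case (Suc n)
    show ?case
      using contr[OF cU cU _ Suc.IH Suc.prems] c by (simp add: U)
  qed
  define m where "m = c * exp (k * (b - s))"
  have "norm (U (Suc n) t - U n t) \<le> m * (1/2)^n" if "t \<in> {s..b}" for n t
  proof -
    have "exp (k * (t - s)) \<le> exp (k * (b - s))" using that k by (auto intro: mult_left_mono)
    then have "c * (1/2)^n * exp (k * (t - s)) \<le> c * (1/2)^n * exp (k * (b - s))"
      using c by (intro mult_left_mono) auto
    then show ?thesis using d[OF that, of n] by (simp add: m_def algebra_simps)
  qed
  moreover have "summable (\<lambda>n. m * (1/2)^n)" by (intro summable_mult summable_geometric) simp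
  ultimately have "uniform_limit {s..b} (\<lambda>n t. \<Sum>i<n. U (Suc i) t - U i t)
      (\<lambda>t. \<Sum>i. U (Suc i) t - U i t) sequentially" by (rule Weierstrass_m_test)
  moreover have "(\<Sum>i<n. U (Suc i) t - U i t) = U n t" for n t
    by (simp add: sum_lessThan_telescope[where f="\<lambda>i. U i t"] U(1))
  ultimately obtain u where u: "uniform_limit {s..b} U u sequentially" by auto
  have cu: "continuous_on {s..b} u"
    by (rule uniform_limit_theorem[OF _ u]) (use cU in auto)
  have "\<Phi> u t = u t" if t: "t \<in> {s..b}" for t
  proof (rule LIMSEQ_unique)
    show "(\<lambda>n. U (Suc n) t) \<longlonglongrightarrow> u t"
      using tendsto_uniform_limitI[OF u t] LIMSEQ_Suc by blast
    show "(\<lambda>n. U (Suc n) t) \<longlonglongrightarrow> \<Phi> u t"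
    proof (rule LIMSEQ_I)
      fix e :: real assume e: "e > 0"
      define e' where "e' = e / exp (k * (t - s))"
      have e': "e' > 0" using e by (simp add: e'_def)
      from uniform_limitD[OF u e'] obtain n0 where n0: "\<And>n r. n \<ge> n0 \<Longrightarrow> r \<in> {s..b} \<Longrightarrow> dist (U n r) (u r) < e'"
        unfolding eventually_sequentially by blast
      show "\<exists>n0. \<forall>n\<ge>n0. norm (U (Suc n) t - \<Phi> u t) < e"
      proof (intro exI[of _ n0] allI impI)
        fix n assume n: "n \<ge> n0"
        have *: "norm (U n r - u r) \<le> e' * exp (k * (r - s))" if r: "r \<in> {s..b}" for r
        proof -
          have "e' * 1 \<le> e' * exp (k * (r - s))" using r k e' by (intro mult_left_mono) auto
          then show ?thesis using n0[OF n r] unfolding dist_norm by linarith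
        qed
        have "norm (\<Phi> (U n) t - \<Phi> u t) \<le> e' / 2 * exp (k * (t - s))"
          using contr[OF cU cu _ * t] e' by simp
        also have "\<dots> < e" using e by (simp add: e'_def)
        finally show "norm (U (Suc n) t - \<Phi> u t) < e" by (simp add: U)
      qed
    qed
  qed
  then show ?thesis using that cu by blast
qed

text \<open>In the norm weighted by the exponential, integration gains the factor 1 / k.\<close>

lemma integral_exp_le:
  fixes f :: "real \<Rightarrow> 'a::banach"
  assumes "continuous_on {s..t} f" "s \<le> t" "k > 0" "c \<ge> 0"
    and le: "\<And>r. r \<in> {s..t} \<Longrightarrow> norm (f r) \<le> c * exp (k * (r - s))"
  shows "norm (integral {s..t} f) \<le> c / k * exp (k * (t - s))"
proof -
  have hi: "((\<lambda>r. c * exp (k * (r - s))) has_integral (c / k * exp (k * (t - s)) - c / k * exp (k * (s - s)))) {s..t}"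
  proof (rule fundamental_theorem_of_calculus[OF assms(2)])
    fix r
    have "((\<lambda>r. c / k * exp (k * (r - s))) has_real_derivative c / k * (exp (k * (r - s)) * k)) (at r within {s..t})"
      by (auto intro!: derivative_eq_intros)
    then show "((\<lambda>r. c / k * exp (k * (r - s))) has_vector_derivative c * exp (k * (r - s))) (at r within {s..t})"
      using assms(3) by (simp add: has_real_derivative_iff_has_vector_derivative algebra_simps)
  qed
  have "norm (integral {s..t} f) \<le> integral {s..t} (\<lambda>r. c * exp (k * (r - s)))"
    by (rule integral_norm_bound_integral[OF integrable_continuous_real[OF assms(1)]
          has_integral_integrable[OF hi] le])
  also have "\<dots> \<le> c / k * exp (k * (t - s))" unfolding integral_unique[OF hi] using assms by simp
  finally show ?thesis .
qed

text \<open>Coefficients are only strongly continuous, so the classical theorem for norm-continuous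
  coefficients does not apply; its proof by a fixed point does, with the bound from uniform
  boundedness.\<close>

lemma linear_ode_ex:
  fixes G :: "real \<Rightarrow> 'a::banach \<Rightarrow> 'a"
  assumes G: "strongly_cont {s..b} G" and ph: "continuous_on {s..b} \<phi>"
  obtains z where "z s = \<zeta>"
    "\<And>t. t \<in> {s..b} \<Longrightarrow> (z has_vector_derivative G t (z t) + \<phi> t) (at t within {s..b})"
proof -
  obtain c where c: "c > 0" "\<And>t x. t \<in> {s..b} \<Longrightarrow> norm (G t x) \<le> c * norm x"
    using strongly_cont_bound[OF G] by auto
  define \<Phi> where "\<Phi> u t = \<zeta> + integral {s..t} (\<lambda>r. G r (u r) + \<phi> r)" for u t
  have ci: "continuous_on {s..b} (\<lambda>r. G r (u r) + \<phi> r)" if "continuous_on {s..b} u" for u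
    by (intro continuous_on_add ph strongly_cont_apply[OF G] that) simp
  have der: "(\<Phi> u has_vector_derivative G t (u t) + \<phi> t) (at t within {s..b})"
    if "continuous_on {s..b} u" "t \<in> {s..b}" for u t
    unfolding \<Phi>_def using integral_has_vector_derivative[OF ci[OF that(1)] that(2)]
    by (auto intro!: derivative_eq_intros)
  \<comment> \<open>The bound \<open>c\<close> of \<open>G\<close> and the gain 1 / (2 c) of
    integration with weight \<open>2 * c\<close> multiply to the contraction factor 1/2.\<close>
  obtain u where u: "continuous_on {s..b} u" "\<And>t. t \<in> {s..b} \<Longrightarrow> \<Phi> u t = u t"
  proof (rule weighted_fixed_point[of "2 * c" s b \<Phi>])
    show "continuous_on {s..b} (\<Phi> u)" if "continuous_on {s..b} u" for u
      by (rule continuous_on_vector_derivative[OF der[OF that]])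
    fix u v :: "real \<Rightarrow> 'a" and a t
    assume *: "continuous_on {s..b} u" "continuous_on {s..b} v" "a \<ge> 0"
      "\<And>r. r \<in> {s..b} \<Longrightarrow> norm (u r - v r) \<le> a * exp (2 * c * (r - s))" and t: "t \<in> {s..b}"
    have sub: "{s..t} \<subseteq> {s..b}" using t by auto
    have int: "(\<lambda>r. G r (u r) + \<phi> r) integrable_on {s..t}" if "continuous_on {s..b} u" for u
      by (rule integrable_continuous_real[OF continuous_on_subset[OF ci[OF that] sub]])
    have cd: "continuous_on {s..t} (\<lambda>r. G r (u r - v r))"
      by (rule continuous_on_subset[OF strongly_cont_apply[OF G closed_atLeastAtMost
              continuous_on_diff[OF *(1,2)]] sub])
    have "\<Phi> u t - \<Phi> v t = integral {s..t} (\<lambda>r. G r (u r) + \<phi> r) - integral {s..t} (\<lambda>r. G r (v r) + \<phi> r)"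
      by (simp add: \<Phi>_def)
    also have "\<dots> = integral {s..t} (\<lambda>r. (G r (u r) + \<phi> r) - (G r (v r) + \<phi> r))"
      by (rule Henstock_Kurzweil_Integration.integral_diff[symmetric, OF int[OF *(1)] int[OF *(2)]])
    also have "\<dots> = integral {s..t} (\<lambda>r. G r (u r - v r))"
    proof (rule Henstock_Kurzweil_Integration.integral_cong)
      fix r assume "r \<in> {s..t}"
      then have "r \<in> {s..b}" using sub by blast
      then interpret bounded_linear "G r" using G strongly_contD by blast
      show "G r (u r) + \<phi> r - (G r (v r) + \<phi> r) = G r (u r - v r)" by (simp add: diff)
    qed
    also have "norm \<dots> \<le> (c * a) / (2 * c) * exp (2 * c * (t - s))"
    proof (rule integral_exp_le[OF cd])
      fix r assume "r \<in> {s..t}"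
      then have r: "r \<in> {s..b}" using sub by blast
      have "norm (G r (u r - v r)) \<le> c * norm (u r - v r)" by (rule c(2)[OF r])
      also have "\<dots> \<le> c * (a * exp (2 * c * (r - s)))" using c *(4)[OF r] by (intro mult_left_mono) auto
      finally show "norm (G r (u r - v r)) \<le> c * a * exp (2 * c * (r - s))" by simp
    qed (use t c * in auto)
    finally show "norm (\<Phi> u t - \<Phi> v t) \<le> a / 2 * exp (2 * c * (t - s))" using c by simp
  qed (use c in auto)
  have "(\<Phi> u has_vector_derivative G t (\<Phi> u t) + \<phi> t) (at t within {s..b})" if "t \<in> {s..b}" for t
    using der[OF u(1) that] u(2)[OF that] by simp
  moreover have "\<Phi> u s = \<zeta>" by (simp add: \<Phi>_def)
  ultimately show ?thesis using that[of "\<Phi> u"] by blast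
qed

text \<open>Steklov averages over [t, t + h]; they are C^1, and uniform continuity makes them
  uniformly close. The function is continued beyond \<open>b\<close> by its value at
  \<open>b\<close>, so that the averages make sense up to the end point.\<close>

lemma smooth_approximation:
  fixes \<phi> :: "real \<Rightarrow> 'a::banach"
  assumes ph: "continuous_on {s..b} \<phi>" and e: "e > 0" and sb: "s \<le> b"
  obtains \<psi> \<psi>' where "continuous_on {s..b} \<psi>'"
    "\<And>t. t \<in> {s..b} \<Longrightarrow> (\<psi> has_vector_derivative \<psi>' t) (at t within {s..b})"
    "\<And>t. t \<in> {s..b} \<Longrightarrow> norm (\<psi> t - \<phi> t) \<le> e"
proof -
  define f where "f r = \<phi> (min r b)" for r
  have cf: "continuous_on {s..b + 1} f"
    unfolding f_def using sb by (intro continuous_on_compose2[OF ph]) (auto intro!: continuous_intros)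
  have "uniformly_continuous_on {s..b + 1} f" using compact_uniformly_continuous[OF cf] by simp
  then obtain d where d: "d > 0"
    "\<And>x y. x \<in> {s..b+1} \<Longrightarrow> y \<in> {s..b+1} \<Longrightarrow> dist x y < d \<Longrightarrow> dist (f x) (f y) < e"
    unfolding uniformly_continuous_on_def using e by metis
  define h where "h = min (d / 2) 1"
  have h: "h > 0" "h < d" "h \<le> 1" using d by (auto simp: h_def)
  define F where "F t = integral {s..t} f" for t
  have dF: "(F has_vector_derivative f t) (at t within {s..b+1})" if "t \<in> {s..b+1}" for t
    unfolding F_def by (rule integral_has_vector_derivative[OF cf that])
  define \<psi> where "\<psi> t = (1/h) *\<^sub>R (F (t + h) - F t)" for t
  define \<psi>' where "\<psi>' t = (1/h) *\<^sub>R (f (t + h) - f t)" for t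
  show ?thesis
  proof (rule that[of \<psi>' \<psi>])
    have "continuous_on {s..b} (\<lambda>t. f (t + h))"
      using h by (intro continuous_on_compose2[OF cf]) (auto intro!: continuous_intros)
    moreover have "continuous_on {s..b} f" by (rule continuous_on_subset[OF cf]) auto
    ultimately show "continuous_on {s..b} \<psi>'" unfolding \<psi>'_def by (intro continuous_intros)
    fix t assume t: "t \<in> {s..b}"
    have "((F \<circ> (\<lambda>t. t + h)) has_vector_derivative 1 *\<^sub>R f (t + h)) (at t within {s..b})"
    proof (rule vector_diff_chain_within)
      show "((\<lambda>t. t + h) has_vector_derivative 1) (at t within {s..b})" by (auto intro!: derivative_eq_intros)
      have "(F has_vector_derivative f (t + h)) (at (t + h) within {s..b+1})" using t h by (intro dF) auto
      then show "(F has_vector_derivative f (t + h)) (at (t + h) within (\<lambda>t. t + h) ` {s..b})"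
        by (rule has_vector_derivative_within_subset) (use h in auto)
    qed
    moreover have "(F has_vector_derivative f t) (at t within {s..b})"
      by (rule has_vector_derivative_within_subset[OF dF]) (use t in auto)
    ultimately have D: "((\<lambda>t. F (t + h) - F t) has_vector_derivative f (t + h) - f t) (at t within {s..b})"
      by (intro has_vector_derivative_diff) (simp_all add: o_def)
    show "(\<psi> has_vector_derivative \<psi>' t) (at t within {s..b})"
      using bounded_linear.has_vector_derivative[OF bounded_linear_scaleR_right D, of "1/h"]
      by (simp add: \<psi>_def[abs_def] \<psi>'_def)
    have sub: "{t..t + h} \<subseteq> {s..b + 1}" using t h by auto
    have "F (t + h) - F t = integral {t..t + h} f"
      using Henstock_Kurzweil_Integration.integral_combine[of s t "t + h" f] t h
        integrable_continuous_real[OF continuous_on_subset[OF cf, of "{s..t + h}"]]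
      by (simp add: F_def algebra_simps)
    also have "\<dots> - h *\<^sub>R f t = integral {t..t + h} (\<lambda>r. f r - f t)"
      using h Henstock_Kurzweil_Integration.integral_diff[OF
          integrable_continuous_real[OF continuous_on_subset[OF cf sub]] integrable_const_ivl[of "f t"]]
      by simp
    finally have eq: "F (t + h) - F t - h *\<^sub>R f t = integral {t..t + h} (\<lambda>r. f r - f t)" .
    have "norm (integral {t..t + h} (\<lambda>r. f r - f t)) \<le> e * (t + h - t)"
    proof (rule integral_bound)
      show "continuous_on {t..t + h} (\<lambda>r. f r - f t)"
        by (intro continuous_intros continuous_on_subset[OF cf sub])
      fix r assume "r \<in> {t..t + h}"
      then show "norm (f r - f t) \<le> e"
        using d(2)[of r t] t h by (auto simp: dist_norm)
    qed (use h in auto)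
    then have "norm (F (t + h) - F t - h *\<^sub>R f t) \<le> e * h" using eq by simp
    then have "(1/h) * norm (F (t + h) - F t - h *\<^sub>R f t) \<le> (1/h) * (e * h)"
      using h by (intro mult_left_mono) auto
    moreover have "\<psi> t - \<phi> t = (1/h) *\<^sub>R (F (t + h) - F t - h *\<^sub>R f t)"
      using h t by (simp add: \<psi>_def f_def scaleR_diff_right)
    then have "norm (\<psi> t - \<phi> t) = (1/h) * norm (F (t + h) - F t - h *\<^sub>R f t)" using h by simp
    ultimately show "norm (\<psi> t - \<phi> t) \<le> e" using h by simp
  qed
qed


section \<open>Kato's theorem on a compact interval\<close>

text \<open>The energy is \<open>N t x \<bullet> x\<close>: since N inverts M, the inner product of
  N (M A x) with x is that of A x with x, hence nonpositive. \<open>A'_cont\<close> states that A'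
  is bounded relative to A without putting a norm on \<open>D\<close>. \<open>P\<close> is a bounded
  perturbation.\<close>

locale kato =
  fixes T :: real and D :: "'a::{real_inner,banach} set"
    and A A' M M' N N' P P' :: "real \<Rightarrow> 'a \<Rightarrow> 'a" and \<nu> :: real
  assumes T: "T > 0"
    and A_md: "\<And>t. t \<in> {0..T} \<Longrightarrow> max_dissipative D (A t)"
    and A_deriv: "\<And>t x. t \<in> {0..T} \<Longrightarrow> x \<in> D \<Longrightarrow>
      ((\<lambda>t. A t x) has_vector_derivative A' t x) (at t within {0..T})"
    and A'_cont: "strongly_cont {0..T} (\<lambda>t y. A' t (resolvent D (A t) 1 y))"
    and M: "strong_C1 {0..T} M M'" and N: "strong_C1 {0..T} N N'" and P: "strong_C1 {0..T} P P'"
    and MN: "\<And>t x. t \<in> {0..T} \<Longrightarrow> M t (N t x) = x"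
    and NM: "\<And>t x. t \<in> {0..T} \<Longrightarrow> N t (M t x) = x"
    and N_sym: "\<And>t x y. t \<in> {0..T} \<Longrightarrow> N t x \<bullet> y = x \<bullet> N t y"
    and \<nu>: "\<nu> > 0" and N_coercive: "\<And>t x. t \<in> {0..T} \<Longrightarrow> N t x \<bullet> x \<ge> \<nu> * (norm x)\<^sup>2"
begin

abbreviation R where "R l t \<equiv> resolvent D (A t) l"
text \<open>This is A'(I - A)^-1, so that A' z = B (z - A z) for z in \<open>D\<close>.\<close>

definition B where "B t y = A' t (R 1 t y)"
definition Yos where "Yos l t y = A t (R l t y)"

lemmas R_in = max_dissipative.R_in[OF A_md]
  and R_eq = max_dissipative.R_eq[OF A_md]
  and norm_R_le = max_dissipative.norm_R_le[OF A_md]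
  and bounded_linear_R = max_dissipative.bounded_linear_R[OF A_md]
  and dense_D = max_dissipative.dense_D[OF A_md]

text \<open>One constant for all seven families; the estimates below only have to count its
  powers.\<close>

definition bounded_by :: "real \<Rightarrow> bool" where
  "bounded_by c \<longleftrightarrow> c \<ge> 1 \<and> (\<forall>t\<in>{0..T}. \<forall>x. norm (M t x) \<le> c * norm x \<and> norm (M' t x) \<le> c * norm x \<and>
     norm (N t x) \<le> c * norm x \<and> norm (N' t x) \<le> c * norm x \<and>
     norm (P t x) \<le> c * norm x \<and> norm (P' t x) \<le> c * norm x \<and> norm (B t x) \<le> c * norm x)"

lemma bounded_by_ex: "\<exists>c. bounded_by c"
proof -
  have b: "\<exists>c>0. \<forall>t\<in>{0..T}. \<forall>x. norm (Q t x) \<le> c * norm x" if Q: "strongly_cont {0..T} Q" for Q :: "real \<Rightarrow> 'a \<Rightarrow> 'a"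
    by (rule strongly_cont_bound[OF Q compact_Icc]) blast
  have BB: "strongly_cont {0..T} B" using A'_cont unfolding B_def[abs_def] .
  obtain c1 where c1: "c1 > 0" "\<forall>t\<in>{0..T}. \<forall>x. norm (M t x) \<le> c1 * norm x"
    using b[OF strong_C1D(3)[OF M]] by blast
  obtain c2 where c2: "c2 > 0" "\<forall>t\<in>{0..T}. \<forall>x. norm (M' t x) \<le> c2 * norm x"
    using b[OF strong_C1D(2)[OF M]] by blast
  obtain c3 where c3: "c3 > 0" "\<forall>t\<in>{0..T}. \<forall>x. norm (N t x) \<le> c3 * norm x"
    using b[OF strong_C1D(3)[OF N]] by blast
  obtain c4 where c4: "c4 > 0" "\<forall>t\<in>{0..T}. \<forall>x. norm (N' t x) \<le> c4 * norm x"
    using b[OF strong_C1D(2)[OF N]] by blast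
  obtain c5 where c5: "c5 > 0" "\<forall>t\<in>{0..T}. \<forall>x. norm (P t x) \<le> c5 * norm x"
    using b[OF strong_C1D(3)[OF P]] by blast
  obtain c6 where c6: "c6 > 0" "\<forall>t\<in>{0..T}. \<forall>x. norm (P' t x) \<le> c6 * norm x"
    using b[OF strong_C1D(2)[OF P]] by blast
  obtain c7 where c7: "c7 > 0" "\<forall>t\<in>{0..T}. \<forall>x. norm (B t x) \<le> c7 * norm x"
    using b[OF BB] by blast
  have le: "a \<le> c * norm x \<Longrightarrow> c \<le> c' \<Longrightarrow> a \<le> c' * norm x" for a c c' :: real and x :: 'a
    by (meson mult_right_mono norm_ge_zero order_trans)
  define c where "c = 1 + c1 + c2 + c3 + c4 + c5 + c6 + c7"
  note pos = c1(1) c2(1) c3(1) c4(1) c5(1) c6(1) c7(1)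
  have "bounded_by c" unfolding bounded_by_def
  proof (intro conjI ballI allI)
    show "c \<ge> 1" using pos by (simp add: c_def)
    fix t x assume t: "t \<in> {0..T}"
    show "norm (M t x) \<le> c * norm x"
      by (rule le[OF c1(2)[rule_format, OF t]]) (use pos in \<open>simp add: c_def\<close>)
    show "norm (M' t x) \<le> c * norm x"
      by (rule le[OF c2(2)[rule_format, OF t]]) (use pos in \<open>simp add: c_def\<close>)
    show "norm (N t x) \<le> c * norm x"
      by (rule le[OF c3(2)[rule_format, OF t]]) (use pos in \<open>simp add: c_def\<close>)
    show "norm (N' t x) \<le> c * norm x"
      by (rule le[OF c4(2)[rule_format, OF t]]) (use pos in \<open>simp add: c_def\<close>)
    show "norm (P t x) \<le> c * norm x"
      by (rule le[OF c5(2)[rule_format, OF t]]) (use pos in \<open>simp add: c_def\<close>)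
    show "norm (P' t x) \<le> c * norm x"
      by (rule le[OF c6(2)[rule_format, OF t]]) (use pos in \<open>simp add: c_def\<close>)
    show "norm (B t x) \<le> c * norm x"
      by (rule le[OF c7(2)[rule_format, OF t]]) (use pos in \<open>simp add: c_def\<close>)
  qed
  then show ?thesis by blast
qed

definition K where "K = (SOME c. bounded_by c)"

lemma K:
  shows "K \<ge> 1"
    and "t \<in> {0..T} \<Longrightarrow> norm (M t x) \<le> K * norm x" "t \<in> {0..T} \<Longrightarrow> norm (M' t x) \<le> K * norm x"
    "t \<in> {0..T} \<Longrightarrow> norm (N t x) \<le> K * norm x" "t \<in> {0..T} \<Longrightarrow> norm (N' t x) \<le> K * norm x"
    "t \<in> {0..T} \<Longrightarrow> norm (P t x) \<le> K * norm x" "t \<in> {0..T} \<Longrightarrow> norm (P' t x) \<le> K * norm x"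
    "t \<in> {0..T} \<Longrightarrow> norm (B t x) \<le> K * norm x"
proof -
  have "bounded_by K" unfolding K_def by (rule someI_ex[OF bounded_by_ex])
  note this[unfolded bounded_by_def]
  then show "K \<ge> 1"
    and "t \<in> {0..T} \<Longrightarrow> norm (M t x) \<le> K * norm x" "t \<in> {0..T} \<Longrightarrow> norm (M' t x) \<le> K * norm x"
    "t \<in> {0..T} \<Longrightarrow> norm (N t x) \<le> K * norm x" "t \<in> {0..T} \<Longrightarrow> norm (N' t x) \<le> K * norm x"
    "t \<in> {0..T} \<Longrightarrow> norm (P t x) \<le> K * norm x" "t \<in> {0..T} \<Longrightarrow> norm (P' t x) \<le> K * norm x"
    "t \<in> {0..T} \<Longrightarrow> norm (B t x) \<le> K * norm x" by blast+
qed

lemma A_cont: "x \<in> D \<Longrightarrow> continuous_on {0..T} (\<lambda>t. A t x)"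
  by (rule continuous_on_vector_derivative[OF A_deriv])

text \<open>The second resolvent identity. As all \<open>A t\<close> share the domain
  \<open>D\<close>, it reduces the regularity of the resolvents in time to that of
  \<open>A t x\<close> at fixed x.\<close>

lemma R_diff:
  assumes t: "t \<in> {0..T}" and s: "s \<in> {0..T}" and l: "l > 0"
  shows "R l t y - R l s y = l *\<^sub>R R l t (A t (R l s y) - A s (R l s y))"
proof -
  interpret Rt: bounded_linear "R l t" by (rule bounded_linear_R[OF t l])
  have "R l t (R l s y - l *\<^sub>R A t (R l s y)) = R l s y"
    by (rule max_dissipative.R_unique[OF A_md[OF t] l R_in[OF s l] refl])
  moreover have "R l s y - l *\<^sub>R A t (R l s y) = y - l *\<^sub>R (A t (R l s y) - A s (R l s y))"
    using R_eq[OF s l, of y] by (simp add: algebra_simps)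
  ultimately have "R l s y = R l t y - l *\<^sub>R R l t (A t (R l s y) - A s (R l s y))"
    by (simp add: Rt.diff Rt.scaleR)
  then show ?thesis by (simp add: algebra_simps)
qed

lemma R_quotient:
  assumes t: "t \<in> {0..T}" and s: "s \<in> {0..T}" and l: "l > 0"
  shows "(1 / (s - t)) *\<^sub>R (R l s y - R l t y) = l *\<^sub>R R l s ((1 / (s - t)) *\<^sub>R (A s (R l t y) - A t (R l t y)))"
proof -
  interpret bounded_linear "R l s" by (rule bounded_linear_R[OF s l])
  show ?thesis unfolding R_diff[OF s t l] by (simp add: scaleR mult.commute)
qed

lemma R_contr_ev:
  assumes "l > 0"
  shows "\<forall>\<^sub>F s in at t within {0..T}. bounded_linear (R l s) \<and> (\<forall>x. norm (R l s x) \<le> 1 * norm x)"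
  unfolding eventually_at_filter using bounded_linear_R[OF _ assms] norm_R_le[OF _ assms] by simp

lemma R_cont:
  assumes l: "l > 0" shows "strongly_cont {0..T} (R l)"
  unfolding strongly_cont_def continuous_on_def
proof (intro conjI ballI allI)
  fix t y assume t: "t \<in> {0..T}"
  have "((\<lambda>s. R l s y - R l t y) \<longlongrightarrow> 0) (at t within {0..T})"
  proof (rule Lim_null_comparison)
    show "\<forall>\<^sub>F s in at t within {0..T}. norm (R l s y - R l t y) \<le> l * norm (A s (R l t y) - A t (R l t y))"
      unfolding eventually_at_filter using R_diff[OF _ t l, of _ y] norm_R_le[OF _ l] l by simp
    have "((\<lambda>s. A s (R l t y)) \<longlongrightarrow> A t (R l t y)) (at t within {0..T})"
      using A_cont[OF R_in[OF t l]] t unfolding continuous_on_def by blast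
    then have "((\<lambda>s. A s (R l t y) - A t (R l t y)) \<longlongrightarrow> 0) (at t within {0..T})"
      by (rule LIM_zero)
    then show "((\<lambda>s. l * norm (A s (R l t y) - A t (R l t y))) \<longlongrightarrow> 0) (at t within {0..T})"
      by (intro tendsto_mult_right_zero tendsto_norm_zero)
  qed
  then show "((\<lambda>s. R l s y) \<longlongrightarrow> R l t y) (at t within {0..T})" by (rule LIM_zero_cancel)
qed (rule bounded_linear_R[OF _ l])

lemma Yos_eq: "t \<in> {0..T} \<Longrightarrow> l > 0 \<Longrightarrow> Yos l t y = (1 / l) *\<^sub>R (R l t y - y)"
  unfolding Yos_def by (rule max_dissipative.A_R[OF A_md])

lemma bounded_linear_Yos: "t \<in> {0..T} \<Longrightarrow> l > 0 \<Longrightarrow> bounded_linear (Yos l t)"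
  unfolding Yos_def[abs_def] by (rule max_dissipative.bounded_linear_AR[OF A_md])

lemma Yos_dissip: "t \<in> {0..T} \<Longrightarrow> l > 0 \<Longrightarrow> Yos l t y \<bullet> y \<le> 0"
  unfolding Yos_def by (rule max_dissipative.AR_dissip[OF A_md])

lemma R_Yos: "t \<in> {0..T} \<Longrightarrow> l > 0 \<Longrightarrow> R l t y = y + l *\<^sub>R Yos l t y"
  unfolding Yos_def using R_eq[of t l y] by (simp add: algebra_simps)

lemma Yos_cont: "l > 0 \<Longrightarrow> strongly_cont {0..T} (Yos l)"
proof -
  assume l: "l > 0"
  have "continuous_on {0..T} (\<lambda>t. (1 / l) *\<^sub>R (R l t y - y))" for y
    by (intro continuous_intros strongly_contD(2)[OF R_cont[OF l]])
  then have "continuous_on {0..T} (\<lambda>t. Yos l t y)" for y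
    by (subst continuous_on_cong[OF refl]) (auto simp: Yos_eq[OF _ l])
  then show ?thesis unfolding strongly_cont_def using bounded_linear_Yos[OF _ l] by blast
qed

lemma A'_R: "t \<in> {0..T} \<Longrightarrow> l > 0 \<Longrightarrow> A' t (R l t y) = B t (R l t y - Yos l t y)"
  unfolding B_def Yos_def using max_dissipative.R_via_one[OF A_md] by simp

lemma strongly_cont_B: "strongly_cont {0..T} B" using A'_cont unfolding B_def[abs_def] .

text \<open>The derivative of the Yosida approximation is R A' R. Written with \<open>B\<close>, it
  is controlled by y and \<open>Yos l t y\<close> without any negative power of l, and this keeps
  later bounds uniform in l.\<close>

lemma Yos_C1:
  assumes l: "l > 0"
  shows "strong_C1 {0..T} (Yos l) (\<lambda>t y. R l t (B t (R l t y - Yos l t y)))"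
  unfolding strong_C1_def
proof (intro conjI ballI allI)
  fix t assume t: "t \<in> {0..T}"
  show "bounded_linear (Yos l t)" by (rule bounded_linear_Yos[OF t l])
next
  have "strongly_cont {0..T} (\<lambda>t y. R l t y + - Yos l t y)"
    by (rule strongly_cont_add[OF R_cont[OF l] strongly_cont_minus[OF Yos_cont[OF l]]])
  from strongly_cont_compose[OF R_cont[OF l] strongly_cont_compose[OF strongly_cont_B this]]
  show "strongly_cont {0..T} (\<lambda>t y. R l t (B t (R l t y - Yos l t y)))" by simp
next
  fix y t assume t: "t \<in> {0..T}"
  let ?d = "A' t (R l t y)"
  have "((\<lambda>s. R l s ((1 / (s - t)) *\<^sub>R (A s (R l t y) - A t (R l t y)))) \<longlongrightarrow> R l t ?d) (at t within {0..T})"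
  proof (rule tendsto_apply_bounded[OF R_contr_ev[OF l]])
    show "((\<lambda>s. (1 / (s - t)) *\<^sub>R (A s (R l t y) - A t (R l t y))) \<longlongrightarrow> ?d) (at t within {0..T})"
      using A_deriv[OF t R_in[OF t l]] by (simp add: has_vector_derivative_iff_quotient)
    show "((\<lambda>s. R l s ?d) \<longlongrightarrow> R l t ?d) (at t within {0..T})"
      using strongly_contD(2)[OF R_cont[OF l], of ?d] t by (simp add: continuous_on_def)
  qed
  moreover have "\<forall>\<^sub>F s in at t within {0..T}. R l s ((1 / (s - t)) *\<^sub>R (A s (R l t y) - A t (R l t y)))
     = (1 / (s - t)) *\<^sub>R (Yos l s y - Yos l t y)"
    unfolding eventually_at_filter
  proof (intro always_eventually allI impI)
    fix s assume s: "s \<noteq> t" "s \<in> {0..T}"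
    have "Yos l s y - Yos l t y = (1 / l) *\<^sub>R (R l s y - R l t y)"
      using s t l by (simp add: Yos_eq scaleR_diff_right)
    then have "(1 / (s - t)) *\<^sub>R (Yos l s y - Yos l t y) = (1 / l) *\<^sub>R ((1 / (s - t)) *\<^sub>R (R l s y - R l t y))"
      by (simp add: mult.commute)
    also have "\<dots> = R l s ((1 / (s - t)) *\<^sub>R (A s (R l t y) - A t (R l t y)))"
      unfolding R_quotient[OF t s(2) l] using l by simp
    finally show "R l s ((1 / (s - t)) *\<^sub>R (A s (R l t y) - A t (R l t y)))
     = (1 / (s - t)) *\<^sub>R (Yos l s y - Yos l t y)" ..
  qed
  ultimately have "((\<lambda>t. Yos l t y) has_vector_derivative R l t ?d) (at t within {0..T})"
    unfolding has_vector_derivative_iff_quotient by (rule Lim_transform_eventually)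
  then show "((\<lambda>t. Yos l t y) has_vector_derivative R l t (B t (R l t y - Yos l t y))) (at t within {0..T})"
    using A'_R[OF t l] by simp
qed

end

lemma mult_le_sum_squares: "a * b \<le> a\<^sup>2 + b\<^sup>2" for a b :: real
proof -
  have "0 \<le> (a - b)\<^sup>2 + a\<^sup>2 + b\<^sup>2" by simp
  then show ?thesis by (simp add: power2_eq_square algebra_simps)
qed

lemma has_vector_derivative_at_interior:
  fixes f :: "real \<Rightarrow> 'b::real_normed_vector"
  assumes "(f has_vector_derivative d) (at t within {s..b})" "s < t" "t < b"
  shows "(f has_vector_derivative d) (at t)"
  using assms at_within_Icc_at[of s t b] by simp

lemma bounded_on:
  fixes f :: "real \<Rightarrow> 'b::real_normed_vector"
  assumes "continuous_on {s..b} f"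
  obtains c where "c \<ge> 0" "\<And>t. t \<in> {s..b} \<Longrightarrow> norm (f t) \<le> c"
proof -
  have "bounded (f ` {s..b})" using compact_continuous_image[OF assms compact_Icc] compact_imp_bounded by blast
  then obtain c where "\<And>t. t \<in> {s..b} \<Longrightarrow> norm (f t) \<le> c" unfolding bounded_iff by blast
  then show ?thesis using that[of "max c 0"] by (meson max.cobounded1 max.cobounded2 order_trans)
qed

section \<open>Energy estimates and Yosida approximations\<close>

context kato
begin

lemmas M_lin = strong_C1D(1)[OF M] and N_lin = strong_C1D(1)[OF N] and P_lin = strong_C1D(1)[OF P]
  and M'_lin = strong_C1D(5)[OF M] and P'_lin = strong_C1D(5)[OF P]
  and B_lin = strongly_contD(1)[OF strongly_cont_B]

text \<open>Differentiation of \<open>N t (z t) \<bullet> z t\<close>. Symmetry of N doubles the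
  term with z', the variation of N contributes at most K times the squared norm, and coercivity
  converts squared norms into energy; this explains the rate
  \<open>(K + 2 * \<alpha>) / \<nu>\<close>.\<close>

lemma energy:
  assumes s: "0 \<le> s" and sb: "s \<le> b" and b: "b \<le> T"
    and cont: "continuous_on {s..b} z"
    and der: "\<And>t. s < t \<Longrightarrow> t < b \<Longrightarrow> (z has_vector_derivative z' t) (at t)"
    and le: "\<And>t. s < t \<Longrightarrow> t < b \<Longrightarrow> N t (z' t) \<bullet> z t \<le> \<alpha> * (norm (z t))\<^sup>2 + h * exp (k * (t - s))"
    and \<alpha>: "\<alpha> \<ge> 0" and h: "h \<ge> 0" and k: "(K + 2 * \<alpha>) / \<nu> < k"
  shows "\<nu> * (norm (z b))\<^sup>2 \<le> exp (k * (b - s)) * (K * (norm (z s))\<^sup>2 + 2 * h / (k - (K + 2 * \<alpha>) / \<nu>))"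
proof -
  define e where "e t = N t (z t) \<bullet> z t" for t
  define c where "c = (K + 2 * \<alpha>) / \<nu>"
  define e' where "e' t = N' t (z t) \<bullet> z t + 2 * (N t (z' t) \<bullet> z t)" for t
  have sub: "{s..b} \<subseteq> {0..T}" using s b by auto
  have Nge: "\<nu> * (norm (z t))\<^sup>2 \<le> e t" if "t \<in> {s..b}" for t
    using N_coercive[of t "z t"] that sub unfolding e_def by auto
  have "e b \<le> exp (k * (b - s)) * (e s + 2 * h / (k - c))"
  proof (rule gronwall[OF sb])
    have "continuous_on {s..b} (\<lambda>t. N t (z t))"
      by (rule strongly_cont_apply[OF strongly_cont_subset[OF strong_C1D(3)[OF N] sub] _ cont]) simp
    then show "continuous_on {s..b} e" unfolding e_def by (intro continuous_intros cont)
    fix t assume t: "s < t" "t < b"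
    then have tI: "t \<in> {0..T}" "0 < t" "t < T" using s b by auto
    have "((\<lambda>t. N t (z t)) has_vector_derivative N' t (z t) + N t (z' t)) (at t within {0..T})"
      by (rule strong_C1_apply[OF N _ tI(1) has_vector_derivative_at_within[OF der[OF t]]]) simp
    then have "((\<lambda>t. N t (z t)) has_vector_derivative N' t (z t) + N t (z' t)) (at t)"
      using has_vector_derivative_at_interior tI by blast
    from bounded_bilinear.has_vector_derivative[OF bounded_bilinear_inner this der[OF t]]
    show "(e has_real_derivative e' t) (at t)"
      unfolding has_real_derivative_iff_has_vector_derivative e_def e'_def
      using N_sym[OF tI(1), of "z t" "z' t"] by (simp add: inner_add_left inner_commute algebra_simps)
    have "N' t (z t) \<bullet> z t \<le> norm (N' t (z t)) * norm (z t)" by (rule norm_cauchy_schwarz)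
    also have "\<dots> \<le> (K * norm (z t)) * norm (z t)" by (intro mult_right_mono K(5) tI) simp
    finally have "e' t \<le> (K + 2 * \<alpha>) * (norm (z t))\<^sup>2 + 2 * h * exp (k * (t - s))"
      using le[OF t] by (simp add: e'_def power2_eq_square algebra_simps)
    also have "(K + 2 * \<alpha>) * (norm (z t))\<^sup>2 \<le> c * e t"
    proof -
      have "(K + 2 * \<alpha>) * (norm (z t))\<^sup>2 = c * (\<nu> * (norm (z t))\<^sup>2)" using \<nu> by (simp add: c_def)
      also have "\<dots> \<le> c * e t" using Nge[of t] t K(1) \<alpha> \<nu> by (intro mult_left_mono) (auto simp: c_def)
      finally show ?thesis .
    qed
    finally show "e' t \<le> c * e t + 2 * h * exp (k * (t - s))" by simp
  next
    show "c < k" using k by (simp add: c_def)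
    show "2 * h \<ge> 0" using h by simp
    show "e s \<ge> 0" using Nge[of s] sb \<nu> by (smt (verit) atLeastAtMost_iff mult_nonneg_nonneg zero_le_power2)
  qed
  moreover have "e s \<le> K * (norm (z s))\<^sup>2"
  proof -
    have "e s \<le> norm (N s (z s)) * norm (z s)" unfolding e_def by (rule norm_cauchy_schwarz)
    also have "\<dots> \<le> (K * norm (z s)) * norm (z s)" using sub sb by (intro mult_right_mono K(4)) auto
    finally show ?thesis by (simp add: power2_eq_square)
  qed
  ultimately have "e b \<le> exp (k * (b - s)) * (K * (norm (z s))\<^sup>2 + 2 * h / (k - c))"
    by (smt (verit) exp_gt_zero mult_left_mono)
  then show ?thesis using Nge[of b] sb by (simp add: c_def)
qed

text \<open>The constant of \<open>energy\<close> when the rate is taken one above the critical one,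
  so that the source enters just as \<open>2 * h\<close>.\<close>

definition C\<^sub>0 :: "real \<Rightarrow> real" where
  "C\<^sub>0 \<alpha> = exp (((K + 2 * \<alpha>) / \<nu> + 1) * T) * (K + 2) / \<nu>"

lemma C\<^sub>0_pos: "C\<^sub>0 \<alpha> > 0"
  using K(1) \<nu> unfolding C\<^sub>0_def by simp

lemma energy_sup:
  assumes s: "0 \<le> s" and sb: "s \<le> b" and b: "b \<le> T"
    and cont: "continuous_on {s..b} z"
    and der: "\<And>t. s < t \<Longrightarrow> t < b \<Longrightarrow> (z has_vector_derivative z' t) (at t)"
    and le: "\<And>t. s < t \<Longrightarrow> t < b \<Longrightarrow> N t (z' t) \<bullet> z t \<le> \<alpha> * (norm (z t))\<^sup>2 + h"
    and \<alpha>: "\<alpha> \<ge> 0" and h: "h \<ge> 0"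
  shows "(norm (z b))\<^sup>2 \<le> C\<^sub>0 \<alpha> * ((norm (z s))\<^sup>2 + h)"
proof -
  define c where "c = (K + 2 * \<alpha>) / \<nu>"
  have c: "c \<ge> 0" using K(1) \<alpha> \<nu> by (simp add: c_def)
  have "\<nu> * (norm (z b))\<^sup>2 \<le> exp ((c + 1) * (b - s)) * (K * (norm (z s))\<^sup>2 + 2 * h / (c + 1 - (K + 2 * \<alpha>) / \<nu>))"
  proof (rule energy[OF s sb b cont der _ \<alpha> h])
    fix t assume t: "s < t" "t < b"
    have "h * 1 \<le> h * exp ((c + 1) * (t - s))" using h c t by (intro mult_left_mono) auto
    then show "N t (z' t) \<bullet> z t \<le> \<alpha> * (norm (z t))\<^sup>2 + h * exp ((c + 1) * (t - s))"
      using le[OF t] by simp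
  qed (auto simp: c_def)
  also have "\<dots> = exp ((c + 1) * (b - s)) * (K * (norm (z s))\<^sup>2 + 2 * h)" by (simp add: c_def)
  also have "\<dots> \<le> exp ((c + 1) * T) * ((K + 2) * ((norm (z s))\<^sup>2 + h))"
  proof (rule mult_mono)
    have "(c + 1) * (b - s) \<le> (c + 1) * T" using c s b by (intro mult_left_mono) auto
    then show "exp ((c + 1) * (b - s)) \<le> exp ((c + 1) * T)" by simp
    show "K * (norm (z s))\<^sup>2 + 2 * h \<le> (K + 2) * ((norm (z s))\<^sup>2 + h)"
      using h K(1) by (simp add: algebra_simps)
  qed (use h K(1) in auto)
  finally show ?thesis using \<nu> unfolding C\<^sub>0_def c_def by (simp add: field_simps)
qed

text \<open>The bounded term \<open>P\<close> is left out of the equation; it will be supplied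
  through the source \<open>\<phi>\<close>.\<close>

definition yosida_solution :: "real \<Rightarrow> real \<Rightarrow> 'a \<Rightarrow> (real \<Rightarrow> 'a) \<Rightarrow> (real \<Rightarrow> 'a) \<Rightarrow> bool" where
  "yosida_solution l s \<zeta> \<phi> z \<longleftrightarrow> z s = \<zeta> \<and>
     (\<forall>t\<in>{s..T}. (z has_vector_derivative M t (Yos l t (z t)) + \<phi> t) (at t within {s..T}))"

lemma MYos_C1:
  "l > 0 \<Longrightarrow> strong_C1 {0..T} (\<lambda>t x. M t (Yos l t x))
    (\<lambda>t x. M' t (Yos l t x) + M t (R l t (B t (R l t x - Yos l t x))))"
  by (rule strong_C1_compose[OF M Yos_C1]) auto

lemma yosida_ex:
  assumes "l > 0" "0 \<le> s" "continuous_on {s..T} \<phi>"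
  shows "\<exists>z. yosida_solution l s \<zeta> \<phi> z"
proof -
  have "strongly_cont {s..T} (\<lambda>t x. M t (Yos l t x))"
    by (rule strongly_cont_subset[OF strong_C1D(3)[OF MYos_C1[OF assms(1)]]]) (use assms in auto)
  from linear_ode_ex[OF this assms(3), of \<zeta>] show ?thesis unfolding yosida_solution_def by metis
qed

lemma yosida_cont: "yosida_solution l s \<zeta> \<phi> z \<Longrightarrow> continuous_on {s..T} z"
  by (rule continuous_on_vector_derivative[of _ _ "\<lambda>t. M t (Yos l t (z t)) + \<phi> t"])
    (simp add: yosida_solution_def)

lemma yosida_diff:
  assumes l: "l > 0" and s: "0 \<le> s"
    and 1: "yosida_solution l s \<zeta>1 \<phi>1 z1" and 2: "yosida_solution l s \<zeta>2 \<phi>2 z2"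
  shows "yosida_solution l s (\<zeta>1 - \<zeta>2) (\<lambda>t. \<phi>1 t - \<phi>2 t) (\<lambda>t. z1 t - z2 t)"
  unfolding yosida_solution_def
proof (intro conjI ballI)
  show "z1 s - z2 s = \<zeta>1 - \<zeta>2" using 1 2 by (simp add: yosida_solution_def)
  fix t assume t: "t \<in> {s..T}"
  then have "t \<in> {0..T}" using s by auto
  then interpret bounded_linear "\<lambda>x. M t (Yos l t x)" using strong_C1D(1)[OF MYos_C1[OF l]] by blast
  have "((\<lambda>t. z1 t - z2 t) has_vector_derivative (M t (Yos l t (z1 t)) + \<phi>1 t) - (M t (Yos l t (z2 t)) + \<phi>2 t))
      (at t within {s..T})"
    using 1 2 t unfolding yosida_solution_def by (intro has_vector_derivative_diff) auto
  then show "((\<lambda>t. z1 t - z2 t) has_vector_derivative M t (Yos l t (z1 t - z2 t)) + (\<phi>1 t - \<phi>2 t)) (at t within {s..T})"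
    by (simp add: diff algebra_simps)
qed

lemma yosida_dissip:
  assumes t: "t \<in> {0..T}" and l: "l > 0"
  shows "N t (M t (Yos l t x) + y) \<bullet> x \<le> (norm x)\<^sup>2 + (K * norm y)\<^sup>2"
proof -
  interpret Nt: bounded_linear "N t" by (rule N_lin[OF t])
  have "N t (M t (Yos l t x) + y) \<bullet> x = Yos l t x \<bullet> x + N t y \<bullet> x"
    by (simp add: Nt.add NM[OF t] inner_add_left)
  also have "\<dots> \<le> 0 + norm (N t y) * norm x"
    by (intro add_mono Yos_dissip[OF t l] norm_cauchy_schwarz)
  also have "\<dots> \<le> 0 + (K * norm y) * norm x" by (intro add_left_mono mult_right_mono K(4) t) simp
  also have "\<dots> \<le> (norm x)\<^sup>2 + (K * norm y)\<^sup>2" using mult_le_sum_squares[of "K * norm y" "norm x"] by simp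
  finally show ?thesis .
qed

text \<open>A source of exponential growth produces a solution of the same growth, with a factor
  that tends to 0 as the rate \<open>k\<close> increases. This is the source of the contraction
  below.\<close>

lemma yosida_bound_exp:
  assumes l: "l > 0" and s: "0 \<le> s" and sol: "yosida_solution l s 0 \<phi> z"
    and ph: "\<And>t. t \<in> {s..T} \<Longrightarrow> norm (\<phi> t) \<le> c * exp (k * (t - s))"
    and c: "c \<ge> 0" and k: "(K + 2) / \<nu> < 2 * k" and b: "b \<in> {s..T}"
  shows "\<nu> * (norm (z b))\<^sup>2 \<le> (exp (k * (b - s)))\<^sup>2 * (2 * (K * c)\<^sup>2 / (2 * k - (K + 2) / \<nu>))"
proof -
  have "\<nu> * (norm (z b))\<^sup>2 \<le> exp (2 * k * (b - s)) * (K * (norm (z s))\<^sup>2 + 2 * (K * c)\<^sup>2 / (2 * k - (K + 2 * 1) / \<nu>))"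
  proof (rule energy[OF s])
    show "continuous_on {s..b} z" using yosida_cont[OF sol] b by (auto intro: continuous_on_subset)
    fix t assume t: "s < t" "t < b"
    then have tI: "t \<in> {s..T}" "t \<in> {0..T}" using b s by auto
    show "(z has_vector_derivative M t (Yos l t (z t)) + \<phi> t) (at t)"
      using sol t b tI unfolding yosida_solution_def by (intro has_vector_derivative_at_interior[of _ _ _ s T]) auto
    have "(K * norm (\<phi> t))\<^sup>2 \<le> (K * (c * exp (k * (t - s))))\<^sup>2"
      using ph[OF tI(1)] K(1) by (intro power_mono mult_left_mono) auto
    also have "\<dots> = (K * c)\<^sup>2 * exp (2 * k * (t - s))"
      by (simp add: power_mult_distrib exp_double[symmetric] mult.assoc)
    finally show "N t (M t (Yos l t (z t)) + \<phi> t) \<bullet> z t \<le> 1 * (norm (z t))\<^sup>2 + (K * c)\<^sup>2 * exp (2 * k * (t - s))"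
      using yosida_dissip[OF tI(2) l, of "z t" "\<phi> t"] by simp
  qed (use b k in auto)
  moreover have "exp (2 * k * (b - s)) = (exp (k * (b - s)))\<^sup>2" by (simp add: exp_double[symmetric] mult.assoc)
  moreover have "z s = 0" using sol by (simp add: yosida_solution_def)
  ultimately show ?thesis by simp
qed

lemma yosida_bound:
  assumes l: "l > 0" and s: "0 \<le> s" and sol: "yosida_solution l s \<zeta> \<phi> z"
    and ph: "\<And>t. t \<in> {s..T} \<Longrightarrow> norm (\<phi> t) \<le> c" and b: "b \<in> {s..T}"
  shows "(norm (z b))\<^sup>2 \<le> C\<^sub>0 1 * ((norm \<zeta>)\<^sup>2 + (K * c)\<^sup>2)"
proof -
  have zs: "z s = \<zeta>" using sol by (simp add: yosida_solution_def)
  show ?thesis unfolding zs[symmetric]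
  proof (rule energy_sup[OF s])
    show "continuous_on {s..b} z" using yosida_cont[OF sol] b by (auto intro: continuous_on_subset)
    fix t assume t: "s < t" "t < b"
    then have tI: "t \<in> {s..T}" "t \<in> {0..T}" using b s by auto
    show "(z has_vector_derivative M t (Yos l t (z t)) + \<phi> t) (at t)"
      using sol t b tI unfolding yosida_solution_def by (intro has_vector_derivative_at_interior[of _ _ _ s T]) auto
    have "(K * norm (\<phi> t))\<^sup>2 \<le> (K * c)\<^sup>2"
      using ph[OF tI(1)] K(1) by (intro power_mono mult_left_mono) auto
    then show "N t (M t (Yos l t (z t)) + \<phi> t) \<bullet> z t \<le> 1 * (norm (z t))\<^sup>2 + (K * c)\<^sup>2"
      using yosida_dissip[OF tI(2) l, of "z t" "\<phi> t"] by simp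
  qed (use b in auto)
qed

text \<open>
  The derivative \<open>w\<close> of a Yosida solution solves the same equation with a source in which
  \<open>A'\<close> acts on the solution; it is controlled through \<open>A\<^sub>l z = N (w - \<phi>)\<close>, uniformly in \<open>l\<close>.
\<close>

lemma yosida_deriv_bound:
  assumes s: "0 \<le> s" "s \<le> T" and \<zeta>: "\<zeta> \<in> D"
    and ph': "continuous_on {s..T} \<phi>'"
    and ph: "\<And>t. t \<in> {s..T} \<Longrightarrow> (\<phi> has_vector_derivative \<phi>' t) (at t within {s..T})"
  obtains c where "c \<ge> 0" "\<And>l z t. l > 0 \<Longrightarrow> yosida_solution l s \<zeta> \<phi> z \<Longrightarrow> t \<in> {s..T} \<Longrightarrow> norm (Yos l t (z t)) \<le> c"
proof -
  have cph: "continuous_on {s..T} \<phi>" by (rule continuous_on_vector_derivative[OF ph])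
  obtain k1 where k1: "k1 \<ge> 0" "\<And>t. t \<in> {s..T} \<Longrightarrow> norm (\<phi> t) \<le> k1" using bounded_on[OF cph] by metis
  obtain k2 where k2: "k2 \<ge> 0" "\<And>t. t \<in> {s..T} \<Longrightarrow> norm (\<phi>' t) \<le> k2" using bounded_on[OF ph'] by metis
  \<comment> \<open>\<open>Z\<close> will bound z, \<open>w0\<close> the initial derivative and
    \<open>W\<close> the derivative w. In \<open>q\<close>, the term \<open>K * K\<close> comes from
    N M' and the term \<open>K\<close> from the resolvent composed with \<open>B\<close>, both
    acting on the Yosida approximation of A z.\<close>
  define Z where "Z = sqrt (C\<^sub>0 1 * ((norm \<zeta>)\<^sup>2 + (K * k1)\<^sup>2))"
  define q where "q = K * K + K"
  define c2 where "c2 = q * (K * k1) + K * Z + K * k2"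
  define w0 where "w0 = K * norm (A s \<zeta>) + k1"
  define W where "W = sqrt (C\<^sub>0 (q * K + 1) * (w0\<^sup>2 + c2\<^sup>2))"
  have K0: "K \<ge> 0" using K(1) by simp
  have Z0: "Z \<ge> 0" using C\<^sub>0_pos[of 1] by (simp add: Z_def)
  have pos: "q \<ge> 0" "c2 \<ge> 0" using K0 Z0 k1 k2 by (auto simp: q_def c2_def)
  have "norm (Yos l b (z b)) \<le> K * (W + k1)"
    if l: "l > 0" and sol: "yosida_solution l s \<zeta> \<phi> z" and b: "b \<in> {s..T}" for l z b
  proof -
    define w where "w t = M t (Yos l t (z t)) + \<phi> t" for t
    define a where "a t = Yos l t (z t)" for t
    define w' where "w' t = M' t (a t) + M t (R l t (B t (R l t (z t) - a t))) + M t (Yos l t (w t)) + \<phi>' t" for t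
    have dz: "(z has_vector_derivative w t) (at t within {s..T})" if "t \<in> {s..T}" for t
      using sol that unfolding yosida_solution_def w_def by blast
    have dw: "(w has_vector_derivative w' t) (at t within {s..T})" if t: "t \<in> {s..T}" for t
      using has_vector_derivative_add[OF strong_C1_apply_subset[OF MYos_C1[OF l] _ _ t dz[OF t]] ph[OF t]] s
      unfolding w_def[abs_def] w'_def a_def by (simp add: algebra_simps)
    have zZ: "norm (z t) \<le> Z" if t: "t \<in> {s..T}" for t
      unfolding Z_def by (rule real_le_rsqrt[OF yosida_bound[OF l s(1) sol k1(2) t]])
    have aw: "norm (a t) \<le> K * (norm (w t) + k1)" if t: "t \<in> {s..T}" for t
    proof -
      have tI: "t \<in> {0..T}" using t s by auto
      have "a t = N t (w t - \<phi> t)" by (simp add: w_def a_def NM[OF tI])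
      then have "norm (a t) \<le> K * norm (w t - \<phi> t)" using K(4)[OF tI] by simp
      also have "\<dots> \<le> K * (norm (w t) + k1)"
        using k1(2)[OF t] norm_triangle_ineq4[of "w t" "\<phi> t"] K0 by (intro mult_left_mono) auto
      finally show ?thesis .
    qed
    have "(norm (w b))\<^sup>2 \<le> C\<^sub>0 (q * K + 1) * ((norm (w s))\<^sup>2 + c2\<^sup>2)"
    proof (rule energy_sup[OF s(1)])
      show "continuous_on {s..b} w"
        using continuous_on_vector_derivative[OF dw] b by (auto intro: continuous_on_subset)
      fix t assume t: "s < t" "t < b"
      then have tI: "t \<in> {s..T}" "t \<in> {0..T}" using b s by auto
      show "(w has_vector_derivative w' t) (at t)"
        using has_vector_derivative_at_interior[OF dw[OF tI(1)]] t b by auto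
      interpret Nt: bounded_linear "N t" by (rule N_lin[OF tI(2)])
      have "N t (w' t) \<bullet> w t = N t (M' t (a t)) \<bullet> w t + R l t (B t (R l t (z t) - a t)) \<bullet> w t
          + Yos l t (w t) \<bullet> w t + N t (\<phi>' t) \<bullet> w t"
        by (simp add: w'_def Nt.add NM[OF tI(2)] inner_add_left)
      also have "\<dots> \<le> K * (K * norm (a t)) * norm (w t) + K * (Z + norm (a t)) * norm (w t) + 0 + K * k2 * norm (w t)"
      proof (intro add_mono Yos_dissip[OF tI(2) l])
        have "norm (N t (M' t (a t))) \<le> K * (K * norm (a t))"
          by (rule order_trans[OF K(4)[OF tI(2)] mult_left_mono[OF K(3)[OF tI(2)] K0]])
        then show "N t (M' t (a t)) \<bullet> w t \<le> K * (K * norm (a t)) * norm (w t)"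
          by (rule order_trans[OF norm_cauchy_schwarz mult_right_mono]) simp
        have "norm (R l t (z t) - a t) \<le> Z + norm (a t)"
          using norm_triangle_ineq4[of "R l t (z t)" "a t"] norm_R_le[OF tI(2) l, of "z t"] zZ[OF tI(1)] by linarith
        then have "norm (R l t (B t (R l t (z t) - a t))) \<le> K * (Z + norm (a t))"
          using K0 by (intro order_trans[OF norm_R_le[OF tI(2) l]] order_trans[OF K(8)[OF tI(2)]] mult_left_mono)
        then show "R l t (B t (R l t (z t) - a t)) \<bullet> w t \<le> K * (Z + norm (a t)) * norm (w t)"
          by (rule order_trans[OF norm_cauchy_schwarz mult_right_mono]) simp
        have "norm (N t (\<phi>' t)) \<le> K * k2"
          by (rule order_trans[OF K(4)[OF tI(2)] mult_left_mono[OF k2(2)[OF tI(1)] K0]])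
        then show "N t (\<phi>' t) \<bullet> w t \<le> K * k2 * norm (w t)"
          by (rule order_trans[OF norm_cauchy_schwarz mult_right_mono]) simp
      qed
      also have "\<dots> = (q * norm (a t) + K * Z + K * k2) * norm (w t)" by (simp add: q_def algebra_simps)
      also have "\<dots> \<le> (q * (K * (norm (w t) + k1)) + K * Z + K * k2) * norm (w t)"
        using aw[OF tI(1)] pos K0 Z0 k2 by (intro mult_right_mono add_mono mult_left_mono) auto
      also have "\<dots> = (q * K) * (norm (w t))\<^sup>2 + c2 * norm (w t)"
        by (simp add: c2_def power2_eq_square algebra_simps)
      also have "\<dots> \<le> (q * K + 1) * (norm (w t))\<^sup>2 + c2\<^sup>2"
        using mult_le_sum_squares[of c2 "norm (w t)"] by (simp add: algebra_simps)
      finally show "N t (w' t) \<bullet> w t \<le> (q * K + 1) * (norm (w t))\<^sup>2 + c2\<^sup>2" .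
    qed (use b pos K0 in auto)
    also have "\<dots> \<le> C\<^sub>0 (q * K + 1) * (w0\<^sup>2 + c2\<^sup>2)"
    proof -
      have sI: "s \<in> {0..T}" "s \<in> {s..T}" using s by auto
      \<comment> \<open>Here \<zeta> \<in> D enters: the Yosida approximation at \<zeta> is the
        resolvent applied to A \<zeta>, hence bounded independently of l.\<close>
      have "Yos l s \<zeta> = R l s (A s \<zeta>)"
        unfolding Yos_def by (rule max_dissipative.R_A[OF A_md[OF sI(1)] l \<zeta>, symmetric])
      then have "norm (Yos l s \<zeta>) \<le> norm (A s \<zeta>)" using norm_R_le[OF sI(1) l] by simp
      then have "norm (M s (Yos l s \<zeta>)) \<le> K * norm (A s \<zeta>)"
        using K0 by (intro order_trans[OF K(2)[OF sI(1)]] mult_left_mono)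
      moreover have "w s = M s (Yos l s \<zeta>) + \<phi> s" using sol by (simp add: w_def yosida_solution_def)
      ultimately have "norm (w s) \<le> w0"
        using k1(2)[OF sI(2)] norm_triangle_ineq[of "M s (Yos l s \<zeta>)" "\<phi> s"] by (simp add: w0_def)
      then have "(norm (w s))\<^sup>2 \<le> w0\<^sup>2" by (intro power_mono) auto
      then show ?thesis using C\<^sub>0_pos[of "q * K + 1"] by (intro mult_left_mono) auto
    qed
    finally have "norm (w b) \<le> W" unfolding W_def by (rule real_le_rsqrt)
    then have "K * (norm (w b) + k1) \<le> K * (W + k1)" using K0 by (intro mult_left_mono) auto
    then show ?thesis using aw[OF b] by (simp add: a_def)
  qed
  moreover have "K * (W + k1) \<ge> 0"
    using K0 k1 C\<^sub>0_pos[of "q * K + 1"] by (simp add: W_def)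
  ultimately show ?thesis using that by blast
qed

text \<open>Dissipativity is applied to the difference of the two resolvents, which lies in
  \<open>D\<close>. What remains carries a factor l or m in front of Yosida terms that are bounded
  uniformly in l and m.\<close>

lemma yosida_Cauchy:
  assumes s: "0 \<le> s" "s \<le> T" and \<zeta>: "\<zeta> \<in> D"
    and ph': "continuous_on {s..T} \<phi>'"
    and ph: "\<And>t. t \<in> {s..T} \<Longrightarrow> (\<phi> has_vector_derivative \<phi>' t) (at t within {s..T})"
  obtains c where "c \<ge> 0" "\<And>l m y z t. l > 0 \<Longrightarrow> m > 0 \<Longrightarrow> yosida_solution l s \<zeta> \<phi> y \<Longrightarrow>
     yosida_solution m s \<zeta> \<phi> z \<Longrightarrow> t \<in> {s..T} \<Longrightarrow> (norm (y t - z t))\<^sup>2 \<le> c * (l + m)"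
proof -
  obtain c where c: "c \<ge> 0" "\<And>l z t. l > 0 \<Longrightarrow> yosida_solution l s \<zeta> \<phi> z \<Longrightarrow> t \<in> {s..T} \<Longrightarrow> norm (Yos l t (z t)) \<le> c"
    using yosida_deriv_bound[OF s \<zeta> ph' ph] by metis
  have "(norm (y b - z b))\<^sup>2 \<le> (C\<^sub>0 0 * (2 * c\<^sup>2)) * (l + m)"
    if l: "l > 0" and m: "m > 0" and y: "yosida_solution l s \<zeta> \<phi> y" and z: "yosida_solution m s \<zeta> \<phi> z"
      and b: "b \<in> {s..T}" for l m y z b
  proof -
    have "(norm (y b - z b))\<^sup>2 \<le> C\<^sub>0 0 * ((norm (y s - z s))\<^sup>2 + 2 * c\<^sup>2 * (l + m))"
    proof (rule energy_sup[OF s(1)])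
      show "continuous_on {s..b} (\<lambda>t. y t - z t)"
        by (rule continuous_on_subset[OF continuous_on_diff[OF yosida_cont[OF y] yosida_cont[OF z]]]) (use b in auto)
      fix t assume t: "s < t" "t < b"
      then have tI: "t \<in> {s..T}" "t \<in> {0..T}" using b s by auto
      let ?a = "Yos l t (y t)" and ?b = "Yos m t (z t)"
      have "((\<lambda>t. y t - z t) has_vector_derivative (M t ?a + \<phi> t) - (M t ?b + \<phi> t)) (at t within {s..T})"
        using y z tI unfolding yosida_solution_def by (intro has_vector_derivative_diff) auto
      then show "((\<lambda>t. y t - z t) has_vector_derivative (M t ?a + \<phi> t) - (M t ?b + \<phi> t)) (at t)"
        by (rule has_vector_derivative_at_interior) (use t b in auto)
      interpret Nt: bounded_linear "N t" by (rule N_lin[OF tI(2)])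
      have e1: "y t - z t = (R l t (y t) - R m t (z t)) - (l *\<^sub>R ?a - m *\<^sub>R ?b)"
        unfolding R_Yos[OF tI(2) l] R_Yos[OF tI(2) m] by simp
      have e2: "?a - ?b = A t (R l t (y t) - R m t (z t))"
        unfolding Yos_def by (rule max_dissipative.A_diff[OF A_md[OF tI(2)] R_in[OF tI(2) l] R_in[OF tI(2) m], symmetric])
      have "N t ((M t ?a + \<phi> t) - (M t ?b + \<phi> t)) \<bullet> (y t - z t) = (?a - ?b) \<bullet> (y t - z t)"
        by (simp add: Nt.diff NM[OF tI(2)])
      also have "\<dots> = (?a - ?b) \<bullet> (R l t (y t) - R m t (z t)) - (?a - ?b) \<bullet> (l *\<^sub>R ?a - m *\<^sub>R ?b)"
        by (subst e1) (simp add: inner_diff_right)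
      also have "\<dots> \<le> norm (?a - ?b) * norm (l *\<^sub>R ?a - m *\<^sub>R ?b)"
      proof -
        have "(?a - ?b) \<bullet> (R l t (y t) - R m t (z t)) \<le> 0"
        unfolding e2 by (intro max_dissipative.A_dissip[OF A_md[OF tI(2)]]
            subspace_diff[OF max_dissipative.subspace_D[OF A_md[OF tI(2)]]] R_in[OF tI(2)] l m)
        then show ?thesis
          using Cauchy_Schwarz_ineq2[of "?a - ?b" "l *\<^sub>R ?a - m *\<^sub>R ?b"] by linarith
      qed
      also have "\<dots> \<le> (2 * c) * (l * c + m * c)"
      proof (intro mult_mono)
        have ab: "norm ?a \<le> c" "norm ?b \<le> c" using c(2)[OF l y tI(1)] c(2)[OF m z tI(1)] by auto
        then show "norm (?a - ?b) \<le> 2 * c" using norm_triangle_ineq4[of ?a ?b] by linarith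
        have "norm (l *\<^sub>R ?a) \<le> l * c" "norm (m *\<^sub>R ?b) \<le> m * c" using ab l m by (auto intro: mult_left_mono)
        then show "norm (l *\<^sub>R ?a - m *\<^sub>R ?b) \<le> l * c + m * c"
          using norm_triangle_ineq4[of "l *\<^sub>R ?a" "m *\<^sub>R ?b"] by linarith
      qed (use c in auto)
      finally show "N t ((M t ?a + \<phi> t) - (M t ?b + \<phi> t)) \<bullet> (y t - z t)
          \<le> 0 * (norm (y t - z t))\<^sup>2 + 2 * c\<^sup>2 * (l + m)"
        by (simp add: power2_eq_square algebra_simps)
    qed (use b l m in auto)
    moreover have "y s = z s" using y z by (simp add: yosida_solution_def)
    ultimately show ?thesis by simp
  qed
  moreover have "C\<^sub>0 0 * (2 * c\<^sup>2) \<ge> 0" using C\<^sub>0_pos[of 0] by simp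
  ultimately show ?thesis using that by blast
qed

section \<open>Mild solutions as limits of Yosida approximations\<close>

definition step :: "nat \<Rightarrow> real" where "step n = inverse (real (Suc n))"

lemma step_pos: "step n > 0" by (simp add: step_def)

lemma step_tendsto: "step \<longlonglongrightarrow> 0"
  unfolding step_def[abs_def] by (rule LIMSEQ_inverse_real_of_nat)

definition yosida :: "nat \<Rightarrow> real \<Rightarrow> 'a \<Rightarrow> (real \<Rightarrow> 'a) \<Rightarrow> real \<Rightarrow> 'a" where
  "yosida n s \<zeta> \<phi> = (SOME z. yosida_solution (step n) s \<zeta> \<phi> z)"

lemma yosida_is_solution:
  "0 \<le> s \<Longrightarrow> continuous_on {s..T} \<phi> \<Longrightarrow> yosida_solution (step n) s \<zeta> \<phi> (yosida n s \<zeta> \<phi>)"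
  unfolding yosida_def by (rule someI_ex[OF yosida_ex[OF step_pos]])

text \<open>A density argument. For initial values in \<open>D\<close> and C^1 sources the
  approximations form a Cauchy sequence, and the energy bound, being uniform in n, transfers this to
  all data.\<close>

lemma yosida_converges:
  assumes s: "0 \<le> s" "s \<le> T" and ph: "continuous_on {s..T} \<phi>"
  shows "uniformly_convergent_on {s..T} (\<lambda>n. yosida n s \<zeta> \<phi>)"
  unfolding uniformly_convergent_eq_Cauchy uniformly_Cauchy_on_def
proof (intro allI impI)
  fix e :: real assume e: "e > 0"
  \<comment> \<open>Replacing both data by smooth ones at distance d changes every approximation by
    at most \<open>q * d\<close>.\<close>
  define q where "q = sqrt (C\<^sub>0 1 * (1 + K\<^sup>2))"
  have q: "q \<ge> 0" "q\<^sup>2 = C\<^sub>0 1 * (1 + K\<^sup>2)" using C\<^sub>0_pos[of 1] by (auto simp: q_def)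
  define d where "d = e / (4 * (q + 1))"
  have d: "d > 0" "q * d \<le> e / 4" using e q by (auto simp: d_def field_simps)
  obtain \<zeta>' where \<zeta>': "\<zeta>' \<in> D" "dist \<zeta>' \<zeta> < d"
    using dense_D[of 0] T d by (metis UNIV_I atLeastAtMost_iff closure_approachable order_refl less_imp_le)
  obtain \<psi> \<psi>' where \<psi>: "continuous_on {s..T} \<psi>'"
    "\<And>t. t \<in> {s..T} \<Longrightarrow> (\<psi> has_vector_derivative \<psi>' t) (at t within {s..T})"
    "\<And>t. t \<in> {s..T} \<Longrightarrow> norm (\<psi> t - \<phi> t) \<le> d"
    using smooth_approximation[OF ph d(1) s(2)] by metis
  have c\<psi>: "continuous_on {s..T} \<psi>" by (rule continuous_on_vector_derivative[OF \<psi>(2)])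
  obtain c where c: "c \<ge> 0" "\<And>l m y z t. l > 0 \<Longrightarrow> m > 0 \<Longrightarrow> yosida_solution l s \<zeta>' \<psi> y \<Longrightarrow>
     yosida_solution m s \<zeta>' \<psi> z \<Longrightarrow> t \<in> {s..T} \<Longrightarrow> (norm (y t - z t))\<^sup>2 \<le> c * (l + m)"
    using yosida_Cauchy[OF s \<zeta>'(1) \<psi>(1,2)] by metis
  have "(\<lambda>n. c * (step n + step n)) \<longlonglongrightarrow> c * (0 + 0)" by (intro tendsto_intros step_tendsto)
  then have "\<forall>\<^sub>F n in sequentially. c * (step n + step n) < (e / 4)\<^sup>2"
    using e by (intro order_tendstoD(2)) auto
  then obtain n0 where n0: "\<And>n. n \<ge> n0 \<Longrightarrow> c * (step n + step n) < (e / 4)\<^sup>2"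
    unfolding eventually_sequentially by blast
  have near: "norm (yosida n s \<zeta> \<phi> t - yosida n s \<zeta>' \<psi> t) \<le> e / 4" if t: "t \<in> {s..T}" for n t
  proof -
    have sol: "yosida_solution (step n) s (\<zeta> - \<zeta>') (\<lambda>t. \<phi> t - \<psi> t) (\<lambda>t. yosida n s \<zeta> \<phi> t - yosida n s \<zeta>' \<psi> t)"
      by (rule yosida_diff[OF step_pos s(1) yosida_is_solution[OF s(1) ph] yosida_is_solution[OF s(1) c\<psi>]])
    have "(norm (yosida n s \<zeta> \<phi> t - yosida n s \<zeta>' \<psi> t))\<^sup>2 \<le> C\<^sub>0 1 * ((norm (\<zeta> - \<zeta>'))\<^sup>2 + (K * d)\<^sup>2)"
      by (rule yosida_bound[OF step_pos s(1) sol _ t]) (use \<psi>(3) in \<open>simp add: norm_minus_commute\<close>)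
    also have "\<dots> \<le> C\<^sub>0 1 * (d\<^sup>2 + (K * d)\<^sup>2)"
      using \<zeta>'(2) C\<^sub>0_pos[of 1] by (intro mult_left_mono add_right_mono power_mono) (auto simp: dist_norm norm_minus_commute)
    also have "\<dots> = (q * d)\<^sup>2" by (simp add: power_mult_distrib q algebra_simps)
    finally have "norm (yosida n s \<zeta> \<phi> t - yosida n s \<zeta>' \<psi> t) \<le> q * d"
      by (rule power2_le_imp_le) (use q d in simp)
    then show ?thesis using d by simp
  qed
  show "\<exists>n0. \<forall>t\<in>{s..T}. \<forall>m\<ge>n0. \<forall>n\<ge>n0. dist (yosida m s \<zeta> \<phi> t) (yosida n s \<zeta> \<phi> t) < e"
  proof (intro exI[of _ n0] ballI allI impI)
    fix t m n assume t: "t \<in> {s..T}" and mn: "m \<ge> n0" "n \<ge> n0"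
    let ?x = "yosida m s \<zeta>' \<psi> t" and ?y = "yosida n s \<zeta>' \<psi> t"
    have "(norm (?x - ?y))\<^sup>2 \<le> c * (step m + step n)"
      by (rule c(2)[OF step_pos step_pos yosida_is_solution[OF s(1) c\<psi>] yosida_is_solution[OF s(1) c\<psi>] t])
    also have "\<dots> \<le> (e / 4)\<^sup>2" using n0[OF mn(1)] n0[OF mn(2)] by (simp add: distrib_left)
    finally have "norm (?x - ?y) \<le> e / 4" by (rule power2_le_imp_le) (use e in simp)
    moreover have "yosida m s \<zeta> \<phi> t - yosida n s \<zeta> \<phi> t
        = (yosida m s \<zeta> \<phi> t - ?x) + (?x - ?y) - (yosida n s \<zeta> \<phi> t - ?y)" by simp
    ultimately have "norm (yosida m s \<zeta> \<phi> t - yosida n s \<zeta> \<phi> t) \<le> e / 4 + e / 4 + e / 4"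
      using near[OF t, of m] near[OF t, of n]
      by (smt (verit) norm_triangle_ineq norm_triangle_ineq4)
    then show "dist (yosida m s \<zeta> \<phi> t) (yosida n s \<zeta> \<phi> t) < e" using e by (simp add: dist_norm)
  qed
qed

text \<open>Covers arbitrary initial values and merely continuous sources; nothing is claimed about
  its derivative.\<close>

definition mild :: "real \<Rightarrow> 'a \<Rightarrow> (real \<Rightarrow> 'a) \<Rightarrow> real \<Rightarrow> 'a" where
  "mild s \<zeta> \<phi> t = lim (\<lambda>n. yosida n s \<zeta> \<phi> t)"

lemma mild_limit:
  assumes "0 \<le> s" "s \<le> T" "continuous_on {s..T} \<phi>"
  shows "uniform_limit {s..T} (\<lambda>n. yosida n s \<zeta> \<phi>) (mild s \<zeta> \<phi>) sequentially"
  using yosida_converges[OF assms] unfolding uniformly_convergent_uniform_limit_iff mild_def .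

lemma mild_cont:
  assumes "0 \<le> s" "s \<le> T" "continuous_on {s..T} \<phi>"
  shows "continuous_on {s..T} (mild s \<zeta> \<phi>)"
proof (rule uniform_limit_theorem[OF _ mild_limit[OF assms]])
  show "\<forall>\<^sub>F n in sequentially. continuous_on {s..T} (yosida n s \<zeta> \<phi>)"
    using yosida_cont[OF yosida_is_solution[OF assms(1,3)]] by simp
qed simp

text \<open>Only the difference of the sources matters, so the bound for zero initial value passes
  to the limit. That \<open>k\<close> depends neither on the data nor on s lets the fixed point
  exist on the whole interval at once.\<close>

lemma mild_contraction:
  assumes L: "L \<ge> 0"
  obtains k where "k \<ge> 1" "\<And>s \<zeta> \<phi> \<psi> c t. 0 \<le> s \<Longrightarrow> s \<le> T \<Longrightarrow> continuous_on {s..T} \<phi> \<Longrightarrow> continuous_on {s..T} \<psi> \<Longrightarrow>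
    c \<ge> 0 \<Longrightarrow> (\<And>r. r \<in> {s..T} \<Longrightarrow> norm (\<phi> r - \<psi> r) \<le> L * c * exp (k * (r - s))) \<Longrightarrow> t \<in> {s..T} \<Longrightarrow>
    norm (mild s \<zeta> \<phi> t - mild s \<zeta> \<psi> t) \<le> c / 2 * exp (k * (t - s))"
proof -
  \<comment> \<open>\<open>p1\<close> is the growth rate of the energy; \<open>p2\<close> is the
    excess over it that gives
    \<open>2 * (K * L * c)\<^sup>2 / p2 \<le> \<nu> * (c / 2)\<^sup>2\<close>, that is, the
    contraction factor 1/2.\<close>
  define p1 where "p1 = (K + 2) / \<nu>"
  define p2 where "p2 = 8 * (K * L)\<^sup>2 / \<nu>"
  define k where "k = p1 + p2 + 2"
  have p: "p1 \<ge> 0" "p2 \<ge> 0" using K(1) \<nu> by (auto simp: p1_def p2_def)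
  then have k1: "k \<ge> 1" by (simp add: k_def)
  have "2 * k - p1 \<ge> p2 + 1" "p1 < 2 * k" using p by (auto simp: k_def)
  then have k2: "2 * k - (K + 2) / \<nu> \<ge> 8 * (K * L)\<^sup>2 / \<nu> + 1" and k3: "(K + 2) / \<nu> < 2 * k"
    by (simp_all only: p1_def p2_def)
  have "norm (mild s \<zeta> \<phi> t - mild s \<zeta> \<psi> t) \<le> c / 2 * exp (k * (t - s))"
    if s: "0 \<le> s" "s \<le> T" and ph: "continuous_on {s..T} \<phi>" and ps: "continuous_on {s..T} \<psi>" and c: "c \<ge> 0"
      and le: "\<And>r. r \<in> {s..T} \<Longrightarrow> norm (\<phi> r - \<psi> r) \<le> L * c * exp (k * (r - s))" and t: "t \<in> {s..T}"
    for s \<zeta> \<phi> \<psi> c t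
  proof -
    have "norm (yosida n s \<zeta> \<phi> t - yosida n s \<zeta> \<psi> t) \<le> c / 2 * exp (k * (t - s))" for n
    proof -
      let ?z = "\<lambda>t. yosida n s \<zeta> \<phi> t - yosida n s \<zeta> \<psi> t"
      have sol: "yosida_solution (step n) s 0 (\<lambda>t. \<phi> t - \<psi> t) ?z"
        using yosida_diff[OF step_pos s(1) yosida_is_solution[OF s(1) ph] yosida_is_solution[OF s(1) ps], of n \<zeta> \<zeta>] by simp
      have "\<nu> * (norm (?z t))\<^sup>2 \<le> (exp (k * (t - s)))\<^sup>2 * (2 * (K * (L * c))\<^sup>2 / (2 * k - (K + 2) / \<nu>))"
        by (rule yosida_bound_exp[OF step_pos s(1) sol le _ k3 t]) (use L c in auto)
      also have "\<dots> \<le> (exp (k * (t - s)))\<^sup>2 * (\<nu> * (c / 2)\<^sup>2)"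
      proof (rule mult_left_mono)
        have pos: "2 * k - (K + 2) / \<nu> > 0" using k3 by simp
        have "8 * (K * L)\<^sup>2 \<le> \<nu> * (2 * k - (K + 2) / \<nu>)"
        proof -
          have "8 * (K * L)\<^sup>2 = \<nu> * (8 * (K * L)\<^sup>2 / \<nu>)" using \<nu> by simp
          also have "\<dots> \<le> \<nu> * (2 * k - (K + 2) / \<nu>)" using k2 \<nu> by (intro mult_left_mono) auto
          finally show ?thesis .
        qed
        then have "8 * (K * L)\<^sup>2 * c\<^sup>2 \<le> \<nu> * (2 * k - (K + 2) / \<nu>) * c\<^sup>2" by (intro mult_right_mono) auto
        moreover have "2 * (K * (L * c))\<^sup>2 \<le> \<nu> * (c / 2)\<^sup>2 * x" if "8 * (K * L)\<^sup>2 * c\<^sup>2 \<le> \<nu> * x * c\<^sup>2" for x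
          using that by (simp add: power_mult_distrib power_divide algebra_simps)
        ultimately have "2 * (K * (L * c))\<^sup>2 \<le> \<nu> * (c / 2)\<^sup>2 * (2 * k - (K + 2) / \<nu>)"
          by blast
        then show "2 * (K * (L * c))\<^sup>2 / (2 * k - (K + 2) / \<nu>) \<le> \<nu> * (c / 2)\<^sup>2"
          using pos by (simp only: pos_divide_le_eq)
      qed simp
      also have "\<dots> = \<nu> * (c / 2 * exp (k * (t - s)))\<^sup>2" by (simp add: power_mult_distrib power_divide)
      finally have "(norm (?z t))\<^sup>2 \<le> (c / 2 * exp (k * (t - s)))\<^sup>2" using \<nu> by simp
      then show ?thesis by (rule power2_le_imp_le) (use c in simp)
    qed
    moreover have "(\<lambda>n. norm (yosida n s \<zeta> \<phi> t - yosida n s \<zeta> \<psi> t)) \<longlonglongrightarrow> norm (mild s \<zeta> \<phi> t - mild s \<zeta> \<psi> t)"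
      by (intro tendsto_norm tendsto_diff tendsto_uniform_limitI[OF mild_limit[OF s ph] t]
          tendsto_uniform_limitI[OF mild_limit[OF s ps] t])
    ultimately show ?thesis by (meson LIMSEQ_le_const2)
  qed
  then show ?thesis using that[OF k1] by blast
qed

text \<open>For a fixed vector, the convergence of the resolvents is uniform in time because
  \<open>A t x'\<close> is bounded in t for x' in the dense set \<open>D\<close>. Compactness of the
  curve, through a finite net, makes it uniform along the curve.\<close>

lemma R_uniform:
  assumes s: "0 \<le> s" and p: "continuous_on {s..T} p" and e: "e > 0"
  shows "\<forall>\<^sub>F n in sequentially. \<forall>t\<in>{s..T}. norm (R (step n) t (p t) - p t) \<le> e"
proof -
  have one: "\<forall>\<^sub>F n in sequentially. \<forall>t\<in>{0..T}. norm (R (step n) t x - x) \<le> d" if d: "d > 0" for d x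
  proof -
    have "x \<in> closure D" using dense_D[of 0] T by simp
    moreover have "d / 4 > 0" using d by simp
    ultimately obtain x' where x': "x' \<in> D" "dist x' x < d / 4" by (meson closure_approachable)
    obtain c where c: "c \<ge> 0" "\<And>t. t \<in> {0..T} \<Longrightarrow> norm (A t x') \<le> c" using bounded_on[OF A_cont[OF x'(1)]] by metis
    have "(\<lambda>n. step n * c) \<longlonglongrightarrow> 0 * c" by (intro tendsto_intros step_tendsto)
    then have "\<forall>\<^sub>F n in sequentially. step n * c < d / 4" using d by (intro order_tendstoD(2)) auto
    then show ?thesis
    proof eventually_elim
      case (elim n)
      show ?case
      proof
        fix t assume t: "t \<in> {0..T}"
        interpret bounded_linear "R (step n) t" by (rule bounded_linear_R[OF t step_pos])
        have eq: "R (step n) t x - x = R (step n) t (x - x') + (R (step n) t x' - x') + (x' - x)" by (simp add: diff)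
        have "norm (R (step n) t (x - x')) \<le> d / 4"
          using norm_R_le[OF t step_pos, of n "x - x'"] x'(2) by (simp add: dist_norm norm_minus_commute)
        moreover have "norm (R (step n) t x' - x') \<le> d / 4"
        proof -
          have "norm (R (step n) t x' - x') \<le> step n * norm (A t x')"
            by (rule max_dissipative.norm_R_diff_le[OF A_md[OF t] step_pos x'(1)])
          also have "\<dots> \<le> step n * c" using c(2)[OF t] step_pos[of n] by (intro mult_left_mono) auto
          finally show ?thesis using elim by simp
        qed
        moreover have "norm (x' - x) \<le> d / 4" using x'(2) by (simp add: dist_norm)
        ultimately show "norm (R (step n) t x - x) \<le> d"
          unfolding eq using d norm_triangle_ineq[of "R (step n) t (x - x') + (R (step n) t x' - x')" "x' - x"]
            norm_triangle_ineq[of "R (step n) t (x - x')" "R (step n) t x' - x'"] by linarith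
      qed
    qed
  qed
  have "compact (p ` {s..T})" using compact_continuous_image[OF p] by simp
  then obtain F where F: "finite F" "p ` {s..T} \<subseteq> (\<Union>x\<in>F. ball x (e / 3))"
    using e unfolding compact_eq_totally_bounded by (metis zero_less_divide_iff zero_less_numeral)
  have "\<forall>\<^sub>F n in sequentially. \<forall>x\<in>F. \<forall>t\<in>{0..T}. norm (R (step n) t x - x) \<le> e / 3"
    using one[of "e / 3"] e by (intro eventually_ball_finite F) auto
  then show ?thesis
  proof eventually_elim
    case (elim n)
    show ?case
    proof
      fix t assume t: "t \<in> {s..T}"
      then have tI: "t \<in> {0..T}" using s by auto
      interpret bounded_linear "R (step n) t" by (rule bounded_linear_R[OF tI step_pos])
      have "p t \<in> (\<Union>x\<in>F. ball x (e / 3))" using F(2) t by blast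
      then obtain x where x: "x \<in> F" "dist x (p t) < e / 3" by auto
      have eq: "R (step n) t (p t) - p t = R (step n) t (p t - x) + (R (step n) t x - x) + (x - p t)" by (simp add: diff)
      have "norm (R (step n) t (p t - x)) \<le> e / 3"
        using norm_R_le[OF tI step_pos, of n "p t - x"] x(2) by (simp add: dist_norm norm_minus_commute)
      moreover have "norm (R (step n) t x - x) \<le> e / 3" using elim x tI by blast
      moreover have "norm (x - p t) \<le> e / 3" using x(2) by (simp add: dist_norm)
      ultimately show "norm (R (step n) t (p t) - p t) \<le> e"
        unfolding eq using norm_triangle_ineq[of "R (step n) t (p t - x) + (R (step n) t x - x)" "x - p t"]
          norm_triangle_ineq[of "R (step n) t (p t - x)" "R (step n) t x - x"] by linarith
    qed
  qed
qed

text \<open>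
  The derivative \<open>w\<close> of the solution \<open>z\<close> is found first, as a fixed point: it has to be the mild
  solution with source \<open>M' a + M B (z - a) + (P z + g)'\<close>, where \<open>a = N (w - P z - g)\<close> stands for
  \<open>A z\<close> and \<open>B (z - A z) = A' z\<close>. That \<open>a = A z\<close> indeed holds follows from Gronwall's inequality
  for the defect of \<open>z\<^sub>0 + \<integral> w\<^sub>n\<close>, where \<open>w\<^sub>n\<close> are the Yosida approximations of \<open>w\<close>.
\<close>

theorem classical_solution_ex:
  assumes s: "0 \<le> s" "s \<le> T" and z0: "z0 \<in> D"
    and g': "continuous_on {s..T} g'"
    and g: "\<And>t. t \<in> {s..T} \<Longrightarrow> (g has_vector_derivative g' t) (at t within {s..T})"
  obtains z w where "z s = z0" "continuous_on {s..T} w"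
    "\<And>t. t \<in> {s..T} \<Longrightarrow> z t \<in> D"
    "\<And>t. t \<in> {s..T} \<Longrightarrow> w t = M t (A t (z t)) + P t (z t) + g t"
    "\<And>t. t \<in> {s..T} \<Longrightarrow> (z has_vector_derivative w t) (at t within {s..T})"
proof -
  have K0: "K \<ge> 0" using K(1) by simp
  have sub: "{s..T} \<subseteq> {0..T}" using s by auto
  have cg: "continuous_on {s..T} g" by (rule continuous_on_vector_derivative[OF g])
  note sc = strongly_cont_apply[OF strongly_cont_subset[OF _ sub] closed_atLeastAtMost]
  \<comment> \<open>Built from a trial derivative w: \<open>Z w\<close> is its primitive,
    \<open>a w\<close> is A z as the equation would give it, and \<open>\<Phi> w\<close> is
    everything that differentiating the equation in time yields apart from the term M A w.\<close>
  define Z where "Z w t = z0 + integral {s..t} w" for w t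
  define a where "a w t = N t (w t - P t (Z w t) - g t)" for w t
  define \<Phi> where "\<Phi> w t = M' t (a w t) + M t (B t (Z w t - a w t)) + P t (w t) + P' t (Z w t) + g' t" for w t
  have dZ: "(Z w has_vector_derivative w t) (at t within {s..T})" if "continuous_on {s..T} w" "t \<in> {s..T}" for w t
    unfolding Z_def using integral_has_vector_derivative[OF that] by (auto intro!: derivative_eq_intros)
  have cZ: "continuous_on {s..T} (Z w)" if "continuous_on {s..T} w" for w
    by (rule continuous_on_vector_derivative[OF dZ[OF that]])
  have ca: "continuous_on {s..T} (a w)" if w: "continuous_on {s..T} w" for w
    unfolding a_def[abs_def]
    by (rule sc[OF strong_C1D(3)[OF N] continuous_on_diff[OF continuous_on_diff[OF w
            sc[OF strong_C1D(3)[OF P] cZ[OF w]]] cg]])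
  have c\<Phi>: "continuous_on {s..T} (\<Phi> w)" if w: "continuous_on {s..T} w" for w
    unfolding \<Phi>_def[abs_def]
    by (rule continuous_on_add[OF continuous_on_add[OF continuous_on_add[OF continuous_on_add[OF
      sc[OF strong_C1D(2)[OF M] ca[OF w]]
      sc[OF strong_C1D(3)[OF M] sc[OF strongly_cont_B continuous_on_diff[OF cZ[OF w] ca[OF w]]]]]
      sc[OF strong_C1D(3)[OF P] w]] sc[OF strong_C1D(2)[OF P] cZ[OF w]]] g'])
  \<comment> \<open>\<open>q\<close> and \<open>L\<close> are Lipschitz constants of
    \<open>a\<close> and \<open>\<Phi>\<close> in the weighted norm, where passing to the primitive
    does not increase the norm because k \<ge> 1.\<close>
  define q where "q = K * (1 + K)"
  define L where "L = K * q + K * (K * (1 + q)) + K + K"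
  have q0: "q \<ge> 0" and L0: "L \<ge> 0" using K0 by (auto simp: q_def L_def)
  obtain k where k: "k \<ge> 1" "\<And>s \<zeta> \<phi> \<psi> c t. 0 \<le> s \<Longrightarrow> s \<le> T \<Longrightarrow> continuous_on {s..T} \<phi> \<Longrightarrow> continuous_on {s..T} \<psi> \<Longrightarrow>
    c \<ge> 0 \<Longrightarrow> (\<And>r. r \<in> {s..T} \<Longrightarrow> norm (\<phi> r - \<psi> r) \<le> L * c * exp (k * (r - s))) \<Longrightarrow> t \<in> {s..T} \<Longrightarrow>
    norm (mild s \<zeta> \<phi> t - mild s \<zeta> \<psi> t) \<le> c / 2 * exp (k * (t - s))"
    using mild_contraction[OF L0] by metis
  \<comment> \<open>The value that the equation forces on the derivative at time s; it is defined
    because z0 lies in \<open>D\<close>.\<close>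
  define w0 where "w0 = M s (A s z0) + P s z0 + g s"
  obtain w where cw: "continuous_on {s..T} w" and fix_w: "\<And>t. t \<in> {s..T} \<Longrightarrow> mild s w0 (\<Phi> w) t = w t"
  proof (rule weighted_fixed_point[of k s T "\<lambda>w. mild s w0 (\<Phi> w)"])
    show "continuous_on {s..T} (mild s w0 (\<Phi> u))" if "continuous_on {s..T} u" for u
      by (rule mild_cont[OF s c\<Phi>[OF that]])
    fix u v :: "real \<Rightarrow> 'a" and c t
    assume cu: "continuous_on {s..T} u" and cv: "continuous_on {s..T} v" and c: "c \<ge> 0"
      and uv: "\<And>r. r \<in> {s..T} \<Longrightarrow> norm (u r - v r) \<le> c * exp (k * (r - s))" and t: "t \<in> {s..T}"
    show "norm (mild s w0 (\<Phi> u) t - mild s w0 (\<Phi> v) t) \<le> c / 2 * exp (k * (t - s))"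
    proof (rule k(2)[OF s c\<Phi>[OF cu] c\<Phi>[OF cv] c _ t])
      fix r assume r: "r \<in> {s..T}"
      then have rI: "r \<in> {0..T}" using sub by auto
      define E where "E = c * exp (k * (r - s))"
      have E0: "E \<ge> 0" using c by (simp add: E_def)
      have uvE: "norm (u r - v r) \<le> E" using uv[OF r] by (simp add: E_def)
      have ZE: "norm (Z u r - Z v r) \<le> E"
      proof -
        have sub': "{s..r} \<subseteq> {s..T}" using r by auto
        have "Z u r - Z v r = integral {s..r} u - integral {s..r} v" by (simp add: Z_def)
        also have "\<dots> = integral {s..r} (\<lambda>x. u x - v x)"
          by (rule Henstock_Kurzweil_Integration.integral_diff[symmetric];
              rule integrable_continuous_real[OF continuous_on_subset[OF _ sub']], fact)
        also have "norm \<dots> \<le> c / k * exp (k * (r - s))"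
          by (rule integral_exp_le[OF continuous_on_subset[OF continuous_on_diff[OF cu cv] sub']])
            (use r k(1) c uv in auto)
        also have "\<dots> \<le> E" unfolding E_def
          using k(1) c mult_left_mono[OF k(1) c] by (intro mult_right_mono) (auto simp: divide_le_eq)
        finally show ?thesis .
      qed
      interpret N: bounded_linear "N r" by (rule N_lin[OF rI])
      interpret P: bounded_linear "P r" by (rule P_lin[OF rI])
      interpret P': bounded_linear "P' r" by (rule P'_lin[OF rI])
      interpret M: bounded_linear "M r" by (rule M_lin[OF rI])
      interpret M': bounded_linear "M' r" by (rule M'_lin[OF rI])
      interpret B: bounded_linear "B r" by (rule B_lin[OF rI])
      have aE: "norm (a u r - a v r) \<le> q * E"
      proof -
        have "a u r - a v r = N r ((u r - v r) - P r (Z u r - Z v r))"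
          unfolding a_def N.diff[symmetric] P.diff by (simp add: algebra_simps)
        also have "norm \<dots> \<le> K * norm ((u r - v r) - P r (Z u r - Z v r))" by (rule K(4)[OF rI])
        also have "\<dots> \<le> K * (E + K * E)"
          using K(6)[OF rI, of "Z u r - Z v r"] mult_left_mono[OF ZE K0] uvE K0
            norm_triangle_ineq4[of "u r - v r" "P r (Z u r - Z v r)"]
          by (intro mult_left_mono) auto
        finally show ?thesis by (simp add: q_def algebra_simps)
      qed
      have eq: "\<Phi> u r - \<Phi> v r = M' r (a u r - a v r) + M r (B r ((Z u r - Z v r) - (a u r - a v r)))
          + P r (u r - v r) + P' r (Z u r - Z v r)"
        by (simp add: \<Phi>_def M'.diff M.diff B.diff P.diff P'.diff)
      have "norm (\<Phi> u r - \<Phi> v r) \<le> K * (q * E) + K * (K * (E + q * E)) + K * E + K * E"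
        unfolding eq
      proof (intro norm_triangle_le add_mono)
        show "norm (M' r (a u r - a v r)) \<le> K * (q * E)"
          by (rule order_trans[OF K(3)[OF rI] mult_left_mono[OF aE K0]])
        have "norm ((Z u r - Z v r) - (a u r - a v r)) \<le> E + q * E"
          using norm_triangle_ineq4[of "Z u r - Z v r" "a u r - a v r"] ZE aE by linarith
        then show "norm (M r (B r ((Z u r - Z v r) - (a u r - a v r)))) \<le> K * (K * (E + q * E))"
          by (intro order_trans[OF K(2)[OF rI]] mult_left_mono order_trans[OF K(8)[OF rI]] K0)
        show "norm (P r (u r - v r)) \<le> K * E" by (rule order_trans[OF K(6)[OF rI] mult_left_mono[OF uvE K0]])
        show "norm (P' r (Z u r - Z v r)) \<le> K * E" by (rule order_trans[OF K(7)[OF rI] mult_left_mono[OF ZE K0]])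
      qed
      also have "\<dots> = L * c * exp (k * (r - s))" by (simp add: L_def E_def algebra_simps)
      finally show "norm (\<Phi> u r - \<Phi> v r) \<le> L * c * exp (k * (r - s))" .
    qed
  qed (use k in auto)
  define z where "z = Z w"
  have cz: "continuous_on {s..T} z" unfolding z_def by (rule cZ[OF cw])
  define \<phi> where "\<phi> = \<Phi> w"
  have cph: "continuous_on {s..T} \<phi>" unfolding \<phi>_def by (rule c\<Phi>[OF cw])
  define al where "al = a w"
  have cal: "continuous_on {s..T} al" unfolding al_def by (rule ca[OF cw])
  define wn where "wn n = yosida n s w0 \<phi>" for n
  have wn_sol: "yosida_solution (step n) s w0 \<phi> (wn n)" for n
    unfolding wn_def by (rule yosida_is_solution[OF s(1) cph])
  have cwn: "continuous_on {s..T} (wn n)" for n by (rule yosida_cont[OF wn_sol])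
  have wn_lim: "uniform_limit {s..T} wn w sequentially"
  proof (rule uniform_limitI)
    fix e :: real assume "e > 0"
    from uniform_limitD[OF mild_limit[OF s cph, of w0] this]
    show "\<forall>\<^sub>F n in sequentially. \<forall>t\<in>{s..T}. dist (wn n t) (w t) < e"
      by eventually_elim (use fix_w in \<open>simp add: wn_def \<phi>_def\<close>)
  qed
  define zn where "zn n = Z (wn n)" for n
  define an where "an n t = Yos (step n) t (zn n t)" for n t
  define d where "d n t = M t (an n t) + P t (zn n t) + g t - wn n t" for n t
  define eps where "eps n e \<longleftrightarrow> (\<forall>t\<in>{s..T}. norm (wn n t - w t) \<le> e \<and> norm (zn n t - z t) \<le> e \<and>
      norm (R (step n) t (z t) - z t) \<le> e \<and> norm (R (step n) t (B t (z t - al t)) - B t (z t - al t)) \<le> e \<and>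
      norm (d n s) \<le> e)" for n e
  have an_eq: "an n t = N t (d n t + wn n t - P t (zn n t) - g t)" if "t \<in> {s..T}" for n t
    using NM[of t] sub that by (auto simp: d_def)
  have ev_eps: "\<forall>\<^sub>F n in sequentially. eps n e" if e: "e > 0" for e
  proof -
    \<comment> \<open>Reduced so that the error integrated over a length of at most T - s is still
      at most e.\<close>
    define e' where "e' = e / (1 + (T - s))"
    have e': "e' > 0" "e' \<le> e" "(T - s) * e' \<le> e" using e s
      by (auto simp: e'_def field_simps)
    have 1: "\<forall>\<^sub>F n in sequentially. \<forall>t\<in>{s..T}. norm (wn n t - w t) \<le> e'"
      using uniform_limitD[OF wn_lim e'(1)] by eventually_elim (auto simp: dist_norm less_imp_le)
    have 2: "\<forall>\<^sub>F n in sequentially. \<forall>t\<in>{s..T}. norm (R (step n) t (z t) - z t) \<le> e"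
      by (rule R_uniform[OF s(1) cz e])
    have 3: "\<forall>\<^sub>F n in sequentially. \<forall>t\<in>{s..T}. norm (R (step n) t (B t (z t - al t)) - B t (z t - al t)) \<le> e"
      by (rule R_uniform[OF s(1) sc[OF strongly_cont_B continuous_on_diff[OF cz cal]] e])
    have 4: "\<forall>\<^sub>F n in sequentially. \<forall>t\<in>{s..T}. norm (R (step n) t (A s z0) - A s z0) \<le> e / K"
      by (rule R_uniform[OF s(1)]) (use e K(1) in auto)
    show ?thesis using 1 2 3 4
    proof eventually_elim
      case (elim n)
      have "norm (zn n t - z t) \<le> e" if t: "t \<in> {s..T}" for t
      proof -
        have sub': "{s..t} \<subseteq> {s..T}" using t by auto
        have "zn n t - z t = integral {s..t} (wn n) - integral {s..t} w" by (simp add: zn_def z_def Z_def)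
        also have "\<dots> = integral {s..t} (\<lambda>x. wn n x - w x)"
          by (rule Henstock_Kurzweil_Integration.integral_diff[symmetric];
              rule integrable_continuous_real[OF continuous_on_subset[OF _ sub']], fact)
        also have "norm \<dots> \<le> e' * (t - s)"
          by (rule integral_bound[OF _ continuous_on_subset[OF continuous_on_diff[OF cwn cw] sub']])
            (use t elim(1) in auto)
        also have "\<dots> \<le> (T - s) * e'" using t e' by (simp add: mult.commute mult_left_mono)
        finally show ?thesis using e' by simp
      qed
      moreover have "norm (wn n t - w t) \<le> e" if "t \<in> {s..T}" for t using elim(1) that e' by fastforce
      \<comment> \<open>Initially the defect is M applied to the difference between A z0 and its
        resolvent, which tends to zero.\<close>
      moreover have "norm (d n s) \<le> e"
      proof -
        have sI: "s \<in> {0..T}" "s \<in> {s..T}" using s by auto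
        interpret M: bounded_linear "M s" by (rule M_lin[OF sI(1)])
        have zn0: "zn n s = z0" by (simp add: zn_def Z_def)
        have "wn n s = w0" using wn_sol[of n] by (simp add: yosida_solution_def)
        moreover have "an n s = R (step n) s (A s z0)"
          unfolding an_def zn0 Yos_def by (rule max_dissipative.R_A[OF A_md[OF sI(1)] step_pos z0, symmetric])
        ultimately have "d n s = M s (R (step n) s (A s z0) - A s z0)"
          by (simp add: d_def w0_def zn0 M.diff)
        then have "norm (d n s) \<le> K * norm (R (step n) s (A s z0) - A s z0)" using K(2)[OF sI(1)] by simp
        also have "\<dots> \<le> K * (e / K)" using elim(4) sI K0 by (intro mult_left_mono) auto
        finally show ?thesis using K(1) by simp
      qed
      ultimately show ?case unfolding eps_def using elim(2,3) by blast
    qed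
  qed
  define c1 where "c1 = K * K + K * (K * K)"
  define r where "r = K * (1 + K)"
  define c2 where "c2 = K * r + K * (K * (2 + r) + 1) + K + K"
  have c0: "c1 \<ge> 0" "c2 \<ge> 0" "r \<ge> 0" using K0 by (auto simp: c1_def c2_def r_def)
  have d_small: "(norm (d n b))\<^sup>2 \<le> exp ((2 * c1 + 2) * (T - s)) * (e\<^sup>2 + (c2 * e)\<^sup>2) \<and> norm (an n b - al b) \<le> K * norm (d n b) + r * e"
    if ep: "eps n e" and e: "e > 0" and b: "b \<in> {s..T}" for n e b
  proof -
    have ep': "norm (wn n t - w t) \<le> e" "norm (zn n t - z t) \<le> e" "norm (R (step n) t (z t) - z t) \<le> e"
      "norm (R (step n) t (B t (z t - al t)) - B t (z t - al t)) \<le> e" "norm (d n s) \<le> e"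
      if "t \<in> {s..T}" for t
      using ep that unfolding eps_def by blast+
    have an_al: "norm (an n t - al t) \<le> K * norm (d n t) + r * e" if t: "t \<in> {s..T}" for t
    proof -
      have tI: "t \<in> {0..T}" using t sub by auto
      interpret N: bounded_linear "N t" by (rule N_lin[OF tI])
      interpret P: bounded_linear "P t" by (rule P_lin[OF tI])
      have "an n t - al t = N t (d n t + ((wn n t - w t) - P t (zn n t - z t)))"
        unfolding an_eq[OF t] al_def a_def z_def[symmetric] N.diff[symmetric] P.diff by (simp add: algebra_simps)
      then have "norm (an n t - al t) \<le> K * norm (d n t + ((wn n t - w t) - P t (zn n t - z t)))"
        using K(4)[OF tI] by simp
      also have "\<dots> \<le> K * (norm (d n t) + (e + K * e))"
        by (rule mult_left_mono[OF norm_triangle_le[OF add_left_mono[OF norm_triangle_le_diff[OF add_mono[OF ep'(1)[OF t]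
              order_trans[OF K(6)[OF tI] mult_left_mono[OF ep'(2)[OF t] K0]]]]]] K0])
      finally show ?thesis by (simp add: r_def algebra_simps)
    qed
    define d' where "d' t = M' t (an n t - al t)
        + M t (R (step n) t (B t (R (step n) t (zn n t) - an n t)) - B t (z t - al t))
        + P' t (zn n t - z t) + P t (wn n t - w t)" for t
    have dd: "(d n has_vector_derivative d' t) (at t within {s..T})" if t: "t \<in> {s..T}" for t
    proof -
      have tI: "t \<in> {0..T}" using t sub by auto
      interpret P: bounded_linear "P t" by (rule P_lin[OF tI])
      interpret P': bounded_linear "P' t" by (rule P'_lin[OF tI])
      interpret M: bounded_linear "M t" by (rule M_lin[OF tI])
      interpret M': bounded_linear "M' t" by (rule M'_lin[OF tI])
      have dzn: "(zn n has_vector_derivative wn n t) (at t within {s..T})"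
        unfolding zn_def by (rule dZ[OF cwn t])
      \<comment> \<open>The unbounded term M \<open>Yos\<close> wn arises here and again in the
        equation for \<open>wn n\<close>; the two cancel, so the derivative of the defect contains
        only bounded operators applied to small quantities or to the defect itself.\<close>
      have 1: "((\<lambda>t. M t (an n t)) has_vector_derivative
          (M' t (an n t) + M t (R (step n) t (B t (R (step n) t (zn n t) - an n t)))) + M t (Yos (step n) t (wn n t))) (at t within {s..T})"
        unfolding an_def by (rule strong_C1_apply_subset[OF MYos_C1[OF step_pos] sub _ t dzn]) simp
      have 2: "((\<lambda>t. P t (zn n t)) has_vector_derivative P' t (zn n t) + P t (wn n t)) (at t within {s..T})"
        by (rule strong_C1_apply_subset[OF P sub _ t dzn]) simp
      have 3: "(wn n has_vector_derivative M t (Yos (step n) t (wn n t)) + \<phi> t) (at t within {s..T})"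
        using wn_sol[of n] t unfolding yosida_solution_def by blast
      have ph_eq: "\<phi> t = M' t (al t) + M t (B t (z t - al t)) + P t (w t) + P' t (z t) + g' t"
        unfolding \<phi>_def \<Phi>_def al_def z_def ..
      show ?thesis
        using has_vector_derivative_diff[OF has_vector_derivative_add[OF has_vector_derivative_add[OF 1 2] g[OF t]] 3]
        unfolding d_def[abs_def] d'_def ph_eq by (simp add: P.diff P'.diff M.diff M'.diff algebra_simps)
    qed
    have d'_le: "norm (d' t) \<le> c1 * norm (d n t) + c2 * e" if t: "t \<in> {s..T}" for t
    proof -
      have tI: "t \<in> {0..T}" using t sub by auto
      interpret B: bounded_linear "B t" by (rule B_lin[OF tI])
      interpret R: bounded_linear "R (step n) t" by (rule bounded_linear_R[OF tI step_pos])
      define x where "x = K * norm (d n t) + r * e"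
      have x: "norm (an n t - al t) \<le> x" using an_al[OF t] by (simp add: x_def)
      have "norm (d' t) \<le> K * x + K * (K * (e + e + x) + e) + K * e + K * e"
        unfolding d'_def
      proof (intro norm_triangle_le add_mono)
        show "norm (M' t (an n t - al t)) \<le> K * x"
          by (rule order_trans[OF K(3)[OF tI] mult_left_mono[OF x K0]])
        show "norm (P' t (zn n t - z t)) \<le> K * e"
          by (rule order_trans[OF K(7)[OF tI] mult_left_mono[OF ep'(2)[OF t] K0]])
        show "norm (P t (wn n t - w t)) \<le> K * e"
          by (rule order_trans[OF K(6)[OF tI] mult_left_mono[OF ep'(1)[OF t] K0]])
        let ?y = "R (step n) t (zn n t - z t) + (R (step n) t (z t) - z t) - (an n t - al t)"
        have eq: "R (step n) t (B t (R (step n) t (zn n t) - an n t)) - B t (z t - al t)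
            = R (step n) t (B t ?y) + (R (step n) t (B t (z t - al t)) - B t (z t - al t))"
          unfolding R.diff[symmetric] B.diff[symmetric] by (simp add: R.diff B.diff R.add B.add algebra_simps)
        have "norm (R (step n) t (B t ?y)) \<le> K * (e + e + x)"
        proof -
          have "norm ?y \<le> e + e + x"
            by (intro norm_triangle_le_diff norm_triangle_le add_mono ep'(3)[OF t] x
                order_trans[OF norm_R_le[OF tI step_pos] ep'(2)[OF t]])
          then show ?thesis
            by (intro order_trans[OF norm_R_le[OF tI step_pos]] order_trans[OF K(8)[OF tI]] mult_left_mono K0)
        qed
        then have "norm (R (step n) t (B t (R (step n) t (zn n t) - an n t)) - B t (z t - al t)) \<le> K * (e + e + x) + e"
          unfolding eq by (rule norm_triangle_le[OF add_mono[OF _ ep'(4)[OF t]]])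
        then show "norm (M t (R (step n) t (B t (R (step n) t (zn n t) - an n t)) - B t (z t - al t))) \<le> K * (K * (e + e + x) + e)"
          by (intro order_trans[OF K(2)[OF tI]] mult_left_mono K0)
      qed
      also have "\<dots> = c1 * norm (d n t) + c2 * e" by (simp add: x_def c1_def c2_def algebra_simps)
      finally show ?thesis .
    qed
    define en where "en t = d n t \<bullet> d n t" for t
    have "en b \<le> exp ((2 * c1 + 2) * (b - s)) * (en s + (c2 * e)\<^sup>2 / ((2 * c1 + 2) - (2 * c1 + 1)))"
    proof (rule gronwall)
      have "continuous_on {s..b} (d n)"
        by (rule continuous_on_subset[OF continuous_on_vector_derivative[OF dd]]) (use b in auto)
      then show "continuous_on {s..b} en" unfolding en_def by (intro continuous_intros)
      fix t assume t: "s < t" "t < b"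
      then have tI: "t \<in> {s..T}" using b by auto
      have "(d n has_vector_derivative d' t) (at t)" using has_vector_derivative_at_interior[OF dd[OF tI]] t b by auto
      from bounded_bilinear.has_vector_derivative[OF bounded_bilinear_inner this this]
      show "(en has_real_derivative 2 * (d' t \<bullet> d n t)) (at t)"
        unfolding has_real_derivative_iff_has_vector_derivative en_def by (simp add: inner_commute)
      have "2 * (d' t \<bullet> d n t) \<le> 2 * ((c1 * norm (d n t) + c2 * e) * norm (d n t))"
        using order_trans[OF norm_cauchy_schwarz[of "d' t" "d n t"] mult_right_mono[OF d'_le[OF tI] norm_ge_zero]] by simp
      also have "\<dots> = 2 * c1 * (norm (d n t))\<^sup>2 + 2 * (c2 * e) * norm (d n t)"
        by (simp add: power2_eq_square algebra_simps)
      also have "\<dots> \<le> (2 * c1 + 1) * (norm (d n t))\<^sup>2 + (c2 * e)\<^sup>2"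
        using sum_squares_bound[of "c2 * e" "norm (d n t)"] by (simp add: algebra_simps)
      also have "\<dots> \<le> (2 * c1 + 1) * en t + (c2 * e)\<^sup>2 * exp ((2 * c1 + 2) * (t - s))"
      proof -
        have "(c2 * e)\<^sup>2 * 1 \<le> (c2 * e)\<^sup>2 * exp ((2 * c1 + 2) * (t - s))"
          using c0 t by (intro mult_left_mono) auto
        then show ?thesis by (simp add: en_def power2_norm_eq_inner)
      qed
      finally show "2 * (d' t \<bullet> d n t) \<le> (2 * c1 + 1) * en t + (c2 * e)\<^sup>2 * exp ((2 * c1 + 2) * (t - s))" .
    qed (use b in \<open>auto simp: en_def\<close>)
    also have "\<dots> \<le> exp ((2 * c1 + 2) * (T - s)) * (e\<^sup>2 + (c2 * e)\<^sup>2)"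
    proof (rule mult_mono)
      show "exp ((2 * c1 + 2) * (b - s)) \<le> exp ((2 * c1 + 2) * (T - s))"
        using b c0 by (auto intro: mult_left_mono)
      have "en s \<le> e\<^sup>2" unfolding en_def power2_norm_eq_inner[symmetric]
        using ep'(5)[OF b] by (intro power_mono) auto
      then show "en s + (c2 * e)\<^sup>2 / ((2 * c1 + 2) - (2 * c1 + 1)) \<le> e\<^sup>2 + (c2 * e)\<^sup>2" by simp
    qed (auto simp: en_def)
    finally show ?thesis using an_al[OF b] by (simp add: en_def power2_norm_eq_inner)
  qed
  have lim_an: "(\<lambda>n. an n t) \<longlonglongrightarrow> al t" and lim_zn: "(\<lambda>n. zn n t) \<longlonglongrightarrow> z t" if t: "t \<in> {s..T}" for t
  proof -
    define H where "H = sqrt (exp ((2 * c1 + 2) * (T - s)) * (1 + c2\<^sup>2))"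
    have H0: "H \<ge> 0" by (simp add: H_def)
    have bound: "norm (an n t - al t) \<le> (K * H + r) * e" if "eps n e" "e > 0" for n e
    proof -
      have "(norm (d n t))\<^sup>2 \<le> exp ((2 * c1 + 2) * (T - s)) * (e\<^sup>2 + (c2 * e)\<^sup>2)"
        using d_small[OF that t] by blast
      also have "\<dots> = (H * e)\<^sup>2" by (simp add: H_def power_mult_distrib algebra_simps)
      finally have "norm (d n t) \<le> H * e" by (rule power2_le_imp_le) (use H0 that in simp)
      then have "K * norm (d n t) \<le> K * (H * e)" using K0 by (intro mult_left_mono)
      then show ?thesis using d_small[OF that t] by (simp add: algebra_simps)
    qed
    show "(\<lambda>n. an n t) \<longlonglongrightarrow> al t"
    proof (rule tendstoI)
      fix e :: real assume e: "e > 0"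
      define e' where "e' = e / (2 * (K * H + r + 1))"
      have p: "K * H + r \<ge> 0" using K0 H0 c0 by simp
      have "x * (e / (2 * (x + 1))) < e" if "x \<ge> 0" for x
        using that e by (simp add: pos_divide_less_eq)
      from this[OF p] have e': "e' > 0" "(K * H + r) * e' < e" using e p by (auto simp: e'_def)
      show "\<forall>\<^sub>F n in sequentially. dist (an n t) (al t) < e"
        using ev_eps[OF e'(1)] by eventually_elim (use bound[OF _ e'(1)] e'(2) in \<open>force simp: dist_norm\<close>)
    qed
    show "(\<lambda>n. zn n t) \<longlonglongrightarrow> z t"
    proof (rule tendstoI)
      fix e :: real assume e: "e > 0"
      then have "e / 2 > 0" by simp
      from ev_eps[OF this] show "\<forall>\<^sub>F n in sequentially. dist (zn n t) (z t) < e"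
        by eventually_elim (use t e in \<open>force simp: eps_def dist_norm\<close>)
    qed
  qed
  \<comment> \<open>The resolvent of \<open>zn n\<close> is \<open>zn n\<close> plus
    \<open>step n\<close> times \<open>an n\<close>, hence tends to z, while A maps it to
    \<open>an n\<close>, which tends to \<open>al\<close>. Closedness of A concludes.\<close>
  have zD: "z t \<in> D \<and> A t (z t) = al t" if t: "t \<in> {s..T}" for t
  proof -
    have tI: "t \<in> {0..T}" using t sub by auto
    have "(\<lambda>n. zn n t + step n *\<^sub>R an n t) \<longlonglongrightarrow> z t + 0 *\<^sub>R al t"
      by (intro tendsto_intros lim_an[OF t] lim_zn[OF t] step_tendsto)
    then have "(\<lambda>n. R (step n) t (zn n t)) \<longlonglongrightarrow> z t"
      by (simp add: R_Yos[OF tI step_pos] an_def)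
    from max_dissipative.A_closed[OF A_md[OF tI] R_in[OF tI step_pos] this]
    show ?thesis using lim_an[OF t] unfolding an_def Yos_def by blast
  qed
  show ?thesis
  proof (rule that[of z w])
    show "z s = z0" by (simp add: z_def Z_def)
    fix t assume t: "t \<in> {s..T}"
    then have tI: "t \<in> {0..T}" using sub by auto
    show "z t \<in> D" using zD[OF t] by blast
    show "w t = M t (A t (z t)) + P t (z t) + g t"
      using zD[OF t] MN[OF tI] by (simp add: al_def a_def z_def)
    show "(z has_vector_derivative w t) (at t within {s..T})" unfolding z_def by (rule dZ[OF cw t])
  qed (rule cw)
qed

text \<open>The defect enters with the factor b - s, as in a variation of constants formula; an
  energy inequality with a fixed rate would not show this factor. Young's inequality and the rate
  are therefore adapted to the length \<tau> = b - s: the contributions of order 1 / \<tau> cost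
  only exp(4 / \<nu>) over an interval of length \<tau>. The linear dependence is what later yields
  derivatives of the evolution family.\<close>

lemma stability:
  obtains C where "C \<ge> 1"
    "\<And>s b z z' c. 0 \<le> s \<Longrightarrow> s \<le> b \<Longrightarrow> b \<le> T \<Longrightarrow> continuous_on {s..b} z \<Longrightarrow>
      (\<And>t. s < t \<Longrightarrow> t < b \<Longrightarrow> z t \<in> D \<and> (z has_vector_derivative z' t) (at t) \<and>
         norm (z' t - (M t (A t (z t)) + P t (z t))) \<le> c) \<Longrightarrow> c \<ge> 0 \<Longrightarrow>
      norm (z b) \<le> C * (norm (z s) + (b - s) * c)"
proof -
  define C where "C = 1 + sqrt (exp ((K + 2 * K\<^sup>2) / \<nu> * T + 4 / \<nu>) * (K / \<nu> + K\<^sup>2))"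
  have K0: "K \<ge> 0" using K(1) by simp
  have C1: "C \<ge> 1" using K0 \<nu> by (simp add: C_def)
  have "norm (z b) \<le> C * (norm (z s) + (b - s) * c)"
    if s: "0 \<le> s" "s \<le> b" "b \<le> T" and cont: "continuous_on {s..b} z"
      and z: "\<And>t. s < t \<Longrightarrow> t < b \<Longrightarrow> z t \<in> D \<and> (z has_vector_derivative z' t) (at t) \<and>
         norm (z' t - (M t (A t (z t)) + P t (z t))) \<le> c" and c: "c \<ge> 0" for s b z z' c
  proof (cases "s = b")
    case True
    have "1 * norm (z b) \<le> C * norm (z b)" using C1 by (intro mult_right_mono) auto
    then show ?thesis using True by simp
  next
    case False
    define \<tau> where "\<tau> = b - s"
    have \<tau>: "\<tau> > 0" "\<tau> \<le> T" using False s by (auto simp: \<tau>_def)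
    define \<alpha> where "\<alpha> = K\<^sup>2 + 1 / \<tau>"
    define h where "h = \<tau> * (K * c)\<^sup>2"
    define k where "k = (K + 2 * \<alpha>) / \<nu> + 2 / (\<nu> * \<tau>)"
    have "\<nu> * (norm (z b))\<^sup>2 \<le> exp (k * (b - s)) * (K * (norm (z s))\<^sup>2 + 2 * h / (k - (K + 2 * \<alpha>) / \<nu>))"
    proof (rule energy[OF s cont])
      fix t assume t: "s < t" "t < b"
      then have tI: "t \<in> {0..T}" using s by auto
      interpret N: bounded_linear "N t" by (rule N_lin[OF tI])
      show "(z has_vector_derivative z' t) (at t)" using z[OF t] by blast
      define f where "f = z' t - (M t (A t (z t)) + P t (z t))"
      have "N t (z' t) \<bullet> z t = A t (z t) \<bullet> z t + N t (P t (z t)) \<bullet> z t + N t f \<bullet> z t"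
        by (simp add: f_def N.diff N.add NM[OF tI] inner_add_left inner_diff_left)
      also have "\<dots> \<le> 0 + (K * (K * norm (z t))) * norm (z t) + (K * c) * norm (z t)"
      proof (intro add_mono)
        show "A t (z t) \<bullet> z t \<le> 0" using max_dissipative.A_dissip[OF A_md[OF tI]] z[OF t] by blast
        show "N t (P t (z t)) \<bullet> z t \<le> (K * (K * norm (z t))) * norm (z t)"
          by (rule order_trans[OF norm_cauchy_schwarz mult_right_mono[OF order_trans[OF K(4)[OF tI] mult_left_mono[OF K(6)[OF tI] K0]]]]) simp
        have "norm f \<le> c" using z[OF t] by (simp add: f_def)
        then show "N t f \<bullet> z t \<le> (K * c) * norm (z t)"
          by (intro order_trans[OF norm_cauchy_schwarz mult_right_mono[OF order_trans[OF K(4)[OF tI] mult_left_mono[OF _ K0]]]]) auto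
      qed
      also have "(K * c) * norm (z t) = (sqrt \<tau> * (K * c)) * (norm (z t) / sqrt \<tau>)" using \<tau> by simp
      also have "\<dots> \<le> (sqrt \<tau> * (K * c))\<^sup>2 + (norm (z t) / sqrt \<tau>)\<^sup>2" by (rule mult_le_sum_squares)
      also have "\<dots> = h + (1 / \<tau>) * (norm (z t))\<^sup>2" using \<tau> by (simp add: h_def power_mult_distrib power_divide)
      finally have "N t (z' t) \<bullet> z t \<le> \<alpha> * (norm (z t))\<^sup>2 + h" by (simp add: \<alpha>_def power2_eq_square algebra_simps)
      moreover have "h * 1 \<le> h * exp (k * (t - s))"
        using t \<tau> \<nu> K0 by (intro mult_left_mono) (auto simp: h_def k_def \<alpha>_def intro!: mult_nonneg_nonneg add_nonneg_nonneg)
      ultimately show "N t (z' t) \<bullet> z t \<le> \<alpha> * (norm (z t))\<^sup>2 + h * exp (k * (t - s))" by simp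
    qed (use \<tau> \<nu> K0 in \<open>auto simp: \<alpha>_def h_def k_def\<close>)
    also have "2 * h / (k - (K + 2 * \<alpha>) / \<nu>) = \<nu> * K\<^sup>2 * (\<tau> * c)\<^sup>2"
      using \<tau> \<nu> by (simp add: k_def h_def power_mult_distrib power2_eq_square)
    also have "exp (k * (b - s)) * (K * (norm (z s))\<^sup>2 + \<nu> * K\<^sup>2 * (\<tau> * c)\<^sup>2) \<le>
        exp ((K + 2 * K\<^sup>2) / \<nu> * T + 4 / \<nu>) * ((K + \<nu> * K\<^sup>2) * (norm (z s) + \<tau> * c)\<^sup>2)"
    proof (rule mult_mono)
      have "k * \<tau> = (K + 2 * K\<^sup>2) / \<nu> * \<tau> + 4 / \<nu>" using \<tau> \<nu> by (simp add: k_def \<alpha>_def field_simps)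
      also have "\<dots> \<le> (K + 2 * K\<^sup>2) / \<nu> * T + 4 / \<nu>" using \<tau> \<nu> K0 by (intro add_right_mono mult_left_mono) auto
      finally show "exp (k * (b - s)) \<le> exp ((K + 2 * K\<^sup>2) / \<nu> * T + 4 / \<nu>)" by (simp add: \<tau>_def)
      have "(norm (z s))\<^sup>2 \<le> (norm (z s) + \<tau> * c)\<^sup>2" "(\<tau> * c)\<^sup>2 \<le> (norm (z s) + \<tau> * c)\<^sup>2"
        using \<tau> c by (auto intro!: power_mono)
      then have "K * (norm (z s))\<^sup>2 + \<nu> * K\<^sup>2 * (\<tau> * c)\<^sup>2 \<le> K * (norm (z s) + \<tau> * c)\<^sup>2 + \<nu> * K\<^sup>2 * (norm (z s) + \<tau> * c)\<^sup>2"
        using K0 \<nu> by (intro add_mono mult_left_mono) auto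
      then show "K * (norm (z s))\<^sup>2 + \<nu> * K\<^sup>2 * (\<tau> * c)\<^sup>2 \<le> (K + \<nu> * K\<^sup>2) * (norm (z s) + \<tau> * c)\<^sup>2"
        by (simp add: algebra_simps)
    qed (use K0 \<nu> in auto)
    also have "\<dots> = \<nu> * ((exp ((K + 2 * K\<^sup>2) / \<nu> * T + 4 / \<nu>) * (K / \<nu> + K\<^sup>2)) * (norm (z s) + \<tau> * c)\<^sup>2)"
      using \<nu> by (simp add: algebra_simps)
    also have "(exp ((K + 2 * K\<^sup>2) / \<nu> * T + 4 / \<nu>) * (K / \<nu> + K\<^sup>2)) = (C - 1)\<^sup>2"
      using K0 \<nu> by (simp add: C_def)
    finally have "(norm (z b))\<^sup>2 \<le> ((C - 1) * (norm (z s) + \<tau> * c))\<^sup>2"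
      using \<nu> by (simp add: power_mult_distrib)
    then have "norm (z b) \<le> (C - 1) * (norm (z s) + \<tau> * c)"
      by (rule power2_le_imp_le) (use C1 \<tau> c in auto)
    also have "\<dots> \<le> C * (norm (z s) + \<tau> * c)" using \<tau> c by (intro mult_right_mono) auto
    finally show ?thesis by (simp add: \<tau>_def)
  qed
  then show ?thesis using that[OF C1] by blast
qed

end


section \<open>The evolution family on the half-line\<close>

lemma at_within_Icc_Ici: "t < b \<Longrightarrow> at t within {s..b} = at t within {s..}" for t :: real
  by (rule at_within_nhd[of _ "{..<b}"]) auto

lemma strongly_cont_dense:
  fixes T :: "'t::metric_space \<Rightarrow> 'a::real_normed_vector \<Rightarrow> 'b::real_normed_vector"
  assumes lin: "\<And>t. t \<in> S \<Longrightarrow> bounded_linear (T t)"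
    and bd: "\<And>t0. t0 \<in> S \<Longrightarrow> \<exists>c. \<forall>\<^sub>F t in at t0 within S. \<forall>x. norm (T t x) \<le> c * norm x"
    and dense: "closure D = UNIV" and cont: "\<And>x. x \<in> D \<Longrightarrow> continuous_on S (\<lambda>t. T t x)"
  shows "strongly_cont S T"
  unfolding strongly_cont_def continuous_on_def
proof (intro conjI ballI allI lin)
  fix x t0 assume t0: "t0 \<in> S"
  interpret T0: bounded_linear "T t0" by (rule lin[OF t0])
  obtain c1 where c1: "\<forall>\<^sub>F t in at t0 within S. \<forall>x. norm (T t x) \<le> c1 * norm x" using bd[OF t0] by blast
  obtain c0 where c0: "\<And>x. norm (T t0 x) \<le> norm x * c0" using T0.bounded by blast
  define c where "c = max (max c0 c1) 1"
  have c: "c > 0" by (simp add: c_def)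
  have T0: "norm (T t0 x) \<le> c * norm x" for x
  proof -
    have "norm x * c0 \<le> c * norm x" unfolding mult.commute[of _ c0] by (rule mult_right_mono) (auto simp: c_def)
    then show ?thesis using c0[of x] by simp
  qed
  have c1': "\<forall>\<^sub>F t in at t0 within S. \<forall>x. norm (T t x) \<le> c * norm x"
    using c1
  proof eventually_elim
    case (elim t)
    have "c1 * norm x \<le> c * norm x" for x :: 'a by (rule mult_right_mono) (auto simp: c_def)
    then show ?case using elim order_trans by blast
  qed
  show "((\<lambda>t. T t x) \<longlongrightarrow> T t0 x) (at t0 within S)"
  proof (rule tendstoI)
    fix e :: real assume e: "e > 0"
    define d where "d = e / (4 * c)"
    have d: "d > 0" "c * d = e / 4" using e c by (auto simp: d_def)
    have "x \<in> closure D" using dense by simp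
    then obtain y where y: "y \<in> D" "dist y x < d" using d by (meson closure_approachable)
    have "((\<lambda>t. T t y) \<longlongrightarrow> T t0 y) (at t0 within S)" using cont[OF y(1)] t0 by (simp add: continuous_on_def)
    then have "\<forall>\<^sub>F t in at t0 within S. dist (T t y) (T t0 y) < e / 4" using e by (intro tendstoD) auto
    moreover have "\<forall>\<^sub>F t in at t0 within S. t \<in> S" by (simp add: eventually_at_filter)
    ultimately show "\<forall>\<^sub>F t in at t0 within S. dist (T t x) (T t0 x) < e"
      using c1'
    proof eventually_elim
      case (elim t)
      interpret T: bounded_linear "T t" by (rule lin[OF elim(2)])
      have cd: "c * norm (x - y) \<le> e / 4"
        using mult_left_mono[of "norm (x - y)" d c] y c d by (simp add: dist_norm norm_minus_commute)
      have "norm (T t (x - y)) \<le> e / 4" "norm (T t0 (x - y)) \<le> e / 4"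
        using elim(3) T0[of "x - y"] cd order_trans by blast+
      moreover have "T t x - T t0 x = T t (x - y) + (T t y - T t0 y) - T t0 (x - y)"
        by (simp add: T.diff T0.diff)
      ultimately show "dist (T t x) (T t0 x) < e"
        using elim(1) e norm_triangle_ineq4[of "T t (x - y) + (T t y - T t0 y)" "T t0 (x - y)"]
          norm_triangle_ineq[of "T t (x - y)" "T t y - T t0 y"] unfolding dist_norm by simp
    qed
  qed
qed

lemma at_within_Ici: "s < t \<Longrightarrow> at t within {s..} = at t" for t :: real
  by (rule at_within_interior) (simp add: interior_Ici[of "s - 1"])

lemma bounded_linear_eq_dense:
  assumes f: "bounded_linear f" and g: "bounded_linear g"
    and S: "closure S = UNIV" and eq: "\<And>x. x \<in> S \<Longrightarrow> f x = g x"
  shows "f x = g x"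
proof -
  have "x \<in> closure S" using S by simp
  then obtain y where y: "\<And>n. y n \<in> S" "y \<longlonglongrightarrow> x" unfolding closure_sequential by blast
  have "(\<lambda>n. f (y n)) \<longlonglongrightarrow> g x" using bounded_linear.tendsto[OF g y(2)] eq[OF y(1)] by simp
  then show ?thesis using bounded_linear.tendsto[OF f y(2)] LIMSEQ_unique by blast
qed

text \<open>The data on the half-line; the inverse of M and the perturbation \<open>P\<close> are
  derived from them. No upper bound uniform in time is assumed, so all estimates are made on compact
  intervals.\<close>

locale hyperbolic =
  fixes D :: "'a::{real_inner,banach} set"
    and A A' M M' M'' :: "real \<Rightarrow> 'a \<Rightarrow> 'a" and \<beta> :: real
  assumes A_md: "\<And>t. t \<ge> 0 \<Longrightarrow> max_dissipative D (A t)"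
    and A_deriv: "\<And>t x. t \<ge> 0 \<Longrightarrow> x \<in> D \<Longrightarrow> ((\<lambda>t. A t x) has_vector_derivative A' t x) (at t within {0..})"
    and A'_cont: "strongly_cont {0..} (\<lambda>t y. A' t (resolvent D (A t) 1 y))"
    and M: "strong_C1 {0..} M M'" and M': "strong_C1 {0..} M' M''"
    and M_sym: "\<And>t x y. t \<ge> 0 \<Longrightarrow> M t x \<bullet> y = x \<bullet> M t y"
    and \<beta>: "\<beta> > 0" and M_coercive: "\<And>t x. t \<ge> 0 \<Longrightarrow> M t x \<bullet> x \<ge> \<beta> * (norm x)\<^sup>2"
begin

definition N where "N t = inv (M t)"
definition N' where "N' t x = - N t (M' t (N t x))"
definition P where "P t x = M' t (N t x)"
definition P' where "P' t x = M'' t (N t x) + M' t (N' t x)"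
text \<open>The generator in the variable z = M x: for x' = A M x one has z' = M' x + M x' = P z + M
  A z.\<close>

definition G where "G t x = M t (A t x) + P t x"

lemma bij_M: "t \<ge> 0 \<Longrightarrow> bij (M t)"
  using coercive_bij[OF _ \<beta> M_coercive] strong_C1D(1)[OF M] by simp

lemma MN: "t \<ge> 0 \<Longrightarrow> M t (N t x) = x" and NM: "t \<ge> 0 \<Longrightarrow> N t (M t x) = x"
  unfolding N_def using bij_M by (simp_all add: bij_is_surj surj_f_inv_f bij_is_inj inv_f_f)

lemma N_C1: "strong_C1 {0..} N N'"
  unfolding N'_def[abs_def] by (rule strong_C1_inverse[OF M]) (auto simp: MN NM)

lemma P_C1: "strong_C1 {0..} P P'"
  unfolding P_def[abs_def] P'_def[abs_def] by (rule strong_C1_compose[OF M' N_C1]) simp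

lemmas M_lin = strong_C1D(1)[OF M] and N_lin = strong_C1D(1)[OF N_C1] and P_lin = strong_C1D(1)[OF P_C1]

text \<open>Since N x . x \<ge> \<beta> |N x|^2 and |x| \<le> c |N x|. The constant depends on the
  interval, because M may be unbounded on the half-line.\<close>

lemma N_coercive:
  obtains \<nu> where "\<nu> > 0" "\<And>t x. t \<in> {0..T} \<Longrightarrow> N t x \<bullet> x \<ge> \<nu> * (norm x)\<^sup>2"
proof -
  obtain c where c: "c > 0" "\<And>t x. t \<in> {0..T} \<Longrightarrow> norm (M t x) \<le> c * norm x"
    using strongly_cont_bound[OF strongly_cont_subset[OF strong_C1D(3)[OF M]], of "{0..T}"] by auto
  have "N t x \<bullet> x \<ge> \<beta> / c\<^sup>2 * (norm x)\<^sup>2" if t: "t \<in> {0..T}" for t x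
  proof -
    have "norm x \<le> c * norm (N t x)" using c(2)[OF t, of "N t x"] MN t by simp
    then have "(norm x)\<^sup>2 \<le> (c * norm (N t x))\<^sup>2" by (intro power_mono) auto
    then have "\<beta> / c\<^sup>2 * (norm x)\<^sup>2 \<le> \<beta> / c\<^sup>2 * (c * norm (N t x))\<^sup>2" using \<beta> by (intro mult_left_mono) auto
    also have "\<dots> = \<beta> * (norm (N t x))\<^sup>2" using c by (simp add: power_mult_distrib)
    also have "\<dots> \<le> M t (N t x) \<bullet> N t x" using M_coercive t by simp
    also have "\<dots> = N t x \<bullet> x" using MN t by (simp add: inner_commute)
    finally show ?thesis .
  qed
  moreover have "\<beta> / c\<^sup>2 > 0" using c \<beta> by simp
  ultimately show ?thesis using that by blast
qed

lemma N_sym: "t \<ge> 0 \<Longrightarrow> N t x \<bullet> y = x \<bullet> N t y"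
  using M_sym[of t "N t x" "N t y"] MN by simp

lemma kato:
  assumes T: "T > 0"
  obtains \<nu> where "kato T D A A' M M' N N' P P' \<nu>"
proof -
  obtain \<nu> where \<nu>: "\<nu> > 0" "\<And>t x. t \<in> {0..T} \<Longrightarrow> N t x \<bullet> x \<ge> \<nu> * (norm x)\<^sup>2"
    using N_coercive by metis
  have "kato T D A A' M M' N N' P P' \<nu>"
  proof
    show "strong_C1 {0..T} M M'" "strong_C1 {0..T} N N'" "strong_C1 {0..T} P P'"
      by (rule strong_C1_subset[OF M] strong_C1_subset[OF N_C1] strong_C1_subset[OF P_C1]; auto)+
    show "strongly_cont {0..T} (\<lambda>t y. A' t (resolvent D (A t) 1 y))"
      by (rule strongly_cont_subset[OF A'_cont]) auto
    fix t x assume t: "t \<in> {0..T}" and x: "x \<in> D"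
    show "((\<lambda>t. A t x) has_vector_derivative A' t x) (at t within {0..T})"
      by (rule has_vector_derivative_within_subset[OF A_deriv]) (use t x in auto)
  qed (use T \<nu> max_dissipative.md[OF A_md] MN NM N_sym in auto)
  then show ?thesis by (rule that)
qed

lemma stability:
  obtains C where "C \<ge> 1"
    "\<And>s b z z' c. 0 \<le> s \<Longrightarrow> s \<le> b \<Longrightarrow> b \<le> T \<Longrightarrow> continuous_on {s..b} z \<Longrightarrow>
      (\<And>t. s < t \<Longrightarrow> t < b \<Longrightarrow> z t \<in> D \<and> (z has_vector_derivative z' t) (at t) \<and>
         norm (z' t - G t (z t)) \<le> c) \<Longrightarrow> c \<ge> 0 \<Longrightarrow>
      norm (z b) \<le> C * (norm (z s) + (b - s) * c)"
proof -
  have "max T 1 > 0" by simp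
  then obtain \<nu> where "kato (max T 1) D A A' M M' N N' P P' \<nu>" by (rule kato)
  then interpret k: kato "max T 1" D A A' M M' N N' P P' \<nu> .
  obtain C where C: "C \<ge> 1" "\<And>s b z z' c. 0 \<le> s \<Longrightarrow> s \<le> b \<Longrightarrow> b \<le> max T 1 \<Longrightarrow> continuous_on {s..b} z \<Longrightarrow>
      (\<And>t. s < t \<Longrightarrow> t < b \<Longrightarrow> z t \<in> D \<and> (z has_vector_derivative z' t) (at t) \<and>
         norm (z' t - (M t (A t (z t)) + P t (z t))) \<le> c) \<Longrightarrow> c \<ge> 0 \<Longrightarrow>
      norm (z b) \<le> C * (norm (z s) + (b - s) * c)" by (rule k.stability) blast
  show ?thesis
  proof (rule that[OF C(1)], goal_cases)
    case (1 s b z z' c)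
    show ?case by (rule C(2)[of s b z z' c]) (use 1 in \<open>auto simp: G_def\<close>)
  qed
qed

lemma D_diff: "x \<in> D \<Longrightarrow> y \<in> D \<Longrightarrow> x - y \<in> D"
  using max_dissipative.subspace_D[OF A_md[of 0]] by (simp add: subspace_diff)

lemma D_add: "x \<in> D \<Longrightarrow> y \<in> D \<Longrightarrow> x + y \<in> D"
  using max_dissipative.subspace_D[OF A_md[of 0]] by (simp add: subspace_add)

lemma D_scale: "x \<in> D \<Longrightarrow> c *\<^sub>R x \<in> D"
  using max_dissipative.subspace_D[OF A_md[of 0]] by (simp add: subspace_scale)

lemma dense_D: "closure D = UNIV" by (rule max_dissipative.dense_D[OF A_md[of 0]]) simp

lemma G_add: "t \<ge> 0 \<Longrightarrow> x \<in> D \<Longrightarrow> y \<in> D \<Longrightarrow> G t (x + y) = G t x + G t y"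
  using max_dissipative.A_add[OF A_md, of t x y] M_lin[of t] P_lin[of t]
  by (simp add: G_def linear_add[OF bounded_linear.axioms(1)])

lemma G_scale: "t \<ge> 0 \<Longrightarrow> x \<in> D \<Longrightarrow> G t (c *\<^sub>R x) = c *\<^sub>R G t x"
  using max_dissipative.A_scale[OF A_md, of t x c] M_lin[of t] P_lin[of t]
  by (simp add: G_def linear_scale[OF bounded_linear.axioms(1)] scaleR_add_right)

lemma G_diff: "t \<ge> 0 \<Longrightarrow> x \<in> D \<Longrightarrow> y \<in> D \<Longrightarrow> G t (x - y) = G t x - G t y"
  using G_add[of t x "(-1) *\<^sub>R y"] G_scale[of t y "-1"] D_scale[of y "-1"] by simp

lemma G_cont: "x \<in> D \<Longrightarrow> continuous_on {0..} (\<lambda>t. G t x)"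
proof -
  assume x: "x \<in> D"
  have "continuous_on {0..} (\<lambda>t. A t x)"
    by (rule continuous_on_vector_derivative[OF A_deriv]) (use x in auto)
  then show ?thesis unfolding G_def
    by (intro continuous_on_add strongly_cont_apply[OF strong_C1D(3)[OF M]] strongly_contD(2)[OF strong_C1D(3)[OF P_C1]]) simp_all
qed

text \<open>Continuity of \<open>G t (z t)\<close> is included so that z is C^1 whenever g is
  continuous.\<close>

definition solution :: "real \<Rightarrow> (real \<Rightarrow> 'a) \<Rightarrow> (real \<Rightarrow> 'a) \<Rightarrow> bool" where
  "solution s g z \<longleftrightarrow> continuous_on {s..} (\<lambda>t. G t (z t)) \<and>
     (\<forall>t\<ge>s. z t \<in> D \<and> (z has_vector_derivative G t (z t) + g t) (at t within {s..}))"

lemma solution_cont: "solution s g z \<Longrightarrow> continuous_on {s..} z"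
  by (rule continuous_on_vector_derivative[of _ _ "\<lambda>t. G t (z t) + g t"]) (simp add: solution_def)

text \<open>Derivatives are taken only inside the interval, because the Cauchy problem in the
  definition of an evolution family asks for a C^1 function only after the initial time.\<close>

lemma unique:
  assumes s: "0 \<le> s" "s \<le> b" and c1: "continuous_on {s..b} z1" and c2: "continuous_on {s..b} z2" and eq: "z1 s = z2 s"
    and z1: "\<And>t. s < t \<Longrightarrow> t < b \<Longrightarrow> z1 t \<in> D \<and> (z1 has_vector_derivative G t (z1 t) + g t) (at t)"
    and z2: "\<And>t. s < t \<Longrightarrow> t < b \<Longrightarrow> z2 t \<in> D \<and> (z2 has_vector_derivative G t (z2 t) + g t) (at t)"
  shows "z1 b = z2 b"
proof -
  obtain C where C: "C \<ge> 1"
    "\<And>s b' z z' c. 0 \<le> s \<Longrightarrow> s \<le> b' \<Longrightarrow> b' \<le> b \<Longrightarrow> continuous_on {s..b'} z \<Longrightarrow>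
      (\<And>t. s < t \<Longrightarrow> t < b' \<Longrightarrow> z t \<in> D \<and> (z has_vector_derivative z' t) (at t) \<and>
         norm (z' t - G t (z t)) \<le> c) \<Longrightarrow> c \<ge> 0 \<Longrightarrow>
      norm (z b') \<le> C * (norm (z s) + (b' - s) * c)"
    by (rule stability[of b]) blast
  have "norm (z1 b - z2 b) \<le> C * (norm (z1 s - z2 s) + (b - s) * 0)"
  proof (rule C(2)[of s b "\<lambda>t. z1 t - z2 t" "\<lambda>t. G t (z1 t) - G t (z2 t)"])
    fix t assume t: "s < t" "t < b"
    have "((\<lambda>t. z1 t - z2 t) has_vector_derivative (G t (z1 t) + g t) - (G t (z2 t) + g t)) (at t)"
      using z1[OF t] z2[OF t] by (intro has_vector_derivative_diff) auto
    then show "z1 t - z2 t \<in> D \<and> ((\<lambda>t. z1 t - z2 t) has_vector_derivative G t (z1 t) - G t (z2 t)) (at t) \<and>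
         norm (G t (z1 t) - G t (z2 t) - G t (z1 t - z2 t)) \<le> 0"
      using D_diff z1[OF t] z2[OF t] G_diff[of t "z1 t" "z2 t"] s t by simp
  qed (use s c1 c2 in \<open>auto intro: continuous_on_diff\<close>)
  then show ?thesis using eq by simp
qed

lemma solution_at:
  "solution s g z \<Longrightarrow> s < t \<Longrightarrow> z t \<in> D \<and> (z has_vector_derivative G t (z t) + g t) (at t)"
  unfolding solution_def using at_within_Ici[of s t] less_imp_le by metis

lemma solution_unique:
  assumes "0 \<le> s" "s \<le> t" "solution s g z1" "solution s g z2" "z1 s = z2 s"
  shows "z1 t = z2 t"
proof (rule unique[where g = g, OF assms(1,2)])
  show "continuous_on {s..t} z1" "continuous_on {s..t} z2"
    by (rule continuous_on_subset[OF solution_cont], fact, auto)+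
qed (rule assms(5) solution_at[OF assms(3)] solution_at[OF assms(4)], assumption?)+

text \<open>Solutions on the intervals [s, T] agree where they overlap and are glued.\<close>

lemma solution_ex:
  assumes s: "0 \<le> s" and z0: "z0 \<in> D" and g': "continuous_on {s..} g'"
    and g: "\<And>t. t \<ge> s \<Longrightarrow> (g has_vector_derivative g' t) (at t within {s..})"
  obtains z where "solution s g z" "z s = z0"
proof -
  have "\<exists>z w. z s = z0 \<and> continuous_on {s..T} w \<and> (\<forall>t\<in>{s..T}. z t \<in> D \<and>
      w t = G t (z t) + g t \<and> (z has_vector_derivative w t) (at t within {s..T}))" if T: "T > s" for T
  proof -
    have "T > 0" using s T by simp
    then obtain \<nu> where "kato T D A A' M M' N N' P P' \<nu>" by (rule kato)
    then interpret k: kato T D A A' M M' N N' P P' \<nu> .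
    have "continuous_on {s..T} g'" by (rule continuous_on_subset[OF g']) auto
    moreover have "(g has_vector_derivative g' t) (at t within {s..T})" if "t \<in> {s..T}" for t
      by (rule has_vector_derivative_within_subset[OF g]) (use that in auto)
    ultimately obtain z w where "z s = z0" "continuous_on {s..T} w"
      "\<And>t. t \<in> {s..T} \<Longrightarrow> z t \<in> D"
      "\<And>t. t \<in> {s..T} \<Longrightarrow> w t = M t (A t (z t)) + P t (z t) + g t"
      "\<And>t. t \<in> {s..T} \<Longrightarrow> (z has_vector_derivative w t) (at t within {s..T})"
      using k.classical_solution_ex[OF s less_imp_le[OF T] z0] by metis
    then show ?thesis unfolding G_def by blast
  qed
  then obtain Z V where ZV: "\<And>T. T > s \<Longrightarrow> Z T s = z0 \<and> continuous_on {s..T} (V T) \<and> (\<forall>t\<in>{s..T}. Z T t \<in> D \<and>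
      V T t = G t (Z T t) + g t \<and> (Z T has_vector_derivative V T t) (at t within {s..T}))" by metis
  have der: "(Z T has_vector_derivative G t (Z T t) + g t) (at t within {s..T})" if "T > s" "t \<in> {s..T}" for T t
    using ZV[OF that(1)] that(2) by metis
  have agree: "Z T t = Z T' t" if "T > s" "T' > s" "t \<in> {s..T}" "t \<in> {s..T'}" for T T' t
  proof (rule unique[of s t "Z T" "Z T'" g])
    show "continuous_on {s..t} (Z T)" "continuous_on {s..t} (Z T')"
      by (rule continuous_on_subset[OF continuous_on_vector_derivative[OF der]]; use that in auto)+
    fix r assume r: "s < r" "r < t"
    show "Z T r \<in> D \<and> (Z T has_vector_derivative G r (Z T r) + g r) (at r)"
      using ZV[OF that(1)] der[OF that(1), of r] r that at_within_Icc_at[of s r T] by auto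
    show "Z T' r \<in> D \<and> (Z T' has_vector_derivative G r (Z T' r) + g r) (at r)"
      using ZV[OF that(2)] der[OF that(2), of r] r that at_within_Icc_at[of s r T'] by auto
  qed (use ZV that s in auto)
  \<comment> \<open>The interval up to t + 1 keeps t away from its right end, so that derivatives
    within it are derivatives within \<open>{s..}\<close>.\<close>
  define z where "z t = Z (t + 1) t" for t
  have zZ: "z r = Z T r" if "r \<in> {s..T}" "T > s" for r T
    unfolding z_def by (rule agree) (use that in auto)
  have "solution s g z"
    unfolding solution_def
  proof (intro conjI allI impI)
    have "continuous_on {s..} (\<lambda>t. G t (z t) + g t)"
      unfolding continuous_on_def
    proof
      fix t assume t: "t \<in> {s..}"
      have T: "t + 1 > s" using t by simp
      have tt: "t \<in> {s..t+1}" using t by simp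
      have "((\<lambda>r. V (t + 1) r) \<longlongrightarrow> V (t + 1) t) (at t within {s..t + 1})"
        using ZV[OF T] tt unfolding continuous_on_def by blast
      moreover have "\<forall>\<^sub>F r in at t within {s..t + 1}. V (t + 1) r = G r (z r) + g r"
        unfolding eventually_at_filter using ZV[OF T] zZ[OF _ T] by (intro always_eventually) auto
      ultimately have "((\<lambda>r. G r (z r) + g r) \<longlongrightarrow> V (t + 1) t) (at t within {s..t + 1})"
        by (rule Lim_transform_eventually)
      moreover have "V (t + 1) t = G t (z t) + g t" using ZV[OF T] zZ[OF tt T] tt by auto
      ultimately show "((\<lambda>r. G r (z r) + g r) \<longlongrightarrow> G t (z t) + g t) (at t within {s..})"
        using at_within_Icc_Ici[of t "t + 1" s] by simp
    qed
    from continuous_on_diff[OF this continuous_on_vector_derivative[OF g]]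
    show "continuous_on {s..} (\<lambda>t. G t (z t))" by simp
    fix t assume t: "s \<le> t"
    have T: "t + 1 > s" using t by simp
    have tt: "t \<in> {s..t+1}" using t by simp
    show "z t \<in> D" using ZV[OF T] tt by (simp add: z_def)
    have "(Z (t + 1) has_vector_derivative G t (z t) + g t) (at t within {s..t+1})"
      using der[OF T tt] by (simp add: z_def)
    then have "(z has_vector_derivative G t (z t) + g t) (at t within {s..t+1})"
      by (rule has_vector_derivative_transform[rotated 2]) (use tt zZ T in auto)
    then show "(z has_vector_derivative G t (z t) + g t) (at t within {s..})"
      using at_within_Icc_Ici[of t "t + 1" s] by simp
  qed
  moreover have "z s = z0" using ZV[of "s + 1"] by (simp add: z_def)
  ultimately show ?thesis by (rule that)
qed

section \<open>The evolution family in the variable z\<close>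

definition U\<^sub>0 :: "real \<Rightarrow> 'a \<Rightarrow> real \<Rightarrow> 'a" where
  "U\<^sub>0 s \<zeta> = (SOME z. solution s (\<lambda>_. 0) z \<and> z s = \<zeta>)"

lemma U\<^sub>0:
  assumes "0 \<le> s" "\<zeta> \<in> D"
  shows "solution s (\<lambda>_. 0) (U\<^sub>0 s \<zeta>)" "U\<^sub>0 s \<zeta> s = \<zeta>"
proof -
  have "((\<lambda>_. 0) has_vector_derivative (0::'a)) (at t within {s..})" for t by simp
  then obtain z where "solution s (\<lambda>_. 0) z \<and> z s = \<zeta>"
    using solution_ex[OF assms, of "\<lambda>_. 0" "\<lambda>_. 0"] by auto
  then have "solution s (\<lambda>_. 0) (U\<^sub>0 s \<zeta>) \<and> U\<^sub>0 s \<zeta> s = \<zeta>" unfolding U\<^sub>0_def by (rule someI[where P = "\<lambda>z. solution s (\<lambda>_. 0) z \<and> z s = \<zeta>"])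
  then show "solution s (\<lambda>_. 0) (U\<^sub>0 s \<zeta>)" "U\<^sub>0 s \<zeta> s = \<zeta>" by auto
qed

lemma solution_zero_add:
  assumes "0 \<le> s" "solution s (\<lambda>_. 0) y" "solution s (\<lambda>_. 0) z"
  shows "solution s (\<lambda>_. 0) (\<lambda>t. y t + z t)"
proof -
  have G: "G t (y t + z t) = G t (y t) + G t (z t)" if "t \<ge> s" for t
    using assms that by (intro G_add) (auto simp: solution_def)
  have "continuous_on {s..} (\<lambda>t. G t (y t + z t))"
    by (rule continuous_on_cong[THEN iffD2, OF refl G, OF _ continuous_on_add])
      (use assms in \<open>auto simp: solution_def\<close>)
  moreover have "((\<lambda>t. y t + z t) has_vector_derivative G t (y t + z t)) (at t within {s..})" if "t \<ge> s" for t
    unfolding G[OF that] using assms that by (intro has_vector_derivative_add) (auto simp: solution_def)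
  ultimately show ?thesis using assms D_add by (auto simp: solution_def)
qed

lemma solution_zero_scale:
  assumes "0 \<le> s" "solution s (\<lambda>_. 0) y"
  shows "solution s (\<lambda>_. 0) (\<lambda>t. c *\<^sub>R y t)"
proof -
  have G: "G t (c *\<^sub>R y t) = c *\<^sub>R G t (y t)" if "t \<ge> s" for t
    using assms that by (intro G_scale) (auto simp: solution_def)
  have "continuous_on {s..} (\<lambda>t. G t (c *\<^sub>R y t))"
    by (rule continuous_on_cong[THEN iffD2, OF refl G, OF _ continuous_on_scaleR[OF continuous_on_const]])
      (use assms in \<open>auto simp: solution_def\<close>)
  moreover have "((\<lambda>t. c *\<^sub>R y t) has_vector_derivative G t (c *\<^sub>R y t)) (at t within {s..})" if "t \<ge> s" for t
    unfolding G[OF that]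
    by (rule bounded_linear.has_vector_derivative[OF bounded_linear_scaleR_right])
      (use assms that in \<open>auto simp: solution_def\<close>)
  ultimately show ?thesis using assms D_scale by (auto simp: solution_def)
qed

lemma U\<^sub>0_add: "0 \<le> s \<Longrightarrow> s \<le> t \<Longrightarrow> x \<in> D \<Longrightarrow> y \<in> D \<Longrightarrow> U\<^sub>0 s (x + y) t = U\<^sub>0 s x t + U\<^sub>0 s y t"
  by (rule solution_unique[OF _ _ U\<^sub>0(1) solution_zero_add]) (simp_all add: U\<^sub>0 D_add)

lemma U\<^sub>0_scale: "0 \<le> s \<Longrightarrow> s \<le> t \<Longrightarrow> x \<in> D \<Longrightarrow> U\<^sub>0 s (c *\<^sub>R x) t = c *\<^sub>R U\<^sub>0 s x t"
  by (rule solution_unique[OF _ _ U\<^sub>0(1) solution_zero_scale]) (simp_all add: U\<^sub>0 D_scale)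

lemma U\<^sub>0_bound:
  obtains C where "C \<ge> 1" "\<And>s t x. 0 \<le> s \<Longrightarrow> s \<le> t \<Longrightarrow> t \<le> T \<Longrightarrow> x \<in> D \<Longrightarrow> norm (U\<^sub>0 s x t) \<le> C * norm x"
proof -
  obtain C where C: "C \<ge> 1" "\<And>s b z z' c. 0 \<le> s \<Longrightarrow> s \<le> b \<Longrightarrow> b \<le> T \<Longrightarrow> continuous_on {s..b} z \<Longrightarrow>
      (\<And>t. s < t \<Longrightarrow> t < b \<Longrightarrow> z t \<in> D \<and> (z has_vector_derivative z' t) (at t) \<and>
         norm (z' t - G t (z t)) \<le> c) \<Longrightarrow> c \<ge> 0 \<Longrightarrow>
      norm (z b) \<le> C * (norm (z s) + (b - s) * c)" by (rule stability) blast
  have "norm (U\<^sub>0 s x t) \<le> C * norm x" if "0 \<le> s" "s \<le> t" "t \<le> T" "x \<in> D" for s t x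
  proof -
    note u = U\<^sub>0[OF that(1,4)]
    have "norm (U\<^sub>0 s x t) \<le> C * (norm (U\<^sub>0 s x s) + (t - s) * 0)"
      by (rule C(2)[of s t _ "\<lambda>t. G t (U\<^sub>0 s x t)"])
        (use that solution_at[OF u(1)] in \<open>auto intro: continuous_on_subset[OF solution_cont[OF u(1)]]\<close>)
    then show ?thesis using u(2) by simp
  qed
  then show ?thesis using that C(1) by blast
qed

text \<open>
  \<open>U\<^sub>0\<close> is extended from \<open>D\<close> by continuity along the resolvents at time \<open>0\<close>: they are linear, so that
  linearity is preserved.
\<close>

definition mollify :: "nat \<Rightarrow> 'a \<Rightarrow> 'a" where "mollify n = resolvent D (A 0) (inverse (real (Suc n)))"

lemma mollify_in: "mollify n x \<in> D"
  unfolding mollify_def by (rule max_dissipative.R_in[OF A_md]) auto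

lemma bounded_linear_mollify: "bounded_linear (mollify n)"
  unfolding mollify_def by (rule max_dissipative.bounded_linear_R[OF A_md]) auto

lemma mollify_tendsto: "(\<lambda>n. mollify n x) \<longlonglongrightarrow> x"
proof -
  show ?thesis
  proof (rule LIMSEQ_I)
    fix e :: real assume e: "e > 0"
    obtain y where y: "y \<in> D" "dist y x < e / 4"
      using dense_D e by (metis UNIV_I closure_approachable zero_less_divide_iff zero_less_numeral)
    have "(\<lambda>n. inverse (real (Suc n)) * norm (A 0 y)) \<longlonglongrightarrow> 0 * norm (A 0 y)"
      by (intro tendsto_intros LIMSEQ_inverse_real_of_nat)
    then have "\<forall>\<^sub>F n in sequentially. inverse (real (Suc n)) * norm (A 0 y) < e / 4"
      using e by (intro order_tendstoD(2)) auto
    then obtain n0 where n0: "\<And>n. n \<ge> n0 \<Longrightarrow> inverse (real (Suc n)) * norm (A 0 y) < e / 4"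
      unfolding eventually_sequentially by blast
    show "\<exists>n0. \<forall>n\<ge>n0. norm (mollify n x - x) < e"
    proof (intro exI[of _ n0] allI impI)
      fix n assume n: "n \<ge> n0"
      interpret bounded_linear "mollify n" by (rule bounded_linear_mollify)
      have "norm (mollify n (x - y)) \<le> norm (x - y)"
        unfolding mollify_def by (rule max_dissipative.norm_R_le[OF A_md]) auto
      moreover have "norm (mollify n y - y) \<le> inverse (real (Suc n)) * norm (A 0 y)"
        unfolding mollify_def by (rule max_dissipative.norm_R_diff_le[OF A_md]) (use y in auto)
      moreover have "mollify n x - x = mollify n (x - y) + (mollify n y - y) + (y - x)" by (simp add: diff)
      ultimately show "norm (mollify n x - x) < e"
        using n0[OF n] y e norm_triangle_ineq[of "mollify n (x - y) + (mollify n y - y)" "y - x"]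
          norm_triangle_ineq[of "mollify n (x - y)" "mollify n y - y"]
        by (simp add: dist_norm norm_minus_commute)
    qed
  qed
qed

definition U :: "real \<Rightarrow> real \<Rightarrow> 'a \<Rightarrow> 'a" where
  "U t s x = lim (\<lambda>n. U\<^sub>0 s (mollify n x) t)"

lemma U_lim:
  assumes "0 \<le> s" "s \<le> t"
  shows "(\<lambda>n. U\<^sub>0 s (mollify n x) t) \<longlonglongrightarrow> U t s x"
proof -
  obtain C where C: "C \<ge> 1" "\<And>s t' x. 0 \<le> s \<Longrightarrow> s \<le> t' \<Longrightarrow> t' \<le> t \<Longrightarrow> x \<in> D \<Longrightarrow> norm (U\<^sub>0 s x t') \<le> C * norm x"
    using U\<^sub>0_bound[of t] by metis
  have "Cauchy (\<lambda>n. mollify n x)" by (rule LIMSEQ_imp_Cauchy[OF mollify_tendsto])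
  have "Cauchy (\<lambda>n. U\<^sub>0 s (mollify n x) t)"
  proof (rule CauchyI)
    fix e :: real assume e: "e > 0"
    then have "e / C > 0" using C by simp
    from CauchyD[OF \<open>Cauchy (\<lambda>n. mollify n x)\<close> this]
    obtain M where M: "\<And>m n. m \<ge> M \<Longrightarrow> n \<ge> M \<Longrightarrow> norm (mollify m x - mollify n x) < e / C" by blast
    show "\<exists>M. \<forall>m\<ge>M. \<forall>n\<ge>M. norm (U\<^sub>0 s (mollify m x) t - U\<^sub>0 s (mollify n x) t) < e"
    proof (intro exI[of _ M] allI impI)
      fix m n assume "m \<ge> M" "n \<ge> M"
      have "U\<^sub>0 s (mollify m x) t - U\<^sub>0 s (mollify n x) t = U\<^sub>0 s (mollify m x - mollify n x) t"
        using U\<^sub>0_add[OF assms mollify_in[of m x] D_scale[OF mollify_in[of n x], of "-1"]] U\<^sub>0_scale[OF assms mollify_in[of n x], of "-1"]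
        by simp
      also have "norm \<dots> \<le> C * norm (mollify m x - mollify n x)"
        using assms by (intro C(2) D_diff mollify_in) auto
      also have "\<dots> < C * (e / C)" using M[OF \<open>m \<ge> M\<close> \<open>n \<ge> M\<close>] C(1) by (intro mult_strict_left_mono) auto
      finally show "norm (U\<^sub>0 s (mollify m x) t - U\<^sub>0 s (mollify n x) t) < e" using C by simp
    qed
  qed
  then show ?thesis unfolding U_def using Cauchy_convergent_iff convergent_LIMSEQ_iff by blast
qed

lemma U_bound:
  obtains C where "C \<ge> 1" "\<And>s t x. 0 \<le> s \<Longrightarrow> s \<le> t \<Longrightarrow> t \<le> T \<Longrightarrow> norm (U t s x) \<le> C * norm x"
proof -
  obtain C where C: "C \<ge> 1" "\<And>s t x. 0 \<le> s \<Longrightarrow> s \<le> t \<Longrightarrow> t \<le> T \<Longrightarrow> x \<in> D \<Longrightarrow> norm (U\<^sub>0 s x t) \<le> C * norm x"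
    using U\<^sub>0_bound[of T] by metis
  have "norm (U t s x) \<le> C * norm x" if "0 \<le> s" "s \<le> t" "t \<le> T" for s t x
  proof (rule LIMSEQ_le)
    show "(\<lambda>n. norm (U\<^sub>0 s (mollify n x) t)) \<longlonglongrightarrow> norm (U t s x)" by (intro tendsto_norm U_lim that)
    show "(\<lambda>n. C * norm (mollify n x)) \<longlonglongrightarrow> C * norm x" by (intro tendsto_intros mollify_tendsto)
  qed (use C(2)[OF that mollify_in] in auto)
  then show ?thesis using that C(1) by blast
qed

lemma bounded_linear_U:
  assumes st: "0 \<le> s" "s \<le> t" shows "bounded_linear (U t s)"
proof -
  obtain C where C: "\<And>s t' x. 0 \<le> s \<Longrightarrow> s \<le> t' \<Longrightarrow> t' \<le> t \<Longrightarrow> norm (U t' s x) \<le> C * norm x"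
    using U_bound[of t] by metis
  show ?thesis
  proof (rule bounded_linear_intro[of _ C])
    fix x y :: 'a and r :: real
    have "(\<lambda>n. U\<^sub>0 s (mollify n (x + y)) t) \<longlonglongrightarrow> U t s x + U t s y"
      using tendsto_add[OF U_lim[OF st] U_lim[OF st]] U\<^sub>0_add[OF st mollify_in mollify_in]
        linear_add[OF bounded_linear.axioms(1)[OF bounded_linear_mollify]] by simp
    then show "U t s (x + y) = U t s x + U t s y" using U_lim[OF st] LIMSEQ_unique by blast
    have "(\<lambda>n. U\<^sub>0 s (mollify n (r *\<^sub>R x)) t) \<longlonglongrightarrow> r *\<^sub>R U t s x"
      using tendsto_scaleR[OF tendsto_const U_lim[OF st]] U\<^sub>0_scale[OF st mollify_in]
        linear_scale[OF bounded_linear.axioms(1)[OF bounded_linear_mollify]] by simp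
    then show "U t s (r *\<^sub>R x) = r *\<^sub>R U t s x" using U_lim[OF st] LIMSEQ_unique by blast
    show "norm (U t s x) \<le> norm x * C" using C[OF st] by (simp add: mult.commute)
  qed
qed

lemma U_eq_U\<^sub>0:
  assumes st: "0 \<le> s" "s \<le> t" and x: "x \<in> D" shows "U t s x = U\<^sub>0 s x t"
proof -
  obtain C where C: "C \<ge> 1" "\<And>s t' x. 0 \<le> s \<Longrightarrow> s \<le> t' \<Longrightarrow> t' \<le> t \<Longrightarrow> x \<in> D \<Longrightarrow> norm (U\<^sub>0 s x t') \<le> C * norm x"
    using U\<^sub>0_bound[of t] by metis
  have "(\<lambda>n. U\<^sub>0 s (mollify n x) t - U\<^sub>0 s x t) \<longlonglongrightarrow> 0"
  proof (rule Lim_null_comparison)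
    have "norm (U\<^sub>0 s (mollify n x) t - U\<^sub>0 s x t) \<le> C * norm (mollify n x - x)" for n
    proof -
      have "U\<^sub>0 s (mollify n x) t - U\<^sub>0 s x t = U\<^sub>0 s (mollify n x - x) t"
        using U\<^sub>0_add[OF st mollify_in[of n x] D_scale[OF x, of "-1"]] U\<^sub>0_scale[OF st x, of "-1"] by simp
      then show ?thesis using C(2)[OF st order_refl D_diff[OF mollify_in x]] by simp
    qed
    then show "\<forall>\<^sub>F n in sequentially. norm (U\<^sub>0 s (mollify n x) t - U\<^sub>0 s x t) \<le> C * norm (mollify n x - x)" by simp
    show "(\<lambda>n. C * norm (mollify n x - x)) \<longlonglongrightarrow> 0"
      by (intro tendsto_mult_right_zero tendsto_norm_zero LIM_zero mollify_tendsto)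
  qed
  from LIM_zero_cancel[OF this] show ?thesis using U_lim[OF st] LIMSEQ_unique by blast
qed

lemma U_solution:
  assumes "0 \<le> s" "x \<in> D" shows "solution s (\<lambda>_. 0) (\<lambda>t. U t s x)"
proof -
  have eq: "U t s x = U\<^sub>0 s x t" if "t \<in> {s..}" for t using U_eq_U\<^sub>0[OF assms(1) _ assms(2)] that by simp
  have "((\<lambda>t. U t s x) has_vector_derivative d) (at t within {s..})"
    if "(U\<^sub>0 s x has_vector_derivative d) (at t within {s..})" "t \<in> {s..}" for d t
    by (rule has_vector_derivative_transform[OF that(2) eq that(1)])
  moreover have "continuous_on {s..} (\<lambda>t. G t (U t s x))"
    by (rule continuous_on_cong[THEN iffD2, of _ _ _ "\<lambda>t. G t (U\<^sub>0 s x t)"]) (use eq U\<^sub>0(1)[OF assms] in \<open>auto simp: solution_def\<close>)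
  ultimately show ?thesis using U\<^sub>0(1)[OF assms] eq by (auto simp: solution_def)
qed

lemma U_self: "0 \<le> s \<Longrightarrow> U s s x = x"
  by (rule bounded_linear_eq_dense[where f = "U s s" and g = "\<lambda>x. x", OF _ _ dense_D])
    (simp_all add: bounded_linear_U bounded_linear_ident U_eq_U\<^sub>0 U\<^sub>0)

lemma U_unique:
  assumes "0 \<le> s" "s \<le> t" "solution s (\<lambda>_. 0) z" shows "U t s (z s) = z t"
proof -
  have "z s \<in> D" using assms(3) by (simp add: solution_def)
  then show ?thesis
    using solution_unique[OF assms(1,2) U_solution[OF assms(1)] assms(3)] U_self[OF assms(1)] by simp
qed

lemma U_comp:
  assumes "0 \<le> s" "s \<le> r" "r \<le> t" shows "U t s x = U t r (U r s x)"
proof (rule bounded_linear_eq_dense[where f = "U t s" and g = "\<lambda>x. U t r (U r s x)", OF _ _ dense_D])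
  fix x assume x: "x \<in> D"
  have "solution r (\<lambda>_. 0) (\<lambda>t. U t s x)"
    unfolding solution_def
  proof (intro conjI allI impI)
    note u = U_solution[OF assms(1) x, unfolded solution_def]
    show "continuous_on {r..} (\<lambda>t. G t (U t s x))"
      by (rule continuous_on_subset[OF conjunct1[OF u]]) (use assms in auto)
    fix t assume t: "r \<le> t"
    then have st: "s \<le> t" using assms by simp
    show "U t s x \<in> D" using u st by blast
    show "((\<lambda>t. U t s x) has_vector_derivative G t (U t s x) + 0) (at t within {r..})"
      by (rule has_vector_derivative_within_subset[of _ _ _ "{s..}"]) (use u st assms in auto)
  qed
  from U_unique[OF _ assms(3) this] show "U t s x = U t r (U r s x)" using assms by simp
qed (use assms in \<open>auto intro!: bounded_linear_U bounded_linear_compose[of "U t r" "U r s"]\<close>)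

lemma U_in_D: "0 \<le> s \<Longrightarrow> s \<le> t \<Longrightarrow> x \<in> D \<Longrightarrow> U t s x \<in> D"
  using U_solution unfolding solution_def by blast

text \<open>\<open>U t s x - x\<close> has initial value zero and solves the equation with source
  \<open>G t x\<close>; the stability bound is then linear in t - s and uniform in s.\<close>

lemma U_short:
  assumes x: "x \<in> D"
  obtains c where "c \<ge> 0" "\<And>s t. 0 \<le> s \<Longrightarrow> s \<le> t \<Longrightarrow> t \<le> T \<Longrightarrow> norm (U t s x - x) \<le> c * (t - s)"
proof -
  obtain C where C: "C \<ge> 1" "\<And>s b z z' c. 0 \<le> s \<Longrightarrow> s \<le> b \<Longrightarrow> b \<le> T \<Longrightarrow> continuous_on {s..b} z \<Longrightarrow>
      (\<And>t. s < t \<Longrightarrow> t < b \<Longrightarrow> z t \<in> D \<and> (z has_vector_derivative z' t) (at t) \<and>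
         norm (z' t - G t (z t)) \<le> c) \<Longrightarrow> c \<ge> 0 \<Longrightarrow>
      norm (z b) \<le> C * (norm (z s) + (b - s) * c)" by (rule stability) blast
  have "bounded ((\<lambda>t. G t x) ` {0..T})"
    by (intro compact_imp_bounded compact_continuous_image continuous_on_subset[OF G_cont[OF x]]) auto
  then obtain c where c: "c > 0" "\<And>t. t \<in> {0..T} \<Longrightarrow> norm (G t x) \<le> c" unfolding bounded_pos by blast
  have "norm (U t s x - x) \<le> (C * c) * (t - s)" if "0 \<le> s" "s \<le> t" "t \<le> T" for s t
  proof -
    note u = U_solution[OF that(1) x]
    have "norm (U t s x - x) \<le> C * (norm (U s s x - x) + (t - s) * c)"
    proof (rule C(2)[of s t "\<lambda>t. U t s x - x" "\<lambda>t. G t (U t s x)"])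
      show "continuous_on {s..t} (\<lambda>t. U t s x - x)"
        by (intro continuous_intros continuous_on_subset[OF solution_cont[OF u]]) auto
      fix r assume r: "s < r" "r < t"
      have "((\<lambda>t. U t s x - x) has_vector_derivative G r (U r s x) - 0) (at r)"
        using solution_at[OF u r(1)] by (intro has_vector_derivative_diff) auto
      moreover have "G r (U r s x) - G r (U r s x - x) = G r x"
        using G_diff[of r "U r s x" x] U_in_D[of s r x] x that r by simp
      ultimately show "U r s x - x \<in> D \<and> ((\<lambda>t. U t s x - x) has_vector_derivative G r (U r s x)) (at r) \<and>
         norm (G r (U r s x) - G r (U r s x - x)) \<le> c"
        using c(2)[of r] that r D_diff U_in_D x by simp
    qed (use that c in auto)
    then show ?thesis using U_self[OF that(1)] by (simp add: algebra_simps)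
  qed
  moreover have "C * c \<ge> 0" using C c by simp
  ultimately show ?thesis using that by blast
qed

text \<open>Local bounds reduce the claim to x in \<open>D\<close>. There the dependence on the
  initial time is Lipschitz, uniformly in t, because U t s x - U t s' x = U t s' (U s' s x - x);
  joint continuity then follows from continuity in t at fixed s.\<close>

lemma U_cont: "strongly_cont {(t, s). 0 \<le> s \<and> s \<le> t} (\<lambda>(t, s). U t s)"
proof (rule strongly_cont_dense[OF _ _ dense_D])
  fix p assume "p \<in> {(t, s). 0 \<le> s \<and> s \<le> (t::real)}"
  then show "bounded_linear (case p of (t, s) \<Rightarrow> U t s)" by (auto intro: bounded_linear_U)
next
  fix p :: "real \<times> real" assume p: "p \<in> {(t, s). 0 \<le> s \<and> s \<le> t}"
  obtain C where C: "\<And>s t x. 0 \<le> s \<Longrightarrow> s \<le> t \<Longrightarrow> t \<le> fst p + 1 \<Longrightarrow> norm (U t s x) \<le> C * norm x"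
    using U_bound[of "fst p + 1"] by metis
  have "\<forall>\<^sub>F q in at p within {(t, s). 0 \<le> s \<and> s \<le> t}. fst q < fst p + 1"
    by (rule order_tendstoD(2)[of fst "fst p"]) (auto intro!: tendsto_intros)
  moreover have "\<forall>\<^sub>F q in at p within {(t, s). 0 \<le> s \<and> s \<le> t}. q \<in> {(t, s). 0 \<le> s \<and> s \<le> t}"
    by (simp add: eventually_at_filter)
  ultimately have "\<forall>\<^sub>F q in at p within {(t, s). 0 \<le> s \<and> s \<le> t}. \<forall>x. norm ((case q of (t, s) \<Rightarrow> U t s) x) \<le> C * norm x"
    by eventually_elim (use C in auto)
  then show "\<exists>c. \<forall>\<^sub>F q in at p within {(t, s). 0 \<le> s \<and> s \<le> t}. \<forall>x. norm ((case q of (t, s) \<Rightarrow> U t s) x) \<le> c * norm x" ..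
next
  fix x assume x: "x \<in> D"
  show "continuous_on {(t, s). 0 \<le> s \<and> s \<le> t} (\<lambda>p. (case p of (t, s) \<Rightarrow> U t s) x)"
    unfolding continuous_on_def
  proof
    fix p assume p: "p \<in> {(t, s). 0 \<le> s \<and> s \<le> (t::real)}"
    obtain t0 s0 where p_eq: "p = (t0, s0)" by force
    then have ts: "0 \<le> s0" "s0 \<le> t0" using p by auto
    let ?F = "at p within {(t, s). 0 \<le> s \<and> s \<le> (t::real)}"
    obtain c where c: "c \<ge> 0" "\<And>s t. 0 \<le> s \<Longrightarrow> s \<le> t \<Longrightarrow> t \<le> t0 + 1 \<Longrightarrow> norm (U t s x - x) \<le> c * (t - s)"
      using U_short[OF x, of "t0 + 1"] by metis
    obtain C where C: "C \<ge> 1" "\<And>s t x. 0 \<le> s \<Longrightarrow> s \<le> t \<Longrightarrow> t \<le> t0 + 1 \<Longrightarrow> norm (U t s x) \<le> C * norm x"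
      using U_bound[of "t0 + 1"] by metis
    have cC: "c * a \<le> C * c * a" if "a \<ge> 0" for a using that c C by (simp add: mult_right_mono mult_le_cancel_right1)
    \<comment> \<open>Extended by the value x to t < s, so that the two times can be varied
      independently of each other.\<close>
    define f where "f s t = U (max t s) s x" for s t
    have lip: "norm (f s t - f s' t) \<le> C * c * (s' - s)" if "0 \<le> s" "s \<le> s'" "s' \<le> t0 + 1" "t \<le> t0 + 1" for s s' t
    proof (cases "s' \<le> t")
      case True
      interpret bounded_linear "U t s'" by (rule bounded_linear_U) (use that True in auto)
      have "f s t - f s' t = U t s' (U s' s x - x)"
        using U_comp[of s s' t x] that True by (simp add: f_def diff max_absorb1)
      also have "norm \<dots> \<le> C * norm (U s' s x - x)" using that True by (intro C(2)) auto
      also have "\<dots> \<le> C * (c * (s' - s))" using C(1) c(2)[of s s'] that by (intro mult_left_mono) auto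
      finally show ?thesis by simp
    next
      case False
      have "f s t - f s' t = U (max t s) s x - x" using False that by (simp add: f_def U_self)
      also have "norm \<dots> \<le> c * (max t s - s)" using that by (intro c(2)) auto
      also have "\<dots> \<le> c * (s' - s)" using c(1) False that by (intro mult_left_mono) auto
      also have "\<dots> \<le> C * c * (s' - s)" using cC that by simp
      finally show ?thesis .
    qed
    have lip': "norm (f s t - f s' t) \<le> C * c * \<bar>s' - s\<bar>" if "0 \<le> s" "0 \<le> s'" "s \<le> t0 + 1" "s' \<le> t0 + 1" "t \<le> t0 + 1" for s s' t
      using lip[of s s' t] lip[of s' s t] that by (cases "s \<le> s'") (auto simp: norm_minus_commute)
    have "continuous_on UNIV (\<lambda>t. f s0 t)"
      unfolding f_def by (rule continuous_on_compose2[OF solution_cont[OF U_solution[OF ts(1) x]]])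
        (auto intro!: continuous_intros)
    then have fc: "((\<lambda>q. f s0 (fst q)) \<longlongrightarrow> f s0 t0) ?F"
      using p_eq by (intro isCont_tendsto_compose[of _ "f s0"]) (auto simp: continuous_on_eq_continuous_at intro!: tendsto_eq_intros)
    have "((\<lambda>q. (case q of (t, s) \<Rightarrow> U t s) x - U t0 s0 x) \<longlongrightarrow> 0) ?F"
    proof (rule Lim_null_comparison)
      have "\<forall>\<^sub>F q in ?F. fst q < t0 + 1"
        by (rule order_tendstoD(2)[of fst t0]) (use p_eq in \<open>auto intro!: tendsto_eq_intros\<close>)
      moreover have "\<forall>\<^sub>F q in ?F. q \<in> {(t, s). 0 \<le> s \<and> s \<le> t}" by (simp add: eventually_at_filter)
      ultimately show "\<forall>\<^sub>F q in ?F. norm ((case q of (t, s) \<Rightarrow> U t s) x - U t0 s0 x)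
          \<le> C * c * \<bar>s0 - snd q\<bar> + norm (f s0 (fst q) - f s0 t0)"
      proof eventually_elim
        case (elim q)
        obtain t s where q: "q = (t, s)" by force
        have "U t s x - U t0 s0 x = (f s t - f s0 t) + (f s0 t - f s0 t0)"
          using elim q ts by (simp add: f_def max_absorb1)
        also have "norm \<dots> \<le> C * c * \<bar>s0 - s\<bar> + norm (f s0 t - f s0 t0)"
          using lip'[of s s0 t] elim q ts by (intro norm_triangle_le add_right_mono) auto
        finally show ?case using q by simp
      qed
      have "((\<lambda>q. C * c * \<bar>s0 - snd q\<bar> + norm (f s0 (fst q) - f s0 t0)) \<longlongrightarrow> C * c * \<bar>s0 - s0\<bar> + norm (f s0 t0 - f s0 t0)) ?F"
        by (intro tendsto_intros fc) (use p_eq in \<open>auto intro!: tendsto_eq_intros\<close>)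
      then show "((\<lambda>q. C * c * \<bar>s0 - snd q\<bar> + norm (f s0 (fst q) - f s0 t0)) \<longlongrightarrow> 0) ?F" by simp
    qed
    from LIM_zero_cancel[OF this] show "((\<lambda>p. (case p of (t, s) \<Rightarrow> U t s) x) \<longlongrightarrow> (case p of (t, s) \<Rightarrow> U t s) x) ?F"
      using p_eq by simp
  qed
qed

text \<open>
  Comparing \<open>U(\<cdot>, a) x\<close> with \<open>\<sigma> \<mapsto> x + (\<sigma> - a) \<eta>\<close>, \<open>\<eta> \<in> D\<close> close to \<open>G r x\<close>, gives the derivative
  at \<open>r\<close> uniformly in the initial time \<open>a\<close>, as needed for the derivative with respect to that time.
\<close>

lemma U_derivative_uniform:
  assumes x: "x \<in> D" and r: "r \<ge> 0" and e: "e > 0"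
  obtains d where "d > 0" "\<And>a b. 0 \<le> a \<Longrightarrow> a \<le> b \<Longrightarrow> r - d < a \<Longrightarrow> b < r + d \<Longrightarrow>
    norm (U b a x - x - (b - a) *\<^sub>R G r x) \<le> e * (b - a)"
proof -
  obtain C where C: "C \<ge> 1" "\<And>s b z z' c. 0 \<le> s \<Longrightarrow> s \<le> b \<Longrightarrow> b \<le> r + 1 \<Longrightarrow> continuous_on {s..b} z \<Longrightarrow>
      (\<And>t. s < t \<Longrightarrow> t < b \<Longrightarrow> z t \<in> D \<and> (z has_vector_derivative z' t) (at t) \<and>
         norm (z' t - G t (z t)) \<le> c) \<Longrightarrow> c \<ge> 0 \<Longrightarrow>
      norm (z b) \<le> C * (norm (z s) + (b - s) * c)" by (rule stability) blast
  \<comment> \<open>The defect will be at most \<open>3 * e1\<close>, which stability turns into 3/4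
    of e; replacing y by \<open>G r x\<close> costs the remaining quarter.\<close>
  define e1 where "e1 = e / (4 * C)"
  have e1: "e1 > 0" using e C by (simp add: e1_def)
  obtain y where y: "y \<in> D" "dist y (G r x) < e1"
    using dense_D e1 by (metis UNIV_I closure_approachable)
  have "bounded ((\<lambda>t. G t y) ` {0..r + 1})"
    by (intro compact_imp_bounded compact_continuous_image continuous_on_subset[OF G_cont[OF y(1)]]) auto
  then obtain c where c: "c > 0" "\<And>t. t \<in> {0..r + 1} \<Longrightarrow> norm (G t y) \<le> c" unfolding bounded_pos by blast
  obtain d0 where d0: "d0 > 0" "\<And>t. t \<ge> 0 \<Longrightarrow> dist t r < d0 \<Longrightarrow> dist (G t x) (G r x) < e1"
    using G_cont[OF x] r e1 unfolding continuous_on_iff by (metis atLeast_iff)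
  \<comment> \<open>In turn: continuity of \<open>G t x\<close> near r, the range r + 1 of the
    stability bound, and smallness of \<open>(t - a) *\<^sub>R G t y\<close>, where t - a < 2
    d.\<close>
  define d where "d = min (min d0 1) (e1 / (2 * c))"
  have d: "d > 0" "d \<le> d0" "d \<le> 1" "2 * d * c \<le> e1"
  proof -
    show "d > 0" "d \<le> d0" "d \<le> 1" using d0 e1 c by (auto simp: d_def)
    have "d \<le> e1 / (2 * c)" by (simp add: d_def)
    then show "2 * d * c \<le> e1" using c by (simp add: field_simps)
  qed
  have "norm (U b a x - x - (b - a) *\<^sub>R G r x) \<le> e * (b - a)"
    if ab: "0 \<le> a" "a \<le> b" "r - d < a" "b < r + d" for a b
  proof -
    note u = U_solution[OF ab(1) x]
    let ?z = "\<lambda>t. U t a x - (x + (t - a) *\<^sub>R y)"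
    have "norm (?z b) \<le> C * (norm (?z a) + (b - a) * (3 * e1))"
    proof (rule C(2)[of a b ?z "\<lambda>t. G t (U t a x) - y"])
      show "continuous_on {a..b} ?z"
        by (intro continuous_intros continuous_on_subset[OF solution_cont[OF u]]) auto
      fix t assume t: "a < t" "t < b"
      have t0: "t \<ge> 0" using ab t by simp
      have "((\<lambda>t. x + (t - a) *\<^sub>R y) has_vector_derivative y) (at t)"
        by (auto intro!: derivative_eq_intros)
      then have dz: "(?z has_vector_derivative G t (U t a x) - y) (at t)"
        using solution_at[OF u t(1)] by (intro has_vector_derivative_diff) auto
      have ty: "(t - a) *\<^sub>R y \<in> D" by (rule D_scale[OF y(1)])
      have UD: "U t a x \<in> D" using U_in_D[of a t x] x ab t by simp
      have "G t (?z t) = G t (U t a x) - (G t x + (t - a) *\<^sub>R G t y)"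
        unfolding G_diff[OF t0 UD D_add[OF x ty]] G_add[OF t0 x ty] G_scale[OF t0 y(1)] ..
      then have "G t (U t a x) - y - G t (?z t) = (G t x - G r x) + (G r x - y) + (t - a) *\<^sub>R G t y"
        by simp
      also have "norm \<dots> \<le> e1 + e1 + e1"
      proof (intro norm_triangle_le add_mono)
        show "norm (G t x - G r x) \<le> e1" using d0(2)[OF t0] ab t d unfolding dist_norm dist_real_def by (simp add: abs_less_iff less_imp_le)
        show "norm (G r x - y) \<le> e1" using y(2) by (simp add: dist_norm norm_minus_commute)
        have "\<bar>t - a\<bar> * norm (G t y) \<le> (2 * d) * c"
          using ab t d c(2)[of t] by (intro mult_mono) auto
        then show "norm ((t - a) *\<^sub>R G t y) \<le> e1" using d by simp
      qed
      finally show "?z t \<in> D \<and> (?z has_vector_derivative G t (U t a x) - y) (at t) \<and>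
         norm (G t (U t a x) - y - G t (?z t)) \<le> 3 * e1"
        using dz D_diff[OF UD D_add[OF x ty]] by simp
    qed (use ab d e1 in auto)
    then have "norm (?z b) \<le> C * ((b - a) * (3 * e1))" using U_self[OF ab(1)] by simp
    also have "\<dots> = (3 * e / 4) * (b - a)" using C by (simp add: e1_def)
    finally have 1: "norm (?z b) \<le> (3 * e / 4) * (b - a)" .
    have "norm ((b - a) *\<^sub>R (y - G r x)) \<le> (b - a) * e1"
      using y(2) ab by (simp add: dist_norm mult_left_mono)
    also have "\<dots> \<le> (b - a) * (e / 4)" 
    proof (rule mult_left_mono)
      show "e1 \<le> e / 4" unfolding e1_def using C(1) e by (intro frac_le) auto
    qed (use ab in simp)
    finally have 2: "norm ((b - a) *\<^sub>R (y - G r x)) \<le> (b - a) * (e / 4)" .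
    have "U b a x - x - (b - a) *\<^sub>R G r x = ?z b + (b - a) *\<^sub>R (y - G r x)" by (simp add: algebra_simps)
    also have "norm \<dots> \<le> (3 * e / 4) * (b - a) + (b - a) * (e / 4)"
      by (intro norm_triangle_le add_mono 1 2)
    also have "\<dots> = e * (b - a)" by (simp add: field_simps)
    finally show ?thesis .
  qed
  then show ?thesis using that d(1) by blast
qed

lemma U_initial_cont: "strongly_cont {0..t} (U t)"
  unfolding strongly_cont_def
proof (intro conjI ballI allI)
  show "bounded_linear (U t s)" if "s \<in> {0..t}" for s using that by (auto intro: bounded_linear_U)
  show "continuous_on {0..t} (\<lambda>s. U t s x)" for x
  proof -
    have "continuous_on {0..t} (\<lambda>s. (case (t, s) of (t, s) \<Rightarrow> U t s) x)"
      by (rule continuous_on_compose2[OF strongly_contD(2)[OF U_cont, of x]]) (auto intro!: continuous_intros)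
    then show ?thesis by simp
  qed
qed

text \<open>In either case the increment is minus or plus the operator from the later time on,
  applied to the short evolution from the earlier time to the later one. For q < r the initial time
  of this short evolution moves, which is why the derivative is needed uniformly in it.\<close>

lemma U_initial_derivative:
  assumes x: "x \<in> D" and r: "r \<in> {0..t}"
  shows "((\<lambda>r. U t r x) has_vector_derivative - U t r (G r x)) (at r within {0..t})"
proof -
  let ?F = "at r within {0..t}"
  \<comment> \<open>Forward quotient over the interval between q and r, whichever comes
    first.\<close>
  define v where "v q = (1 / \<bar>q - r\<bar>) *\<^sub>R (U (max q r) (min q r) x - x)" for q
  have v: "(v \<longlongrightarrow> G r x) ?F"
  proof (rule tendstoI)
    fix e :: real assume e: "e > 0"
    then have "e / 2 > 0" by simp
    then obtain d where d: "d > 0" "\<And>a b. 0 \<le> a \<Longrightarrow> a \<le> b \<Longrightarrow> r - d < a \<Longrightarrow> b < r + d \<Longrightarrow>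
      norm (U b a x - x - (b - a) *\<^sub>R G r x) \<le> e / 2 * (b - a)"
      using U_derivative_uniform[OF x, of r "e / 2"] r by (metis atLeastAtMost_iff)
    show "\<forall>\<^sub>F q in ?F. dist (v q) (G r x) < e"
      unfolding eventually_at
    proof (intro exI[of _ d] conjI ballI impI)
      fix q assume q: "q \<in> {0..t}" "q \<noteq> r \<and> dist q r < d"
      let ?h = "\<bar>q - r\<bar>"
      have h: "?h > 0" "max q r - min q r = ?h" using q by auto
      have "norm (U (max q r) (min q r) x - x - ?h *\<^sub>R G r x) \<le> e / 2 * ?h"
        using d(2)[of "min q r" "max q r"] q r h d(1) by (auto simp: dist_real_def abs_less_iff)
      then have "(1 / ?h) * norm (U (max q r) (min q r) x - x - ?h *\<^sub>R G r x) \<le> e / 2"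
        using h by (simp add: field_simps)
      also have "(1 / ?h) * norm (U (max q r) (min q r) x - x - ?h *\<^sub>R G r x) = norm (v q - G r x)"
      proof -
        have "v q - G r x = (1 / ?h) *\<^sub>R (U (max q r) (min q r) x - x - ?h *\<^sub>R G r x)"
          using h(1) by (simp add: v_def scaleR_diff_right)
        then show ?thesis using h(1) by simp
      qed
      finally show "dist (v q) (G r x) < e" using e by (simp add: dist_norm)
    qed (rule d)
  qed
  have tm: "((\<lambda>q. max q r) \<longlongrightarrow> r) ?F"
    by (rule tendsto_eq_rhs[OF tendsto_max[OF tendsto_ident_at tendsto_const]]) simp
  obtain C where C: "\<And>s t' x. 0 \<le> s \<Longrightarrow> s \<le> t' \<Longrightarrow> t' \<le> t \<Longrightarrow> norm (U t' s x) \<le> C * norm x"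
    using U_bound[of t] by metis
  have "((\<lambda>q. U t (max q r) (v q)) \<longlongrightarrow> U t r (G r x)) ?F"
  proof (rule tendsto_apply_bounded[OF _ v])
    show "\<forall>\<^sub>F q in ?F. bounded_linear (U t (max q r)) \<and> (\<forall>x. norm (U t (max q r) x) \<le> C * norm x)"
      unfolding eventually_at_filter using r C by (intro always_eventually) (auto intro!: bounded_linear_U)
    have "continuous_on {0..t} (\<lambda>q. U t (max q r) (G r x))"
      by (rule continuous_on_compose2[OF strongly_contD(2)[OF U_initial_cont]]) (use r in \<open>auto intro!: continuous_intros\<close>)
    then show "((\<lambda>q. U t (max q r) (G r x)) \<longlongrightarrow> U t r (G r x)) ?F"
      using r unfolding continuous_on_def by fastforce
  qed
  then have "((\<lambda>q. - U t (max q r) (v q)) \<longlongrightarrow> - U t r (G r x)) ?F" by (rule tendsto_minus)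
  moreover have "\<forall>\<^sub>F q in ?F. - U t (max q r) (v q) = (1 / (q - r)) *\<^sub>R (U t q x - U t r x)"
    unfolding eventually_at_filter
  proof (intro always_eventually allI impI)
    fix q assume q: "q \<noteq> r" "q \<in> {0..t}"
    interpret bounded_linear "U t (max q r)" by (rule bounded_linear_U) (use q r in auto)
    have *: "U t (max q r) (v q) = (1 / \<bar>q - r\<bar>) *\<^sub>R (U t (min q r) x - U t (max q r) x)"
      using U_comp[of "min q r" "max q r" t x] q r by (simp add: v_def scaleR diff)
    then show "- U t (max q r) (v q) = (1 / (q - r)) *\<^sub>R (U t q x - U t r x)"
    proof (cases "q < r")
      case True
      then have "1 / \<bar>q - r\<bar> = - (1 / (q - r))" by (simp add: abs_if minus_divide_right)
      with * True show ?thesis by simp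
    next
      case False
      then have "1 / \<bar>q - r\<bar> = 1 / (q - r)" "max q r = q" "min q r = r" using q by auto
      with * show ?thesis by (simp add: scaleR_diff_right)
    qed
  qed
  ultimately show ?thesis
    unfolding has_vector_derivative_iff_quotient by (rule Lim_transform_eventually)
qed

text \<open>The increment is U t p (q p - q r) plus the change of \<open>U t p\<close> on the fixed
  vector \<open>q r\<close>. The second part is the derivative in the initial time, and only there
  membership in \<open>D\<close> is used.\<close>

theorem duhamel:
  assumes S: "r \<in> S" "S \<subseteq> {0..t}" and q: "(q has_vector_derivative q') (at r within S)" and qD: "q r \<in> D"
  shows "((\<lambda>r. U t r (q r)) has_vector_derivative U t r (q' - G r (q r))) (at r within S)"
proof -
  have r: "r \<in> {0..t}" using S by auto
  interpret bounded_linear "U t r" by (rule bounded_linear_U) (use r in auto)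
  obtain C where C: "\<And>s t' x. 0 \<le> s \<Longrightarrow> s \<le> t' \<Longrightarrow> t' \<le> t \<Longrightarrow> norm (U t' s x) \<le> C * norm x"
    using U_bound[of t] by metis
  have ev: "\<forall>\<^sub>F p in at r within S. p \<in> {0..t}"
    unfolding eventually_at_filter using S by (intro always_eventually) auto
  have "((\<lambda>p. U t p ((1 / (p - r)) *\<^sub>R (q p - q r))) \<longlongrightarrow> U t r q') (at r within S)"
  proof (rule tendsto_apply_bounded[where T = "U t" and c = C])
    show "\<forall>\<^sub>F p in at r within S. bounded_linear (U t p) \<and> (\<forall>x. norm (U t p x) \<le> C * norm x)"
      using ev by eventually_elim (use C in \<open>auto intro!: bounded_linear_U\<close>)
    show "((\<lambda>p. (1 / (p - r)) *\<^sub>R (q p - q r)) \<longlongrightarrow> q') (at r within S)"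
      using q by (simp add: has_vector_derivative_iff_quotient)
    have "((\<lambda>p. U t p q') \<longlongrightarrow> U t r q') (at r within {0..t})"
      using strongly_contD(2)[OF U_initial_cont, of t q'] r by (simp add: continuous_on_def)
    then show "((\<lambda>p. U t p q') \<longlongrightarrow> U t r q') (at r within S)" by (rule tendsto_within_subset[OF _ S(2)])
  qed
  moreover have "((\<lambda>p. (1 / (p - r)) *\<^sub>R (U t p (q r) - U t r (q r))) \<longlongrightarrow> - U t r (G r (q r))) (at r within S)"
    using tendsto_within_subset[OF U_initial_derivative[OF qD r, unfolded has_vector_derivative_iff_quotient] S(2)] .
  ultimately have "((\<lambda>p. U t p ((1 / (p - r)) *\<^sub>R (q p - q r)) + (1 / (p - r)) *\<^sub>R (U t p (q r) - U t r (q r)))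
      \<longlongrightarrow> U t r (q' - G r (q r))) (at r within S)" using tendsto_add by (fastforce simp: diff)
  moreover have "\<forall>\<^sub>F p in at r within S. U t p ((1 / (p - r)) *\<^sub>R (q p - q r)) + (1 / (p - r)) *\<^sub>R (U t p (q r) - U t r (q r))
     = (1 / (p - r)) *\<^sub>R (U t p (q p) - U t r (q r))"
    using ev
  proof eventually_elim
    case (elim p)
    then interpret Up: bounded_linear "U t p" by (auto intro: bounded_linear_U)
    show ?case by (simp add: Up.scaleR Up.diff algebra_simps)
  qed
  ultimately show ?thesis
    unfolding has_vector_derivative_iff_quotient by (rule Lim_transform_eventually)
qed

end

lemma strongly_cont_comp:
  assumes "strongly_cont S T" "continuous_on S' f" "f ` S' \<subseteq> S"
  shows "strongly_cont S' (\<lambda>p. T (f p))"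
  using assms continuous_on_compose2[of S "\<lambda>t. T t _" S' f] unfolding strongly_cont_def by blast

lemma closed_triangle: "closed {(t, s). 0 \<le> s \<and> s \<le> (t::real)}"
proof -
  have "{(t, s). 0 \<le> s \<and> s \<le> (t::real)} = {p. 0 \<le> snd p} \<inter> {p. snd p \<le> fst p}" by auto
  then show ?thesis by (auto intro!: closed_Int closed_Collect_le continuous_intros)
qed

section \<open>Return to the original variable x = N z\<close>

context hyperbolic
begin

definition W where "W t s x = N t (U t s (M s x))"

lemma bounded_linear_W: "0 \<le> s \<Longrightarrow> s \<le> t \<Longrightarrow> bounded_linear (W t s)"
  unfolding W_def
  by (intro bounded_linear_compose[OF N_lin] bounded_linear_compose[OF bounded_linear_U] M_lin) auto

lemma W_self: "0 \<le> s \<Longrightarrow> W s s x = x"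
  by (simp add: W_def U_self NM)

lemma W_comp: "0 \<le> s \<Longrightarrow> s \<le> r \<Longrightarrow> r \<le> t \<Longrightarrow> W t s x = W t r (W r s x)"
  using U_comp[of s r t "M s x"] by (simp add: W_def MN)

lemma W_cont: "strongly_cont {(t, s). 0 \<le> s \<and> s \<le> t} (\<lambda>p. W (fst p) (snd p))"
proof -
  let ?S = "{(t, s). 0 \<le> s \<and> s \<le> (t::real)}"
  have 1: "strongly_cont ?S (\<lambda>p. N (fst p))"
    by (rule strongly_cont_comp[OF strong_C1D(3)[OF N_C1]]) (auto intro!: continuous_intros)
  have 2: "strongly_cont ?S (\<lambda>p. M (snd p))"
    by (rule strongly_cont_comp[OF strong_C1D(3)[OF M]]) (auto intro!: continuous_intros)
  have 3: "strongly_cont ?S (\<lambda>p. U (fst p) (snd p))" using U_cont by (simp add: case_prod_beta')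
  show ?thesis unfolding W_def[abs_def]
    using strongly_cont_compose[OF 1 strongly_cont_compose[OF 3 2 closed_triangle] closed_triangle] by simp
qed

definition classical :: "real \<Rightarrow> (real \<Rightarrow> 'a) \<Rightarrow> (real \<Rightarrow> 'a) \<Rightarrow> bool" where
  "classical s f x \<longleftrightarrow> continuous_on {s..} (\<lambda>t. A t (M t (x t))) \<and>
     (\<forall>t\<ge>s. M t (x t) \<in> D \<and> (x has_vector_derivative A t (M t (x t)) + f t) (at t within {s..}))"

lemma classical_cont: "classical s f x \<Longrightarrow> continuous_on {s..} x"
  by (rule continuous_on_vector_derivative[of _ _ "\<lambda>t. A t (M t (x t)) + f t"]) (simp add: classical_def)

text \<open>The terms with M' cancel: N' z + N P z = 0.\<close>

lemma classical_of_solution: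
  assumes s: "0 \<le> s" and z: "solution s g z" and g: "\<And>t. t \<ge> s \<Longrightarrow> g t = M t (f t)"
  shows "classical s f (\<lambda>t. N t (z t))"
  unfolding classical_def
proof (intro conjI allI impI)
  have sub: "{s..} \<subseteq> {0..}" using s by auto
  have AG: "A t (M t (N t (z t))) = N t (G t (z t) - P t (z t))" if "t \<ge> s" for t
    using that s by (simp add: MN NM G_def)
  have "continuous_on {s..} (\<lambda>t. N t (G t (z t) - P t (z t)))"
  proof (rule strongly_cont_apply[OF strongly_cont_subset[OF strong_C1D(3)[OF N_C1] sub]])
    have "continuous_on {s..} (\<lambda>t. P t (z t))"
      by (rule strongly_cont_apply[OF strongly_cont_subset[OF strong_C1D(3)[OF P_C1] sub] _ solution_cont[OF z]]) simp
    then show "continuous_on {s..} (\<lambda>t. G t (z t) - P t (z t))"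
      using z by (intro continuous_on_diff) (auto simp: solution_def)
  qed simp
  then show "continuous_on {s..} (\<lambda>t. A t (M t (N t (z t))))"
    by (rule continuous_on_cong[THEN iffD1, rotated 2]) (simp_all add: AG)
  fix t assume t: "s \<le> t"
  then have t0: "t \<ge> 0" using s by simp
  show "M t (N t (z t)) \<in> D" using z t t0 by (simp add: MN solution_def)
  have dz: "(z has_vector_derivative G t (z t) + g t) (at t within {s..})" using z t by (simp add: solution_def)
  interpret Nt: bounded_linear "N t" by (rule N_lin) (use t0 in simp)
  have "((\<lambda>t. N t (z t)) has_vector_derivative N' t (z t) + N t (G t (z t) + g t)) (at t within {s..})"
    by (rule strong_C1_apply_subset[OF N_C1 sub _ _ dz]) (use t in auto)
  moreover have "N' t (z t) + N t (G t (z t) + g t) = A t (M t (N t (z t))) + f t"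
    using t0 g[OF t] by (simp add: N'_def P_def G_def Nt.add NM MN)
  ultimately show "((\<lambda>t. N t (z t)) has_vector_derivative A t (M t (N t (z t))) + f t) (at t within {s..})" by simp
qed

lemma M_deriv:
  assumes t: "t \<ge> 0" and S: "closed S" "S \<subseteq> {0..}" "t \<in> S"
    and x: "(x has_vector_derivative A t (M t (x t)) + f) (at t within S)"
  shows "((\<lambda>t. M t (x t)) has_vector_derivative G t (M t (x t)) + M t f) (at t within S)"
proof -
  interpret Mt: bounded_linear "M t" by (rule M_lin) (use t in simp)
  have "((\<lambda>t. M t (x t)) has_vector_derivative M' t (x t) + M t (A t (M t (x t)) + f)) (at t within S)"
    by (rule strong_C1_apply_subset[OF M S(2,1,3) x])
  then show ?thesis using t by (simp add: G_def P_def NM Mt.add algebra_simps)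
qed

lemma classical_unique:
  assumes s: "0 \<le> s" "s \<le> b" and c1: "continuous_on {s..b} x1" and c2: "continuous_on {s..b} x2" and eq: "x1 s = x2 s"
    and x1: "\<And>t. s < t \<Longrightarrow> t < b \<Longrightarrow> M t (x1 t) \<in> D \<and> (x1 has_vector_derivative A t (M t (x1 t)) + f t) (at t)"
    and x2: "\<And>t. s < t \<Longrightarrow> t < b \<Longrightarrow> M t (x2 t) \<in> D \<and> (x2 has_vector_derivative A t (M t (x2 t)) + f t) (at t)"
  shows "x1 b = x2 b"
proof -
  have sub: "{s..b} \<subseteq> {0..}" using s by auto
  have cont: "continuous_on {s..b} (\<lambda>t. M t (x t))" if "continuous_on {s..b} x" for x
    by (rule strongly_cont_apply[OF strongly_cont_subset[OF strong_C1D(3)[OF M] sub] _ that]) simp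
  have der: "((\<lambda>t. M t (x t)) has_vector_derivative G t (M t (x t)) + M t (f t)) (at t)"
    if t: "s < t" "t < b" and x: "(x has_vector_derivative A t (M t (x t)) + f t) (at t)" for x t
    using M_deriv[OF _ _ order_refl _ has_vector_derivative_at_within[OF x, of "{0..}"]] t s at_within_Ici[of 0 t] by simp
  have "M b (x1 b) = M b (x2 b)"
    by (rule unique[where g = "\<lambda>t. M t (f t)", OF s cont[OF c1] cont[OF c2]])
      (use eq x1 x2 der in auto)
  then show ?thesis using NM[of b] s by (metis order_trans)
qed

lemma classical_unique_Ici:
  assumes "0 \<le> s" "s \<le> t" "classical s f x1" "classical s f x2" "x1 s = x2 s"
  shows "x1 t = x2 t"
proof (rule classical_unique[where f = f, OF assms(1,2)])
  show "continuous_on {s..t} x1" "continuous_on {s..t} x2"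
    by (rule continuous_on_subset[OF classical_cont], fact, auto)+
  have gen: "M r (x r) \<in> D \<and> (x has_vector_derivative A r (M r (x r)) + f r) (at r)" if "s < r" "r < t" "classical s f x" for r x
    using that(3) at_within_Ici[OF that(1)] less_imp_le[OF that(1)] unfolding classical_def by metis
  show "M r (x1 r) \<in> D \<and> (x1 has_vector_derivative A r (M r (x1 r)) + f r) (at r)"
    "M r (x2 r) \<in> D \<and> (x2 has_vector_derivative A r (M r (x2 r)) + f r) (at r)" if "s < r" "r < t" for r
    by (rule gen[OF that assms(3)] gen[OF that assms(4)])+
qed (rule assms(5))

lemma classical_ex:
  assumes s: "0 \<le> s" and x0: "M s x0 \<in> D" and f': "continuous_on {s..} f'"
    and f: "\<And>t. t \<ge> s \<Longrightarrow> (f has_vector_derivative f' t) (at t within {s..})"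
  obtains x where "classical s f x" "x s = x0"
proof -
  have sub: "{s..} \<subseteq> {0..}" using s by auto
  have cf: "continuous_on {s..} f" by (rule continuous_on_vector_derivative[OF f]) simp
  have cg': "continuous_on {s..} (\<lambda>t. M' t (f t) + M t (f' t))"
    by (rule continuous_on_add[OF strongly_cont_apply[OF strongly_cont_subset[OF strong_C1D(2)[OF M] sub] _ cf]
          strongly_cont_apply[OF strongly_cont_subset[OF strong_C1D(3)[OF M] sub] _ f']]) simp_all
  have g: "((\<lambda>t. M t (f t)) has_vector_derivative M' t (f t) + M t (f' t)) (at t within {s..})" if "t \<ge> s" for t
    by (rule strong_C1_apply_subset[OF M sub _ _ f[OF that]]) (use that in auto)
  obtain z where z: "solution s (\<lambda>t. M t (f t)) z" "z s = M s x0"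
    by (rule solution_ex[OF s x0 cg' g])
  show ?thesis
    by (rule that[OF classical_of_solution[OF s z(1)]]) (use z s in \<open>simp_all add: NM\<close>)
qed

lemma W_classical:
  assumes "0 \<le> s" "M s x \<in> D" shows "classical s (\<lambda>_. 0) (\<lambda>t. W t s x)"
proof -
  have "classical s (\<lambda>_. 0) (\<lambda>t. N t (U t s (M s x)))"
  proof (rule classical_of_solution[OF assms(1) U_solution[OF assms]])
    fix t assume "s \<le> t"
    then interpret bounded_linear "M t" using M_lin[of t] assms by simp
    show "0 = M t 0" by (simp add: zero)
  qed
  then show ?thesis by (simp add: W_def)
qed

text \<open>What remains is the defect of p in the equation, transported from r to t; it vanishes
  along solutions.\<close>

lemma duhamel_W:
  assumes S: "r \<in> S" "S \<subseteq> {0..t}" "closed S" and p: "(p has_vector_derivative p') (at r within S)" and pD: "M r (p r) \<in> D"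
  shows "((\<lambda>r. W t r (p r)) has_vector_derivative W t r (p' - A r (M r (p r)))) (at r within S)"
proof -
  have r: "0 \<le> r" "r \<le> t" using S by auto
  have sub: "S \<subseteq> {0..}" using S by auto
  interpret M: bounded_linear "M r" by (rule M_lin) (use r in simp)
  have p'': "(p has_vector_derivative A r (M r (p r)) + (p' - A r (M r (p r)))) (at r within S)" using p by simp
  have "((\<lambda>r. U t r (M r (p r))) has_vector_derivative U t r (G r (M r (p r)) + M r (p' - A r (M r (p r))) - G r (M r (p r)))) (at r within S)"
    by (rule duhamel[OF S(1,2) M_deriv[OF r(1) S(3) sub S(1) p''] pD])
  moreover have "bounded_linear (N t)" by (rule N_lin) (use r in simp)
  ultimately show ?thesis unfolding W_def
    using bounded_linear.has_vector_derivative[of "N t"] by fastforce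
qed

text \<open>The integral is the value at t of the classical solution with source f and initial value
  zero. Hence it exists and lies in the domain of the main operator at time t, so that the output
  operator can be applied to it.\<close>

lemma W_integral:
  assumes s: "0 \<le> s" "s \<le> t" and f': "continuous_on {s..} f'"
    and f: "\<And>t. t \<ge> s \<Longrightarrow> (f has_vector_derivative f' t) (at t within {s..})"
  shows "(\<lambda>r. W t r (f r)) integrable_on {s..t}" "M t (integral {s..t} (\<lambda>r. W t r (f r))) \<in> D"
proof -
  have "0 \<in> D" using max_dissipative.subspace_D[OF A_md[of 0]] by (simp add: subspace_0)
  moreover have "M s 0 = 0" by (rule linear_0[OF bounded_linear.axioms(1)[OF M_lin]]) (use s in simp)
  ultimately have "M s 0 \<in> D" by simp
  then obtain x where x: "classical s f x" "x s = 0" by (rule classical_ex[OF s(1) _ f' f])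
  have "((\<lambda>r. W t r (f r)) has_integral (W t t (x t) - W t s (x s))) {s..t}"
  proof (rule fundamental_theorem_of_calculus[OF s(2)])
    fix r assume r: "r \<in> {s..t}"
    have "(x has_vector_derivative A r (M r (x r)) + f r) (at r within {s..t})"
      by (rule has_vector_derivative_within_subset[of _ _ _ "{s..}"]) (use x r in \<open>auto simp: classical_def\<close>)
    from duhamel_W[OF r _ _ this] show "((\<lambda>r. W t r (x r)) has_vector_derivative W t r (f r)) (at r within {s..t})"
      using x r s by (auto simp: classical_def)
  qed
  moreover have "W t s 0 = 0" by (rule linear_0[OF bounded_linear.axioms(1)[OF bounded_linear_W[OF s]]])
  ultimately have i: "((\<lambda>r. W t r (f r)) has_integral x t) {s..t}"
    using W_self[of t] s x(2) by simp
  then show "(\<lambda>r. W t r (f r)) integrable_on {s..t}" by (rule has_integral_integrable)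
  show "M t (integral {s..t} (\<lambda>r. W t r (f r))) \<in> D"
    unfolding integral_unique[OF i] using x(1) s by (simp add: classical_def)
qed

lemma dense_domain: "t \<ge> 0 \<Longrightarrow> (\<lambda>n. N t (mollify n (M t x))) \<longlonglongrightarrow> x" "t \<ge> 0 \<Longrightarrow> M t (N t (mollify n (M t x))) \<in> D"
  using bounded_linear.tendsto[OF N_lin mollify_tendsto, of t "M t x"] NM[of t x] by (simp_all add: MN mollify_in)

lemma closure_domain: "t \<ge> 0 \<Longrightarrow> closure {x. M t x \<in> D} = UNIV"
proof (intro set_eqI iffI UNIV_I)
  fix x assume t: "t \<ge> 0"
  show "x \<in> closure {x. M t x \<in> D}"
    unfolding closure_sequential
    by (rule exI[of _ "\<lambda>n. N t (mollify n (M t x))"]) (use dense_domain(1)[OF t, of x] dense_domain(2)[OF t] in simp)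
qed

text \<open>By uniqueness, since Q composed with W solves the same Cauchy problem. With Q a scalar
  multiplication this gives linearity over \<open>K\<close> of an evolution family constructed over
  the reals.\<close>

lemma W_commute:
  assumes st: "0 \<le> s" "s \<le> t" and Q: "bounded_linear Q" and QD: "\<And>x. x \<in> D \<Longrightarrow> Q x \<in> D"
    and QA: "\<And>t x. t \<ge> 0 \<Longrightarrow> x \<in> D \<Longrightarrow> A t (Q x) = Q (A t x)" and QM: "\<And>t x. t \<ge> 0 \<Longrightarrow> M t (Q x) = Q (M t x)"
  shows "W t s (Q x) = Q (W t s x)"
proof (rule bounded_linear_eq_dense[where f = "\<lambda>x. W t s (Q x)" and g = "\<lambda>x. Q (W t s x)",
      OF _ _ closure_domain[OF st(1)]])
  show "bounded_linear (\<lambda>x. W t s (Q x))" "bounded_linear (\<lambda>x. Q (W t s x))"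
    by (rule bounded_linear_compose[OF bounded_linear_W[OF st] Q] bounded_linear_compose[OF Q bounded_linear_W[OF st]])+
  fix x assume "x \<in> {x. M s x \<in> D}"
  then have x: "M s x \<in> D" by simp
  then have Qx: "M s (Q x) \<in> D" using QM st QD by simp
  have "classical s (\<lambda>_. 0) (\<lambda>t. Q (W t s x))"
    unfolding classical_def
  proof (intro conjI allI impI)
    note c = W_classical[OF st(1) x, unfolded classical_def]
    have eq: "A r (M r (Q (W r s x))) = Q (A r (M r (W r s x)))" if "r \<in> {s..}" for r
      using QM[of r] QA[of r] c that st by simp
    have "continuous_on {s..} (\<lambda>r. Q (A r (M r (W r s x))))"
      by (rule bounded_linear.continuous_on[OF Q]) (use c in blast)
    then show "continuous_on {s..} (\<lambda>r. A r (M r (Q (W r s x))))"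
      by (rule continuous_on_cong[THEN iffD1, rotated 2]) (simp_all add: eq)
    fix r assume r: "s \<le> r"
    show "M r (Q (W r s x)) \<in> D" using QM[of r] QD c r st by simp
    have "((\<lambda>r. W r s x) has_vector_derivative A r (M r (W r s x))) (at r within {s..})" using c r by simp
    from bounded_linear.has_vector_derivative[OF Q this]
    show "((\<lambda>r. Q (W r s x)) has_vector_derivative A r (M r (Q (W r s x))) + 0) (at r within {s..})"
      using eq r by simp
  qed
  from classical_unique_Ici[OF st W_classical[OF st(1) Qx] this]
  show "W t s (Q x) = Q (W t s x)" using W_self[OF st(1)] by simp
qed

end

text \<open>Frozen coefficients, used for the semigroup generated by A(t)M(t) at a fixed t.\<close>

lemma hyperbolic_constant:
  fixes A M :: "'a::{real_inner,banach} \<Rightarrow> 'a"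
  assumes "max_dissipative D A" "bounded_linear M" "\<And>x y. M x \<bullet> y = x \<bullet> M y" "\<beta> > 0" "\<And>x. M x \<bullet> x \<ge> \<beta> * (norm x)\<^sup>2"
  shows "hyperbolic D (\<lambda>_. A) (\<lambda>_ _. 0) (\<lambda>_. M) (\<lambda>_ _. 0) (\<lambda>_ _. 0) \<beta>"
  by unfold_locales
    (use assms in \<open>auto simp: strong_C1_def strongly_cont_def max_dissipative.md\<close>)

section \<open>Real-linear consequences of linearity over the scalar field\<close>

lemma hilbert_overD:
  assumes "hilbert_over K X"
  shows "of_real r \<in> K" "smul X (of_real r) x = r *\<^sub>R x"
    "a \<in> K \<Longrightarrow> b \<in> K \<Longrightarrow> smul X (a * b) x = smul X a (smul X b x)"
    "a \<in> K \<Longrightarrow> smul X a (x + y) = smul X a x + smul X a y"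
    "a \<in> K \<Longrightarrow> ip X (smul X a x) y = a * ip X x y"
    "ip X y x = cnj (ip X x y)" "Re (ip X x y) = x \<bullet> y"
proof -
  note h = assms[unfolded hilbert_over_def]
  have "K = \<real> \<or> K = UNIV" using h by (elim conjE)
  then show "of_real r \<in> K" by (metis Reals_of_real UNIV_I)
  have "\<forall>r x. smul X (of_real r) x = r *\<^sub>R x" using h by (elim conjE)
  then show "smul X (of_real r) x = r *\<^sub>R x" by blast
  have "\<forall>a\<in>K. \<forall>b\<in>K. \<forall>x. smul X (a * b) x = smul X a (smul X b x)" using h by (elim conjE)
  then show "a \<in> K \<Longrightarrow> b \<in> K \<Longrightarrow> smul X (a * b) x = smul X a (smul X b x)" by blast
  have "\<forall>a\<in>K. \<forall>x y. smul X a (x + y) = smul X a x + smul X a y" using h by (elim conjE)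
  then show "a \<in> K \<Longrightarrow> smul X a (x + y) = smul X a x + smul X a y" by blast
  have "\<forall>a\<in>K. \<forall>x y. ip X (smul X a x) y = a * ip X x y" using h by (elim conjE)
  then show "a \<in> K \<Longrightarrow> ip X (smul X a x) y = a * ip X x y" by blast
  have "\<forall>x y. ip X y x = cnj (ip X x y)" using h by (elim conjE)
  then show "ip X y x = cnj (ip X x y)" by blast
  have "\<forall>x y. Re (ip X x y) = x \<bullet> y" using h by (elim conjE)
  then show "Re (ip X x y) = x \<bullet> y" by blast
qed

lemma K_subspace_real:
  assumes "hilbert_over K X" "K_subspace K X D"
  shows "subspace D"
proof -
  note r = hilbert_overD(1)[OF assms(1)]
  have "smul X (of_real r) x = r *\<^sub>R x" for r x by (rule hilbert_overD(2)[OF assms(1)])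
  moreover have "\<forall>c\<in>K. \<forall>x\<in>D. smul X c x \<in> D" "0 \<in> D" "\<forall>x\<in>D. \<forall>y\<in>D. x + y \<in> D"
    using assms(2) by (simp_all add: K_subspace_def)
  ultimately show ?thesis using r unfolding subspace_def by metis
qed

lemma K_linear_real:
  assumes "hilbert_over K X" "hilbert_over K Y" "K_linear_on K X Y D T"
  shows "x \<in> D \<Longrightarrow> T (c *\<^sub>R x) = c *\<^sub>R T x" "x \<in> D \<Longrightarrow> y \<in> D \<Longrightarrow> T (x + y) = T x + T y"
    "x \<in> D \<Longrightarrow> y \<in> D \<Longrightarrow> T (x - y) = T x - T y" "subspace D"
proof -
  note r = hilbert_overD(1)[OF assms(1)]
  note sm = hilbert_overD(2)[OF assms(1)] hilbert_overD(2)[OF assms(2)]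
  show D: "subspace D" using K_subspace_real[OF assms(1)] assms(3) by (simp add: K_linear_on_def)
  have "\<forall>c\<in>K. \<forall>x\<in>D. T (smul X c x) = smul Y c (T x)" using assms(3) by (simp add: K_linear_on_def)
  then show sc: "x \<in> D \<Longrightarrow> T (c *\<^sub>R x) = c *\<^sub>R T x" for x c
    using r sm by metis
  show ad: "x \<in> D \<Longrightarrow> y \<in> D \<Longrightarrow> T (x + y) = T x + T y" for x y
    using assms(3) by (simp add: K_linear_on_def)
  show "x \<in> D \<Longrightarrow> y \<in> D \<Longrightarrow> T (x - y) = T x - T y"
    using ad[of x "(-1) *\<^sub>R y"] sc[of y "-1"] subspace_scale[OF D, of y "-1"] by simp
qed

text \<open>Real linearity is commutation with real scalars; the norm is multiplied by the modulus
  of c because the inner product is sesquilinear.\<close>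

lemma smul_bounded:
  assumes X: "hilbert_over K X" and c: "c \<in> K"
  shows "bounded_linear (smul X c)"
proof (rule bounded_linear_intro)
  note r = hilbert_overD(1)[OF X]
  show "smul X c (x + y) = smul X c x + smul X c y" for x y by (rule hilbert_overD(4)[OF X c])
  show "smul X c (a *\<^sub>R x) = a *\<^sub>R smul X c x" for a x
  proof -
    have "smul X c (smul X (of_real a) x) = smul X (of_real a) (smul X c x)"
      using hilbert_overD(3)[OF X c r, of a x] hilbert_overD(3)[OF X r c, of a x] by (simp add: mult.commute)
    then show ?thesis by (simp add: hilbert_overD(2)[OF X])
  qed
  show "norm (smul X c x) \<le> norm x * cmod c" for x
  proof -
    have ip: "ip X (smul X c x) y = c * ip X x y" "ip X y x = cnj (ip X x y)" "Re (ip X x y) = x \<bullet> y" for x y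
      by (rule hilbert_overD(5)[OF X c] hilbert_overD(6)[OF X] hilbert_overD(7)[OF X])+
    have "ip X x (smul X c x) = cnj (c * ip X x x)" using ip(2)[of x "smul X c x"] ip(1)[of x x] by simp
    also have "\<dots> = cnj c * ip X x x" using ip(2)[of x x] by simp
    finally have "ip X (smul X c x) (smul X c x) = c * cnj c * ip X x x"
      using ip(1)[of x "smul X c x"] by simp
    also have "c * cnj c = of_real ((cmod c)\<^sup>2)" by (rule complex_norm_square[symmetric])
    finally have "Re (ip X (smul X c x) (smul X c x)) = (cmod c)\<^sup>2 * Re (ip X x x)" by simp
    then have "(norm (smul X c x))\<^sup>2 = (norm x * cmod c)\<^sup>2"
      by (simp add: ip(3) power2_norm_eq_inner power_mult_distrib)
    then show ?thesis by (simp add: power2_eq_iff_nonneg)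
  qed
qed


section \<open>Semigroups\<close>

lemma tendsto_at_right_unique:
  fixes f :: "real \<Rightarrow> 'a::real_normed_vector"
  assumes "(f \<longlongrightarrow> a) (at_right 0)" "(f \<longlongrightarrow> b) (at_right 0)" shows "a = b"
  using tendsto_unique[OF trivial_limit_at_right_real assms] .

text \<open>The setting for the necessity half of the Lumer-Phillips theorem: the generator is
  maximal dissipative.\<close>

locale contraction_semigroup =
  fixes S :: "real \<Rightarrow> 'a::{real_inner,banach} \<Rightarrow> 'a" and D A
  assumes lin: "\<And>t. t \<ge> 0 \<Longrightarrow> bounded_linear (S t)" and zero: "\<And>x. S 0 x = x"
    and add: "\<And>t s x. t \<ge> 0 \<Longrightarrow> s \<ge> 0 \<Longrightarrow> S (t + s) x = S t (S s x)"
    and cont: "\<And>x. continuous_on {0..} (\<lambda>t. S t x)"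
    and contr: "\<And>t x. t \<ge> 0 \<Longrightarrow> norm (S t x) \<le> norm x"
    and gen: "is_generator D A S"
begin

lemma genD: "x \<in> D \<Longrightarrow> ((\<lambda>h. (1 / h) *\<^sub>R (S h x - x)) \<longlongrightarrow> A x) (at_right 0)"
  using gen by (simp add: is_generator_def)

lemma genI:
  assumes "((\<lambda>h. (1 / h) *\<^sub>R (S h x - x)) \<longlongrightarrow> y) (at_right 0)" shows "x \<in> D" "A x = y"
proof -
  show "x \<in> D" using gen assms unfolding is_generator_def by blast
  then show "A x = y" using genD assms tendsto_at_right_unique by blast
qed

lemma ev_pos: "\<forall>\<^sub>F h in at_right 0. (h::real) > 0"
  by (simp add: eventually_at_filter)

lemma gen_scale: "x \<in> D \<Longrightarrow> c *\<^sub>R x \<in> D \<and> A (c *\<^sub>R x) = c *\<^sub>R A x"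
proof -
  assume x: "x \<in> D"
  have "((\<lambda>h. c *\<^sub>R ((1 / h) *\<^sub>R (S h x - x))) \<longlongrightarrow> c *\<^sub>R A x) (at_right 0)"
    by (intro tendsto_intros genD x)
  moreover have "\<forall>\<^sub>F h in at_right 0. c *\<^sub>R ((1 / h) *\<^sub>R (S h x - x)) = (1 / h) *\<^sub>R (S h (c *\<^sub>R x) - c *\<^sub>R x)"
    using ev_pos
  proof eventually_elim
    case (elim h)
    then interpret bounded_linear "S h" by (intro lin) simp
    show ?case by (simp add: scaleR scaleR_diff_right mult.commute)
  qed
  ultimately have "((\<lambda>h. (1 / h) *\<^sub>R (S h (c *\<^sub>R x) - c *\<^sub>R x)) \<longlongrightarrow> c *\<^sub>R A x) (at_right 0)"
    by (rule Lim_transform_eventually)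
  then show ?thesis using genI by blast
qed

lemma gen_add: "x \<in> D \<Longrightarrow> y \<in> D \<Longrightarrow> x + y \<in> D \<and> A (x + y) = A x + A y"
proof -
  assume x: "x \<in> D" and y: "y \<in> D"
  have "((\<lambda>h. (1 / h) *\<^sub>R (S h x - x) + (1 / h) *\<^sub>R (S h y - y)) \<longlongrightarrow> A x + A y) (at_right 0)"
    by (intro tendsto_intros genD x y)
  moreover have "\<forall>\<^sub>F h in at_right 0. (1 / h) *\<^sub>R (S h x - x) + (1 / h) *\<^sub>R (S h y - y) = (1 / h) *\<^sub>R (S h (x + y) - (x + y))"
    using ev_pos
  proof eventually_elim
    case (elim h)
    then interpret bounded_linear "S h" by (intro lin) simp
    show ?case by (simp add: add algebra_simps)
  qed
  ultimately have "((\<lambda>h. (1 / h) *\<^sub>R (S h (x + y) - (x + y))) \<longlongrightarrow> A x + A y) (at_right 0)"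
    by (rule Lim_transform_eventually)
  then show ?thesis using genI by blast
qed

lemma gen_dissip: "x \<in> D \<Longrightarrow> A x \<bullet> x \<le> 0"
proof -
  assume x: "x \<in> D"
  have "((\<lambda>h. ((1 / h) *\<^sub>R (S h x - x)) \<bullet> x) \<longlongrightarrow> A x \<bullet> x) (at_right 0)"
    by (intro tendsto_intros genD x)
  moreover have "\<forall>\<^sub>F h in at_right 0. ((1 / h) *\<^sub>R (S h x - x)) \<bullet> x \<le> 0"
    using ev_pos
  proof eventually_elim
    case (elim h)
    have "S h x \<bullet> x \<le> norm (S h x) * norm x" by (rule norm_cauchy_schwarz)
    also have "\<dots> \<le> norm x * norm x" using contr[of h x] elim by (intro mult_right_mono) auto
    finally have "(S h x - x) \<bullet> x \<le> 0" by (simp add: inner_diff_left power2_norm_eq_inner[symmetric] power2_eq_square)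
    then show ?case using elim by (simp add: divide_nonpos_pos)
  qed
  ultimately show ?thesis by (rule tendsto_upperbound) (rule trivial_limit_at_right_real)
qed

text \<open>
  A Laplace transform over the finite interval \<open>[0, \<tau>]\<close>: it solves \<open>(l - A) J = v - e\<^sup>-\<^sup>l\<^sup>\<tau> S(\<tau>) v\<close>, and
  \<open>I - e\<^sup>-\<^sup>l\<^sup>\<tau> S(\<tau>)\<close> is invertible by the contraction principle.
\<close>

definition J where "J l \<tau> v = integral {0..\<tau>} (\<lambda>t. exp (- l * t) *\<^sub>R S t v)"

lemma J_gen:
  assumes \<tau>: "\<tau> > 0"
  shows "J l \<tau> v \<in> D" "A (J l \<tau> v) = l *\<^sub>R J l \<tau> v + (exp (- l * \<tau>) *\<^sub>R S \<tau> v - v)"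
proof -
  define f where "f t = exp (- l * t) *\<^sub>R S t v" for t
  define F where "F t = integral {0..t} f" for t
  have cf: "continuous_on {0..b} f" for b
    unfolding f_def by (intro continuous_intros continuous_on_subset[OF cont]) auto
  have dF: "(F has_vector_derivative f t) (at t within {0..b})" if "t \<in> {0..b}" for t b
    unfolding F_def by (rule integral_has_vector_derivative[OF cf that])
  have shift: "((\<lambda>t. F (t + h)) has_vector_derivative f (t + h)) (at t within {a..b})"
    if "0 \<le> a + h" "t \<in> {a..b}" for a b h t
  proof -
    have "((F \<circ> (\<lambda>t. t + h)) has_vector_derivative 1 *\<^sub>R f (t + h)) (at t within {a..b})"
    proof (rule vector_diff_chain_within)
      show "((\<lambda>t. t + h) has_vector_derivative 1) (at t within {a..b})" by (auto intro!: derivative_eq_intros)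
      show "(F has_vector_derivative f (t + h)) (at (t + h) within (\<lambda>t. t + h) ` {a..b})"
        by (rule has_vector_derivative_within_subset[OF dF[of "t + h" "b + h"]]) (use that in auto)
    qed
    then show ?thesis by (simp add: o_def)
  qed
  \<comment> \<open>Translation by h turns the action of \<open>S h\<close> on the transform into a
    difference of primitives, whose derivative at h = 0 can be computed; this puts the transform
    into \<open>D\<close>.\<close>
  have Fshift: "S h (J l \<tau> v) = exp (l * h) *\<^sub>R (F (\<tau> + h) - F h)" if h: "h \<ge> 0" for h
  proof -
    have i: "((\<lambda>t. f (t + h)) has_integral (F (\<tau> + h) - F (0 + h))) {0..\<tau>}"
      by (rule fundamental_theorem_of_calculus) (use \<tau> h in \<open>auto intro!: shift\<close>)
    have "S h (J l \<tau> v) = integral {0..\<tau>} (S h \<circ> f)"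
      unfolding J_def f_def[symmetric]
      by (rule integral_linear[OF integrable_continuous_real[OF cf] lin[OF h], symmetric])
    also have "\<dots> = integral {0..\<tau>} (\<lambda>t. exp (l * h) *\<^sub>R f (t + h))"
    proof (rule Henstock_Kurzweil_Integration.integral_cong)
      fix t assume t: "t \<in> {0..\<tau>}"
      interpret bounded_linear "S h" by (rule lin[OF h])
      have "exp (l * h) * exp (- l * (t + h)) = exp (- l * t)" by (simp add: mult_exp_exp algebra_simps)
      then show "(S h \<circ> f) t = exp (l * h) *\<^sub>R f (t + h)"
        using contraction_semigroup.add[OF contraction_semigroup_axioms, of h t v] h t
        by (simp add: f_def scaleR add.commute)
    qed
    also have "\<dots> = exp (l * h) *\<^sub>R integral {0..\<tau>} (\<lambda>t. f (t + h))" by simp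
    finally show ?thesis using integral_unique[OF i] by simp
  qed
  define q where "q h = exp (l * h) *\<^sub>R (F (h + \<tau>) - F (h + 0))" for h
  have "(q has_vector_derivative exp (l * 0) *\<^sub>R (f (0 + \<tau>) - f (0 + 0)) + (l * exp (l * 0)) *\<^sub>R (F (0 + \<tau>) - F (0 + 0))) (at 0 within {0..1})"
    unfolding q_def
  proof (rule has_vector_derivative_scaleR)
    show "((\<lambda>h. exp (l * h)) has_real_derivative l * exp (l * 0)) (at 0 within {0..1})"
      by (auto intro!: derivative_eq_intros)
    show "((\<lambda>h. F (h + \<tau>) - F (h + 0)) has_vector_derivative f (0 + \<tau>) - f (0 + 0)) (at 0 within {0..1})"
      using \<tau> by (intro has_vector_derivative_diff shift) auto
  qed
  moreover have "at (0::real) within {0..1} = at_right 0" by (rule at_within_Icc_at_right) simp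
  moreover have Jq: "F \<tau> = J l \<tau> v" by (simp add: F_def f_def[abs_def] J_def)
  moreover have "F 0 = 0" by (simp add: F_def)
  ultimately have "(q has_vector_derivative (exp (- l * \<tau>) *\<^sub>R S \<tau> v - v) + l *\<^sub>R J l \<tau> v) (at_right 0)"
    by (simp add: f_def zero)
  then have lim: "((\<lambda>h. (1 / (h - 0)) *\<^sub>R (q h - q 0)) \<longlongrightarrow> (exp (- l * \<tau>) *\<^sub>R S \<tau> v - v) + l *\<^sub>R J l \<tau> v) (at_right 0)"
    unfolding has_vector_derivative_iff_quotient .
  have q0: "q 0 = J l \<tau> v" using Jq \<open>F 0 = 0\<close> by (simp add: q_def)
  have "\<forall>\<^sub>F h in at_right 0. (1 / (h - 0)) *\<^sub>R (q h - q 0) = (1 / h) *\<^sub>R (S h (J l \<tau> v) - J l \<tau> v)"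
    using ev_pos by eventually_elim (simp add: q0 Fshift, simp add: q_def add.commute)
  with lim have "((\<lambda>h. (1 / h) *\<^sub>R (S h (J l \<tau> v) - J l \<tau> v)) \<longlongrightarrow> (exp (- l * \<tau>) *\<^sub>R S \<tau> v - v) + l *\<^sub>R J l \<tau> v) (at_right 0)"
    by (rule Lim_transform_eventually)
  from genI[OF this] show "J l \<tau> v \<in> D" "A (J l \<tau> v) = l *\<^sub>R J l \<tau> v + (exp (- l * \<tau>) *\<^sub>R S \<tau> v - v)"
    by (simp_all add: add.commute)
qed

theorem max_dissipative: "max_dissipative D A"
  unfolding max_dissipative_def maximal_dissipative_def
proof (intro conjI ballI allI impI)
  have "((\<lambda>h. (1 / h) *\<^sub>R (S h 0 - 0)) \<longlongrightarrow> 0) (at_right 0)"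
  proof (rule Lim_transform_eventually[OF tendsto_const])
    show "\<forall>\<^sub>F h in at_right 0. 0 = (1 / h) *\<^sub>R (S h 0 - 0)"
      using ev_pos by eventually_elim (use linear_0[OF bounded_linear.axioms(1)[OF lin]] in simp)
  qed
  from genI(1)[OF this] show "subspace D"
    unfolding subspace_def using gen_add gen_scale by blast
  show "closure D = UNIV"
  proof (intro set_eqI iffI UNIV_I)
    fix v
    \<comment> \<open>The transform with l = 0 over [0, h]: the averages lie in \<open>D\<close> and
      tend to v, which proves density.\<close>
    define F where "F t = integral {0..t} (\<lambda>t. exp (- 0 * t) *\<^sub>R S t v)" for t
    have "(F has_vector_derivative exp (- 0 * 0) *\<^sub>R S 0 v) (at 0 within {0..1})"
      unfolding F_def
      by (rule integral_has_vector_derivative) (auto intro!: continuous_intros continuous_on_subset[OF cont])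
    moreover have "at (0::real) within {0..1} = at_right 0" by (rule at_within_Icc_at_right) simp
    ultimately have "((\<lambda>h. (1 / h) *\<^sub>R F h) \<longlongrightarrow> v) (at_right 0)"
      unfolding has_vector_derivative_iff_quotient by (simp add: F_def zero)
    moreover have "\<forall>\<^sub>F h in at_right 0. (1 / h) *\<^sub>R F h \<in> D"
      using ev_pos by eventually_elim (use J_gen(1)[of _ 0 v] gen_scale in \<open>simp add: F_def J_def\<close>)
    ultimately show "v \<in> closure D"
      using Lim_in_closed_set[OF closed_closure, of "\<lambda>h. (1 / h) *\<^sub>R F h" D "at_right 0" v] closure_subset
      by (meson eventually_mono subsetD trivial_limit_at_right_real)
  qed
  fix l :: real and y assume l: "l > 0"
  \<comment> \<open>The transform is used with parameter 1 / l and \<tau> = 1. The fixed point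
    solves v - k S(1) v = y, and the transform of this v, divided by l, is the required preimage of
    y.\<close>
  define k where "k = exp (- (1 / l) * 1)"
  have k: "0 \<le> k" "k < 1" using l by (simp_all add: k_def)
  interpret S1: bounded_linear "S 1" by (rule lin) simp
  define f where "f v = y + k *\<^sub>R S 1 v" for v
  have "dist (f u) (f v) \<le> k * dist u v" for u v
  proof -
    have "f u - f v = k *\<^sub>R S 1 (u - v)" by (simp add: f_def S1.diff scaleR_diff_right)
    then show ?thesis using contr[of 1 "u - v"] k by (simp add: dist_norm mult_left_mono)
  qed
  then have "\<exists>!v. f v = v" by (intro banach_fix_type[OF k]) auto
  then obtain v where v: "f v = v" by blast
  let ?J = "J (1 / l) 1 v"
  have AJ: "A ?J = (1 / l) *\<^sub>R ?J + (k *\<^sub>R S 1 v - v)" and JD: "?J \<in> D"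
    using J_gen[of 1 "1 / l" v] by (simp_all add: k_def)
  show "\<exists>x\<in>D. x - l *\<^sub>R A x = y"
  proof (rule bexI[of _ "(1 / l) *\<^sub>R ?J"])
    have "(1 / l) *\<^sub>R ?J - l *\<^sub>R A ((1 / l) *\<^sub>R ?J) = (1 / l) *\<^sub>R ?J - A ?J"
      using gen_scale[OF JD] l by simp
    also have "\<dots> = v - k *\<^sub>R S 1 v" by (simp add: AJ)
    also have "\<dots> = y" using v by (simp add: f_def algebra_simps)
    finally show "(1 / l) *\<^sub>R ?J - l *\<^sub>R A ((1 / l) *\<^sub>R ?J) = y" .
    show "(1 / l) *\<^sub>R ?J \<in> D" using gen_scale[OF JD] by blast
  qed
qed (use gen_add gen_scale gen_dissip in auto)

end

lemma contraction_generator_max_dissipative: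
  fixes X :: "'a::{real_inner,banach} hilbert_structure"
  assumes "generates_contraction_C0_semigroup K X D A"
  shows "max_dissipative D A"
proof -
  obtain S where S: "C0_semigroup K X S" "\<forall>t\<ge>0. \<forall>x. norm (S t x) \<le> norm x" "is_generator D A S"
    using assms unfolding generates_contraction_C0_semigroup_def by blast
  have "\<forall>t\<ge>0. bounded_linear (S t)" using S(1) by (simp add: C0_semigroup_def bdd_op_def)
  moreover have "S 0 = id" "\<forall>t\<ge>0. \<forall>s\<ge>0. S (t + s) = S t \<circ> S s" "\<forall>x. continuous_on {0..} (\<lambda>t. S t x)"
    using S(1) by (simp_all add: C0_semigroup_def)
  ultimately have "contraction_semigroup S D A"
    by (intro contraction_semigroup.intro) (use S(2,3) in simp_all)
  then interpret contraction_semigroup S D A .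
  show ?thesis by (rule max_dissipative)
qed

text \<open>The semigroup is the evolution family with frozen coefficients. Its generator could a
  priori be a proper extension of A M; this is excluded because the semigroup is a contraction in
  the inner product (M x | y) and I - A M is onto.\<close>

lemma generates_semigroup_perturbed:
  fixes X :: "'a::{real_inner,banach} hilbert_structure"
  assumes X: "hilbert_over K X" and A: "max_dissipative D A" and AK: "K_linear_on K X X D A"
    and M: "bdd_op K X X M" and sym: "\<And>x y. M x \<bullet> y = x \<bullet> M y"
    and \<beta>: "\<beta> > 0" and coer: "\<And>x. M x \<bullet> x \<ge> \<beta> * (norm x)\<^sup>2"
  shows "generates_C0_semigroup K X {x. M x \<in> D} (\<lambda>x. A (M x))"
proof -
  have Mlin: "bounded_linear M" using M by (simp add: bdd_op_def)
  interpret M: bounded_linear M by (rule Mlin)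
  interpret md: max_dissipative D A by (rule A)
  interpret h: hyperbolic D "\<lambda>_. A" "\<lambda>_ _. 0" "\<lambda>_. M" "\<lambda>_ _. 0" "\<lambda>_ _. 0" \<beta>
    by (rule hyperbolic_constant[OF A Mlin sym \<beta> coer])
  define S where "S t = h.W t 0" for t
  have blS: "bounded_linear (S t)" if "t \<ge> 0" for t unfolding S_def by (rule h.bounded_linear_W) (use that in auto)
  have cl: "M (S t x) \<in> D" "((\<lambda>t. S t x) has_vector_derivative A (M (S t x))) (at t within {0..})"
    "continuous_on {0..} (\<lambda>t. A (M (S t x)))" if "M x \<in> D" "t \<ge> 0" for t x
    using h.W_classical[of 0 x] that unfolding h.classical_def S_def by auto
  have S0: "S 0 x = x" for x unfolding S_def by (rule h.W_self) simp
  have Scont: "continuous_on {0..} (\<lambda>t. S t x)" for x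
  proof -
    have "strongly_cont {0..} (\<lambda>t. h.W (fst (t, 0::real)) (snd (t, 0::real)))"
      by (rule strongly_cont_comp[OF h.W_cont, of "{0..}" "\<lambda>t. (t, 0)"])
        (auto intro!: continuous_intros)
    from strongly_contD(2)[OF this, of x] show ?thesis by (simp add: S_def)
  qed
  have Sadd: "S (t + s) x = S t (S s x)" if ts: "t \<ge> 0" "s \<ge> 0" for t s x
  proof -
    \<comment> \<open>Autonomy: a solution shifted in time is again a solution, so uniqueness
      identifies the evolution over [s, t + s] with that over [0, t].\<close>
    have "h.W (t + s) s y = S t y" for y
    proof (rule bounded_linear_eq_dense[where f = "h.W (t + s) s" and g = "S t", OF _ blS[OF ts(1)] h.closure_domain[OF ts(2)]])
      show "bounded_linear (h.W (t + s) s)" by (rule h.bounded_linear_W) (use ts in auto)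
      fix y assume "y \<in> {x. M x \<in> D}"
      then have y: "M y \<in> D" by simp
      have "h.classical s (\<lambda>_. 0) (\<lambda>r. S (r - s) y)"
        unfolding h.classical_def
      proof (intro conjI allI impI)
        show "continuous_on {s..} (\<lambda>r. A (M (S (r - s) y)))"
          by (rule continuous_on_compose2[OF cl(3)[OF y order_refl]]) (auto intro!: continuous_intros)
        fix r assume r: "s \<le> r"
        then have rs: "0 \<le> r - s" by simp
        show "M (S (r - s) y) \<in> D" by (rule cl(1)[OF y rs])
        have "((\<lambda>t. S t y) \<circ> (\<lambda>r. r - s) has_vector_derivative 1 *\<^sub>R A (M (S (r - s) y))) (at r within {s..})"
        proof (rule vector_diff_chain_within)
          show "((\<lambda>r. r - s) has_vector_derivative 1) (at r within {s..})" by (auto intro!: derivative_eq_intros)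
          show "((\<lambda>t. S t y) has_vector_derivative A (M (S (r - s) y))) (at (r - s) within (\<lambda>r. r - s) ` {s..})"
            by (rule has_vector_derivative_within_subset[OF cl(2)[OF y rs]]) auto
        qed
        then show "((\<lambda>r. S (r - s) y) has_vector_derivative A (M (S (r - s) y)) + 0) (at r within {s..})"
          by (simp add: o_def)
      qed
      from h.classical_unique_Ici[OF ts(2) _ h.W_classical[OF ts(2) y] this, of "t + s"]
      show "h.W (t + s) s y = S t y" using ts h.W_self[OF ts(2)] S0 by simp
    qed
    then show ?thesis using h.W_comp[of 0 s "t + s" x] ts by (simp add: S_def)
  qed
  have SK: "S t (smul X c x) = smul X c (S t x)" if "t \<ge> 0" "c \<in> K" for t c x
    unfolding S_def
    by (rule h.W_commute[OF order_refl that(1) smul_bounded[OF X that(2)]])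
      (use AK M that(2) in \<open>auto simp: K_linear_on_def K_subspace_def bdd_op_def\<close>)
  have C0: "C0_semigroup K X S"
    unfolding C0_semigroup_def bdd_op_def using blS SK S0 Sadd Scont by (auto simp: fun_eq_iff)
  \<comment> \<open>Contraction in the inner product given by M, obtained on the domain by
    differentiation and elsewhere by density.\<close>
  have dissM: "M (S t x) \<bullet> S t x \<le> M x \<bullet> x" if t: "t \<ge> 0" for t x
  proof -
    have dom: "M (S t x) \<bullet> S t x \<le> M x \<bullet> x" if x: "M x \<in> D" for x
    proof -
      define e where "e t = M (S t x) \<bullet> S t x" for t
      have de: "(e has_vector_derivative 2 * (A (M (S r x)) \<bullet> M (S r x))) (at r within {0..})" if r: "r \<ge> 0" for r
      proof -
        have "M (S r x) \<bullet> A (M (S r x)) + M (A (M (S r x))) \<bullet> S r x = 2 * (A (M (S r x)) \<bullet> M (S r x))"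
          using sym[of "A (M (S r x))" "S r x"] inner_commute[of "M (S r x)" "A (M (S r x))"] by linarith
        then show ?thesis
          using bounded_bilinear.has_vector_derivative[OF bounded_bilinear_inner
              bounded_linear.has_vector_derivative[OF Mlin cl(2)[OF x r]] cl(2)[OF x r]]
          unfolding e_def by simp
      qed
      have "e t \<le> e 0"
      proof (cases "t = 0")
        case False
        then have t0: "0 < t" using t by simp
        have "\<exists>z. 0 < z \<and> z < t \<and> e t - e 0 = (t - 0) *\<^sub>R (2 * (A (M (S z x)) \<bullet> M (S z x)))"
        proof (rule mvt_simple[OF t0, of e "\<lambda>z h. h *\<^sub>R (2 * (A (M (S z x)) \<bullet> M (S z x)))", THEN bexE])
          show "(e has_derivative (\<lambda>h. h *\<^sub>R (2 * (A (M (S z x)) \<bullet> M (S z x))))) (at z within {0..t})" if "0 \<le> z" "z \<le> t" for z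
            using has_vector_derivative_within_subset[OF de, of z "{0..t}"] that by (auto simp: has_vector_derivative_def)
        qed auto
        then obtain z where z: "0 < z" "z < t" "e t - e 0 = t * (2 * (A (M (S z x)) \<bullet> M (S z x)))" by auto
        have "A (M (S z x)) \<bullet> M (S z x) \<le> 0" using md.A_dissip cl(1)[OF x, of z] z by simp
        then have "t * (2 * (A (M (S z x)) \<bullet> M (S z x))) \<le> 0" using t0 by (simp add: mult_nonneg_nonpos)
        then show ?thesis using z by simp
      qed simp
      then show ?thesis by (simp add: e_def S0)
    qed
    define y where "y n = h.N 0 (h.mollify n (M x))" for n
    have y: "\<And>n. M (y n) \<in> D" "y \<longlonglongrightarrow> x"
      using h.dense_domain(1)[of 0 x] h.dense_domain(2)[of 0] by (simp_all add: y_def[abs_def])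
    have "(\<lambda>n. M (S t (y n)) \<bullet> S t (y n)) \<longlonglongrightarrow> M (S t x) \<bullet> S t x"
      by (intro tendsto_intros M.tendsto bounded_linear.tendsto[OF blS[OF t]] y)
    moreover have "(\<lambda>n. M (y n) \<bullet> y n) \<longlonglongrightarrow> M x \<bullet> x" by (intro tendsto_intros M.tendsto y)
    ultimately show ?thesis by (rule LIMSEQ_le) (use dom y in auto)
  qed
  have gen1: "((\<lambda>h. (1 / h) *\<^sub>R (S h x - x)) \<longlongrightarrow> A (M x)) (at_right 0)" if "M x \<in> D" for x
  proof -
    have "((\<lambda>t. S t x) has_vector_derivative A (M (S 0 x))) (at 0 within {0<..})"
      by (rule has_vector_derivative_within_subset[OF cl(2)[OF that order_refl]]) auto
    then show ?thesis unfolding has_vector_derivative_iff_quotient by (simp add: S0)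
  qed
  have gen2: "M x \<in> D" if x: "((\<lambda>h. (1 / h) *\<^sub>R (S h x - x)) \<longlongrightarrow> y) (at_right 0)" for x y
  proof -
    obtain \<nu> where \<nu>: "\<nu> > 0" "\<And>t x. t \<in> {0..0} \<Longrightarrow> h.N t x \<bullet> x \<ge> \<nu> * (norm x)\<^sup>2"
      using h.N_coercive by metis
    \<comment> \<open>With z = M x' this says x' - A M x' = x - y. The generator then maps d = x -
      x' to d itself, which dissipativity in the inner product given by M permits only for d =
      0.\<close>
    obtain z where z: "z \<in> D" "h.N 0 z - A z = x - y"
      using md.coercive_minus_onto[OF h.N_lin[of 0] \<nu>(1) \<nu>(2)[of 0] complete_UNIV, of "x - y"] by auto
    define x' where "x' = h.N 0 z"
    have Mx': "M x' = z" using h.MN[of 0] by (simp add: x'_def)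
    define d where "d = x - x'"
    have y: "y = d + A (M x')" using z(2) by (simp add: d_def x'_def[symmetric] Mx' algebra_simps)
    have "((\<lambda>h. (1 / h) *\<^sub>R (S h x - x) - (1 / h) *\<^sub>R (S h x' - x')) \<longlongrightarrow> y - A (M x')) (at_right 0)"
      by (intro tendsto_diff x gen1) (simp add: Mx' z)
    then have "((\<lambda>h. (1 / h) *\<^sub>R (S h x - x) - (1 / h) *\<^sub>R (S h x' - x')) \<longlongrightarrow> d) (at_right 0)"
      by (simp add: y)
    then have "((\<lambda>h. M ((1 / h) *\<^sub>R (S h x - x) - (1 / h) *\<^sub>R (S h x' - x')) \<bullet> d) \<longlongrightarrow> M d \<bullet> d) (at_right 0)"
      by (intro tendsto_intros M.tendsto)
    moreover have "\<forall>\<^sub>F h in at_right 0. M ((1 / h) *\<^sub>R (S h x - x) - (1 / h) *\<^sub>R (S h x' - x')) \<bullet> d \<le> 0"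
      unfolding eventually_at_filter
    proof (intro always_eventually allI impI)
      fix r :: real assume "r \<noteq> 0" "r \<in> {0<..}"
      then have r: "r > 0" by simp
      interpret Sr: bounded_linear "S r" by (rule blS) (use r in simp)
      have "0 \<le> \<beta> * (norm (S r d - d))\<^sup>2" using \<beta> by simp
      also have "\<dots> \<le> M (S r d - d) \<bullet> (S r d - d)" by (rule coer)
      also have "\<dots> = M (S r d) \<bullet> S r d + M d \<bullet> d - 2 * (M (S r d) \<bullet> d)"
        using sym[of d "S r d"] by (simp add: M.diff inner_diff_left inner_diff_right inner_commute)
      finally have "M (S r d) \<bullet> d \<le> M d \<bullet> d" using dissM[of r d] r by simp
      then have "(1 / r) * (M (S r d - d) \<bullet> d) \<le> 0" using r by (simp add: M.diff inner_diff_left divide_nonpos_pos)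
      moreover have "(1 / r) *\<^sub>R (S r x - x) - (1 / r) *\<^sub>R (S r x' - x') = (1 / r) *\<^sub>R (S r d - d)"
        by (simp add: d_def Sr.diff algebra_simps)
      ultimately show "M ((1 / r) *\<^sub>R (S r x - x) - (1 / r) *\<^sub>R (S r x' - x')) \<bullet> d \<le> 0"
        by (simp add: M.scaleR)
    qed
    ultimately have "M d \<bullet> d \<le> 0" by (rule tendsto_upperbound) (rule trivial_limit_at_right_real)
    then have "\<beta> * (norm d)\<^sup>2 \<le> 0" using coer[of d] by simp
    then have "d = 0" using \<beta> by (simp add: mult_le_0_iff)
    then show ?thesis using Mx' z by (simp add: d_def)
  qed
  have "is_generator {x. M x \<in> D} (\<lambda>x. A (M x)) S"
    unfolding is_generator_def using gen1 gen2 by blast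
  then show ?thesis unfolding generates_C0_semigroup_def using C0 by blast
qed


section \<open>The perturbed system\<close>

lemma at_within_Ici_nontrivial: "0 \<le> t \<Longrightarrow> at t within {0..} \<noteq> bot" for t :: real
proof -
  assume "0 \<le> t"
  then have "at t within {t<..} \<le> at t within {0..}" by (intro at_le) auto
  then show ?thesis using trivial_limit_at_right_real[of t] by (metis bot.extremum_uniqueI)
qed

text \<open>One-sided at 0; it is the derivative that appears in the solution formula.\<close>

abbreviation deriv0 :: "(real \<Rightarrow> 'a::real_normed_vector) \<Rightarrow> real \<Rightarrow> 'a" where
  "deriv0 f t \<equiv> vector_derivative f (at t within {0..})"

lemma deriv0_eq: "0 \<le> t \<Longrightarrow> (f has_vector_derivative d) (at t within {0..}) \<Longrightarrow> deriv0 f t = d"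
  using vector_derivative_within at_within_Ici_nontrivial by blast

lemma Ck_on_cong:
  assumes "\<And>t. t \<in> S \<Longrightarrow> f t = g t" shows "Ck_on k S f \<longleftrightarrow> Ck_on k S g"
proof (cases k)
  case 0
  then show ?thesis using continuous_on_cong[OF refl assms] by simp
next
  case (Suc m)
  have "(f has_vector_derivative d) (at t within S) \<longleftrightarrow> (g has_vector_derivative d) (at t within S)" if "t \<in> S" for t d
    using has_vector_derivative_transform[OF that, of f g] has_vector_derivative_transform[OF that, of g f] assms by auto
  then show ?thesis using Suc by auto
qed

lemma Ck_on_SucD:
  assumes "Ck_on (Suc k) {0..} f"
  shows "0 \<le> t \<Longrightarrow> (f has_vector_derivative deriv0 f t) (at t within {0..})" "Ck_on k {0..} (deriv0 f)"
proof -
  obtain f' where f': "\<And>t. t \<in> {0..} \<Longrightarrow> (f has_vector_derivative f' t) (at t within {0..})" "Ck_on k {0..} f'"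
    using assms by auto
  have eq: "f' t = deriv0 f t" if "t \<in> {0..}" for t using deriv0_eq[OF _ f'(1)] that by simp
  show "0 \<le> t \<Longrightarrow> (f has_vector_derivative deriv0 f t) (at t within {0..})" using f'(1)[of t] eq[of t] by simp
  show "Ck_on k {0..} (deriv0 f)" using Ck_on_cong[of "{0..}" f' "deriv0 f", OF eq] f'(2) by simp
qed

lemma strong_C1_of_Ck:
  fixes T :: "real \<Rightarrow> 'a::banach \<Rightarrow> 'b::real_normed_vector"
  assumes "\<And>t. 0 \<le> t \<Longrightarrow> bounded_linear (T t)" "\<And>x. Ck_on 1 {0..} (\<lambda>t. T t x)"
  shows "strong_C1 {0..} T (\<lambda>t x. deriv0 (\<lambda>t. T t x) t)"
proof (rule strong_C1_I)
  have *: "Ck_on (Suc 0) {0..} (\<lambda>t. T t x)" for x using assms(2) by simp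
  show "continuous_on {0..} (deriv0 (\<lambda>t. T t x))" for x using Ck_on_SucD(2)[OF *] by simp
  show "((\<lambda>t. T t x) has_vector_derivative deriv0 (\<lambda>t. T t x) t) (at t within {0..})" if "t \<in> {0..}" for x t
    using Ck_on_SucD(1)[OF *] that by simp
qed (use assms at_within_Ici_nontrivial in auto)

text \<open>Regularity of the orbits suffices: both derivative families are linear and bounded as
  limits of difference quotients.\<close>

lemma strong_C2_of_Ck:
  fixes T :: "real \<Rightarrow> 'a::banach \<Rightarrow> 'b::real_normed_vector"
  assumes lin: "\<And>t. 0 \<le> t \<Longrightarrow> bounded_linear (T t)" and C2: "\<And>x. Ck_on 2 {0..} (\<lambda>t. T t x)"
  obtains T' T'' where "strong_C1 {0..} T T'" "strong_C1 {0..} T' T''"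
proof -
  have *: "Ck_on (Suc (Suc 0)) {0..} (\<lambda>t. T t x)" for x using C2[of x] by (simp only: numeral_2_eq_2)
  have C1: "Ck_on 1 {0..} (\<lambda>t. deriv0 (\<lambda>t. T t x) t)" for x using Ck_on_SucD(2)[OF *] by simp
  have c1: "Ck_on 1 {0..} (\<lambda>t. T t x)" for x
  proof -
    have "continuous_on {0..} (deriv0 (\<lambda>t. T t x))"
      by (rule continuous_on_vector_derivative) (use Ck_on_SucD(1)[of 0 "deriv0 (\<lambda>t. T t x)"] Ck_on_SucD(2)[OF *] in auto)
    then show ?thesis using Ck_on_SucD(1)[OF *, of _ x] unfolding One_nat_def Ck_on.simps
      by (intro exI[of _ "deriv0 (\<lambda>t. T t x)"]) simp
  qed
  have S: "strong_C1 {0..} T (\<lambda>t x. deriv0 (\<lambda>t. T t x) t)" by (rule strong_C1_of_Ck[OF lin c1])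
  have "strong_C1 {0..} (\<lambda>t x. deriv0 (\<lambda>t. T t x) t) (\<lambda>t x. deriv0 (\<lambda>t. deriv0 (\<lambda>t. T t x) t) t)"
    by (rule strong_C1_of_Ck[OF _ C1]) (use strong_C1D(5)[OF S] in auto)
  with S show ?thesis by (rule that)
qed

lemma Ck2_apply:
  fixes T :: "real \<Rightarrow> 'a::banach \<Rightarrow> 'b::banach"
  assumes T: "strong_C1 {0..} T T'" and T': "strong_C1 {0..} T' T''" and u: "Ck_on 2 {0..} u"
  shows "Ck_on 2 {0..} (\<lambda>t. T t (u t))"
proof -
  have *: "Ck_on (Suc (Suc 0)) {0..} u" using u by (simp only: numeral_2_eq_2)
  let ?u' = "deriv0 u" let ?u'' = "deriv0 ?u'"
  have du: "(u has_vector_derivative ?u' t) (at t within {0..})" if "t \<in> {0..}" for t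
    using Ck_on_SucD(1)[OF *] that by simp
  have ddu: "(?u' has_vector_derivative ?u'' t) (at t within {0..})" if "t \<in> {0..}" for t
    using Ck_on_SucD(1)[OF Ck_on_SucD(2)[OF *]] that by simp
  have cu'': "continuous_on {0..} ?u''" using Ck_on_SucD(2)[OF Ck_on_SucD(2)[OF *]] by simp
  have cu: "continuous_on {0..} u" "continuous_on {0..} ?u'"
    using continuous_on_vector_derivative[of "{0..}" u, OF du] continuous_on_vector_derivative[of "{0..}" ?u', OF ddu]
    by simp_all
  note sc = strongly_cont_apply[OF _ closed_atLeast]
  have c: "continuous_on {0..} (\<lambda>t. (T'' t (u t) + T' t (?u' t)) + (T' t (?u' t) + T t (?u'' t)))"
    by (rule continuous_on_add[OF continuous_on_add[OF sc[OF strong_C1D(2)[OF T'] cu(1)] sc[OF strong_C1D(3)[OF T'] cu(2)]]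
      continuous_on_add[OF sc[OF strong_C1D(3)[OF T'] cu(2)] sc[OF strong_C1D(3)[OF T] cu'']]])
  have d1: "((\<lambda>t. T t (u t)) has_vector_derivative T' t (u t) + T t (?u' t)) (at t within {0..})" if "t \<in> {0..}" for t
    by (rule strong_C1_apply[OF T closed_atLeast that du[OF that]])
  have d2: "((\<lambda>t. T' t (u t) + T t (?u' t)) has_vector_derivative
      (T'' t (u t) + T' t (?u' t)) + (T' t (?u' t) + T t (?u'' t))) (at t within {0..})" if "t \<in> {0..}" for t
    by (rule has_vector_derivative_add[OF strong_C1_apply[OF T' closed_atLeast that du[OF that]]
          strong_C1_apply[OF T closed_atLeast that ddu[OF that]]])
  show ?thesis unfolding numeral_2_eq_2 Ck_on.simps
    by (rule exI[of _ "\<lambda>t. T' t (u t) + T t (?u' t)"], rule conjI, rule ballI, erule d1,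
        rule exI[of _ "\<lambda>t. (T'' t (u t) + T' t (?u' t)) + (T' t (?u' t) + T t (?u'' t))"],
        rule conjI, rule ballI, erule d2, rule c)
qed

lemma strong_C1_const: "bounded_linear L \<Longrightarrow> strong_C1 {0..} (\<lambda>_. L) (\<lambda>_ _. 0)"
  by (auto simp: strong_C1_def strongly_cont_def)

lemma strong_C1_minus:
  assumes "strong_C1 S T T'" shows "strong_C1 S (\<lambda>t x. - T t x) (\<lambda>t x. - T' t x)"
  using assms strongly_cont_minus unfolding strong_C1_def
  by (auto intro!: bounded_linear_minus has_vector_derivative_minus)

lemma strongly_cont_cong:
  assumes "strongly_cont S T" and eq: "\<And>t x. t \<in> S \<Longrightarrow> T t x = R t x"
  shows "strongly_cont S R"
  unfolding strongly_cont_def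
proof (intro conjI ballI allI)
  fix t assume t: "t \<in> S"
  have "T t = R t" using eq[OF t] by auto
  then show "bounded_linear (R t)" using strongly_contD(1)[OF assms(1) t] by simp
next
  fix x show "continuous_on S (\<lambda>t. R t x)"
    using strongly_contD(2)[OF assms(1), of x] continuous_on_cong[OF refl eq, of S "\<lambda>t. t" "\<lambda>_. x"] by simp
qed

lemma K_linear_comp:
  assumes M: "bdd_op K X X M" and T: "K_linear_on K X Y D T"
  shows "K_linear_on K X Y {x. M x \<in> D} (\<lambda>x. T (M x))"
proof -
  interpret bounded_linear M using M by (simp add: bdd_op_def)
  show ?thesis using T M by (auto simp: K_linear_on_def K_subspace_def bdd_op_def add zero)
qed

lemma graph_bounded_pos:
  assumes "graph_bounded D A T"
  obtains c where "c \<ge> 0" "\<And>x. x \<in> D \<Longrightarrow> norm (T x) \<le> c * (norm x + norm (A x))"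
proof -
  obtain c where c: "\<forall>x\<in>D. norm (T x) \<le> c * (norm x + norm (A x))" using assms by (auto simp: graph_bounded_def)
  have "norm (T x) \<le> \<bar>c\<bar> * (norm x + norm (A x))" if "x \<in> D" for x
  proof -
    have "c * (norm x + norm (A x)) \<le> \<bar>c\<bar> * (norm x + norm (A x))" by (rule mult_right_mono) auto
    then show ?thesis using c that by fastforce
  qed
  then show ?thesis using that[of "\<bar>c\<bar>"] by simp
qed

section \<open>Reduction of the boundary control system to the hyperbolic setting\<close>

locale perturbed_system =
  fixes K :: "complex set"
    and X :: "'x::{real_inner,banach} hilbert_structure"
    and U :: "'u::{real_inner,banach} hilbert_structure"
    and Y :: "'y::{real_inner,banach} hilbert_structure"
    and D :: "'x set" and A :: "real \<Rightarrow> 'x \<Rightarrow> 'x"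
    and DB :: "'x set" and B :: "'x \<Rightarrow> 'u"
    and C :: "'x \<Rightarrow> 'y"
    and Bt :: "real \<Rightarrow> 'u \<Rightarrow> 'x"
    and M :: "real \<Rightarrow> 'x \<Rightarrow> 'x"
  assumes X: "hilbert_over K X" and U: "hilbert_over K U" and Y: "hilbert_over K Y"
    and bco: "\<And>t. 0 \<le> t \<Longrightarrow> bco_system K X U Y D (A t) DB B C"
    and lifting: "\<And>t. 0 \<le> t \<Longrightarrow> is_lifting K X U D (A t) B (Bt t)"
    and M_bdd: "\<And>t. 0 \<le> t \<Longrightarrow> bdd_op K X X (M t)"
    and M_sa: "selfadjoint_valued X M" and M_uc: "uniformly_coercive X M"
    and M_C2: "\<And>x. Ck_on 2 {0..} (\<lambda>t. M t x)"
    and A_C1: "strongly_C1 D A"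
    and A_contr: "\<And>t. 0 \<le> t \<Longrightarrow> generates_contraction_C0_semigroup K X (main_domain D B) (A t)"
    and Bt_C2: "\<And>u. Ck_on 2 {0..} (\<lambda>t. Bt t u)"
begin

abbreviation "D\<^sub>0 \<equiv> main_domain D B"

lemma K_lin: "0 \<le> t \<Longrightarrow> K_linear_on K X X D (A t)" "K_linear_on K X U DB B" "K_linear_on K X Y D C" "D \<subseteq> DB"
  "0 \<le> t \<Longrightarrow> graph_bounded D (A t) C"
  using bco[of t] bco[of 0] by (simp_all add: bco_system_def)

lemmas A_add = K_linear_real(2)[OF X X K_lin(1)] and A_diff = K_linear_real(3)[OF X X K_lin(1)]
  and A_scale = K_linear_real(1)[OF X X K_lin(1)]
  and C_add = K_linear_real(2)[OF X Y K_lin(3)] and C_diff = K_linear_real(3)[OF X Y K_lin(3)]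
  and C_scale = K_linear_real(1)[OF X Y K_lin(3)]
  and D_sub = K_linear_real(4)[OF X Y K_lin(3)]

lemma B_add: "x \<in> D \<Longrightarrow> y \<in> D \<Longrightarrow> B (x + y) = B x + B y" and B_diff: "x \<in> D \<Longrightarrow> y \<in> D \<Longrightarrow> B (x - y) = B x - B y"
  using K_linear_real(2,3)[OF X U K_lin(2), of x y] K_lin(4) by auto

lemma D\<^sub>0D: "x \<in> D\<^sub>0 \<Longrightarrow> x \<in> D" "x \<in> D\<^sub>0 \<Longrightarrow> B x = 0" and D\<^sub>0I: "x \<in> D \<Longrightarrow> B x = 0 \<Longrightarrow> x \<in> D\<^sub>0"
  by (auto simp: main_domain_def)

lemma D\<^sub>0_diff: "x \<in> D \<Longrightarrow> y \<in> D \<Longrightarrow> B x = B y \<Longrightarrow> x - y \<in> D\<^sub>0"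
  using B_diff[of x y] subspace_diff[OF D_sub] by (auto intro: D\<^sub>0I)

lemma K_linear_D\<^sub>0: "0 \<le> t \<Longrightarrow> K_linear_on K X X D\<^sub>0 (A t)"
proof -
  assume t: "0 \<le> t"
  have B: "\<forall>x\<in>DB. \<forall>y\<in>DB. B (x + y) = B x + B y" "\<forall>c\<in>K. \<forall>x\<in>DB. B (smul X c x) = smul U c (B x)"
    using K_lin(2) by (simp_all add: K_linear_on_def)
  have A: "K_subspace K X D" "\<forall>x\<in>D. \<forall>y\<in>D. A t (x + y) = A t x + A t y" "\<forall>c\<in>K. \<forall>x\<in>D. A t (smul X c x) = smul X c (A t x)"
    using K_lin(1)[OF t] by (simp_all add: K_linear_on_def)
  have s0: "smul U c 0 = 0" if "c \<in> K" for c
    by (rule linear_0[OF bounded_linear.axioms(1)[OF smul_bounded[OF U that]]])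
  have B0: "B 0 = 0" using B_add[of 0 0] subspace_0[OF D_sub] by simp
  have "K_subspace K X D\<^sub>0"
    using A(1) B B0 s0 K_lin(4) unfolding K_subspace_def main_domain_def
    by (auto simp: subset_iff)
  then show ?thesis using A(2,3) unfolding K_linear_on_def main_domain_def by blast
qed

definition A' where "A' t x = deriv0 (\<lambda>t. A t x) t"

lemma A_deriv:
  assumes "x \<in> D"
  shows "0 \<le> t \<Longrightarrow> ((\<lambda>t. A t x) has_vector_derivative A' t x) (at t within {0..})" "continuous_on {0..} (\<lambda>t. A' t x)"
proof -
  have "Ck_on (Suc 0) {0..} (\<lambda>t. A t x)" using A_C1 assms by (simp add: strongly_C1_def)
  from Ck_on_SucD[OF this] show "0 \<le> t \<Longrightarrow> ((\<lambda>t. A t x) has_vector_derivative A' t x) (at t within {0..})"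
    "continuous_on {0..} (\<lambda>t. A' t x)" unfolding A'_def by simp_all
qed

text \<open>A time whose graph norm bounds all \<open>A t\<close>. This graph norm is the fixed norm
  on \<open>D\<close>, and the lifting at this time serves as a fixed lifting.\<close>

definition \<rho> where "\<rho> = (SOME r. r \<ge> 0 \<and> (\<forall>t\<ge>0. graph_bounded D (A r) (A t)))"

lemma \<rho>: "\<rho> \<ge> 0" "0 \<le> t \<Longrightarrow> graph_bounded D (A \<rho>) (A t)"
proof -
  have "\<exists>r. r \<ge> 0 \<and> (\<forall>t\<ge>0. graph_bounded D (A r) (A t))" using A_C1 by (auto simp: strongly_C1_def)
  then have "\<rho> \<ge> 0 \<and> (\<forall>t\<ge>0. graph_bounded D (A \<rho>) (A t))" unfolding \<rho>_def by (rule someI_ex)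
  then show "\<rho> \<ge> 0" "0 \<le> t \<Longrightarrow> graph_bounded D (A \<rho>) (A t)" by auto
qed

lemma md: "0 \<le> t \<Longrightarrow> max_dissipative D\<^sub>0 (A t)"
  by (rule contraction_generator_max_dissipative[OF A_contr])

text \<open>On \<open>D\<^sub>0\<close>, with S = (I - A \<rho>)^-1, the operators E t = (I - A t) S
  and F t = (I - A \<rho>) (I - A t)^-1 are inverse to each other. They replace operators on
  \<open>D\<close> with its graph norm by bounded operators on the whole space, where strong
  differentiability of inverses is available; S composed with \<open>F t\<close> is the resolvent of
  \<open>A t\<close>.\<close>

definition S where "S = resolvent D\<^sub>0 (A \<rho>) 1"
definition F where "F t y = resolvent D\<^sub>0 (A t) 1 y - A \<rho> (resolvent D\<^sub>0 (A t) 1 y)"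
definition E where "E t y = S y - A t (S y)"
definition E' where "E' t y = - A' t (S y)"

lemma S_props: "S y \<in> D\<^sub>0" "A \<rho> (S y) = S y - y" "norm (S y) \<le> norm y" "bounded_linear S"
  "x \<in> D\<^sub>0 \<Longrightarrow> S (x - A \<rho> x) = x"
proof -
  interpret m: max_dissipative "D\<^sub>0" "A \<rho>" by (rule md[OF \<rho>(1)])
  show "S y \<in> D\<^sub>0" "norm (S y) \<le> norm y" "bounded_linear S"
    unfolding S_def by (simp_all add: m.R_in m.norm_R_le m.bounded_linear_R)
  show "A \<rho> (S y) = S y - y" using m.R_eq[of 1 y] unfolding S_def by (simp add: algebra_simps)
  show "x \<in> D\<^sub>0 \<Longrightarrow> S (x - A \<rho> x) = x" unfolding S_def by (rule m.R_unique) simp_all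
qed

lemma bounded_linear_comp_S:
  fixes T :: "'x \<Rightarrow> 'b::real_normed_vector"
  assumes "graph_bounded D (A \<rho>) T" "\<And>x y. x \<in> D \<Longrightarrow> y \<in> D \<Longrightarrow> T (x + y) = T x + T y"
    "\<And>c x. x \<in> D \<Longrightarrow> T (c *\<^sub>R x) = c *\<^sub>R T x"
  shows "bounded_linear (\<lambda>y. T (S y))"
proof -
  obtain c where c: "c \<ge> 0" "\<And>x. x \<in> D \<Longrightarrow> norm (T x) \<le> c * (norm x + norm (A \<rho> x))"
    using graph_bounded_pos[OF assms(1)] by metis
  interpret S: bounded_linear S by (rule S_props)
  have SD: "S y \<in> D" for y using S_props(1) D\<^sub>0D by blast
  show ?thesis
  proof (rule bounded_linear_intro[of _ "c * 3"])
    show "T (S (x + y)) = T (S x) + T (S y)" for x y by (simp add: S.add assms(2) SD)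
    show "T (S (r *\<^sub>R x)) = r *\<^sub>R T (S x)" for r x by (simp add: S.scaleR assms(3) SD)
    fix y
    have "norm (S y) + norm (A \<rho> (S y)) \<le> 3 * norm y"
      using S_props(3)[of y] norm_triangle_ineq4[of "S y" y] unfolding S_props(2) by linarith
    then have "c * (norm (S y) + norm (A \<rho> (S y))) \<le> c * (3 * norm y)" using c(1) by (rule mult_left_mono)
    then show "norm (T (S y)) \<le> norm y * (c * 3)" using c(2)[OF SD, of y] by (simp add: algebra_simps)
  qed
qed

text \<open>The lifting is bounded into the graph norm at \<rho>, since
  \<open>A \<rho> (Bt \<rho> v)\<close> is bounded in v.\<close>

lemma bounded_linear_comp_lifting:
  fixes T :: "'x \<Rightarrow> 'b::real_normed_vector"
  assumes "graph_bounded D (A \<rho>) T" "\<And>x y. x \<in> D \<Longrightarrow> y \<in> D \<Longrightarrow> T (x + y) = T x + T y"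
    "\<And>c x. x \<in> D \<Longrightarrow> T (c *\<^sub>R x) = c *\<^sub>R T x"
  shows "bounded_linear (\<lambda>v. T (Bt \<rho> v))"
proof -
  obtain c where c: "c \<ge> 0" "\<And>x. x \<in> D \<Longrightarrow> norm (T x) \<le> c * (norm x + norm (A \<rho> x))"
    using graph_bounded_pos[OF assms(1)] by metis
  have L: "bounded_linear (Bt \<rho>)" "\<And>v. Bt \<rho> v \<in> D" "bounded_linear (\<lambda>v. A \<rho> (Bt \<rho> v))"
    using lifting[OF \<rho>(1)] by (auto simp: is_lifting_def bdd_op_def)
  interpret L: bounded_linear "Bt \<rho>" by (rule L)
  interpret AL: bounded_linear "\<lambda>v. A \<rho> (Bt \<rho> v)" by (rule L)
  obtain b1 where b1: "\<And>v. norm (Bt \<rho> v) \<le> norm v * b1" using L.bounded by blast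
  obtain b2 where b2: "\<And>v. norm (A \<rho> (Bt \<rho> v)) \<le> norm v * b2" using AL.bounded by blast
  show ?thesis
  proof (rule bounded_linear_intro[of _ "c * (b1 + b2)"])
    show "T (Bt \<rho> (x + y)) = T (Bt \<rho> x) + T (Bt \<rho> y)" for x y by (simp add: L.add assms(2) L(2))
    show "T (Bt \<rho> (r *\<^sub>R x)) = r *\<^sub>R T (Bt \<rho> x)" for r x by (simp add: L.scaleR assms(3) L(2))
    fix v
    have "c * (norm (Bt \<rho> v) + norm (A \<rho> (Bt \<rho> v))) \<le> c * (norm v * b1 + norm v * b2)"
      using c(1) b1 b2 by (intro mult_left_mono add_mono)
    then show "norm (T (Bt \<rho> v)) \<le> norm v * (c * (b1 + b2))" using c(2)[OF L(2), of v] by (simp add: algebra_simps)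
  qed
qed

lemma E_C1: "strong_C1 {0..} E E'"
proof (rule strong_C1_I)
  interpret S: bounded_linear S by (rule S_props)
  have SD: "S y \<in> D" for y using S_props(1) D\<^sub>0D by blast
  fix t :: real assume t: "t \<in> {0..}"
  have "bounded_linear (\<lambda>y. A t (S y))"
    by (rule bounded_linear_comp_S[OF \<rho>(2)]) (use t A_add A_scale in auto)
  then show "bounded_linear (E t)" unfolding E_def by (intro bounded_linear_sub S_props)
  show "((\<lambda>t. E t x) has_vector_derivative E' t x) (at t within {0..})" for x
  proof -
    have "((\<lambda>t. A t (S x)) has_vector_derivative A' t (S x)) (at t within {0..})"
      by (rule A_deriv(1)[OF SD]) (use t in simp)
    from has_vector_derivative_diff[OF has_vector_derivative_const this, of "S x"]
    show ?thesis by (simp add: E_def E'_def)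
  qed
next
  fix x show "continuous_on {0..} (\<lambda>t. E' t x)"
    unfolding E'_def by (intro continuous_intros A_deriv(2) D\<^sub>0D(1)[OF S_props(1)])
qed (use at_within_Ici_nontrivial in auto)

lemma SF: "0 \<le> t \<Longrightarrow> S (F t y) = resolvent D\<^sub>0 (A t) 1 y"
  unfolding F_def by (rule S_props(5)) (simp add: max_dissipative.R_in[OF md])

lemma F_cont: "strongly_cont {0..} F"
proof (rule strong_C1D(3)[OF strong_C1_inverse[OF E_C1]])
  fix t y assume "t \<in> {0::real..}"
  then have t: "0 \<le> t" by simp
  interpret m: max_dissipative "D\<^sub>0" "A t" by (rule md[OF t])
  show "E t (F t y) = y" unfolding E_def SF[OF t] using m.R_eq[of 1 y] by simp
  have "m.R 1 (E t y) = S y" unfolding E_def by (rule m.R_unique) (simp_all add: S_props)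
  then show "F t (E t y) = y" unfolding F_def by (simp add: S_props)
qed simp

text \<open>A'(I - A)^-1 equals - E' F, a product of strongly continuous families.\<close>

lemma A'_cont: "strongly_cont {0..} (\<lambda>t y. A' t (resolvent D\<^sub>0 (A t) 1 y))"
proof -
  have "strongly_cont {0..} (\<lambda>t y. - E' t (F t y))"
    by (intro strongly_cont_minus strongly_cont_compose[OF strong_C1D(2)[OF E_C1] F_cont]) simp
  moreover have "- E' t (F t y) = A' t (resolvent D\<^sub>0 (A t) 1 y)" if "t \<in> {0..}" for t y
    using SF that by (simp add: E'_def)
  ultimately show ?thesis by (rule strongly_cont_cong)
qed

lemma M_lin: "0 \<le> t \<Longrightarrow> bounded_linear (M t)" using M_bdd by (simp add: bdd_op_def)

lemma hyperbolic_ex: "\<exists>M' M'' \<beta>. hyperbolic D\<^sub>0 A A' M M' M'' \<beta>"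
proof -
  obtain M' M'' where M': "strong_C1 {0..} M M'" "strong_C1 {0..} M' M''"
    using strong_C2_of_Ck[OF M_lin M_C2] by metis
  obtain \<beta> where \<beta>: "\<beta> > 0" "\<And>t x. t \<ge> 0 \<Longrightarrow> Re (ip X (M t x) x) \<ge> \<beta> * (norm x)\<^sup>2"
    using M_uc unfolding uniformly_coercive_def by blast
  have "hyperbolic D\<^sub>0 A A' M M' M'' \<beta>"
  proof
    fix t :: real assume t: "t \<ge> 0"
    show "maximal_dissipative D\<^sub>0 (A t)" by (rule max_dissipative.md[OF md[OF t]])
    show "((\<lambda>t. A t x) has_vector_derivative A' t x) (at t within {0..})" if "x \<in> D\<^sub>0" for x
      by (rule A_deriv(1)[OF D\<^sub>0D(1)[OF that] t])
    show "M t x \<bullet> y = x \<bullet> M t y" for x y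
      using M_sa t hilbert_overD(7)[OF X] unfolding selfadjoint_valued_def by metis
    show "\<beta> * (norm x)\<^sup>2 \<le> M t x \<bullet> x" for x using \<beta>(2)[OF t, of x] hilbert_overD(7)[OF X] by simp
  qed (rule A'_cont M' \<beta>(1))+
  then show ?thesis by blast
qed

end

locale perturbed_hyperbolic = perturbed_system K X U Y D A DB B C Bt M
    + h: hyperbolic "main_domain D B" A "perturbed_system.A' A" M M' M'' \<beta>
  for K X U Y D A DB B C Bt M M' M'' \<beta>
begin

section \<open>The evolution family of the perturbed system\<close>

lemma dom_eq: "main_domain {x. M t x \<in> D} (\<lambda>x. B (M t x)) = {x. M t x \<in> D\<^sub>0}"
  by (auto simp: main_domain_def)

lemma N_bdd: "0 \<le> t \<Longrightarrow> bdd_op K X X (h.N t)"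
proof -
  assume t: "0 \<le> t"
  have "h.N t (smul X c x) = smul X c (h.N t x)" if "c \<in> K" for c x
  proof -
    have "M t (smul X c (h.N t x)) = smul X c x" using M_bdd[OF t] that h.MN[OF t] by (simp add: bdd_op_def)
    then show ?thesis using h.NM[OF t] by metis
  qed
  then show ?thesis using h.N_lin[of t] t by (simp add: bdd_op_def)
qed

lemma W_K_linear:
  assumes "0 \<le> s" "s \<le> t" "c \<in> K" shows "h.W t s (smul X c x) = smul X c (h.W t s x)"
proof (rule h.W_commute[OF assms(1,2) smul_bounded[OF X assms(3)]])
  show "smul X c x \<in> D\<^sub>0" if "x \<in> D\<^sub>0" for x
    using K_linear_D\<^sub>0[of 0] that assms(3) by (simp add: K_linear_on_def K_subspace_def)
  show "A t (smul X c x) = smul X c (A t x)" if "t \<ge> 0" "x \<in> D\<^sub>0" for t x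
    using K_linear_D\<^sub>0[of t] that assms(3) by (simp add: K_linear_on_def)
  show "M t (smul X c x) = smul X c (M t x)" if "t \<ge> 0" for t x
    using M_bdd[OF that] assms(3) by (simp add: bdd_op_def)
qed

lemma W_evolution: "evolution_family K X h.W"
  unfolding evolution_family_def
proof (intro conjI allI impI)
  show "bdd_op K X X (h.W t s)" if "0 \<le> s \<and> s \<le> t" for t s
    using h.bounded_linear_W W_K_linear that by (simp add: bdd_op_def)
  show "continuous_on {(t, s). 0 \<le> s \<and> s \<le> t} (\<lambda>(t, s). h.W t s x)" for x
    using strongly_contD(2)[OF h.W_cont, of x] by (simp add: case_prod_beta')
  show "h.W t t = id" if "0 \<le> t" for t using h.W_self[OF that] by (simp add: fun_eq_iff)
  show "h.W t s = h.W t r \<circ> h.W r s" if "0 \<le> s \<and> s \<le> r \<and> r \<le> t" for t r s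
    using h.W_comp[of s r t] that by (simp add: fun_eq_iff)
qed

lemma AM_K_linear: "0 \<le> t \<Longrightarrow> K_linear_on K X X {x. M t x \<in> D\<^sub>0} (\<lambda>x. A t (M t x))"
  by (rule K_linear_comp[OF M_bdd K_linear_D\<^sub>0])

lemma AM_closed: "0 \<le> t \<Longrightarrow> closed_operator K X {x. M t x \<in> D\<^sub>0} (\<lambda>x. A t (M t x))"
  unfolding closed_operator_def
proof (intro conjI AM_K_linear)
  assume t: "0 \<le> t"
  interpret m: max_dissipative "D\<^sub>0" "A t" by (rule md[OF t])
  show "closed {(x, A t (M t x)) |x. x \<in> {x. M t x \<in> D\<^sub>0}}"
    unfolding closed_sequential_limits
  proof (intro allI impI, elim conjE)
    fix f l
    assume f: "\<forall>n. f n \<in> {(x, A t (M t x)) |x. x \<in> {x. M t x \<in> D\<^sub>0}}" and lim: "f \<longlonglongrightarrow> l"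
    have f': "M t (fst (f n)) \<in> D\<^sub>0" "snd (f n) = A t (M t (fst (f n)))" for n using f[rule_format, of n] by auto
    have "(\<lambda>n. M t (fst (f n))) \<longlonglongrightarrow> M t (fst l)"
      by (intro bounded_linear.tendsto[OF M_lin[OF t]] tendsto_fst lim)
    moreover have "(\<lambda>n. A t (M t (fst (f n)))) \<longlonglongrightarrow> snd l"
      using tendsto_snd[OF lim] unfolding f'(2) .
    ultimately have "M t (fst l) \<in> D\<^sub>0" "A t (M t (fst l)) = snd l"
      by (rule m.A_closed[OF f'(1)])+
    then show "l \<in> {(x, A t (M t x)) |x. x \<in> {x. M t x \<in> D\<^sub>0}}" by (auto intro!: exI[of _ "fst l"] simp: prod_eq_iff)
  qed
qed

lemma cauchy_unique:
  assumes s: "0 \<le> s" and v: "cauchy_classical_solution (\<lambda>t. {x. M t x \<in> D\<^sub>0}) (\<lambda>t x. A t (M t x)) s xs v" and t: "s \<le> t"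
  shows "v t = h.W t s xs"
proof -
  have v': "continuous_on {s..} v" "\<And>t. t \<ge> s \<Longrightarrow> M t (v t) \<in> D\<^sub>0" "v s = xs"
    "\<And>t. t > s \<Longrightarrow> (v has_vector_derivative A t (M t (v t))) (at t)"
    using v by (auto simp: cauchy_classical_solution_def)
  have "M s xs \<in> D\<^sub>0" using v' by auto
  note w = h.W_classical[OF s this]
  show ?thesis
  proof (rule h.classical_unique[where f = "\<lambda>_. 0", OF s t])
    show "continuous_on {s..t} v" by (rule continuous_on_subset[OF v'(1)]) auto
    show "continuous_on {s..t} (\<lambda>t. h.W t s xs)" by (rule continuous_on_subset[OF h.classical_cont[OF w]]) auto
    show "v s = h.W s s xs" using v' h.W_self[OF s] by simp
    fix r assume r: "s < r" "r < t"
    show "M r (v r) \<in> D\<^sub>0 \<and> (v has_vector_derivative A r (M r (v r)) + 0) (at r)" using v' r by simp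
    show "M r (h.W r s xs) \<in> D\<^sub>0 \<and> ((\<lambda>t. h.W t s xs) has_vector_derivative A r (M r (h.W r s xs)) + 0) (at r)"
      using w r at_within_Ici[OF r(1)] unfolding h.classical_def by (metis less_imp_le)
  qed
qed

lemma W_cauchy:
  assumes s: "0 \<le> s" and xs: "M s xs \<in> D\<^sub>0"
  shows "cauchy_classical_solution (\<lambda>t. {x. M t x \<in> D\<^sub>0}) (\<lambda>t x. A t (M t x)) s xs (\<lambda>t. h.W t s xs)"
proof -
  note w = h.W_classical[OF s xs]
  have der: "((\<lambda>t. h.W t s xs) has_vector_derivative A t (M t (h.W t s xs))) (at t)" if "t > s" for t
    using w that at_within_Ici[OF that] unfolding h.classical_def by (metis add.right_neutral less_imp_le)
  have "continuous_on {s<..} (\<lambda>t. A t (M t (h.W t s xs)))"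
    by (rule continuous_on_subset[of "{s..}"]) (use w in \<open>auto simp: h.classical_def\<close>)
  then have "Ck_on 1 {s<..} (\<lambda>t. h.W t s xs)"
    unfolding One_nat_def Ck_on.simps
    by (intro exI[of _ "\<lambda>t. A t (M t (h.W t s xs))"] conjI ballI has_vector_derivative_at_within[OF der]) simp
  moreover have "\<forall>t\<ge>s. M t (h.W t s xs) \<in> D\<^sub>0" using w by (simp add: h.classical_def)
  ultimately show ?thesis
    unfolding cauchy_classical_solution_def mem_Collect_eq
    by (intro conjI h.classical_cont[OF w] allI impI der h.W_self[OF s]) simp_all
qed

text \<open>The whole domains of the main operators serve as regularity spaces.\<close>

lemma W_generated:
  "generated_by K X h.W (\<lambda>t. main_domain {x. M t x \<in> D} (\<lambda>x. B (M t x))) (\<lambda>t x. A t (M t x))"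
  unfolding generated_by_def dom_eq
proof (intro conjI allI impI W_evolution AM_closed exI[of _ "\<lambda>t. {x. M t x \<in> D\<^sub>0}"] ballI order_refl)
  show "K_subspace K X {x. M t x \<in> D\<^sub>0}" if "0 \<le> t" for t using AM_K_linear[OF that] by (simp add: K_linear_on_def)
  show "closure {x. M t x \<in> D\<^sub>0} = UNIV" if "0 \<le> t" for t by (rule h.closure_domain[OF that])
qed (use W_cauchy cauchy_unique in auto)

text \<open>Any generated family solves the Cauchy problem on its own dense regularity spaces, hence
  agrees there with the constructed one, and both are bounded. Properties of the constructed family
  thus pass to every generated family.\<close>

lemma generated_eq_W:
  assumes V: "generated_by K X V (\<lambda>t. main_domain {x. M t x \<in> D} (\<lambda>x. B (M t x))) (\<lambda>t x. A t (M t x))"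
    and s: "0 \<le> s" and t: "s \<le> t"
  shows "V t s = h.W t s"
proof
  fix x
  obtain Z where Z: "\<forall>t\<ge>0. K_subspace K X (Z t) \<and> closure (Z t) = UNIV \<and> Z t \<subseteq> {x. M t x \<in> D\<^sub>0}"
    "\<forall>s\<ge>0. \<forall>xs\<in>Z s. cauchy_classical_solution (\<lambda>t. {x. M t x \<in> D\<^sub>0}) (\<lambda>t x. A t (M t x)) s xs (\<lambda>t. V t s xs)"
  proof -
    have "\<exists>Z. (\<forall>t\<ge>0. K_subspace K X (Z t) \<and> closure (Z t) = UNIV \<and> Z t \<subseteq> {x. M t x \<in> D\<^sub>0}) \<and>
      (\<forall>s\<ge>0. \<forall>xs\<in>Z s. cauchy_classical_solution (\<lambda>t. {x. M t x \<in> D\<^sub>0}) (\<lambda>t x. A t (M t x)) s xs (\<lambda>t. V t s xs) \<and>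
        (\<forall>v. cauchy_classical_solution (\<lambda>t. {x. M t x \<in> D\<^sub>0}) (\<lambda>t x. A t (M t x)) s xs v \<longrightarrow> (\<forall>t\<ge>s. v t = V t s xs)))"
      using V unfolding generated_by_def dom_eq by (elim conjE)
    then show ?thesis using that by (elim exE conjE) simp
  qed
  have "evolution_family K X V" using V by (simp only: generated_by_def)
  then have "\<forall>t s. 0 \<le> s \<and> s \<le> t \<longrightarrow> bdd_op K X X (V t s)" unfolding evolution_family_def by (elim conjE)
  then have bl: "bounded_linear (V t s)" using s t by (simp add: bdd_op_def)
  show "V t s x = h.W t s x"
  proof (rule bounded_linear_eq_dense[where f = "V t s" and g = "h.W t s" and S = "Z s", OF bl h.bounded_linear_W[OF s t]])
    show "closure (Z s) = UNIV" using Z(1) s by blast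
    show "V t s y = h.W t s y" if "y \<in> Z s" for y
      using Z(2) s that cauchy_unique[OF s _ t, of y "\<lambda>t. V t s y"] by blast
  qed
qed

theorem perturbed_nbco:
  "nbco_system K X U Y (\<lambda>t. {x. M t x \<in> D}) (\<lambda>t x. A t (M t x)) (\<lambda>t. {x. M t x \<in> DB})
     (\<lambda>t x. B (M t x)) (\<lambda>t x. C (M t x))"
  unfolding nbco_system_def
proof (intro conjI allI impI)
  show "\<exists>W. generated_by K X W (\<lambda>t. main_domain {x. M t x \<in> D} (\<lambda>x. B (M t x))) (\<lambda>t x. A t (M t x))"
    using W_generated by blast
  fix t :: real assume t: "0 \<le> t"
  have L: "bdd_op K U X (Bt t)" "\<And>u. Bt t u \<in> D" "\<And>u. B (Bt t u) = u" "bdd_op K U X (\<lambda>u. A t (Bt t u))"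
    using lifting[OF t] by (auto simp: is_lifting_def)
  show "bco_system K X U Y {x. M t x \<in> D} (\<lambda>x. A t (M t x)) {x. M t x \<in> DB} (\<lambda>x. B (M t x)) (\<lambda>x. C (M t x))"
    unfolding bco_system_def
  proof (intro conjI)
    show "K_linear_on K X X {x. M t x \<in> D} (\<lambda>x. A t (M t x))" by (rule K_linear_comp[OF M_bdd[OF t] K_lin(1)[OF t]])
    show "K_linear_on K X U {x. M t x \<in> DB} (\<lambda>x. B (M t x))" by (rule K_linear_comp[OF M_bdd[OF t] K_lin(2)])
    show "K_linear_on K X Y {x. M t x \<in> D} (\<lambda>x. C (M t x))" by (rule K_linear_comp[OF M_bdd[OF t] K_lin(3)])
    show "{x. M t x \<in> D} \<subseteq> {x. M t x \<in> DB}" using K_lin(4) by auto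
    show "generates_C0_semigroup K X (main_domain {x. M t x \<in> D} (\<lambda>x. B (M t x))) (\<lambda>x. A t (M t x))"
      unfolding dom_eq
      by (rule generates_semigroup_perturbed[OF X md[OF t] K_linear_D\<^sub>0[OF t] M_bdd[OF t] h.M_sym[OF t] h.\<beta> h.M_coercive[OF t]])
    \<comment> \<open>M cancels its inverse, so N \<open>Bt\<close> lifts the boundary operator B M,
      and A M N \<open>Bt\<close> is A \<open>Bt\<close>, which is bounded.\<close>
    have "is_lifting K X U {x. M t x \<in> D} (\<lambda>x. A t (M t x)) (\<lambda>x. B (M t x)) (\<lambda>u. h.N t (Bt t u))"
      unfolding is_lifting_def
    proof (intro conjI allI)
      show "bdd_op K U X (\<lambda>u. h.N t (Bt t u))"
        using N_bdd[OF t] L(1) bounded_linear_compose[of "h.N t" "Bt t"] by (simp add: bdd_op_def)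
    qed (use L h.MN[OF t] in auto)
    then show "\<exists>L. is_lifting K X U {x. M t x \<in> D} (\<lambda>x. A t (M t x)) (\<lambda>x. B (M t x)) L"
      by (rule exI[where x = "\<lambda>u. h.N t (Bt t u)"])
    obtain c where c: "c \<ge> 0" "\<And>x. x \<in> D \<Longrightarrow> norm (C x) \<le> c * (norm x + norm (A t x))"
      using graph_bounded_pos[OF K_lin(5)[OF t]] by metis
    obtain b where b: "b > 0" "\<And>x. norm (M t x) \<le> norm x * b"
      using bounded_linear.pos_bounded[OF M_lin[OF t]] by metis
    have "norm (C (M t x)) \<le> (c * (b + 1)) * (norm x + norm (A t (M t x)))" if "M t x \<in> D" for x
    proof -
      have "norm (M t x) + norm (A t (M t x)) \<le> (b + 1) * (norm x + norm (A t (M t x)))"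
        using b(2)[of x] mult_nonneg_nonneg[OF less_imp_le[OF b(1)] norm_ge_zero, of "A t (M t x)"]
        by (simp add: algebra_simps add_increasing2 add_increasing)
      from mult_left_mono[OF this c(1)] c(2)[OF that] show ?thesis by (simp add: mult.assoc)
    qed
    then show "graph_bounded {x. M t x \<in> D} (\<lambda>x. A t (M t x)) (\<lambda>x. C (M t x))"
      unfolding graph_bounded_def by blast
  qed
qed

section \<open>Classical solutions and the solution formula\<close>

lemma N_C1': obtains N'' where "strong_C1 {0..} h.N' N''"
proof -
  have "strong_C1 {0..} (\<lambda>t x. - h.N t (M' t (h.N t x)))
     (\<lambda>t x. - (h.N' t (M' t (h.N t x)) + h.N t (M'' t (h.N t x) + M' t (h.N' t x))))"
    by (rule strong_C1_minus[OF strong_C1_compose[OF h.N_C1 strong_C1_compose[OF h.M' h.N_C1 closed_atLeast] closed_atLeast]])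
  then show ?thesis using that unfolding h.N'_def[abs_def, symmetric] by blast
qed

lemma lifting_lin: "0 \<le> t \<Longrightarrow> bounded_linear (Bt t)" "0 \<le> t \<Longrightarrow> Bt t v \<in> D" "0 \<le> t \<Longrightarrow> B (Bt t v) = v"
  using lifting[of t] by (auto simp: is_lifting_def bdd_op_def)

text \<open>The derivative - N M' N of N is again strongly C^1, by the second derivative of M, so
  applying N preserves C^2.\<close>

lemma N_Ck2: "Ck_on 2 {0..} f \<Longrightarrow> Ck_on 2 {0..} (\<lambda>t. h.N t (f t))"
proof -
  obtain N'' where "strong_C1 {0..} h.N' N''" by (rule N_C1')
  then show "Ck_on 2 {0..} f \<Longrightarrow> Ck_on 2 {0..} (\<lambda>t. h.N t (f t))" by (rule Ck2_apply[OF h.N_C1])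
qed

lemma AL_C1: "strong_C1 {0..} (\<lambda>t v. A t (Bt \<rho> v)) (\<lambda>t v. A' t (Bt \<rho> v))"
proof (rule strong_C1_I)
  note LD = lifting_lin(2)[OF \<rho>(1)]
  show "bounded_linear (\<lambda>v. A t (Bt \<rho> v))" if "t \<in> {0..}" for t
    by (rule bounded_linear_comp_lifting[OF \<rho>(2)]) (use that A_add A_scale in auto)
  show "((\<lambda>t. A t (Bt \<rho> v)) has_vector_derivative A' t (Bt \<rho> v)) (at t within {0..})" if "t \<in> {0..}" for v t
    using A_deriv(1)[OF LD] that by simp
  show "continuous_on {0..} (\<lambda>t. A' t (Bt \<rho> v))" for v by (rule A_deriv(2)[OF LD])
qed (use at_within_Ici_nontrivial in auto)

text \<open>
  The lifting at the fixed time \<open>\<rho>\<close> is used to reduce to homogeneous boundary conditions, since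
  \<open>A t (Bt t v)\<close> need not be continuous in \<open>t\<close>, whereas \<open>A t (Bt \<rho> v)\<close> is \<open>C\<^sup>1\<close>.
\<close>

theorem classical_solution_exists:
  assumes s: "0 \<le> s" and u: "Ck_on 2 {0..} u" and xs: "M s xs \<in> D" "B (M s xs) = u s"
  obtains x where
    "classical_solution (\<lambda>t. {x. M t x \<in> D}) (\<lambda>t x. A t (M t x)) (\<lambda>t x. B (M t x)) (\<lambda>t x. C (M t x))
       s xs u x (\<lambda>t. C (M t (x t)))"
proof -
  have sub: "{s..} \<subseteq> {0..}" using s by auto
  note LD = lifting_lin(2)[OF \<rho>(1)] and BL = lifting_lin(3)[OF \<rho>(1)]
  \<comment> \<open>M p is the lifted input and has boundary value u, so x - p satisfies the
    homogeneous boundary condition.\<close>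
  define p where "p t = h.N t (Bt \<rho> (u t))" for t
  have "Ck_on 2 {0..} (\<lambda>t. Bt \<rho> (u t))"
    by (rule Ck2_apply[OF strong_C1_const[OF lifting_lin(1)[OF \<rho>(1)]] strong_C1_const u]) simp
  then have "Ck_on 2 {0..} p" unfolding p_def by (rule N_Ck2)
  then have p2: "Ck_on (Suc (Suc 0)) {0..} p" by (simp only: numeral_2_eq_2)
  have dp: "(p has_vector_derivative deriv0 p t) (at t within {s..})" if "t \<ge> s" for t
    by (rule has_vector_derivative_within_subset[OF Ck_on_SucD(1)[OF p2] sub]) (use that s in simp)
  have ddp: "(deriv0 p has_vector_derivative deriv0 (deriv0 p) t) (at t within {s..})" if "t \<ge> s" for t
    by (rule has_vector_derivative_within_subset[OF Ck_on_SucD(1)[OF Ck_on_SucD(2)[OF p2]] sub]) (use that s in simp)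
  have cddp: "continuous_on {s..} (deriv0 (deriv0 p))"
    using Ck_on_SucD(2)[OF Ck_on_SucD(2)[OF p2]] continuous_on_subset[OF _ sub] by simp
  have u2: "Ck_on (Suc (Suc 0)) {0..} u" using u by (simp only: numeral_2_eq_2)
  have du: "(u has_vector_derivative deriv0 u t) (at t within {s..})" if "t \<ge> s" for t
    by (rule has_vector_derivative_within_subset[OF Ck_on_SucD(1)[OF u2] sub]) (use that s in simp)
  have cdu: "continuous_on {s..} (deriv0 u)"
    by (rule continuous_on_vector_derivative, rule has_vector_derivative_within_subset[OF Ck_on_SucD(1)[OF Ck_on_SucD(2)[OF u2]] sub])
      (use s in auto)
  have cu: "continuous_on {s..} u" by (rule continuous_on_vector_derivative[OF du]) simp
  note sc = strongly_cont_apply[OF strongly_cont_subset[OF _ sub] closed_atLeast]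
  \<comment> \<open>The source in the equation for w = x - p, from A M x - p' = A M w + A (Bt \<rho>
    u) - p'. It is C^1, as required for classical solutions.\<close>
  define f where "f t = A t (Bt \<rho> (u t)) - deriv0 p t" for t
  define f' where "f' t = (A' t (Bt \<rho> (u t)) + A t (Bt \<rho> (deriv0 u t))) - deriv0 (deriv0 p) t" for t
  have cf': "continuous_on {s..} f'"
    unfolding f'_def
    by (rule continuous_on_diff[OF continuous_on_add[OF sc[OF strong_C1D(2)[OF AL_C1] cu] sc[OF strong_C1D(3)[OF AL_C1] cdu]] cddp])
  have df: "(f has_vector_derivative f' t) (at t within {s..})" if "t \<ge> s" for t
    unfolding f_def f'_def
    by (rule has_vector_derivative_diff[OF strong_C1_apply_subset[OF AL_C1 sub closed_atLeast _ du[OF that]] ddp[OF that]])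
      (use that in simp)
  interpret Ms: bounded_linear "M s" by (rule M_lin[OF s])
  have "M s (xs - p s) \<in> D\<^sub>0"
    using D\<^sub>0_diff[OF xs(1) LD[of "u s"]] xs(2) BL by (simp add: Ms.diff p_def h.MN[OF s])
  then obtain w where w: "h.classical s f w" "w s = xs - p s"
    by (rule h.classical_ex[OF s _ cf' df])
  define x where "x t = w t + p t" for t
  have Mx: "M t (x t) = M t (w t) + Bt \<rho> (u t)" if "t \<ge> s" for t
    using linear_add[OF bounded_linear.axioms(1)[OF M_lin[of t]]] h.MN[of t] that s by (simp add: x_def p_def)
  have wD: "M t (w t) \<in> D\<^sub>0" "M t (w t) \<in> D" if "t \<ge> s" for t
    using w(1) that D\<^sub>0D(1) by (auto simp: h.classical_def)
  have AMx: "A t (M t (x t)) = A t (M t (w t)) + A t (Bt \<rho> (u t))" if "t \<ge> s" for t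
    using A_add[of t, OF _ wD(2)[OF that] LD] Mx[OF that] that s by simp
  have dx: "(x has_vector_derivative A t (M t (x t))) (at t within {s..})" if "t \<ge> s" for t
  proof -
    have "(w has_vector_derivative A t (M t (w t)) + f t) (at t within {s..})" using w(1) that by (simp add: h.classical_def)
    from has_vector_derivative_add[OF this dp[OF that]]
    show ?thesis using AMx[OF that] by (simp add: x_def[abs_def] f_def)
  qed
  have cAw: "continuous_on {s..} (\<lambda>t. A t (M t (w t)))" using w(1) by (simp add: h.classical_def)
  have cAMx: "continuous_on {s..} (\<lambda>t. A t (M t (x t)))"
    by (rule continuous_on_cong[THEN iffD2, OF refl AMx continuous_on_add[OF cAw sc[OF strong_C1D(3)[OF AL_C1] cu]]]) simp
  \<comment> \<open>C is bounded only in the graph norm. On \<open>D\<^sub>0\<close> it is factored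
    as (C S) F (I - A): C S is bounded, F is strongly continuous, and (I - A) M w is continuous
    because w is a classical solution.\<close>
  have cC: "continuous_on {s..} (\<lambda>t. C (M t (x t)))"
  proof -
    have CS: "bounded_linear (\<lambda>y. C (S y))"
      by (rule bounded_linear_comp_S[OF K_lin(5)[OF \<rho>(1)] C_add C_scale])
    have CL: "bounded_linear (\<lambda>v. C (Bt \<rho> v))"
      by (rule bounded_linear_comp_lifting[OF K_lin(5)[OF \<rho>(1)] C_add C_scale])
    have cMw: "continuous_on {s..} (\<lambda>t. M t (w t))"
      by (rule sc[OF strong_C1D(3)[OF h.M] h.classical_cont[OF w(1)]])
    have "continuous_on {s..} (\<lambda>t. F t (M t (w t) - A t (M t (w t))))"
      by (rule sc[OF F_cont continuous_on_diff[OF cMw cAw]])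
    then have c1: "continuous_on {s..} (\<lambda>t. C (S (F t (M t (w t) - A t (M t (w t))))))"
      by (rule bounded_linear.continuous_on[OF CS])
    have eq: "C (M t (x t)) = C (S (F t (M t (w t) - A t (M t (w t))))) + C (Bt \<rho> (u t))" if "t \<in> {s..}" for t
    proof -
      have t: "t \<ge> s" "0 \<le> t" using that s by auto
      interpret m: max_dissipative "D\<^sub>0" "A t" by (rule md[OF t(2)])
      have "S (F t (M t (w t) - A t (M t (w t)))) = M t (w t)"
        unfolding SF[OF t(2)] by (rule m.R_unique) (use wD t in simp_all)
      then show ?thesis using C_add[OF wD(2)[OF t(1)] LD] Mx[OF t(1)] by simp
    qed
    show ?thesis
      by (rule continuous_on_cong[THEN iffD2, OF refl eq continuous_on_add[OF c1 bounded_linear.continuous_on[OF CL cu]]])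
  qed
  show ?thesis
  proof (rule that[of x])
    show "classical_solution (\<lambda>t. {x. M t x \<in> D}) (\<lambda>t x. A t (M t x)) (\<lambda>t x. B (M t x)) (\<lambda>t x. C (M t x))
       s xs u x (\<lambda>t. C (M t (x t)))"
      unfolding classical_solution_def
    proof (intro conjI allI impI refl cC)
      show "Ck_on 1 {s..} x" using dx cAMx by (auto intro!: exI[of _ "\<lambda>t. A t (M t (x t))"])
      show "x s = xs" using w(2) by (simp add: x_def)
      fix t assume t: "s \<le> t"
      show "x t \<in> {x. M t x \<in> D}" using Mx[OF t] wD(2)[OF t] LD subspace_add[OF D_sub] by simp
      show "(x has_vector_derivative A t (M t (x t))) (at t within {s..})" by (rule dx[OF t])
      show "B (M t (x t)) = u t" using Mx[OF t] B_add[OF wD(2)[OF t] LD] D\<^sub>0D(2)[OF wD(1)[OF t]] BL by simp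
    qed
  qed
qed

abbreviation "classical_solution\<^sub>M \<equiv>
  classical_solution (\<lambda>t. {x. M t x \<in> D}) (\<lambda>t x. A t (M t x)) (\<lambda>t x. B (M t x)) (\<lambda>t x. C (M t x))"

lemma classical_solutionD:
  assumes "classical_solution\<^sub>M s xs u x y"
  shows "x s = xs" "t \<ge> s \<Longrightarrow> M t (x t) \<in> D" "t \<ge> s \<Longrightarrow> B (M t (x t)) = u t" "t \<ge> s \<Longrightarrow> C (M t (x t)) = y t"
    "t \<ge> s \<Longrightarrow> (x has_vector_derivative A t (M t (x t))) (at t within {s..})" "continuous_on {s..} x" "continuous_on {s..} y"
proof -
  show "x s = xs" "t \<ge> s \<Longrightarrow> M t (x t) \<in> D" "t \<ge> s \<Longrightarrow> B (M t (x t)) = u t" "t \<ge> s \<Longrightarrow> C (M t (x t)) = y t" "continuous_on {s..} y"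
    using assms by (auto simp: classical_solution_def)
  show d: "t \<ge> s \<Longrightarrow> (x has_vector_derivative A t (M t (x t))) (at t within {s..})" for t
    using assms by (auto simp: classical_solution_def)
  show "continuous_on {s..} x" by (rule continuous_on_vector_derivative[OF d]) simp
qed

text \<open>The integrand with \<open>A r (Bt r (u r))\<close> is not known to be continuous, so it
  is not integrated by itself: the fundamental theorem yields the integral of the difference, and
  the integral of the other term is obtained separately. The domain statements are what allow C M to
  be distributed over the formula.\<close>

theorem variation_of_constants:
  assumes s: "0 \<le> s" and u: "Ck_on 2 {0..} u" and x: "classical_solution\<^sub>M s xs u x y" and t: "s \<le> t"
  defines "b \<equiv> \<lambda>r. h.N r (Bt r (u r))"
  shows "((\<lambda>r. h.W t r (A r (Bt r (u r))) - h.W t r (deriv0 b r)) has_integral (x t - b t - h.W t s (xs - b s))) {s..t}"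
    "(\<lambda>r. h.W t r (deriv0 b r)) integrable_on {s..t}"
    "M t (integral {s..t} (\<lambda>r. h.W t r (deriv0 b r))) \<in> D\<^sub>0"
    "M t (h.W t s (xs - b s)) \<in> D\<^sub>0" "M t (x t - b t) \<in> D\<^sub>0"
proof -
  have sub: "{s..} \<subseteq> {0..}" using s by auto
  note c = classical_solutionD[OF x]
  obtain Bt' Bt'' where Bt': "strong_C1 {0..} Bt Bt'" "strong_C1 {0..} Bt' Bt''"
    using strong_C2_of_Ck[OF lifting_lin(1) Bt_C2] by metis
  have "Ck_on 2 {0..} b" unfolding b_def by (rule N_Ck2[OF Ck2_apply[OF Bt' u]])
  then have b2: "Ck_on (Suc (Suc 0)) {0..} b" by (simp only: numeral_2_eq_2)
  have Mb: "M r (b r) = Bt r (u r)" if "0 \<le> r" for r by (simp add: b_def h.MN[OF that])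
  have xb: "M r (x r - b r) \<in> D\<^sub>0" "M r (x r - b r) = M r (x r) - Bt r (u r)" if r: "s \<le> r" for r
  proof -
    have r0: "0 \<le> r" using r s by simp
    show "M r (x r - b r) = M r (x r) - Bt r (u r)"
      using linear_diff[OF bounded_linear.axioms(1)[OF M_lin[OF r0]]] Mb[OF r0] by simp
    then show "M r (x r - b r) \<in> D\<^sub>0"
      using D\<^sub>0_diff[OF c(2)[OF r] lifting_lin(2)[OF r0]] c(3)[OF r] lifting_lin(3)[OF r0] by simp
  qed
  show "M t (x t - b t) \<in> D\<^sub>0" by (rule xb(1)[OF t])
  have ddb: "(deriv0 b has_vector_derivative deriv0 (deriv0 b) r) (at r within {s..})" if "r \<ge> s" for r
    by (rule has_vector_derivative_within_subset[OF Ck_on_SucD(1)[OF Ck_on_SucD(2)[OF b2]] sub]) (use that s in simp)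
  have cddb: "continuous_on {s..} (deriv0 (deriv0 b))"
    using Ck_on_SucD(2)[OF Ck_on_SucD(2)[OF b2]] continuous_on_subset[OF _ sub] by simp
  show "(\<lambda>r. h.W t r (deriv0 b r)) integrable_on {s..t}"
    "M t (integral {s..t} (\<lambda>r. h.W t r (deriv0 b r))) \<in> D\<^sub>0"
    by (rule h.W_integral[OF s t cddb ddb]; assumption)+
  have "M s (xs - b s) \<in> D\<^sub>0" using xb(1)[OF order_refl] c(1) by simp
  then show "M t (h.W t s (xs - b s)) \<in> D\<^sub>0" using h.W_classical[OF s] t by (simp add: h.classical_def)
  have "((\<lambda>r. h.W t r (A r (Bt r (u r))) - h.W t r (deriv0 b r)) has_integral (h.W t t (x t - b t) - h.W t s (x s - b s))) {s..t}"
  proof (rule fundamental_theorem_of_calculus[OF t])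
    fix r assume r: "r \<in> {s..t}"
    then have r': "s \<le> r" "0 \<le> r" "r \<le> t" using s by auto
    have "(x has_vector_derivative A r (M r (x r))) (at r within {s..t})"
      by (rule has_vector_derivative_within_subset[OF c(5)[OF r'(1)]]) auto
    moreover have "(b has_vector_derivative deriv0 b r) (at r within {s..t})"
      by (rule has_vector_derivative_within_subset[OF Ck_on_SucD(1)[OF b2 r'(2)]]) (use s in auto)
    ultimately have d: "((\<lambda>r. x r - b r) has_vector_derivative A r (M r (x r)) - deriv0 b r) (at r within {s..t})"
      by (rule has_vector_derivative_diff)
    have "((\<lambda>r. h.W t r (x r - b r)) has_vector_derivative
        h.W t r (A r (M r (x r)) - deriv0 b r - A r (M r (x r - b r)))) (at r within {s..t})"
      by (rule h.duhamel_W[where p = "\<lambda>r. x r - b r", OF r _ _ d xb(1)[OF r'(1)]]) (use s in auto)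
    moreover have "A r (M r (x r)) - deriv0 b r - A r (M r (x r - b r)) = A r (Bt r (u r)) - deriv0 b r"
      using A_diff[OF r'(2) c(2)[OF r'(1)] lifting_lin(2)[OF r'(2)]] xb(2)[OF r'(1)] by simp
    ultimately show "((\<lambda>r. h.W t r (x r - b r)) has_vector_derivative
        h.W t r (A r (Bt r (u r))) - h.W t r (deriv0 b r)) (at r within {s..t})"
      using linear_diff[OF bounded_linear.axioms(1)[OF h.bounded_linear_W[OF r'(2,3)]]] by simp
  qed
  moreover have "h.W t t (x t - b t) = x t - b t" by (rule h.W_self) (use s t in simp)
  ultimately show "((\<lambda>r. h.W t r (A r (Bt r (u r))) - h.W t r (deriv0 b r)) has_integral (x t - b t - h.W t s (xs - b s))) {s..t}"
    using c(1) by simp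
qed

text \<open>The difference of two solutions has boundary value zero, hence solves the homogeneous
  equation of the main operators.\<close>

lemma classical_solution_unique:
  assumes s: "0 \<le> s" and x1: "classical_solution\<^sub>M s xs u x1 y1" and x2: "classical_solution\<^sub>M s xs u x2 y2" and t: "s \<le> t"
  shows "x1 t = x2 t" "y1 t = y2 t"
proof -
  note c1 = classical_solutionD[OF x1] and c2 = classical_solutionD[OF x2]
  have "x1 t - x2 t = 0"
  proof (rule h.classical_unique[where f = "\<lambda>_. 0" and ?x1.0 = "\<lambda>t. x1 t - x2 t" and ?x2.0 = "\<lambda>_. 0", OF s t])
    show "continuous_on {s..t} (\<lambda>t. x1 t - x2 t)"
      by (rule continuous_on_subset[OF continuous_on_diff[OF c1(6) c2(6)]]) auto
    fix r assume r: "s < r" "r < t"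
    then have r': "s \<le> r" "0 \<le> r" using s by auto
    interpret M: bounded_linear "M r" by (rule M_lin[OF r'(2)])
    have "((\<lambda>t. x1 t - x2 t) has_vector_derivative A r (M r (x1 r)) - A r (M r (x2 r))) (at r)"
      using has_vector_derivative_diff[OF c1(5)[OF r'(1)] c2(5)[OF r'(1)]] at_within_Ici[OF r(1)] by simp
    then show "M r (x1 r - x2 r) \<in> D\<^sub>0 \<and> ((\<lambda>t. x1 t - x2 t) has_vector_derivative A r (M r (x1 r - x2 r)) + 0) (at r)"
      using D\<^sub>0_diff[OF c1(2)[OF r'(1)] c2(2)[OF r'(1)]] c1(3)[OF r'(1)] c2(3)[OF r'(1)]
        A_diff[OF r'(2) c1(2)[OF r'(1)] c2(2)[OF r'(1)]] by (simp add: M.diff)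
    have "A r 0 = 0" using A_diff[OF r'(2) subspace_0[OF D_sub] subspace_0[OF D_sub]] by simp
    then show "M r 0 \<in> D\<^sub>0 \<and> ((\<lambda>_. 0) has_vector_derivative A r (M r 0) + 0) (at r)"
      using D\<^sub>0_diff[OF subspace_0[OF D_sub] subspace_0[OF D_sub]] by (simp add: M.zero)
  qed (use c1 c2 in auto)
  then show "x1 t = x2 t" by simp
  then show "y1 t = y2 t" using c1(4)[OF t] c2(4)[OF t] by simp
qed

end

section \<open>Well-posedness\<close>

lemma nn_integral_Icc:
  fixes f :: "real \<Rightarrow> real"
  assumes "continuous_on {a..b} f" "\<And>t. t \<in> {a..b} \<Longrightarrow> 0 \<le> f t"
  shows "(\<integral>\<^sup>+t\<in>{a..b}. ennreal (f t) \<partial>lborel) = ennreal (integral {a..b} f)"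
proof -
  define g where "g t = (if t \<in> {a..b} then f t else 0)" for t
  have "(\<lambda>t. indicator {a..b} t *\<^sub>R f t) \<in> borel_measurable borel"
    by (rule borel_measurable_continuous_on_indicator[OF _ assms(1)]) simp
  moreover have "(\<lambda>t. indicator {a..b} t *\<^sub>R f t) = g" by (auto simp: g_def fun_eq_iff)
  ultimately have "g \<in> borel_measurable borel" by simp
  moreover have "(g has_integral integral {a..b} f) UNIV"
    unfolding g_def[abs_def] has_integral_restrict_UNIV
    by (rule integrable_integral[OF integrable_continuous_real[OF assms(1)]])
  moreover have "0 \<le> g t" for t using assms(2) by (simp add: g_def)
  ultimately have "integral\<^sup>N lborel (\<lambda>t. ennreal (g t)) = ennreal (integral {a..b} f)"
    using nn_integral_has_integral_lborel by blast
  moreover have "(\<lambda>t. ennreal (g t)) = (\<lambda>t. ennreal (f t) * indicator {a..b} t)"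
    by (auto simp: g_def fun_eq_iff)
  ultimately show ?thesis by simp
qed

context perturbed_hyperbolic
begin

text \<open>The input u = B M x is not known to be square integrable, so it is kept out of the
  integrated balance. In its place stands the positive part \<open>w\<close> of the continuous
  function 2 (A M x | M x) + \<gamma> |y|^2, which the dissipation inequality and the local bound on
  R bound by c |u|^2 almost everywhere.\<close>

theorem well_posed_of_dissipation:
  assumes R: "Linfty_loc K U R" and J: "uniformly_coercive Y J"
    and diss: "\<And>t x. 0 \<le> t \<Longrightarrow> x \<in> D \<Longrightarrow>
      2 * Re (ip X (A t x) x) \<le> Re (ip U (R t (B x)) (B x)) - Re (ip Y (C x) (J t (C x)))"
  shows "well_posed (\<lambda>t. {x. M t x \<in> D}) (\<lambda>t x. A t (M t x)) (\<lambda>t x. B (M t x)) (\<lambda>t x. C (M t x))"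
  unfolding well_posed_def
proof (intro allI impI)
  fix \<tau> :: real assume \<tau>: "\<tau> > 0"
  obtain \<gamma> where \<gamma>: "\<gamma> > 0" "\<And>t y. 0 \<le> t \<Longrightarrow> Re (ip Y (J t y) y) \<ge> \<gamma> * (norm y)\<^sup>2"
    using J unfolding uniformly_coercive_def by blast
  have "\<exists>c. AE t in lebesgue_on {0..\<tau>}. onorm (R t) \<le> c" using R \<tau> unfolding Linfty_loc_def by (elim conjE) blast
  then obtain c0 where "AE t in lebesgue_on {0..\<tau>}. onorm (R t) \<le> c0" ..
  then have "AE t in lebesgue. t \<in> {0..\<tau>} \<longrightarrow> onorm (R t) \<le> c0" by (subst (asm) AE_restrict_space_iff) auto
  then have ae0: "AE t in lborel. t \<in> {0..\<tau>} \<longrightarrow> onorm (R t) \<le> c0" by (simp only: AE_completion_iff)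
  \<comment> \<open>Made positive, since the estimate of u divides by it.\<close>
  define c where "c = max c0 1"
  have c: "c > 0" by (simp add: c_def)
  have R_lin: "bounded_linear (R t)" if "0 \<le> t" for t
  proof -
    have "\<forall>t\<ge>0. bdd_op K U U (R t)" using R unfolding Linfty_loc_def by (elim conjE)
    then show ?thesis using that by (simp add: bdd_op_def)
  qed
  have cpt: "strongly_cont {0..\<tau>} M" "strongly_cont {0..\<tau>} M'"
    by (rule strongly_cont_subset[OF strong_C1D(3)[OF h.M]] strongly_cont_subset[OF strong_C1D(2)[OF h.M]]; auto)+
  obtain m1 where m1: "m1 > 0" "\<And>t x. t \<in> {0..\<tau>} \<Longrightarrow> norm (M t x) \<le> m1 * norm x"
    using strongly_cont_bound[OF cpt(1)] by auto
  obtain m2 where m2: "m2 > 0" "\<And>t x. t \<in> {0..\<tau>} \<Longrightarrow> norm (M' t x) \<le> m2 * norm x"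
    using strongly_cont_bound[OF cpt(2)] by auto
  \<comment> \<open>The rate \<open>k\<close> absorbs the term with M' into the energy.
    \<open>q\<close> is what remains of the left-hand side after the exponential factor and both
    coercivity constants, and \<open>m\<close> compares the two sides.\<close>
  define k where "k = m2 / \<beta>"
  have k: "k > 0" using m2 h.\<beta> by (simp add: k_def)
  define q where "q = exp (- k * \<tau>) * min \<beta> \<gamma>"
  have q: "q > 0" using h.\<beta> \<gamma> by (simp add: q_def)
  define m where "m = max m1 c / q"
  have m: "m > 0" using m1 q by (simp add: m_def)
  show "\<exists>m>0. \<forall>s\<in>{0..\<tau>}. \<forall>xs u x y. classical_solution\<^sub>M s xs u x y \<longrightarrow>
        ennreal ((norm (x \<tau>))\<^sup>2) + (\<integral>\<^sup>+r\<in>{s..\<tau>}. ennreal ((norm (y r))\<^sup>2) \<partial>lborel)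
        \<le> ennreal m * (ennreal ((norm (x s))\<^sup>2) + (\<integral>\<^sup>+r\<in>{s..\<tau>}. ennreal ((norm (u r))\<^sup>2) \<partial>lborel))"
  proof (intro exI[of _ m] conjI m ballI allI impI)
    fix s xs u x y assume s: "s \<in> {0..\<tau>}" and sol: "classical_solution\<^sub>M s xs u x y"
    note cs = classical_solutionD[OF sol]
    have sub: "{s..\<tau>} \<subseteq> {0..\<tau>}" "{s..\<tau>} \<subseteq> {s..}" using s by auto
    define a where "a t = 2 * (A t (M t (x t)) \<bullet> M t (x t))" for t
    define v where "v t = a t + \<gamma> * (norm (y t))\<^sup>2" for t
    define w where "w t = max (v t) 0" for t
    define e where "e t = M t (x t) \<bullet> x t" for t
    have v_le: "v t \<le> R t (u t) \<bullet> u t" if t: "t \<in> {s..\<tau>}" for t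
    proof -
      have t0: "0 \<le> t" "s \<le> t" using t s by auto
      have "Re (ip Y (y t) (J t (y t))) = Re (ip Y (J t (y t)) (y t))"
        using hilbert_overD(6)[OF Y, of "y t" "J t (y t)"] by simp
      then have "\<gamma> * (norm (y t))\<^sup>2 \<le> Re (ip Y (y t) (J t (y t)))" using \<gamma>(2)[OF t0(1), of "y t"] by simp
      then show ?thesis
        using diss[OF t0(1) cs(2)[OF t0(2)]] unfolding cs(3)[OF t0(2)] cs(4)[OF t0(2)]
        by (simp add: v_def a_def hilbert_overD(7)[OF X] hilbert_overD(7)[OF U])
    qed
    have cx: "continuous_on {s..\<tau>} x" and cy: "continuous_on {s..\<tau>} y"
      using cs(6,7) sub(2) continuous_on_subset by blast+
    have cAM: "continuous_on {s..\<tau>} (\<lambda>t. A t (M t (x t)))"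
    proof -
      \<comment> \<open>A classical solution has some continuous derivative; by uniqueness of
        derivatives it is A M x, whose continuity is needed for the balance.\<close>
      obtain x' where x': "\<And>t. t \<in> {s..} \<Longrightarrow> (x has_vector_derivative x' t) (at t within {s..})" "continuous_on {s..} x'"
      proof -
        have "Ck_on 1 {s..} x" using sol unfolding classical_solution_def by (elim conjE)
        then show ?thesis using that unfolding One_nat_def Ck_on.simps by blast
      qed
      have "A t (M t (x t)) = x' t" if t: "t \<in> {s..}" for t
      proof -
        have "at t within {s..} \<noteq> bot"
        proof -
          have "at t within {t<..} \<le> at t within {s..}" using t by (intro at_le) auto
          then show ?thesis using trivial_limit_at_right_real[of t] by (metis bot.extremum_uniqueI)
        qed
        then show ?thesis using vector_derivative_unique_within x'(1)[OF t] cs(5)[of t] t by auto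
      qed
      then have "continuous_on {s..} (\<lambda>t. A t (M t (x t)))" 
        using x'(2) by (subst continuous_on_cong[OF refl]) auto
      then show ?thesis by (rule continuous_on_subset[OF _ sub(2)])
    qed
    have cM: "continuous_on {s..\<tau>} (\<lambda>t. M t (x t))"
      by (rule strongly_cont_apply[OF strongly_cont_subset[OF cpt(1) sub(1)] closed_atLeastAtMost cx])
    have cw: "continuous_on {s..\<tau>} w" unfolding w_def v_def a_def by (intro continuous_intros cAM cM cy)
    have cy2: "continuous_on {s..\<tau>} (\<lambda>t. (norm (y t))\<^sup>2)" by (intro continuous_intros cy)
    define Iy where "Iy = integral {s..\<tau>} (\<lambda>t. (norm (y t))\<^sup>2)"
    define Iw where "Iw = integral {s..\<tau>} w"
    have Iy0: "Iy \<ge> 0" unfolding Iy_def by (rule Henstock_Kurzweil_Integration.integral_nonneg[OF integrable_continuous_real[OF cy2]]) simp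
    have Iw0: "Iw \<ge> 0" unfolding Iw_def by (rule Henstock_Kurzweil_Integration.integral_nonneg[OF integrable_continuous_real[OF cw]]) (simp add: w_def)
    define e' where "e' t = M' t (x t) \<bullet> x t + a t" for t
    have de: "(e has_real_derivative e' t) (at t within {s..\<tau>})" if t: "t \<in> {s..\<tau>}" for t
    proof -
      have t0: "0 \<le> t" "s \<le> t" using t s by auto
      have dx: "(x has_vector_derivative A t (M t (x t))) (at t within {s..\<tau>})"
        by (rule has_vector_derivative_within_subset[OF cs(5)[OF t0(2)] sub(2)])
      have "((\<lambda>t. M t (x t)) has_vector_derivative M' t (x t) + M t (A t (M t (x t)))) (at t within {s..\<tau>})"
        by (rule strong_C1_apply_subset[OF h.M _ closed_atLeastAtMost t dx]) (use s in auto)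
      from bounded_bilinear.has_vector_derivative[OF bounded_bilinear_inner this dx]
      have "(e has_vector_derivative M t (x t) \<bullet> A t (M t (x t)) + (M' t (x t) + M t (A t (M t (x t)))) \<bullet> x t) (at t within {s..\<tau>})"
        unfolding e_def .
      moreover have "M t (x t) \<bullet> A t (M t (x t)) + (M' t (x t) + M t (A t (M t (x t)))) \<bullet> x t = e' t"
        using h.M_sym[OF t0(1), of "A t (M t (x t))" "x t"] inner_commute[of "M t (x t)" "A t (M t (x t))"]
        by (simp add: e'_def a_def inner_add_left)
      ultimately show ?thesis by (simp add: has_real_derivative_iff_has_vector_derivative)
    qed
    define \<phi> where "\<phi> t = e t * exp (- k * (t - s))" for t
    have d\<phi>: "(\<phi> has_vector_derivative (e' t - k * e t) * exp (- k * (t - s))) (at t within {s..\<tau>})" if t: "t \<in> {s..\<tau>}" for t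
    proof -
      have "(\<phi> has_real_derivative (e' t - k * e t) * exp (- k * (t - s))) (at t within {s..\<tau>})"
        unfolding \<phi>_def by (auto intro!: derivative_eq_intros de[OF t] simp: algebra_simps)
      then show ?thesis by (simp add: has_real_derivative_iff_has_vector_derivative)
    qed
    have "\<phi> \<tau> - \<phi> s \<le> Iw - exp (- k * \<tau>) * \<gamma> * Iy"
    proof (rule has_integral_le)
      show "((\<lambda>t. (e' t - k * e t) * exp (- k * (t - s))) has_integral (\<phi> \<tau> - \<phi> s)) {s..\<tau>}"
        by (rule fundamental_theorem_of_calculus) (use s d\<phi> in auto)
      show "((\<lambda>t. w t - exp (- k * \<tau>) * \<gamma> * (norm (y t))\<^sup>2) has_integral (Iw - exp (- k * \<tau>) * \<gamma> * Iy)) {s..\<tau>}"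
        unfolding Iw_def Iy_def
        by (intro has_integral_diff has_integral_mult_right integrable_integral integrable_continuous_real cw cy2)
      fix t assume t: "t \<in> {s..\<tau>}"
      then have tI: "t \<in> {0..\<tau>}" "0 \<le> t" using sub s by auto
      have E: "exp (- k * (t - s)) \<le> 1" "exp (- k * \<tau>) \<le> exp (- k * (t - s))"
        using t s k by (auto intro: mult_left_mono)
      have "M' t (x t) \<bullet> x t \<le> (m2 * norm (x t)) * norm (x t)"
        using order_trans[OF norm_cauchy_schwarz mult_right_mono[OF m2(2)[OF tI(1)] norm_ge_zero]] .
      also have "\<dots> = k * (\<beta> * (norm (x t))\<^sup>2)" using h.\<beta> by (simp add: k_def power2_eq_square)
      also have "\<dots> \<le> k * e t" using h.M_coercive[OF tI(2), of "x t"] k by (simp add: e_def)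
      finally have "e' t - k * e t \<le> a t" by (simp add: e'_def)
      then have "(e' t - k * e t) * exp (- k * (t - s)) \<le> a t * exp (- k * (t - s))" by (rule mult_right_mono) simp
      also have "\<dots> = v t * exp (- k * (t - s)) - \<gamma> * (norm (y t))\<^sup>2 * exp (- k * (t - s))"
        by (simp add: v_def algebra_simps)
      also have "\<dots> \<le> w t - exp (- k * \<tau>) * \<gamma> * (norm (y t))\<^sup>2"
      proof (rule diff_mono)
        have "v t * exp (- k * (t - s)) \<le> w t * exp (- k * (t - s))" by (rule mult_right_mono) (simp_all add: w_def)
        also have "\<dots> \<le> w t * 1" by (rule mult_left_mono[OF E(1)]) (simp add: w_def)
        finally show "v t * exp (- k * (t - s)) \<le> w t" by simp
        show "exp (- k * \<tau>) * \<gamma> * (norm (y t))\<^sup>2 \<le> \<gamma> * (norm (y t))\<^sup>2 * exp (- k * (t - s))"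
          using mult_left_mono[OF E(2), of "\<gamma> * (norm (y t))\<^sup>2"] \<gamma>(1) by (simp add: algebra_simps)
      qed
      finally show "(e' t - k * e t) * exp (- k * (t - s)) \<le> w t - exp (- k * \<tau>) * \<gamma> * (norm (y t))\<^sup>2" .
    qed
    moreover have "exp (- k * \<tau>) * (\<beta> * (norm (x \<tau>))\<^sup>2) \<le> \<phi> \<tau>"
    proof -
      have "exp (- k * \<tau>) * (\<beta> * (norm (x \<tau>))\<^sup>2) \<le> exp (- k * (\<tau> - s)) * e \<tau>"
        using h.M_coercive[of \<tau> "x \<tau>"] \<tau> s k h.\<beta> by (intro mult_mono) (auto simp: e_def algebra_simps)
      then show ?thesis by (simp add: \<phi>_def mult.commute)
    qed
    moreover have "\<phi> s \<le> m1 * (norm (x s))\<^sup>2"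
    proof -
      have "e s \<le> norm (M s (x s)) * norm (x s)" unfolding e_def by (rule norm_cauchy_schwarz)
      also have "\<dots> \<le> (m1 * norm (x s)) * norm (x s)" using s by (intro mult_right_mono m1) auto
      finally show ?thesis by (simp add: \<phi>_def power2_eq_square)
    qed
    ultimately have key: "exp (- k * \<tau>) * (\<beta> * (norm (x \<tau>))\<^sup>2) + exp (- k * \<tau>) * \<gamma> * Iy \<le> m1 * (norm (x s))\<^sup>2 + Iw"
      by linarith
    have "q * ((norm (x \<tau>))\<^sup>2 + Iy) \<le> exp (- k * \<tau>) * (\<beta> * (norm (x \<tau>))\<^sup>2 + \<gamma> * Iy)"
    proof -
      have "min \<beta> \<gamma> * (norm (x \<tau>))\<^sup>2 + min \<beta> \<gamma> * Iy \<le> \<beta> * (norm (x \<tau>))\<^sup>2 + \<gamma> * Iy"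
        using Iy0 by (intro add_mono mult_right_mono) auto
      then show ?thesis unfolding q_def mult.assoc by (intro mult_left_mono) (simp_all add: distrib_left)
    qed
    with key have "q * ((norm (x \<tau>))\<^sup>2 + Iy) \<le> m1 * (norm (x s))\<^sup>2 + Iw" by (simp add: algebra_simps)
    also have "\<dots> \<le> max m1 c * ((norm (x s))\<^sup>2 + Iw / c)"
    proof -
      have "m1 * (norm (x s))\<^sup>2 \<le> max m1 c * (norm (x s))\<^sup>2" by (intro mult_right_mono) auto
      moreover have "c * (Iw / c) \<le> max m1 c * (Iw / c)" using Iw0 c by (intro mult_right_mono) auto
      ultimately show ?thesis using c by (simp add: distrib_left)
    qed
    finally have real_ineq: "(norm (x \<tau>))\<^sup>2 + Iy \<le> m * ((norm (x s))\<^sup>2 + Iw / c)"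
      using q by (simp add: m_def field_simps)
    have "ennreal (Iw / c) \<le> (\<integral>\<^sup>+r\<in>{s..\<tau>}. ennreal ((norm (u r))\<^sup>2) \<partial>lborel)"
    proof -
      have "(\<integral>\<^sup>+r\<in>{s..\<tau>}. ennreal (w r / c) \<partial>lborel) = ennreal (integral {s..\<tau>} (\<lambda>r. w r / c))"
      proof (rule nn_integral_Icc)
        show "continuous_on {s..\<tau>} (\<lambda>r. w r / c)"
          by (rule continuous_on_divide[OF cw continuous_on_const]) (use c in simp)
        show "0 \<le> w t / c" for t using c by (simp add: w_def)
      qed
      then have "ennreal (Iw / c) = (\<integral>\<^sup>+r\<in>{s..\<tau>}. ennreal (w r / c) \<partial>lborel)" by (simp add: Iw_def)
      \<comment> \<open>Monotonicity of this integral requires no measurability of u.\<close>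
      also have "\<dots> \<le> (\<integral>\<^sup>+r\<in>{s..\<tau>}. ennreal ((norm (u r))\<^sup>2) \<partial>lborel)"
      proof (rule nn_integral_mono_AE)
        show "AE r in lborel. ennreal (w r / c) * indicator {s..\<tau>} r \<le> ennreal ((norm (u r))\<^sup>2) * indicator {s..\<tau>} r"
          using ae0
        proof eventually_elim
          case (elim r)
          show ?case
          proof (cases "r \<in> {s..\<tau>}")
            case True
            then have rI: "r \<in> {0..\<tau>}" "0 \<le> r" using sub s by auto
            have "R r (u r) \<bullet> u r \<le> norm (R r (u r)) * norm (u r)" by (rule norm_cauchy_schwarz)
            also have "\<dots> \<le> (onorm (R r) * norm (u r)) * norm (u r)"
              by (intro mult_right_mono onorm[OF R_lin[OF rI(2)]]) simp
            also have "\<dots> \<le> (c * norm (u r)) * norm (u r)"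
              using elim rI by (intro mult_right_mono) (auto simp: c_def)
            finally have "v r \<le> c * (norm (u r))\<^sup>2" using v_le[OF True] by (simp add: power2_eq_square)
            moreover have "0 \<le> c * (norm (u r))\<^sup>2" using c by simp
            ultimately have "w r \<le> c * (norm (u r))\<^sup>2" by (simp add: w_def)
            then have "w r / c \<le> (norm (u r))\<^sup>2" using c by (simp add: divide_le_eq mult.commute)
            then show ?thesis using True by (simp add: ennreal_leI)
          qed simp
        qed
      qed
      finally show ?thesis .
    qed
    then have "ennreal m * (ennreal ((norm (x s))\<^sup>2) + ennreal (Iw / c))
        \<le> ennreal m * (ennreal ((norm (x s))\<^sup>2) + (\<integral>\<^sup>+r\<in>{s..\<tau>}. ennreal ((norm (u r))\<^sup>2) \<partial>lborel))"
      by (intro mult_left_mono add_left_mono) auto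
    moreover have "ennreal ((norm (x \<tau>))\<^sup>2) + (\<integral>\<^sup>+r\<in>{s..\<tau>}. ennreal ((norm (y r))\<^sup>2) \<partial>lborel) = ennreal ((norm (x \<tau>))\<^sup>2 + Iy)"
      using nn_integral_Icc[OF cy2] Iy0 by (simp add: Iy_def)
    moreover have "ennreal m * (ennreal ((norm (x s))\<^sup>2) + ennreal (Iw / c)) = ennreal (m * ((norm (x s))\<^sup>2 + Iw / c))"
      using m c Iw0 by (simp add: ennreal_mult)
    ultimately show "ennreal ((norm (x \<tau>))\<^sup>2) + (\<integral>\<^sup>+r\<in>{s..\<tau>}. ennreal ((norm (y r))\<^sup>2) \<partial>lborel)
        \<le> ennreal m * (ennreal ((norm (x s))\<^sup>2) + (\<integral>\<^sup>+r\<in>{s..\<tau>}. ennreal ((norm (u r))\<^sup>2) \<partial>lborel))"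
      using ennreal_leI[OF real_ineq] order_trans by fastforce
  qed
qed

end

theorem theorem4p8:
  fixes K :: "complex set"
    and X :: "'x::{real_inner,banach} hilbert_structure"
    and U :: "'u::{real_inner,banach} hilbert_structure"
    and Y :: "'y::{real_inner,banach} hilbert_structure"
    and D :: "'x set" and A :: "real \<Rightarrow> 'x \<Rightarrow> 'x"
    and DB :: "'x set" and B :: "'x \<Rightarrow> 'u"
    and C :: "'x \<Rightarrow> 'y"
    and Bt :: "real \<Rightarrow> 'u \<Rightarrow> 'x"
    and M :: "real \<Rightarrow> 'x \<Rightarrow> 'x"
  assumes "hilbert_over K X" and "hilbert_over K U" and "hilbert_over K Y"
    and "nbco_system K X U Y (\<lambda>_. D) A (\<lambda>_. DB) (\<lambda>_. B) (\<lambda>_. C)"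
    and "\<forall>t\<ge>0. is_lifting K X U D (A t) B (Bt t)"
    and "\<forall>t\<ge>0. bdd_op K X X (M t)"
    and "selfadjoint_valued X M" and "uniformly_coercive X M"
    and "\<forall>x. Ck_on 2 {0..} (\<lambda>t. M t x)"
    and "\<forall>x. continuous_on {0..} (\<lambda>t. inv (M t) x)"
    and "strongly_C1 D A"
    and "\<forall>t\<ge>0. generates_contraction_C0_semigroup K X (main_domain D B) (A t)"
    and "\<forall>u\<^sub>0. Ck_on 2 {0..} (\<lambda>t. Bt t u\<^sub>0)"
  shows "let
      D\<^sub>M = (\<lambda>t. {x. M t x \<in> D});
      A\<^sub>M = (\<lambda>t x. A t (M t x));
      DB\<^sub>M = (\<lambda>t. {x. M t x \<in> DB});
      B\<^sub>M = (\<lambda>t x. B (M t x));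
      C\<^sub>M = (\<lambda>t x. C (M t x));
      Bt\<^sub>M = (\<lambda>t v. inv (M t) (Bt t v))
    in
      nbco_system K X U Y D\<^sub>M A\<^sub>M DB\<^sub>M B\<^sub>M C\<^sub>M \<and>
      (\<forall>W. generated_by K X W (\<lambda>t. main_domain (D\<^sub>M t) (B\<^sub>M t)) A\<^sub>M \<longrightarrow>
        (\<forall>s\<ge>0. \<forall>xs u. Ck_on 2 {0..} u \<and> M s xs \<in> D \<and> B (M s xs) = u s \<longrightarrow>
          (\<exists>x y. classical_solution D\<^sub>M A\<^sub>M B\<^sub>M C\<^sub>M s xs u x y \<and>
            (\<forall>x' y'. classical_solution D\<^sub>M A\<^sub>M B\<^sub>M C\<^sub>M s xs u x' y' \<longrightarrow>
               (\<forall>t\<ge>s. x' t = x t \<and> y' t = y t)) \<and>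
            (\<forall>t\<ge>s.
              let f = (\<lambda>r. W t r (A r (Bt r (u r))));
                  g = (\<lambda>r. W t r (vector_derivative (\<lambda>q. Bt\<^sub>M q (u q)) (at r within {0..})))
              in f integrable_on {s..t} \<and> g integrable_on {s..t} \<and>
                 x t = (W t s (xs - Bt\<^sub>M s (u s)) + Bt\<^sub>M t (u t))
                       + integral {s..t} f - integral {s..t} g \<and>
                 y t = (C\<^sub>M t (W t s (xs - Bt\<^sub>M s (u s))) + C\<^sub>M t (Bt\<^sub>M t (u t)))
                       + C\<^sub>M t (integral {s..t} f) - C\<^sub>M t (integral {s..t} g))))) \<and>
      (\<forall>R J.
        Linfty_loc K U R \<and> selfadjoint_valued U R \<and>
        (\<forall>t\<ge>0. bdd_op K Y Y (J t)) \<and> selfadjoint_valued Y J \<and> uniformly_coercive Y J \<and>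
        (\<forall>t\<ge>0. \<forall>(x\<^sub>0, u\<^sub>0) \<in> {(x, u). x \<in> D \<and> B x = u}.
           2 * Re (ip X (A t x\<^sub>0) x\<^sub>0)
           \<le> Re (ip U (R t u\<^sub>0) (B x\<^sub>0)) - Re (ip Y (C x\<^sub>0) (J t (C x\<^sub>0)))) \<longrightarrow>
        well_posed D\<^sub>M A\<^sub>M B\<^sub>M C\<^sub>M)"
proof -
  let ?DM = "\<lambda>t. {x. M t x \<in> D}" and ?AM = "\<lambda>t x. A t (M t x)" and ?BM = "\<lambda>t x. B (M t x)" and ?CM = "\<lambda>t x. C (M t x)"
  have bco: "\<And>t. 0 \<le> t \<Longrightarrow> bco_system K X U Y D (A t) DB B C"
    using assms(4) by (simp add: nbco_system_def)
  interpret perturbed_system K X U Y D A DB B C Bt M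
    by (rule perturbed_system.intro) (use assms bco in blast)+
  obtain M' M'' \<beta> where "hyperbolic (main_domain D B) A A' M M' M'' \<beta>" using hyperbolic_ex by blast
  then interpret perturbed_hyperbolic K X U Y D A DB B C Bt M M' M'' \<beta>
    by (intro perturbed_hyperbolic.intro perturbed_system_axioms)
  have formula: "\<exists>x y. classical_solution ?DM ?AM ?BM ?CM s xs u x y \<and>
      (\<forall>x' y'. classical_solution ?DM ?AM ?BM ?CM s xs u x' y' \<longrightarrow> (\<forall>t\<ge>s. x' t = x t \<and> y' t = y t)) \<and>
      (\<forall>t\<ge>s.
        let f = (\<lambda>r. W t r (A r (Bt r (u r))));
            g = (\<lambda>r. W t r (vector_derivative (\<lambda>q. inv (M q) (Bt q (u q))) (at r within {0..})))
        in f integrable_on {s..t} \<and> g integrable_on {s..t} \<and>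
           x t = (W t s (xs - inv (M s) (Bt s (u s))) + inv (M t) (Bt t (u t))) + integral {s..t} f - integral {s..t} g \<and>
           y t = (C (M t (W t s (xs - inv (M s) (Bt s (u s))))) + C (M t (inv (M t) (Bt t (u t)))))
                 + C (M t (integral {s..t} f)) - C (M t (integral {s..t} g)))"
    if W: "generated_by K X W (\<lambda>t. main_domain (?DM t) (?BM t)) ?AM"
      and s: "0 \<le> s" and u: "Ck_on 2 {0..} u" and xs: "M s xs \<in> D" "B (M s xs) = u s" for W s xs u
  proof -
    obtain x where x: "classical_solution\<^sub>M s xs u x (\<lambda>t. C (M t (x t)))"
      by (rule classical_solution_exists[OF s u xs])
    show ?thesis
    proof (rule exI[of _ x], rule exI[of _ "\<lambda>t. C (M t (x t))"], intro conjI allI impI x)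
      fix x' y' t assume "classical_solution\<^sub>M s xs u x' y'" "s \<le> t"
      from classical_solution_unique[OF s this(1) x this(2)] show "x' t = x t" "y' t = C (M t (x t))" .
    next
      fix t assume t: "s \<le> t"
      have t0: "0 \<le> t" using s t by simp
      define b where "b r = h.N r (Bt r (u r))" for r
      define f where "f r = W t r (A r (Bt r (u r)))" for r
      define g where "g r = W t r (deriv0 b r)" for r
      have WW: "W t r = h.W t r" if "r \<in> {s..t}" for r
        using generated_eq_W[OF W, of r t] that s by simp
      note v = variation_of_constants[OF s u x t, folded b_def]
      have gi: "g integrable_on {s..t}"
        by (rule integrable_eq[OF v(2)]) (simp add: g_def WW)
      have ig: "integral {s..t} g = integral {s..t} (\<lambda>r. h.W t r (deriv0 b r))"
        by (rule Henstock_Kurzweil_Integration.integral_cong) (simp add: g_def WW)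
      have fg: "((\<lambda>r. f r - g r) has_integral (x t - b t - W t s (xs - b s))) {s..t}"
        unfolding WW[of s, simplified, OF t]
        by (rule has_integral_eq[OF _ v(1)]) (simp add: f_def g_def WW)
      \<comment> \<open>The first integrand is recovered as the difference of both plus the
        second.\<close>
      have fi: "f integrable_on {s..t}"
        using integrable_add[OF has_integral_integrable[OF fg] gi] by simp
      have eq: "integral {s..t} f = x t - b t - W t s (xs - b s) + integral {s..t} g"
        using Henstock_Kurzweil_Integration.integral_diff[OF fi gi] integral_unique[OF fg] by simp
      have xt: "x t = (W t s (xs - b s) + b t) + integral {s..t} f - integral {s..t} g"
        using eq by (simp add: algebra_simps)
      interpret Mt: bounded_linear "M t" by (rule M_lin[OF t0])
      have d: "M t (W t s (xs - b s)) \<in> D" "M t (integral {s..t} g) \<in> D" "M t (x t - b t) \<in> D"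
        using D\<^sub>0D(1)[OF v(3)] D\<^sub>0D(1)[OF v(4)] D\<^sub>0D(1)[OF v(5)] WW[of s] t ig by auto
      have db: "M t (b t) \<in> D" using lifting_lin(2)[OF t0] by (simp add: b_def h.MN[OF t0])
      \<comment> \<open>The integral of f lies in the required domain because it is a combination of
        the other terms of the formula, each of which does.\<close>
      have df: "M t (integral {s..t} f) \<in> D"
        unfolding eq Mt.add Mt.diff[of "x t - b t"] using d subspace_add[OF D_sub] subspace_diff[OF D_sub] by blast
      have "C (M t (x t)) = (C (M t (W t s (xs - b s))) + C (M t (b t))) + C (M t (integral {s..t} f)) - C (M t (integral {s..t} g))"
        using d db df subspace_add[OF D_sub]
        by (subst xt) (simp add: Mt.add Mt.diff C_add C_diff)
      with xt fi gi show "let f = (\<lambda>r. W t r (A r (Bt r (u r))));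
            g = (\<lambda>r. W t r (vector_derivative (\<lambda>q. inv (M q) (Bt q (u q))) (at r within {0..})))
        in f integrable_on {s..t} \<and> g integrable_on {s..t} \<and>
           x t = (W t s (xs - inv (M s) (Bt s (u s))) + inv (M t) (Bt t (u t))) + integral {s..t} f - integral {s..t} g \<and>
           C (M t (x t)) = (C (M t (W t s (xs - inv (M s) (Bt s (u s))))) + C (M t (inv (M t) (Bt t (u t)))))
                 + C (M t (integral {s..t} f)) - C (M t (integral {s..t} g))"
        unfolding Let_def f_def[abs_def] g_def[abs_def] b_def[abs_def] h.N_def by blast
    qed
  qed
  have wp: "well_posed ?DM ?AM ?BM ?CM"
    if "Linfty_loc K U R" "uniformly_coercive Y J"
      and "\<forall>t\<ge>0. \<forall>(x\<^sub>0, u\<^sub>0) \<in> {(x, u). x \<in> D \<and> B x = u}.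
           2 * Re (ip X (A t x\<^sub>0) x\<^sub>0) \<le> Re (ip U (R t u\<^sub>0) (B x\<^sub>0)) - Re (ip Y (C x\<^sub>0) (J t (C x\<^sub>0)))" for R J
    by (rule well_posed_of_dissipation[OF that(1,2)]) (use that(3) in auto)
  show ?thesis
    unfolding Let_def
  proof (intro conjI allI impI)
    show "nbco_system K X U Y ?DM ?AM (\<lambda>t. {x. M t x \<in> DB}) ?BM ?CM" by (rule perturbed_nbco)
  qed (use formula[unfolded Let_def] wp in blast)+
qed

end
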